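(* Let $M=\mathbb{C}^n/(\mathbb{Z}^n+i\mathbb{Z}^n)$ with its standard flat Kähler form $\omega$, written in coordinates $(y,w)\in(\mathbb{R}^n/\mathbb{Z}^n)^2$ as $\omega=2\sum_a dy^a\wedge dw^a$. Let $u$ be a symplectic potential, and let $J=J_u$ be the $\mathbb{T}^n$-invariant integrable complex structure $$J_u=\begin{pmatrix}0&-(D^2u)^{-1}\\ D^2u&0\end{pmatrix}$$ in the frame $(\partial_y,\partial_w)$. Let $\alpha$ be a $\mathbb{T}^n$-invariant cotangent vector at $J_u$, with associated Higgs tensor $\xi$, such that $r(\xi\,D^2u\,\bar\xi\,D^2u)<1$ at every point, where $r$ denotes the spectral radius. Then the pair $(J_u,\alpha)$ satisfies the HcscK equations $$m^{\mathbb{R}}_{(J,\alpha)}(h)=m^{\mathbb{C}}_{(J,\alpha)}(h)=0\quad\text{for all }h\in\mathfrak{ham}(M,\omega)$$ if and only if $(u,\xi)$ satisfies the system $$\begin{cases}\xi^{ab}{}_{,ab}=0,\\ \left(\left(\mathbb{1}-\xi\,D^2u\,\bar\xi\,D^2u\right)^{1/2}(D^2u)^{-1}\right)^{ab}{}_{,ab}=0.\end{cases}$$ More precisely, the first equation is equivalent to the vanishing of the complex moment map $m^{\mathbb C}_{(J,\alpha)}$ and the second to the vanishing of the real moment map $m^{\mathbb R}_{(J,\alpha)}$.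
   Context: Indices after a comma are partial derivatives in $y$ and repeated indices are summed. A bar denotes complex conjugation. $\mathbb{T}^n=\mathbb{R}^n/\mathbb{Z}^n$ acts on $M$ by translations in $w$. Symplectic potential: a function $u(y)=\frac12|y|^2+\phi(y)$ with $\phi$ smooth and $\mathbb{Z}^n$-periodic and with Hessian $D^2u=(u_{ab})$ positive definite everywhere; $(u^{ab})$ is the inverse matrix. Complex structures: $\mathcal J$ is the space of almost complex structures compatible with $\omega$, with metric $g_J=\omega(\cdot,J\cdot)$. $T_J\mathcal J$ consists of the endomorphisms $\dot J$ of $TM$ with $J\dot J+\dot JJ=0$ and $\omega(J\cdot,\dot J\cdot)+\omega(\dot J\cdot,J\cdot)=0$. The complex structure on $\mathcal J$ is $\dot J\mapsto J\dot J$. Cotangent vectors: a point of $T^*\mathcal J$ is a pair $(J,\alpha)$, where $\alpha:{T^{0,1}}^*M\to{T^{1,0}}^*M$ has dual $\alpha^\vee:T^{1,0}M\to T^{0,1}M$ (extended by $0$ to $T_{\mathbb C}M$), such that $A:=\alpha^\vee+\overline{\alpha^\vee}\in T_J\mathcal J$. It acts as the $(1,0)$-covector $\dot J\mapsto\frac12\mathrm{Tr}(\alpha^\vee\dot J)$. Let $\mathrm I$ be the induced complex structure on the holomorphic cotangent bundle, both pointwise (fibre $T^*(\mathrm{Sp}(2n)/\mathrm U(n))$) and globally. Higgs tensor: for $J=J_u$ put $Z_a=\frac12(u^{ab}\partial_{y^b}-i\,\partial_{w^a})$ (a frame of $T^{1,0}M$). A $\mathbb T^n$-invariant $\alpha$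 corresponds to the smooth $\mathbb Z^n$-periodic complex symmetric matrix function $\xi=(\xi^{ab}(y))$ (the Higgs tensor) determined by $\alpha^\vee(Z_a)=u_{bc}\,\xi^{ca}\,\overline{Z_b}$. No integrability of $\alpha$ is assumed. Biquard–Gauduchon function: where $\alpha\bar\alpha$ has spectral radius $<1$, $$\rho(J,\alpha)=\tfrac12\mathrm{Tr}\left(f_0(\Xi_A)(A)\,A\right),\qquad \Xi_A(B)=-\tfrac12(A^2B+BA^2),$$ with $\Xi_A$ acting on $T_J\mathcal J$ and $f_0(x)=\frac1x\left((1+x)^{1/2}-1-\log\frac{1+(1+x)^{1/2}}{2}\right)$. Moment maps: $\mathfrak{ham}(M,\omega)$ is the space of smooth real functions $h$ on $M$ with zero integral, $X_h$ is defined by $\iota_{X_h}\omega=-dh$, $d^c\rho=-d\rho\circ\mathrm I$, and $s(g_J)=-g^{a\bar b}\partial_a\partial_{\bar b}\log\det(g_{c\bar d})$ with average $\hat s$ (here $\hat s=0$). Then $$m^{\mathbb R}_{(J,\alpha)}(h)=\int_M2(s(g_J)-\hat s)h\,\frac{\omega^n}{n!}+\int_{x\in M}d^c\rho_{(J(x),\alpha(x))}\left(\mathcal L_{X_h}J,\mathcal L_{X_h}\alpha\right)\frac{\omega^n}{n!},$$ $$m^{\mathbb C}_{(J,\alpha)}(h)=-\int_M\tfrac12\mathrm{Tr}\left(\alpha^\vee\mathcal L_{X_h}J\right)\frac{\omega^n}{n!}.$$ Square root: the matrix $\xi\,D^2u\,\bar\xi\,D^2u$ is diagonalizable with eigenvalues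 in $[0,1)$; $(\mathbb{1}-\xi\,D^2u\,\bar\xi\,D^2u)^{1/2}$ is the unique square root with positive eigenvalues. *)

theory Defs
  imports "HOL-Analysis.Analysis"
begin

section \<open>Smooth and periodic functions on Euclidean space\<close>

definition pd :: "'m \<Rightarrow> (real^'m::finite \<Rightarrow> 'b::real_normed_vector) \<Rightarrow> real^'m \<Rightarrow> 'b" where
  "pd k f x = frechet_derivative f (at x) (axis k 1)"

text \<open>On an open set this is \<open>C\<^sup>\<infinity>\<close>: every iterated partial derivative is differentiable.\<close>

definition smooth_in :: "(real^'m::finite) set \<Rightarrow> (real^'m \<Rightarrow> 'b::real_normed_vector) \<Rightarrow> bool" where
  "smooth_in U f \<longleftrightarrow> (\<forall>ks. foldr pd ks f differentiable_on U)"

abbreviation smooth :: "(real^'m::finite \<Rightarrow> 'b::real_normed_vector) \<Rightarrow> bool" where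
  "smooth \<equiv> smooth_in UNIV"

definition lattice_periodic :: "(real^'m::finite \<Rightarrow> 'b) \<Rightarrow> bool" where
  "lattice_periodic f \<longleftrightarrow> (\<forall>x m. (\<forall>i. m $ i \<in> \<int>) \<longrightarrow> f (x + m) = f x)"

definition double_divergence :: "(real^'n::finite \<Rightarrow> complex^'n^'n) \<Rightarrow> real^'n \<Rightarrow> complex" where
  "double_divergence F y = (\<Sum>a\<in>UNIV. \<Sum>b\<in>UNIV. pd b (pd a (\<lambda>x. F x $ a $ b)) y)"

section \<open>Linear algebra\<close>

definition cmat :: "real^'m^'k \<Rightarrow> ('a::real_algebra_1)^'m::finite^'k::finite" where
  "cmat = map_matrix of_real"

definition cnj_vec :: "complex^'m \<Rightarrow> complex^'m::finite" where
  "cnj_vec v = (\<chi> k. cnj (v $ k))"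

definition cnj_mat :: "complex^'m^'k \<Rightarrow> complex^'m::finite^'k::finite" where
  "cnj_mat = map_matrix cnj"

definition eigenvalues :: "complex^'m^'m::finite \<Rightarrow> complex set" where
  "eigenvalues A = {l. \<exists>v. v \<noteq> 0 \<and> A *v v = l *s v}"

definition spectral_radius :: "complex^'m^'m::finite \<Rightarrow> real" where
  "spectral_radius A = Max (cmod ` eigenvalues A)"

definition matrix_sqrt :: "complex^'m^'m::finite \<Rightarrow> complex^'m^'m" where
  "matrix_sqrt B = (THE R. R ** R = B \<and> (\<forall>l\<in>eigenvalues R. l \<in> \<real> \<and> 0 < Re l))"

definition pos_def :: "real^'m^'m::finite \<Rightarrow> bool" where
  "pos_def H \<longleftrightarrow> (\<forall>v. v \<noteq> 0 \<longrightarrow> 0 < v \<bullet> (H *v v))"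

text \<open>
  Functional calculus \<open>f(L)B\<close> for an operator \<open>L\<close> on a subspace \<open>S\<close>, where \<open>L\<close> is diagonalizable
  with real eigenvalues: decompose \<open>B\<close> into eigenvectors and multiply each component by \<open>f\<close> of
  its eigenvalue.
\<close>

definition fun_calc ::
    "'v::real_vector set \<Rightarrow> (real \<Rightarrow> real) \<Rightarrow> ('v \<Rightarrow> 'v) \<Rightarrow> 'v \<Rightarrow> 'v" where
  "fun_calc S f L B = (THE C. \<exists>\<Lambda> E. finite \<Lambda> \<and>
      (\<forall>l\<in>\<Lambda>. E l \<in> S \<and> L (E l) = l *\<^sub>R E l) \<and>
      B = (\<Sum>l\<in>\<Lambda>. E l) \<and> C = (\<Sum>l\<in>\<Lambda>. f l *\<^sub>R E l))"

section \<open>Tangent vectors and derivatives on embedded submanifolds\<close>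

definition curve_through :: "'v::real_normed_vector set \<Rightarrow> 'v \<Rightarrow> 'v \<Rightarrow> (real \<Rightarrow> 'v) \<Rightarrow> bool" where
  "curve_through S p v \<gamma> \<longleftrightarrow>
     (\<forall>\<^sub>F t in nhds 0. \<gamma> t \<in> S) \<and> \<gamma> 0 = p \<and> (\<gamma> has_vector_derivative v) (at 0)"

definition tangent_vectors :: "'v::real_normed_vector set \<Rightarrow> 'v \<Rightarrow> 'v set" where
  "tangent_vectors S p = {v. \<exists>\<gamma>. curve_through S p v \<gamma>}"

text \<open>The differential at \<open>p\<close>, in the direction \<open>v\<close>, of a function \<open>f\<close> on the submanifold \<open>S\<close>.\<close>

definition differential ::
    "'v::real_normed_vector set \<Rightarrow> ('v \<Rightarrow> 'b::real_normed_vector) \<Rightarrow> 'v \<Rightarrow> 'v \<Rightarrow> 'b" where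
  "differential S f p v =
     (THE d. \<forall>\<gamma>. curve_through S p v \<gamma> \<longrightarrow> ((\<lambda>t. f (\<gamma> t)) has_vector_derivative d) (at 0))"

section \<open>The torus and its symplectic form\<close>

text \<open>
  Points of the universal cover of \<open>M\<close> are vectors \<open>(y,w)\<close>, with \<open>y\<^sup>a\<close> in position \<open>Inl a\<close> and
  \<open>w\<^sup>a\<close> in position \<open>Inr a\<close>.  Tensor fields on \<open>M\<close> are given by their components in the frame
  \<open>(\<partial>\<^sub>y, \<partial>\<^sub>w)\<close>; these are functions of \<open>(y,w)\<close> that are periodic under the integer lattice.
\<close>

type_synonym 'n vec2 = "real^('n + 'n)"
type_synonym 'n endo = "real^('n + 'n)^('n + 'n)"
type_synonym 'n cvec2 = "complex^('n + 'n)"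
type_synonym 'n cendo = "complex^('n + 'n)^('n + 'n)"

definition pair_vec :: "'a^'n \<Rightarrow> 'a^'n \<Rightarrow> 'a^('n::finite + 'n)" where
  "pair_vec p q = (\<chi> i. case i of Inl a \<Rightarrow> p $ a | Inr a \<Rightarrow> q $ a)"

definition y_part :: "('n::finite) vec2 \<Rightarrow> real^'n" where
  "y_part p = (\<chi> a. p $ Inl a)"

definition block_mat ::
    "'a^'n^'n \<Rightarrow> 'a^'n^'n \<Rightarrow> 'a^'n^'n \<Rightarrow> 'a^'n^'n \<Rightarrow> 'a^('n::finite + 'n)^('n + 'n)" where
  "block_mat P Q R S = (\<chi> i j. case i of
      Inl a \<Rightarrow> (case j of Inl b \<Rightarrow> P $ a $ b | Inr b \<Rightarrow> Q $ a $ b)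
    | Inr a \<Rightarrow> (case j of Inl b \<Rightarrow> R $ a $ b | Inr b \<Rightarrow> S $ a $ b))"

text \<open>
  \<open>\<omega> = 2 \<Sum>\<^sub>a dy\<^sup>a \<and> dw\<^sup>a\<close>; over the complex numbers this is the complex bilinear extension.
\<close>

definition omega :: "'a^('n::finite + 'n) \<Rightarrow> 'a^('n + 'n) \<Rightarrow> 'a::comm_ring_1" where
  "omega v w = 2 * (\<Sum>a\<in>(UNIV::'n set). v $ Inl a * w $ Inr a - v $ Inr a * w $ Inl a)"

text \<open>
  Integration over \<open>M\<close> against \<open>\<omega>\<^sup>n/n! = 2\<^sup>n dy\<^sup>1 \<and> dw\<^sup>1 \<and> \<dots> \<and> dy\<^sup>n \<and> dw\<^sup>n\<close>, on the fundamental
  domain given by the unit cube.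
\<close>

definition integral_M :: "(('n::finite) vec2 \<Rightarrow> 'b::euclidean_space) \<Rightarrow> 'b" where
  "integral_M f = 2 ^ CARD('n) *\<^sub>R integral (cbox 0 One) f"

definition average_M :: "(('n::finite) vec2 \<Rightarrow> real) \<Rightarrow> real" where
  "average_M f = integral_M f / integral_M (\<lambda>p::'n vec2. 1::real)"

definition ham :: "(('n::finite) vec2 \<Rightarrow> real) set" where
  "ham = {h. smooth h \<and> lattice_periodic h \<and> integral_M h = 0}"

definition ham_field :: "(('n::finite) vec2 \<Rightarrow> real) \<Rightarrow> 'n vec2 \<Rightarrow> 'n vec2" where
  "ham_field h p = (THE X. \<forall>v. omega X v = - frechet_derivative h (at p) v)"

text \<open>
  Lie derivative of a field \<open>T\<close> of (real or complexified) endomorphisms of \<open>TM\<close>: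
  \<open>(\<L>\<^sub>X T)Y = [X, TY] - T[X, Y]\<close> in coordinates.
\<close>

definition lie_endo ::
    "(('n::finite) vec2 \<Rightarrow> 'n vec2) \<Rightarrow> ('n vec2 \<Rightarrow> ('a::real_normed_field)^('n + 'n)^('n + 'n))
      \<Rightarrow> 'n vec2 \<Rightarrow> 'a^('n + 'n)^('n + 'n)" where
  "lie_endo X T p =
     (let DX = cmat (matrix (frechet_derivative X (at p)))
      in frechet_derivative T (at p) (X p) - DX ** T p + T p ** DX)"

section \<open>Compatible complex structures and cotangent vectors, pointwise\<close>

definition AC :: "('n::finite) endo set" where
  "AC = {J. J ** J = - mat 1 \<and> (\<forall>v w. omega (J *v v) (J *v w) = omega v w) \<and>
            (\<forall>v. v \<noteq> 0 \<longrightarrow> 0 < omega v (J *v v))}"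

definition tangent_AC :: "('n::finite) endo \<Rightarrow> 'n endo set" where
  "tangent_AC J = {B. J ** B + B ** J = 0 \<and>
            (\<forall>v w. omega (J *v v) (B *v w) + omega (B *v v) (J *v w) = 0)}"

definition T10 :: "('n::finite) endo \<Rightarrow> 'n cvec2 set" where
  "T10 J = {v. cmat J *v v = \<i> *s v}"

definition T01 :: "('n::finite) endo \<Rightarrow> 'n cvec2 set" where
  "T01 J = {v. cmat J *v v = - \<i> *s v}"

text \<open>
  A cotangent vector \<open>\<alpha>\<close> is the matrix of an endomorphism of the complexified cotangent space
  (extended by \<open>0\<close>), acting on columns of covector components; its dual is the transpose, an
  endomorphism of the complexified tangent space.
\<close>

definition dual_endo :: "('n::finite) cendo \<Rightarrow> 'n cendo" where
  "dual_endo \<alpha> = transpose \<alpha>"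

definition real_endo :: "('n::finite) cendo \<Rightarrow> 'n endo" where
  "real_endo \<alpha> = map_matrix Re (dual_endo \<alpha> + cnj_mat (dual_endo \<alpha>))"

definition cotangent_AC :: "('n::finite) endo \<Rightarrow> 'n cendo set" where
  "cotangent_AC J = {\<alpha>.
     (\<forall>v\<in>T10 J. dual_endo \<alpha> *v v \<in> T01 J) \<and> (\<forall>v\<in>T01 J. dual_endo \<alpha> *v v = 0) \<and>
     real_endo \<alpha> \<in> tangent_AC J}"

definition cotangent_bundle_AC :: "(('n::finite) endo \<times> 'n cendo) set" where
  "cotangent_bundle_AC = {(J, \<alpha>). J \<in> AC \<and> \<alpha> \<in> cotangent_AC J}"

text \<open>The \<open>(1,0)\<close>-covector on \<open>T\<^sub>J AC\<close> given by \<open>\<alpha>\<close>.\<close>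

definition pairing :: "('n::finite) cendo \<Rightarrow> 'n endo \<Rightarrow> complex" where
  "pairing \<alpha> B = trace (dual_endo \<alpha> ** cmat B) / 2"

section \<open>The complex structure of the holomorphic cotangent bundle\<close>

text \<open>
  The Siegel coordinate \<open>\<tau>\<close> of \<open>J\<close> is the complex symmetric matrix, with positive definite
  imaginary part, whose graph is \<open>T\<^sup>0\<^sup>1\<^sub>J\<close>.  It is a global chart of \<open>AC\<close> with values in the Siegel
  upper half space \<open>Sp(2n)/U(n)\<close>, and it is holomorphic for the complex structure
  \<open>B \<mapsto> J B\<close>: differentiating \<open>J f = -i f\<close>, the subspace \<open>T\<^sup>0\<^sup>1\<^sub>J\<close> varies along \<open>B\<close> by the map
  \<open>(i/2) B : T\<^sup>0\<^sup>1\<^sub>J \<rightarrow> T\<^sup>1\<^sup>0\<^sub>J\<close>, and \<open>J\<close> is multiplication by \<open>i\<close> on the target.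
\<close>

definition siegel :: "('n::finite) endo \<Rightarrow> complex^'n^'n" where
  "siegel J = (THE \<tau>. \<forall>v. pair_vec v (\<tau> *v v) \<in> T01 J)"

text \<open>
  The fibre coordinates on the holomorphic cotangent bundle dual to the holomorphic coordinates
  \<open>\<tau>\<close>: the symmetric matrix \<open>\<zeta>\<close> such that the covector is \<open>Tr(\<zeta> d\<tau>)\<close>.
\<close>

definition fibre_coord :: "('n::finite) endo \<times> 'n cendo \<Rightarrow> complex^'n^'n" where
  "fibre_coord = (\<lambda>(J, \<alpha>). THE \<zeta>. transpose \<zeta> = \<zeta> \<and>
     (\<forall>B\<in>tangent_AC J. pairing \<alpha> B = trace (\<zeta> ** differential AC siegel J B)))"

text \<open>
  The induced complex structure: it covers \<open>B \<mapsto> J B\<close> on the base, and the fibre coordinates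
  \<open>\<zeta>\<close> are holomorphic for it, so that \<open>(\<tau>, \<zeta>)\<close> is a holomorphic chart.
\<close>

definition cplx_I ::
    "('n::finite) endo \<times> 'n cendo \<Rightarrow> 'n endo \<times> 'n cendo \<Rightarrow> 'n endo \<times> 'n cendo" where
  "cplx_I p v = (THE w. w \<in> tangent_vectors cotangent_bundle_AC p \<and>
     fst w = fst p ** fst v \<and>
     differential cotangent_bundle_AC fibre_coord p w =
       map_matrix (\<lambda>c. \<i> * c) (differential cotangent_bundle_AC fibre_coord p v))"

section \<open>The Biquard--Gauduchon function\<close>

text \<open>The value at \<open>0\<close> is the removable singularity.\<close>

definition f0 :: "real \<Rightarrow> real" where
  "f0 x = (if x = 0 then 1 / 4
           else (1 / x) * (sqrt (1 + x) - 1 - ln ((1 + sqrt (1 + x)) / 2)))"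

definition Xi :: "('n::finite) endo \<Rightarrow> 'n endo \<Rightarrow> 'n endo" where
  "Xi A B = (- 1 / 2) *\<^sub>R (A ** A ** B + B ** (A ** A))"

text \<open>
  The formula is meaningful only where \<open>\<alpha>\<close> composed with its conjugate has spectral radius less
  than \<open>1\<close>: there the eigenvalues of \<open>\<Xi>\<^sub>A\<close> lie in \<open>(-1, 0]\<close>.  This is an open condition, so the
  values elsewhere do not affect the differential of \<open>\<rho>\<close> at such points.
\<close>

definition BG :: "('n::finite) endo \<times> 'n cendo \<Rightarrow> real" where
  "BG = (\<lambda>(J, \<alpha>). let A = real_endo \<alpha>
     in trace (fun_calc (tangent_AC J) f0 (Xi A) A ** A) / 2)"

definition dc_BG :: "('n::finite) endo \<times> 'n cendo \<Rightarrow> 'n endo \<times> 'n cendo \<Rightarrow> real" where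
  "dc_BG p v = - differential cotangent_bundle_AC BG p (cplx_I p v)"

section \<open>Scalar curvature\<close>

text \<open>Holomorphic coordinates on an open set \<open>U\<close>; \<open>J\<close> is a field of complex structures.\<close>

definition holomorphic_chart ::
    "(('n::finite) vec2 \<Rightarrow> 'n endo) \<Rightarrow> 'n vec2 set \<Rightarrow> ('n vec2 \<Rightarrow> complex^'n) \<Rightarrow> bool" where
  "holomorphic_chart J U z \<longleftrightarrow> open U \<and> smooth_in U z \<and> inj_on z U \<and>
     (\<forall>q\<in>U. inj (frechet_derivative z (at q)) \<and>
        (\<forall>v. frechet_derivative z (at q) (J q *v v) = \<i> *s frechet_derivative z (at q) v))"

text \<open>The coordinate vector field \<open>\<partial>/\<partial>z\<^sup>a\<close>, dual to the coframe \<open>dz\<^sup>b\<close>, \<open>cnj dz\<^sup>b\<close>.\<close>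

definition coord_field ::
    "(('n::finite) vec2 \<Rightarrow> complex^'n) \<Rightarrow> 'n \<Rightarrow> 'n vec2 \<Rightarrow> 'n cvec2" where
  "coord_field z a q = (THE Z. \<forall>b.
     (\<Sum>k\<in>UNIV. Z $ k * pd k (\<lambda>x. z x $ b) q) = (if a = b then 1 else 0) \<and>
     (\<Sum>k\<in>UNIV. Z $ k * cnj (pd k (\<lambda>x. z x $ b) q)) = 0)"

definition vec_deriv ::
    "(('n::finite) vec2 \<Rightarrow> 'n cvec2) \<Rightarrow> ('n vec2 \<Rightarrow> complex) \<Rightarrow> 'n vec2 \<Rightarrow> complex" where
  "vec_deriv Z f q = (\<Sum>k\<in>UNIV. Z q $ k * pd k f q)"

definition dz :: "(('n::finite) vec2 \<Rightarrow> complex^'n) \<Rightarrow> 'n \<Rightarrow> ('n vec2 \<Rightarrow> complex) \<Rightarrow> 'n vec2 \<Rightarrow> complex" where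
  "dz z a = vec_deriv (coord_field z a)"

definition dzbar :: "(('n::finite) vec2 \<Rightarrow> complex^'n) \<Rightarrow> 'n \<Rightarrow> ('n vec2 \<Rightarrow> complex) \<Rightarrow> 'n vec2 \<Rightarrow> complex" where
  "dzbar z a = vec_deriv (\<lambda>q. cnj_vec (coord_field z a q))"

text \<open>
  The components \<open>g(Z\<^sub>a, cnj Z\<^sub>b)\<close> for \<open>Z\<^sub>a = \<partial>/\<partial>z\<^sup>a\<close>, where \<open>g = \<omega>(\<cdot>, J\<cdot>)\<close> is extended complex
  bilinearly.
\<close>

definition metric_mat ::
    "(('n::finite) vec2 \<Rightarrow> 'n endo) \<Rightarrow> ('n vec2 \<Rightarrow> complex^'n) \<Rightarrow> 'n vec2 \<Rightarrow> complex^'n^'n" where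
  "metric_mat J z q =
     (\<chi> a b. omega (coord_field z a q) (cmat (J q) *v cnj_vec (coord_field z b q)))"

text \<open>
  For integrable \<open>J\<close> the value does not depend on the holomorphic coordinates.  The first index of
  \<open>g\<^sup>a\<^sup>b\<close> is the unbarred one and \<open>\<Sum>\<^sub>b g\<^sup>a\<^sup>b g\<^sub>c\<^sub>b = \<delta>\<close>, whence the transposed indices below.
\<close>

definition scalar_curvature :: "(('n::finite) vec2 \<Rightarrow> 'n endo) \<Rightarrow> 'n vec2 \<Rightarrow> real" where
  "scalar_curvature J p = (THE s. \<exists>U z. holomorphic_chart J U z \<and> p \<in> U \<and>
     complex_of_real s = - (\<Sum>a\<in>UNIV. \<Sum>b\<in>UNIV.
       matrix_inv (metric_mat J z p) $ b $ a *
       dz z a (dzbar z b (\<lambda>q. Ln (det (metric_mat J z q)))) p))"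

section \<open>Moment maps\<close>

definition moment_R ::
    "(('n::finite) vec2 \<Rightarrow> 'n endo) \<Rightarrow> ('n vec2 \<Rightarrow> 'n cendo) \<Rightarrow> ('n vec2 \<Rightarrow> real) \<Rightarrow> real" where
  "moment_R J \<alpha> h =
     integral_M (\<lambda>x. 2 * (scalar_curvature J x - average_M (scalar_curvature J)) * h x) +
     integral_M (\<lambda>x. dc_BG (J x, \<alpha> x)
       (lie_endo (ham_field h) J x,
        dual_endo (lie_endo (ham_field h) (\<lambda>q. dual_endo (\<alpha> q)) x)))"

definition moment_C ::
    "(('n::finite) vec2 \<Rightarrow> 'n endo) \<Rightarrow> ('n vec2 \<Rightarrow> 'n cendo) \<Rightarrow> ('n vec2 \<Rightarrow> real) \<Rightarrow> complex" where
  "moment_C J \<alpha> h = - integral_M (\<lambda>x. pairing (\<alpha> x) (lie_endo (ham_field h) J x))"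

section \<open>Symplectic potentials and Higgs tensors\<close>

definition hessian :: "(real^'n::finite \<Rightarrow> real) \<Rightarrow> real^'n \<Rightarrow> real^'n^'n" where
  "hessian u y = (\<chi> a b. pd b (pd a u) y)"

definition symplectic_potential :: "(real^'n::finite \<Rightarrow> real) \<Rightarrow> bool" where
  "symplectic_potential u \<longleftrightarrow>
     (\<exists>\<phi>. smooth \<phi> \<and> lattice_periodic \<phi> \<and> u = (\<lambda>y. (norm y)\<^sup>2 / 2 + \<phi> y)) \<and>
     (\<forall>y. pos_def (hessian u y))"

definition J_of :: "(real^'n::finite \<Rightarrow> real) \<Rightarrow> 'n vec2 \<Rightarrow> 'n endo" where
  "J_of u p = (let H = hessian u (y_part p) in block_mat 0 (- matrix_inv H) H 0)"

text \<open>\<open>Z\<^sub>a = (u\<^sup>a\<^sup>b \<partial>\<^sub>y\<^sub>b - i \<partial>\<^sub>w\<^sub>a) / 2\<close>\<close>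

definition Z_frame :: "(real^'n::finite \<Rightarrow> real) \<Rightarrow> 'n \<Rightarrow> 'n vec2 \<Rightarrow> 'n cvec2" where
  "Z_frame u a p = (1 / 2) *s pair_vec
     (\<chi> b. complex_of_real (matrix_inv (hessian u (y_part p)) $ a $ b)) (- \<i> *s axis a 1)"

definition cotangent_field :: "(('n::finite) vec2 \<Rightarrow> 'n endo) \<Rightarrow> ('n vec2 \<Rightarrow> 'n cendo) \<Rightarrow> bool" where
  "cotangent_field J \<alpha> \<longleftrightarrow>
     smooth \<alpha> \<and> lattice_periodic \<alpha> \<and> (\<forall>p. \<alpha> p \<in> cotangent_AC (J p))"

text \<open>The frame \<open>(\<partial>\<^sub>y, \<partial>\<^sub>w)\<close> is itself invariant under translations in \<open>w\<close>.\<close>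

definition torus_invariant :: "(('n::finite) vec2 \<Rightarrow> 'b) \<Rightarrow> bool" where
  "torus_invariant T \<longleftrightarrow> (\<forall>p t. T (p + pair_vec 0 t) = T p)"

definition higgs_tensor ::
    "(real^'n::finite \<Rightarrow> real) \<Rightarrow> ('n vec2 \<Rightarrow> 'n cendo) \<Rightarrow> (real^'n \<Rightarrow> complex^'n^'n) \<Rightarrow> bool" where
  "higgs_tensor u \<alpha> \<xi> \<longleftrightarrow>
     smooth \<xi> \<and> lattice_periodic \<xi> \<and> (\<forall>y. transpose (\<xi> y) = \<xi> y) \<and>
     (\<forall>p a. dual_endo (\<alpha> p) *v Z_frame u a p =
        (\<Sum>b\<in>UNIV. \<Sum>c\<in>UNIV.
          (complex_of_real (hessian u (y_part p) $ b $ c) * \<xi> (y_part p) $ c $ a) *s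
            cnj_vec (Z_frame u b p)))"

text \<open>\<open>\<xi> D\<^sup>2u cnj(\<xi>) D\<^sup>2u\<close>\<close>

definition higgs_square ::
    "(real^'n::finite \<Rightarrow> real) \<Rightarrow> (real^'n \<Rightarrow> complex^'n^'n) \<Rightarrow> real^'n \<Rightarrow> complex^'n^'n" where
  "higgs_square u \<xi> y = \<xi> y ** cmat (hessian u y) ** cnj_mat (\<xi> y) ** cmat (hessian u y)"

end

theory Submission
  imports Defs
begin

text \<open>
  The Siegel coordinate \<open>\<tau>\<close> of \<open>J\<close> and the dual fibre coordinate reduce all pointwise objects to matrix
  algebra.  With \<open>R\<close> the square root of \<open>1 - A\<^sup>2\<close> that is positive for \<open>g\<^sub>J\<close>, the Biquard--Gauduchon
  function is \<open>(tr (1 - R) + log det ((1 + R) / 2)) / 2\<close>.  It is invariant under the symplectic group, so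
  its differential only sees the part of a tangent vector transverse to the orbits.  At \<open>J\<^sub>u\<close> the
  operator \<open>R\<close> is given by \<open>\<sigma> = (1 - \<xi> D\<^sup>2u cnj(\<xi>) D\<^sup>2u)\<^sup>1\<^sup>/\<^sup>2\<close>, and with \<open>G = (D\<^sup>2u)\<inverse>\<close> one finds that
  \<open>d\<^sup>c\<rho>\<close> on the Lie derivatives along \<open>X\<^sub>h\<close> is \<open>Re tr ((1 - \<sigma>) G D\<^sup>2\<^sub>y h) / 2\<close> up to \<open>w\<close>-derivatives.
  Abreu's formula \<open>s(g\<^sub>J) = - G\<^sup>a\<^sup>b\<^sub>,\<^sub>a\<^sub>b / 4\<close> cancels the term with \<open>G\<close>, and integration by parts gives
  \<open>m\<^sup>\<real>(h) = - (\<integral> (\<sigma> G)\<^sup>a\<^sup>b\<^sub>,\<^sub>a\<^sub>b h) / 2\<close> and \<open>m\<^sup>\<complex>(h) = (\<integral> \<xi>\<^sup>a\<^sup>b\<^sub>,\<^sub>a\<^sub>b h) / 4\<close>.  A double divergence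
  has mean zero, so the functions \<open>h\<close> of mean zero suffice to detect it.

  These computations need \<open>R\<close> to be smooth in \<open>y\<close>, which follows from the Sylvester equation satisfied
  by its derivative.
\<close>


section \<open>Partial derivatives and smoothness\<close>

text \<open>Differentials, functional calculus and curvature are definite descriptions: over all
  curves, over some spectral decomposition, over some holomorphic chart. Each evaluation therefore
  needs existence together with independence of the choice. This is why the Biquard--Gauduchon
  function is differentiated along arbitrary curves in the bundle and why the curvature is computed
  in an arbitrary chart.

  All coefficients depend on y alone, so a term linear in a derivative of h that contains a
  w-derivative integrates to zero. The vector \<open>X_h\<close> moves y only through w-derivatives
  of h. Hence the derivative of \<xi> and the whole variation of the fibre coordinate disappear, and
  only the block of second y-derivatives of h remains.

  The link between R and \<sigma> is that R commutes with J. It therefore acts on the (0,1) space,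
  which the first component identifies with \<open>\<complex>^n\<close>, and there the square of A
  becomes \<xi> H cnj(\<xi>) H.

  The product \<sigma> G need not be real, whereas the real moment map is a real functional. The
  imaginary part of \<sigma> G is antisymmetric, so its double divergence vanishes and nothing is
  lost.\<close>

lemma pd_eq:
  assumes "(f has_derivative f') (at x)" shows "pd k f x = f' (axis k 1)"
  unfolding pd_def using frechet_derivative_at[OF assms] by simp

lemma pd_const [simp]: "pd k (\<lambda>x. c) = (\<lambda>x. 0)"
  by (rule ext, rule pd_eq) (auto intro: derivative_eq_intros)

lemma pd_add:
  assumes "f differentiable at x" "g differentiable at x"
  shows "pd k (\<lambda>x. f x + g x) x = pd k f x + pd k g x"
  using assms unfolding frechet_derivative_works
  by (intro pd_eq[THEN trans]) (auto simp: pd_def intro: derivative_eq_intros)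

lemma pd_bounded_linear:
  assumes "bounded_linear L" "f differentiable at x"
  shows "pd k (\<lambda>x. L (f x)) x = L (pd k f x)"
  using assms unfolding frechet_derivative_works
  by (intro pd_eq[THEN trans]) (auto simp: pd_def intro: bounded_linear.has_derivative)

lemma pd_mult:
  fixes f g :: "real^'m::finite \<Rightarrow> 'a::real_normed_field"
  assumes "f differentiable at x" "g differentiable at x"
  shows "pd k (\<lambda>x. f x * g x) x = f x * pd k g x + pd k f x * g x"
  using assms unfolding frechet_derivative_works
  by (intro pd_eq[THEN trans]) (auto simp: pd_def intro: has_derivative_mult)

lemma pd_inverse:
  fixes f :: "real^'m::finite \<Rightarrow> 'a::real_normed_field"
  assumes "f differentiable at x" "f x \<noteq> 0"
  shows "pd k (\<lambda>x. inverse (f x)) x = - (inverse (f x) * pd k f x * inverse (f x))"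
  using assms unfolding frechet_derivative_works
  by (intro pd_eq[THEN trans]) (auto simp: pd_def intro: has_derivative_inverse)

lemma pd_cong_open:
  assumes "open U" "x \<in> U" "\<And>y. y \<in> U \<Longrightarrow> f y = g y"
  shows "pd k f x = pd k g x"
proof -
  have "frechet_derivative f (at x) = frechet_derivative g (at x)"
    unfolding frechet_derivative_def
    using has_derivative_transform_within_open[OF _ assms(1,2), of f _ UNIV g]
      has_derivative_transform_within_open[OF _ assms(1,2), of g _ UNIV f] assms(3)
    by metis
  then show ?thesis by (simp add: pd_def)
qed

section \<open>Closure properties of smooth functions\<close>

lemma smooth_in_differentiable:
  assumes "smooth_in U f" "open U" "x \<in> U" shows "f differentiable at x"
  using assms(1)[unfolded smooth_in_def, rule_format, of "[]"] assms(2,3)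
  by (simp add: differentiable_on_eq_differentiable_at)

lemma smooth_differentiable: "smooth f \<Longrightarrow> f differentiable at x"
  using smooth_in_differentiable[of UNIV] by simp

lemma smooth_in_pd: "smooth_in U f \<Longrightarrow> smooth_in U (pd k f)"
  unfolding smooth_in_def
proof
  fix ks assume *: "\<forall>ks. foldr pd ks f differentiable_on U"
  show "foldr pd ks (pd k f) differentiable_on U"
    using *[rule_format, of "ks @ [k]"] by simp
qed

lemma smooth_continuous: "smooth f \<Longrightarrow> continuous_on A f"
  by (meson continuous_at_imp_continuous_on differentiable_imp_continuous_within smooth_differentiable)

text \<open>Smoothness is the largest property that implies differentiability and passes to partial
  derivatives. Exhibiting an invariant set \<open>Q\<close> replaces formulas for iterated
  derivatives of a composite expression.\<close>

lemma smooth_coinduct: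
  assumes "f \<in> Q" and diff: "\<And>g x. g \<in> Q \<Longrightarrow> g differentiable at x"
    and step: "\<And>g k. g \<in> Q \<Longrightarrow> pd k g \<in> Q"
  shows "smooth f"
proof -
  have "foldr pd ks f \<in> Q" for ks
    by (induction ks) (auto simp: assms)
  then show ?thesis
    unfolding smooth_in_def by (auto simp: differentiable_on_def intro: diff)
qed

lemma smooth_bounded_linear:
  assumes L: "bounded_linear L" and f: "smooth f" shows "smooth (\<lambda>x. L (f x))"
proof (rule smooth_coinduct[where Q = "{\<lambda>x. L (f x) | f. smooth f}"], goal_cases)
  case (2 g x)
  then show ?case
    by (force intro: differentiable_compose[of L] smooth_differentiable bounded_linear_imp_differentiable[OF L])
next
  case (3 g k)
  then obtain f where f: "smooth f" "g = (\<lambda>x. L (f x))" by auto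
  then have "pd k g = (\<lambda>x. L (pd k f x))"
    using pd_bounded_linear[OF L] smooth_differentiable by blast
  then show ?case using f smooth_in_pd by blast
qed (use f in auto)

lemma smooth_add:
  assumes "smooth f" "smooth g" shows "smooth (\<lambda>x. f x + g x)"
proof (rule smooth_coinduct[where Q = "{\<lambda>x. f x + g x | f g. smooth f \<and> smooth g}"], goal_cases)
  case (2 g x)
  then show ?case by (force intro: differentiable_add smooth_differentiable)
next
  case (3 h k)
  then obtain f g where f: "smooth f" "smooth g" "h = (\<lambda>x. f x + g x)" by auto
  then have "pd k h = (\<lambda>x. pd k f x + pd k g x)"
    using pd_add smooth_differentiable by blast
  then show ?case using f smooth_in_pd by blast
qed (use assms in auto)

lemma smooth_const [simp]: "smooth (\<lambda>x. c)"
  by (rule smooth_coinduct[where Q = "range (\<lambda>c x. c)"]) auto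

lemma smooth_minus: "smooth f \<Longrightarrow> smooth (\<lambda>x. - f x)"
  by (rule smooth_bounded_linear[OF bounded_linear_minus[OF bounded_linear_ident]])

lemma smooth_diff: "smooth f \<Longrightarrow> smooth g \<Longrightarrow> smooth (\<lambda>x. f x - g x)"
  using smooth_add[of f "\<lambda>x. - g x"] smooth_minus[of g] by simp

lemma smooth_sum: "(\<And>i. i \<in> I \<Longrightarrow> smooth (f i)) \<Longrightarrow> smooth (\<lambda>x. \<Sum>i\<in>I. f i x)"
  by (induction I rule: infinite_finite_induct) (auto intro: smooth_add)

lemma smooth_scaleR: "smooth f \<Longrightarrow> smooth (\<lambda>x. c *\<^sub>R f x)"
  by (rule smooth_bounded_linear[OF bounded_linear_scaleR_right])

lemma smooth_of_real: "smooth f \<Longrightarrow> smooth (\<lambda>x. of_real (f x))"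
  by (rule smooth_bounded_linear[OF bounded_linear_of_real])

lemma smooth_Re: "smooth f \<Longrightarrow> smooth (\<lambda>x. Re (f x))"
  by (rule smooth_bounded_linear[OF bounded_linear_Re])

lemma bounded_linear_axis: "bounded_linear (axis i :: 'a::real_normed_vector \<Rightarrow> 'a^'n::finite)"
proof (rule bounded_linear_intro[where K=1])
  fix x y :: 'a and r
  show "axis i (x + y) = axis i x + axis i y" "axis i (r *\<^sub>R x) = r *\<^sub>R axis i x"
    by (auto simp: vec_eq_iff axis_def)
  show "norm (axis i x :: 'a^'n) \<le> norm x * 1"
    by (simp add: norm_vec_def axis_def if_distrib[of norm] L2_set_def if_distrib[of "\<lambda>t. t\<^sup>2"] sum.delta cong: if_cong)
qed

lemma smooth_nth: "smooth f \<Longrightarrow> smooth (\<lambda>x. f x $ i)"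
  by (rule smooth_bounded_linear[OF bounded_linear_vec_nth])

lemma vec_axis_sum: "(v :: 'a::comm_monoid_add^'n::finite) = (\<Sum>i\<in>UNIV. axis i (v $ i))"
  by (simp add: vec_eq_iff axis_def if_distrib sum.delta cong: if_cong)

lemma smooth_vecI:
  assumes "\<And>i. smooth (\<lambda>x. f x $ i)" shows "smooth f"
proof -
  have "f = (\<lambda>x. \<Sum>i\<in>UNIV. axis i (f x $ i))" using vec_axis_sum by blast
  moreover have "smooth (\<lambda>x. \<Sum>i\<in>UNIV. axis i (f x $ i))"
    by (intro smooth_sum smooth_bounded_linear[OF bounded_linear_axis] assms)
  ultimately show ?thesis by simp
qed

lemma smooth_matI: "(\<And>i j. smooth (\<lambda>x. f x $ i $ j)) \<Longrightarrow> smooth f"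
  by (intro smooth_vecI)

lemma smooth_entry: "smooth f \<Longrightarrow> smooth (\<lambda>x. f x $ i $ j)"
  by (intro smooth_nth)

text \<open>Rational expressions in the functions of \<open>B\<close> with nowhere vanishing
  denominators. The generators are a parameter because the square root argument needs generators
  whose smoothness is still to be proved.\<close>

inductive_set fun_alg :: "(real^'m::finite \<Rightarrow> 'a::real_normed_field) set \<Rightarrow> (real^'m \<Rightarrow> 'a) set" for B where
  base: "f \<in> B \<Longrightarrow> f \<in> fun_alg B"
| const: "(\<lambda>x. c) \<in> fun_alg B"
| add: "f \<in> fun_alg B \<Longrightarrow> g \<in> fun_alg B \<Longrightarrow> (\<lambda>x. f x + g x) \<in> fun_alg B"
| mult: "f \<in> fun_alg B \<Longrightarrow> g \<in> fun_alg B \<Longrightarrow> (\<lambda>x. f x * g x) \<in> fun_alg B"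
| inv: "f \<in> fun_alg B \<Longrightarrow> (\<And>x. f x \<noteq> 0) \<Longrightarrow> (\<lambda>x. inverse (f x)) \<in> fun_alg B"

lemma fun_alg_minus: "f \<in> fun_alg B \<Longrightarrow> (\<lambda>x. - f x) \<in> fun_alg B"
  using fun_alg.mult[OF fun_alg.const[of "-1"], of f] by simp

lemma fun_alg_sum: "(\<And>i. i \<in> I \<Longrightarrow> f i \<in> fun_alg B) \<Longrightarrow> (\<lambda>x. \<Sum>i\<in>I. f i x) \<in> fun_alg B"
  by (induction I rule: infinite_finite_induct) (auto intro: fun_alg.intros)

lemma fun_alg_prod: "(\<And>i. i \<in> I \<Longrightarrow> f i \<in> fun_alg B) \<Longrightarrow> (\<lambda>x. \<Prod>i\<in>I. f i x) \<in> fun_alg B"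
  by (induction I rule: infinite_finite_induct) (auto intro: fun_alg.intros)

lemma fun_alg_det: "(\<And>i j. (\<lambda>x. M x $ i $ j) \<in> fun_alg B) \<Longrightarrow> (\<lambda>x. det (M x)) \<in> fun_alg B"
  unfolding det_def by (intro fun_alg_sum fun_alg.mult fun_alg_prod fun_alg.const)

lemma fun_alg_divide:
  "f \<in> fun_alg B \<Longrightarrow> g \<in> fun_alg B \<Longrightarrow> (\<And>x. g x \<noteq> 0) \<Longrightarrow> (\<lambda>x. f x / g x) \<in> fun_alg B"
  unfolding divide_inverse by (intro fun_alg.mult fun_alg.inv)

lemma fun_alg_differentiable:
  assumes "\<And>f x. f \<in> B \<Longrightarrow> f differentiable at x"
  shows "f \<in> fun_alg B \<Longrightarrow> f differentiable at x"
proof (induction arbitrary: x rule: fun_alg.induct)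
  case (inv f)
  then have "(f has_derivative frechet_derivative f (at x)) (at x)"
    using frechet_derivative_works by blast
  from Deriv.has_derivative_inverse[OF inv.hyps(2) this] show ?case unfolding differentiable_def by blast
qed (auto intro: assms differentiable_add differentiable_mult)

text \<open>By the product and quotient rules the algebra is closed under partial derivatives as
  soon as the derivatives of the generators lie in it. The generators may thus satisfy a
  differential equation that is rational in themselves, and differentiability alone is then
  enough.\<close>

lemma fun_alg_smooth:
  assumes diff: "\<And>f x. f \<in> B \<Longrightarrow> f differentiable at x"
    and step: "\<And>f k. f \<in> B \<Longrightarrow> pd k f \<in> fun_alg B"
    and f: "f \<in> fun_alg B"
  shows "smooth f"
proof (rule smooth_coinduct[where Q = "fun_alg B", OF f])
  show d: "\<And>g x. g \<in> fun_alg B \<Longrightarrow> g differentiable at x"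
    using fun_alg_differentiable diff by blast
  show "\<And>g k. g \<in> fun_alg B \<Longrightarrow> pd k g \<in> fun_alg B"
  proof -
    fix g k assume "g \<in> fun_alg B"
    then show "pd k g \<in> fun_alg B"
    proof (induction rule: fun_alg.induct)
      case (add f g)
      have "pd k (\<lambda>x. f x + g x) = (\<lambda>x. pd k f x + pd k g x)"
        using pd_add d add.hyps by blast
      then show ?case using add by (auto intro: fun_alg.intros)
    next
      case (mult f g)
      have "pd k (\<lambda>x. f x * g x) = (\<lambda>x. f x * pd k g x + pd k f x * g x)"
        using pd_mult d mult.hyps by blast
      then show ?case using mult by (auto intro!: fun_alg.add fun_alg.mult)
    next
      case (inv f)
      have "pd k (\<lambda>x. inverse (f x)) = (\<lambda>x. - (inverse (f x) * pd k f x * inverse (f x)))"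
        using pd_inverse d inv.hyps by blast
      then show ?case using inv by (auto intro!: fun_alg.mult fun_alg_minus fun_alg.inv)
    qed (auto intro: fun_alg.const step)
  qed
qed

lemma fun_alg_smooth_set: "f \<in> fun_alg {f. smooth f} \<Longrightarrow> smooth f"
  by (rule fun_alg_smooth) (auto intro: smooth_differentiable fun_alg.base smooth_in_pd)

lemma smooth_mult:
  fixes f g :: "real^'m::finite \<Rightarrow> 'a::real_normed_field"
  shows "smooth f \<Longrightarrow> smooth g \<Longrightarrow> smooth (\<lambda>x. f x * g x)"
  by (intro fun_alg_smooth_set fun_alg.mult) (auto intro: fun_alg.base)

lemma smooth_divide:
  fixes f g :: "real^'m::finite \<Rightarrow> 'a::real_normed_field"
  shows "smooth f \<Longrightarrow> smooth g \<Longrightarrow> (\<And>x. g x \<noteq> 0) \<Longrightarrow> smooth (\<lambda>x. f x / g x)"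
  by (intro fun_alg_smooth_set fun_alg_divide) (auto intro: fun_alg.base)

lemma smooth_det:
  fixes M :: "real^'m::finite \<Rightarrow> 'a::real_normed_field^'k^'k::finite"
  assumes "smooth M" shows "smooth (\<lambda>x. det (M x))"
  by (intro fun_alg_smooth_set fun_alg_det) (auto intro: fun_alg.base smooth_entry assms)

lemma smooth_matrix_mult:
  fixes A :: "real^'m::finite \<Rightarrow> 'a::real_normed_field^'k::finite^'l::finite"
    and B :: "real^'m::finite \<Rightarrow> 'a::real_normed_field^'q::finite^'k::finite"
  assumes "smooth A" "smooth B" shows "smooth (\<lambda>x. A x ** B x)"
  by (rule smooth_matI) (auto simp: matrix_matrix_mult_def intro!: smooth_sum smooth_mult smooth_entry assms)

lemma smooth_map_matrix: "bounded_linear L \<Longrightarrow> smooth A \<Longrightarrow> smooth (\<lambda>x. map_matrix L (A x))"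
  by (rule smooth_matI) (auto intro!: smooth_bounded_linear[where L=L] smooth_entry)

lemma smooth_cmat: "smooth A \<Longrightarrow> smooth (\<lambda>x. cmat (A x) :: 'a::real_normed_algebra_1^'k::finite^'l::finite)"
  unfolding cmat_def by (rule smooth_map_matrix[OF bounded_linear_of_real])

lemma smooth_block_mat:
  assumes "smooth P" "smooth Q" "smooth R" "smooth S"
  shows "smooth (\<lambda>x. block_mat (P x) (Q x) (R x) (S x))"
proof (rule smooth_matI)
  fix i j
  show "smooth (\<lambda>x. block_mat (P x) (Q x) (R x) (S x) $ i $ j)"
    using assms[THEN smooth_entry] by (cases i; cases j) (simp_all add: block_mat_def)
qed

lemma smooth_trace:
  fixes A :: "real^'m::finite \<Rightarrow> 'a::real_normed_field^'k::finite^'k::finite"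
  shows "smooth A \<Longrightarrow> smooth (\<lambda>x. trace (A x))"
  unfolding trace_def by (auto intro!: smooth_sum smooth_entry)

section \<open>Matrix inverses by Cramer's rule\<close>

lemma matrix_inv_props:
  assumes "invertible A"
  shows "A ** matrix_inv A = mat 1" "matrix_inv A ** A = mat 1"
  using assms someI_ex[of "\<lambda>A'. A ** A' = mat 1 \<and> A' ** A = mat 1"]
  unfolding invertible_def matrix_inv_def by auto

text \<open>\<open>matrix_inv\<close> is defined by choice. Cramer's rule makes its entries rational
  functions of the entries of \<open>A\<close>, which gives access to continuity and
  smoothness.\<close>

lemma matrix_inv_entry:
  fixes A :: "'a::field^'n^'n::finite"
  assumes "det A \<noteq> 0"
  shows "matrix_inv A $ k $ j = det (\<chi> i l. if l = k then mat 1 $ i $ j else A $ i $ l) / det A"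
proof -
  have "A ** matrix_inv A = mat 1"
    using matrix_inv_props(1)[of A] assms invertible_det_nz[of A] by blast
  then have "A *v (column j (matrix_inv A)) = column j (mat 1)"
    by (simp add: vec_eq_iff matrix_vector_mult_def matrix_matrix_mult_def column_def)
  then have "column j (matrix_inv A) = (\<chi> k. det (\<chi> i l. if l = k then column j (mat 1) $ i else A $ i $ l) / det A)"
    using cramer[OF assms] by blast
  then have "column j (matrix_inv A) $ k = det (\<chi> i l. if l = k then column j (mat 1) $ i else A $ i $ l) / det A"
    by simp
  then show ?thesis by (simp add: column_def cong: if_cong)
qed

lemma fun_alg_matrix_inv:
  assumes "\<And>i j. (\<lambda>x. M x $ i $ j) \<in> fun_alg B" "\<And>x. det (M x) \<noteq> 0"
  shows "(\<lambda>x. matrix_inv (M x) $ i $ j) \<in> fun_alg B"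
proof -
  have *: "(\<lambda>x. if c then f x else g x) \<in> fun_alg B" if "f \<in> fun_alg B" "g \<in> fun_alg B" for c f g
    using that by (cases c) auto
  show ?thesis
    unfolding matrix_inv_entry[OF assms(2)]
    by (intro fun_alg_divide fun_alg_det assms) (auto intro!: * fun_alg.const assms)
qed

lemma smooth_matrix_inv:
  fixes M :: "real^'m::finite \<Rightarrow> 'a::real_normed_field^'k^'k::finite"
  assumes "smooth M" "\<And>x. det (M x) \<noteq> 0" shows "smooth (\<lambda>x. matrix_inv (M x))"
  by (intro smooth_matI fun_alg_smooth_set fun_alg_matrix_inv assms(2))
    (auto intro: fun_alg.base smooth_entry assms)

section \<open>Functions of y alone on the universal cover\<close>

lemma y_part_add: "y_part (p + q) = y_part p + y_part q"
  by (simp add: y_part_def vec_eq_iff)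

lemma bounded_linear_y_part: "bounded_linear y_part"
proof -
  have "linear y_part"
    by unfold_locales (simp_all add: y_part_def vec_eq_iff)
  then show ?thesis using linear_conv_bounded_linear by blast
qed

lemma y_part_axis [simp]:
  "y_part (axis (Inl a) c) = axis a c" "y_part (axis (Inr a) c) = 0"
  by (simp_all add: y_part_def axis_def vec_eq_iff)

lemma pd_y_part:
  assumes "f differentiable at (y_part p)"
  shows "pd (Inl a) (\<lambda>p. f (y_part p)) p = pd a f (y_part p)"
    and "pd (Inr a) (\<lambda>p. f (y_part p)) p = 0"
proof -
  have y: "(y_part has_derivative y_part) (at p)"
    using bounded_linear_imp_has_derivative[OF bounded_linear_y_part] .
  have f: "(f has_derivative frechet_derivative f (at (y_part p))) (at (y_part p))"
    using assms frechet_derivative_works by blast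
  have *: "((\<lambda>p. f (y_part p)) has_derivative (\<lambda>x. frechet_derivative f (at (y_part p)) (y_part x))) (at p)"
    using has_derivative_compose[OF y f] .
  show "pd (Inl a) (\<lambda>p. f (y_part p)) p = pd a f (y_part p)"
    using pd_eq[OF *, of "Inl a"] by (simp add: pd_def)
  show "pd (Inr a) (\<lambda>p. f (y_part p)) p = 0"
    using pd_eq[OF *, of "Inr a"] linear_0[OF linear_frechet_derivative[OF assms]] by simp
qed

lemma smooth_y_part: "smooth f \<Longrightarrow> smooth (\<lambda>p. f (y_part p))"
proof (rule smooth_coinduct[where Q = "{\<lambda>p. f (y_part p) | f. smooth f}"], goal_cases)
  case (2 g x)
  then show ?case
    by (force intro: differentiable_compose[of _ y_part] smooth_differentiable
        bounded_linear_imp_differentiable[OF bounded_linear_y_part])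
next
  case (3 g k)
  then obtain f where f: "smooth f" "g = (\<lambda>x. f (y_part x))" by auto
  show ?case
  proof (cases k)
    case (Inl a)
    then have "pd k g = (\<lambda>x. pd a f (y_part x))" using f pd_y_part(1) smooth_differentiable by blast
    then show ?thesis using f smooth_in_pd by blast
  next
    case (Inr a)
    then have "pd k g = (\<lambda>x. (\<lambda>y. 0) (y_part x))" using f pd_y_part(2) smooth_differentiable by blast
    then show ?thesis by (auto intro!: exI[of _ "\<lambda>y. 0"])
  qed
qed auto

text \<open>Symmetry of second partial derivatives, by evaluating the second difference quotient with the
  mean value theorem.\<close>

lemma second_difference_limit:
  fixes f :: "real^'m::finite \<Rightarrow> real"
  assumes U: "open U" "x \<in> U" and f: "\<And>y. y \<in> U \<Longrightarrow> f differentiable at y"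
    and fi: "pd i f differentiable at x"
  shows "((\<lambda>t. (f (x + t *\<^sub>R axis i 1 + t *\<^sub>R axis j 1) - f (x + t *\<^sub>R axis i 1)
      - f (x + t *\<^sub>R axis j 1) + f x) / t\<^sup>2) \<longlongrightarrow> pd j (pd i f) x) (at_right 0)"
proof -
  define di dj :: "real^'m" where "di = axis i 1" and "dj = axis j 1"
  have nd: "norm di = 1" "norm dj = 1" by (simp_all add: di_def dj_def)
  define F where "F = frechet_derivative (pd i f) (at x)"
  have F: "(pd i f has_derivative F) (at x)"
    using fi frechet_derivative_works unfolding F_def by blast
  then have linF: "linear F" by (rule has_derivative_linear)
  obtain r where r: "r > 0" "ball x r \<subseteq> U" using U openE by blast
  have "\<forall>\<^sub>F t in at_right 0. \<bar>(f (x + t *\<^sub>R di + t *\<^sub>R dj) - f (x + t *\<^sub>R di) - f (x + t *\<^sub>R dj) + f x) / t\<^sup>2 - F dj\<bar> < e"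
    if e: "e > 0" for e
  proof -
    \<comment> \<open>The tolerance is e / 4 because the linear approximation is used at two points
      of distance at most 2 t and t from x. The errors add up to 3/4 e t, which stays strictly below
      e t.\<close>
    obtain d where d: "d > 0"
      "\<And>y. norm (y - x) < d \<Longrightarrow> \<bar>pd i f y - pd i f x - F (y - x)\<bar> \<le> e / 4 * norm (y - x)"
    proof -
      have "e / 4 > 0" using e by simp
      then show ?thesis using F that unfolding has_derivative_at_alt real_norm_def by blast
    qed
    \<comment> \<open>Halves, because the points used lie within distance 2 t of x.\<close>
    define m where "m = min (d / 2) (r / 2)"
    have "m > 0" using d r by (simp add: m_def)
    have "\<bar>(f (x + t *\<^sub>R di + t *\<^sub>R dj) - f (x + t *\<^sub>R di) - f (x + t *\<^sub>R dj) + f x) / t\<^sup>2 - F dj\<bar> < e"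
      if t: "0 < t" "t < m" for t
    proof -
      \<comment> \<open>The increment in direction j, as a function of the displacement s in
        direction i. The mean value theorem in s turns the second difference into t times a
        difference of values of \<open>pd i f\<close>, to which differentiability at x
        applies.\<close>
      define g where "g s = f (x + t *\<^sub>R dj + s *\<^sub>R di) - f (x + s *\<^sub>R di)" for s
      have nrm: "norm (c *\<^sub>R dj + s *\<^sub>R di) \<le> c + s" if "0 \<le> s" "0 \<le> c" for s c
        using norm_triangle_ineq[of "c *\<^sub>R dj" "s *\<^sub>R di"] that nd by simp
      have inU: "x + (c *\<^sub>R dj + s *\<^sub>R di) \<in> U" if "0 \<le> s" "s \<le> t" "0 \<le> c" "c \<le> t" for s c
      proof -
        have "norm (c *\<^sub>R dj + s *\<^sub>R di) < r" using nrm[of s c] that t by (simp add: m_def)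
        then have "x + (c *\<^sub>R dj + s *\<^sub>R di) \<in> ball x r"
          by (metis add_diff_cancel_left' dist_commute dist_norm mem_ball)
        then show ?thesis using r(2) by blast
      qed
      have der: "((\<lambda>s. f (x + c *\<^sub>R dj + s *\<^sub>R di)) has_real_derivative pd i f (x + c *\<^sub>R dj + s *\<^sub>R di)) (at s)"
        if "0 \<le> s" "s \<le> t" "0 \<le> c" "c \<le> t" for s c
      proof -
        let ?p = "x + c *\<^sub>R dj + s *\<^sub>R di"
        have "f differentiable at ?p" using f[OF inU[OF that]] by (simp add: add.assoc)
        then have fd: "(f has_derivative frechet_derivative f (at ?p)) (at ?p)"
          using frechet_derivative_works by blast
        have "((\<lambda>s. x + c *\<^sub>R dj + s *\<^sub>R di) has_derivative (\<lambda>h. h *\<^sub>R di)) (at s)"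
          by (auto intro!: derivative_eq_intros)
        from has_derivative_compose[OF this fd]
        have "((\<lambda>s. f (x + c *\<^sub>R dj + s *\<^sub>R di)) has_derivative (\<lambda>h. frechet_derivative f (at ?p) (h *\<^sub>R di))) (at s)" .
        moreover have "frechet_derivative f (at ?p) (h *\<^sub>R di) = h * pd i f ?p" for h
          using linear_cmul[OF has_derivative_linear[OF fd]] by (simp add: pd_def di_def)
        ultimately show ?thesis
          by (simp add: has_field_derivative_def mult_commute_abs)
      qed
      have gder: "(g has_real_derivative pd i f (x + t *\<^sub>R dj + s *\<^sub>R di) - pd i f (x + s *\<^sub>R di)) (at s)"
        if "0 \<le> s" "s \<le> t" for s
        using DERIV_diff[OF der[OF that, of t] der[OF that, of 0]] t by (simp add: g_def[abs_def])
      obtain s where s: "0 < s" "s < t"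
        "g t - g 0 = t * (pd i f (x + t *\<^sub>R dj + s *\<^sub>R di) - pd i f (x + s *\<^sub>R di))"
        using MVT2[OF t(1) gder] by auto
      let ?z1 = "t *\<^sub>R dj + s *\<^sub>R di" and ?z2 = "0 *\<^sub>R dj + s *\<^sub>R di"
      have n1: "norm ?z1 \<le> 2 * t" and n2: "norm ?z2 \<le> t"
        using nrm[of s t] s nd by auto
      have b1: "\<bar>pd i f (x + ?z1) - pd i f x - F ?z1\<bar> \<le> e / 4 * (2 * t)"
        using order_trans[OF d(2)[of "x + ?z1", unfolded add_diff_cancel_left'] mult_left_mono[OF n1, of "e / 4"]]
          n1 t e unfolding m_def by linarith
      have b2: "\<bar>pd i f (x + ?z2) - pd i f x - F ?z2\<bar> \<le> e / 4 * t"
        using order_trans[OF d(2)[of "x + ?z2", unfolded add_diff_cancel_left'] mult_left_mono[OF n2, of "e / 4"]]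
          n2 t e unfolding m_def by linarith
      have "F ?z1 - F ?z2 = t * F dj"
        using linear_add[OF linF] linear_cmul[OF linF] by simp
      moreover have "e / 4 * (2 * t) = 2 * (e / 4 * t)" "e / 4 * (3 * t) = 3 * (e / 4 * t)" by simp_all
      ultimately have "\<bar>(pd i f (x + ?z1) - pd i f (x + ?z2)) - t * F dj\<bar> \<le> e / 4 * (3 * t)"
        using b1 b2 by linarith
      moreover have "(g t - g 0) / t\<^sup>2 - F dj = ((pd i f (x + ?z1) - pd i f (x + ?z2)) - t * F dj) / t"
        unfolding s(3) using t(1) by (simp add: power2_eq_square add.assoc diff_divide_distrib)
      ultimately have "\<bar>(g t - g 0) / t\<^sup>2 - F dj\<bar> \<le> e / 4 * (3 * t) / t"
        using divide_right_mono[of _ _ t] t by (simp only: abs_divide abs_of_pos less_imp_le)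
      also have "\<dots> < e" using t e by simp
      finally show ?thesis by (simp add: g_def algebra_simps)
    qed
    then show ?thesis using \<open>m > 0\<close> unfolding eventually_at_right_field by blast
  qed
  then show ?thesis
    unfolding tendsto_iff dist_real_def di_def[symmetric] dj_def[symmetric]
    by (simp add: F_def pd_def dj_def)
qed

lemma pd_commute_real:
  fixes f :: "real^'m::finite \<Rightarrow> real"
  assumes U: "open U" "x \<in> U" and f: "\<And>y. y \<in> U \<Longrightarrow> f differentiable at y"
    and fi: "pd i f differentiable at x" and fj: "pd j f differentiable at x"
  shows "pd i (pd j f) x = pd j (pd i f) x"
proof -
  have e: "(\<lambda>t. (f (x + t *\<^sub>R axis i 1 + t *\<^sub>R axis j 1) - f (x + t *\<^sub>R axis i 1)
      - f (x + t *\<^sub>R axis j 1) + f x) / t\<^sup>2) = (\<lambda>t. (f (x + t *\<^sub>R axis j 1 + t *\<^sub>R axis i 1) - f (x + t *\<^sub>R axis j 1)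
      - f (x + t *\<^sub>R axis i 1) + f x) / t\<^sup>2)"
    by (simp add: algebra_simps)
  show ?thesis
    using second_difference_limit[OF U f fi, of j] second_difference_limit[OF U f fj, of i]
    unfolding e by (meson tendsto_unique trivial_limit_at_right_real)
qed

text \<open>The real case applies to each component with respect to an orthonormal basis of the
  target.\<close>

lemma pd_commute_in:
  fixes f :: "real^'m::finite \<Rightarrow> 'b::euclidean_space"
  assumes U: "open U" "x \<in> U" and f: "\<And>y. y \<in> U \<Longrightarrow> f differentiable at y"
    and fi: "\<And>i y. y \<in> U \<Longrightarrow> pd i f differentiable at y"
  shows "pd i (pd j f) x = pd j (pd i f) x"
proof (rule euclidean_eqI)
  fix b :: 'b
  have L: "bounded_linear (\<lambda>v. v \<bullet> b)" by (rule bounded_linear_inner_left)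
  have 1: "pd k (\<lambda>y. f y \<bullet> b) y = pd k f y \<bullet> b" if "y \<in> U" for k y
    using pd_bounded_linear[OF L f[OF that]] .
  have 2: "pd l (pd k (\<lambda>y. f y \<bullet> b)) x = pd l (pd k f) x \<bullet> b" for k l
    by (rule trans[OF pd_cong_open[OF U 1] pd_bounded_linear[OF L fi[OF U(2)]]])
  have dl: "(\<lambda>y. g y \<bullet> b) differentiable at y" if "g differentiable at y" for g :: "real^'m \<Rightarrow> 'b" and y
    using differentiable_compose[OF bounded_linear_imp_differentiable[OF L] that] by simp
  have 3: "pd k (\<lambda>y. f y \<bullet> b) differentiable at x" for k
  proof -
    have "((\<lambda>y. pd k f y \<bullet> b) has_derivative frechet_derivative (\<lambda>y. pd k f y \<bullet> b) (at x)) (at x)"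
      using dl[OF fi[OF U(2)]] frechet_derivative_works by blast
    then have "(pd k (\<lambda>y. f y \<bullet> b) has_derivative frechet_derivative (\<lambda>y. pd k f y \<bullet> b) (at x)) (at x)"
      by (rule has_derivative_transform_within_open[OF _ U]) (simp add: 1)
    then show ?thesis unfolding differentiable_def by blast
  qed
  show "pd i (pd j f) x \<bullet> b = pd j (pd i f) x \<bullet> b"
    using pd_commute_real[OF U dl[OF f] 3 3, of i j] by (simp add: 2)
qed

lemma pd_commute:
  fixes f :: "real^'m::finite \<Rightarrow> 'b::euclidean_space"
  assumes "smooth_in U f" "open U" "x \<in> U"
  shows "pd i (pd j f) x = pd j (pd i f) x"
  using assms by (intro pd_commute_in) (auto intro: smooth_in_differentiable smooth_in_pd)

section \<open>Periodic functions and integration over the unit cube\<close>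

lemma lattice_periodic_pd:
  assumes "lattice_periodic f" shows "lattice_periodic (pd k f)"
  unfolding lattice_periodic_def
proof (intro allI impI)
  fix x m :: "real^'a" assume m: "\<forall>i. m $ i \<in> \<int>"
  have e: "(\<lambda>x. f (x + m)) = f" using assms m by (auto simp: lattice_periodic_def)
  have "(f has_derivative f') (at (x + m)) \<longleftrightarrow> (f has_derivative f') (at x)" for f'
  proof -
    have "((\<lambda>x. f (x + m)) has_derivative f') (at x) \<longleftrightarrow> (f has_derivative f') (at (x + m))"
    proof
      assume *: "((\<lambda>x. f (x + m)) has_derivative f') (at x)"
      have "((\<lambda>y. y - m) has_derivative (\<lambda>h. h)) (at (x + m))" by (auto intro!: derivative_eq_intros)
      from has_derivative_compose[OF this, of "\<lambda>x. f (x + m)" f'] *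
      show "(f has_derivative f') (at (x + m))" by simp
    next
      assume *: "(f has_derivative f') (at (x + m))"
      have "((\<lambda>y. y + m) has_derivative (\<lambda>h. h)) (at x)" by (auto intro!: derivative_eq_intros)
      from has_derivative_compose[OF this *]
      show "((\<lambda>x. f (x + m)) has_derivative f') (at x)" by simp
    qed
    then show ?thesis by (simp add: e)
  qed
  then show "pd k f (x + m) = pd k f x" by (simp add: pd_def frechet_derivative_def)
qed

lemma One_nth: "(One :: real^'m) $ i = 1"
  by (subst cart_eq_inner_axis) (simp add: axis_in_Basis_iff)

lemma sum_Basis_nth [simp]: "(\<Sum>b\<in>Basis. (b :: real^'m) $ i) = 1"
  using One_nth[of i] by simp

text \<open>Cut the translated cube along the hyperplane where coordinate i equals 1. The slab
  beyond it moves back by one period and fills exactly the part of the unit cube that the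
  translation left.\<close>

lemma integral_cube_translate:
  fixes f :: "real^'m::finite \<Rightarrow> 'b::euclidean_space"
  assumes f: "continuous_on UNIV f" "lattice_periodic f" and t: "0 \<le> t" "t \<le> 1"
  shows "integral (cbox 0 One) (\<lambda>x. f (x + t *\<^sub>R axis i 1)) = integral (cbox 0 One) f"
proof -
  let ?e = "axis i 1 :: real^'m"
  have cb: "x \<in> cbox a b \<longleftrightarrow> (a $ i \<le> x $ i \<and> x $ i \<le> b $ i) \<and> (\<forall>k. k \<noteq> i \<longrightarrow> a $ k \<le> x $ k \<and> x $ k \<le> b $ k)"
    for x a b :: "real^'m" by (metis mem_box_cart(2))
  have ax: "?e $ i = 1" "\<And>k. k \<noteq> i \<Longrightarrow> ?e $ k = 0" by (simp_all add: axis_def)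
  have int: "f integrable_on cbox a b" for a b
    using integrable_continuous[OF continuous_on_subset[OF f(1)]] by simp
  have "integral (cbox 0 One) (\<lambda>x. f (x + t *\<^sub>R ?e)) = integral (cbox (t *\<^sub>R ?e) (One + t *\<^sub>R ?e)) f"
    using integral_shift_cbox[of "t *\<^sub>R ?e" "t *\<^sub>R ?e" "One + t *\<^sub>R ?e" f] by simp
  also have "\<dots> = integral (cbox (t *\<^sub>R ?e) (One + t *\<^sub>R ?e) \<inter> {x. x \<bullet> ?e \<le> 1}) f
     + integral (cbox (t *\<^sub>R ?e) (One + t *\<^sub>R ?e) \<inter> {x. x \<bullet> ?e \<ge> 1}) f"
    by (rule integral_split[OF int]) (simp add: axis_in_Basis_iff)
  also have "cbox (t *\<^sub>R ?e) (One + t *\<^sub>R ?e) \<inter> {x. x \<bullet> ?e \<le> 1} = cbox 0 One \<inter> {x. x \<bullet> ?e \<ge> t}"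
    using t by (auto simp: cb ax cart_eq_inner_axis[symmetric])
  also have "cbox (t *\<^sub>R ?e) (One + t *\<^sub>R ?e) \<inter> {x. x \<bullet> ?e \<ge> 1} = cbox ?e (One + t *\<^sub>R ?e)"
    using t by (auto simp: cb ax cart_eq_inner_axis[symmetric])
  also have "integral (cbox ?e (One + t *\<^sub>R ?e)) f = integral (cbox (?e - ?e) (One + t *\<^sub>R ?e - ?e)) (\<lambda>x. f (x + ?e))"
    by (rule integral_shift_cbox[symmetric])
  also have "(\<lambda>x. f (x + ?e)) = f"
    using f(2) by (auto simp: lattice_periodic_def axis_def)
  also have "cbox (?e - ?e) (One + t *\<^sub>R ?e - ?e) = cbox 0 One \<inter> {x. x \<bullet> ?e \<le> t}"
    using t by (auto simp: cb ax cart_eq_inner_axis[symmetric])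
  also have "integral (cbox 0 One \<inter> {x. x \<bullet> ?e \<ge> t}) f + integral (cbox 0 One \<inter> {x. x \<bullet> ?e \<le> t}) f
      = integral (cbox 0 One) f"
    using integral_split[OF int, of ?e 0 One t] by (simp add: axis_in_Basis_iff)
  finally show ?thesis .
qed

text \<open>The integral over the translated cube does not depend on the translation, and
  differentiating it under the integral sign at t = 0 gives the integral of \<open>pd i f\<close>.
  The derivative is taken within [0,1], the range in which translation invariance is
  available.\<close>

lemma integral_pd_zero:
  fixes f :: "real^'m::finite \<Rightarrow> 'b::euclidean_space"
  assumes f: "smooth f" "lattice_periodic f"
  shows "integral (cbox 0 One) (pd i f) = 0"
proof -
  let ?e = "axis i 1 :: real^'m"
  have c: "continuous_on UNIV f" "continuous_on UNIV (pd i f)"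
    using f smooth_continuous smooth_in_pd by blast+
  have d: "((\<lambda>t. f (x + t *\<^sub>R ?e)) has_vector_derivative pd i f (x + t *\<^sub>R ?e)) (at t within {0..1})" for x t
  proof -
    have fd: "(f has_derivative frechet_derivative f (at (x + t *\<^sub>R ?e))) (at (x + t *\<^sub>R ?e))"
      using smooth_differentiable[OF f(1)] frechet_derivative_works by blast
    have "((\<lambda>t. x + t *\<^sub>R ?e) has_derivative (\<lambda>h. h *\<^sub>R ?e)) (at t within {0..1})"
      by (auto intro!: derivative_eq_intros)
    from has_derivative_compose[OF this fd] show ?thesis
      using linear_cmul[OF has_derivative_linear[OF fd]]
      by (simp add: has_vector_derivative_def pd_def)
  qed
  have "((\<lambda>t. integral (cbox 0 One) (\<lambda>x. f (x + t *\<^sub>R ?e))) has_vector_derivative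
     integral (cbox 0 One) (\<lambda>x. pd i f (x + 0 *\<^sub>R ?e))) (at 0 within {0..1})"
  proof (rule leibniz_rule_vector_derivative)
    show "(\<lambda>x. f (x + t *\<^sub>R ?e)) integrable_on cbox 0 One" for t
      by (intro integrable_continuous continuous_intros continuous_on_compose2[OF c(1)]) auto
    show "continuous_on ({0..1} \<times> cbox 0 One) (\<lambda>(t, x). pd i f (x + t *\<^sub>R ?e))"
      unfolding split_beta by (intro continuous_intros continuous_on_compose2[OF c(2)]) auto
  qed (use d in auto)
  then have "((\<lambda>t. integral (cbox 0 One) f) has_vector_derivative integral (cbox 0 One) (pd i f)) (at 0 within {0..1})"
    by (intro has_vector_derivative_transform[of 0 "{0..1}" "\<lambda>t. integral (cbox 0 One) f"
          "\<lambda>t. integral (cbox 0 One) (\<lambda>x. f (x + t *\<^sub>R ?e))"])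
      (simp_all add: integral_cube_translate[OF c(1) f(2)])
  moreover have "((\<lambda>t. integral (cbox 0 One) f) has_vector_derivative 0) (at 0 within {0..1})" by simp
  ultimately show ?thesis
    by (metis atLeastAtMost_iff vector_derivative_unique_within_closed_interval[of 0 1 0]
        order_refl zero_less_one zero_le_one cbox_interval)
qed

lemma lattice_periodic_mult [intro]:
  "lattice_periodic f \<Longrightarrow> lattice_periodic g \<Longrightarrow> lattice_periodic (\<lambda>x. f x * g x)"
  by (auto simp: lattice_periodic_def)

lemma integrable_smooth: "smooth f \<Longrightarrow> f integrable_on cbox a b" for f :: "real^'m::finite \<Rightarrow> 'b::euclidean_space"
  by (intro integrable_continuous smooth_continuous)

lemma integral_by_parts:
  fixes f g :: "real^'m::finite \<Rightarrow> 'a::{real_normed_field, euclidean_space}"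
  assumes f: "smooth f" "lattice_periodic f" and g: "smooth g" "lattice_periodic g"
  shows "integral (cbox 0 One) (\<lambda>x. f x * pd i g x) = - integral (cbox 0 One) (\<lambda>x. pd i f x * g x)"
proof -
  have "pd i (\<lambda>x. f x * g x) = (\<lambda>x. f x * pd i g x + pd i f x * g x)"
    using pd_mult smooth_differentiable f g by blast
  then have "integral (cbox 0 One) (\<lambda>x. f x * pd i g x + pd i f x * g x) = 0"
    using integral_pd_zero[OF smooth_mult[OF f(1) g(1)], of i] f g by auto
  moreover have "integral (cbox 0 One) (\<lambda>x. f x * pd i g x + pd i f x * g x)
     = integral (cbox 0 One) (\<lambda>x. f x * pd i g x) + integral (cbox 0 One) (\<lambda>x. pd i f x * g x)"
    by (intro Henstock_Kurzweil_Integration.integral_add integrable_smooth smooth_mult smooth_in_pd f g)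
  ultimately show ?thesis by (simp add: eq_neg_iff_add_eq_0)
qed

text \<open>Subtracting the integer parts of the coordinates moves any point into the cube, where a
  continuous nonnegative function with zero integral vanishes.\<close>

lemma periodic_square_integral_zero:
  fixes f :: "real^'m::finite \<Rightarrow> real"
  assumes f: "continuous_on UNIV f" "lattice_periodic f" and 0: "integral (cbox 0 One) (\<lambda>x. f x * f x) = 0"
  shows "f x = 0"
proof -
  define x' where "x' = (\<chi> i. frac (x $ i))"
  have x': "x' \<in> cbox 0 One" by (auto simp: x'_def mem_box_cart less_imp_le[OF frac_lt_1])
  have c: "continuous_on (cbox 0 One) (\<lambda>x. f x * f x)"
    by (intro continuous_intros continuous_on_subset[OF f(1)]) auto
  have "((\<lambda>x. f x * f x) has_integral 0) (cbox 0 One)"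
    using integrable_integral[OF integrable_continuous[OF c]] 0 by simp
  moreover have "box (0::real^'m) One \<noteq> {}" by (auto simp: box_ne_empty)
  ultimately have "f x' * f x' = 0"
    using has_integral_0_cbox_imp_0[OF c _ _ _ x'] by auto
  moreover have "f (x' + (\<chi> i. of_int \<lfloor>x $ i\<rfloor>)) = f x'"
    using f(2) by (auto simp: lattice_periodic_def)
  moreover have "x' + (\<chi> i. of_int \<lfloor>x $ i\<rfloor>) = x"
    by (auto simp: vec_eq_iff x'_def frac_def)
  ultimately show ?thesis by auto
qed

section \<open>Matrices depending on parameters\<close>

lemma matmul_add_left: "(A + B) ** C = A ** C + B ** (C :: 'a::semiring_1^'p^'n::finite)"
  and matmul_zero_left [simp]: "(0 :: 'a^'n^'m) ** C = 0"
  by (simp_all add: matrix_matrix_mult_def vec_eq_iff algebra_simps sum.distrib)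

lemma matmul_minus_left: "(- A) ** C = - (A ** (C :: 'a::ring_1^'p^'n::finite))"
  and matmul_minus_right: "A' ** (- C) = - (A' ** (C :: 'a::ring_1^'p^'n::finite))"
  by (simp_all add: matrix_matrix_mult_def vec_eq_iff sum_negf)

lemma matmul_diff_left: "(A - B) ** C = A ** C - B ** (C :: 'a::ring_1^'p^'n::finite)"
  and matmul_diff_right: "C' ** (A' - B') = C' ** A' - C' ** (B' :: 'a::ring_1^'p^'n::finite)"
  by (simp_all add: matrix_matrix_mult_def vec_eq_iff algebra_simps sum_subtractf)

lemma matmul_scaleR_left: "(c *\<^sub>R A) ** C = c *\<^sub>R (A ** (C :: 'a::real_algebra_1^'p^'n::finite))"
  and matmul_scaleR_right: "A' ** (c *\<^sub>R C) = c *\<^sub>R (A' ** (C :: 'a::real_algebra_1^'p^'n::finite))"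
  by (simp_all add: matrix_matrix_mult_def vec_eq_iff scaleR_sum_right)

text \<open>Scaling by elements of the coefficient ring itself. \<open>*\<^sub>R\<close> offers real
  scalars only, while factors of \<i> occur everywhere below.\<close>

definition cscale :: "'a::times \<Rightarrow> 'a^'n^'m \<Rightarrow> 'a^'n^'m" (infixr "*k" 75) where
  "c *k M = (\<chi> i j. c * M $ i $ j)"

lemma cscale_nth [simp]: "(c *k M) $ i $ j = c * M $ i $ j"
  by (simp add: cscale_def)

lemma map_matrix_cscale: "map_matrix (\<lambda>x. c * x) M = c *k M"
  by (simp add: vec_eq_iff)

lemma cscale_mult_left: "(c *k A) ** B = c *k (A ** (B :: 'a::comm_ring_1^'p^'n::finite))"
  and cscale_mult_right: "A' ** (c *k B) = c *k (A' ** (B :: 'a::comm_ring_1^'p^'n::finite))"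
  by (simp_all add: matrix_matrix_mult_def vec_eq_iff sum_distrib_left mult.left_commute mult.assoc)

lemma cscale_cscale: "c *k d *k A = (c * d) *k (A :: 'a::comm_ring_1^'p^'n)"
  and cscale_add: "c *k (A + B) = c *k A + c *k B"
  and cscale_diff: "c *k (A - B) = c *k A - c *k B"
  and cscale_minus: "c *k (- A) = - (c *k A)"
  and cscale_minus_left: "(- c) *k A = - (c *k A)"
  and cscale_one [simp]: "1 *k A = A"
  and cscale_zero [simp]: "c *k 0 = (0 :: 'a^'p^'n)"
  by (simp_all add: vec_eq_iff algebra_simps)

lemma transpose_add: "transpose (A + B) = transpose A + transpose B"
  and transpose_diff: "transpose (A' - B') = transpose A' - transpose B'"
  and transpose_minus: "transpose (- A') = - transpose (A' :: 'b::ab_group_add^'m^'k)"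
  and transpose_zero [simp]: "transpose 0 = 0"
  and transpose_cscale: "transpose (c *k C) = c *k transpose C"
  by (simp_all add: transpose_def vec_eq_iff)

lemma trace_cscale: "trace (c *k A) = c * trace (A :: 'a::comm_ring_1^'n^'n::finite)"
  and trace_minus: "trace (- A) = - trace A"
  and trace_zero [simp]: "trace (0 :: 'a^'n^'n) = 0"
  by (simp_all add: trace_def sum_distrib_left sum_negf)

lemmas mat_expand = matmul_add_left matrix_add_ldistrib matmul_minus_left matmul_minus_right
  matmul_diff_left matmul_diff_right matmul_scaleR_left matmul_scaleR_right matrix_mul_assoc[symmetric]
  cscale_mult_left cscale_mult_right cscale_cscale cscale_add cscale_diff cscale_minus cscale_minus_left

lemma bounded_bilinear_matmul:
  "bounded_bilinear ((**) :: 'a::{real_normed_field, euclidean_space}^'n::finite^'m::finite \<Rightarrow> 'a^'p::finite^'n \<Rightarrow> _)"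
proof -
  have "bilinear ((**) :: 'a^'n^'m \<Rightarrow> 'a^'p^'n \<Rightarrow> _)"
    unfolding bilinear_def
    by (intro conjI allI linearI)
      (simp_all add: matrix_matrix_mult_def vec_eq_iff algebra_simps sum.distrib scaleR_sum_right)
  then show ?thesis by (simp add: bilinear_conv_bounded_bilinear)
qed

lemma bounded_linear_trace: "bounded_linear (trace :: 'a::{real_normed_field, euclidean_space}^'n^'n::finite \<Rightarrow> 'a)"
proof -
  have "linear (trace :: 'a^'n^'n \<Rightarrow> 'a)"
    by (intro linearI) (simp_all add: trace_def sum.distrib scaleR_sum_right)
  then show ?thesis by (simp add: linear_conv_bounded_linear)
qed

lemmas has_derivative_matmul = bounded_bilinear.FDERIV[OF bounded_bilinear_matmul]
lemmas has_vector_derivative_matmul = bounded_bilinear.has_vector_derivative[OF bounded_bilinear_matmul]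
lemmas continuous_matmul = bounded_bilinear.continuous[OF bounded_bilinear_matmul]
lemmas tendsto_matmul = bounded_bilinear.tendsto[OF bounded_bilinear_matmul]

text \<open>If the second factor vanishes at \<open>x\<close>, continuity of the first suffices for differentiability.\<close>

lemma (in bounded_bilinear) has_derivative_vanishing:
  fixes f :: "'d::real_normed_vector \<Rightarrow> 'a"
  assumes f: "isCont f x" and g: "(g has_derivative g') (at x)" and 0: "g x = 0"
  shows "((\<lambda>t. prod (f t) (g t)) has_derivative (\<lambda>h. prod (f x) (g' h))) (at x)"
proof -
  have g': "bounded_linear g'" using g by (rule has_derivative_bounded_linear)
  obtain B where B: "B > 0" "\<And>h. norm (g' h) \<le> norm h * B"
    using bounded_linear.pos_bounded[OF g'] by blast
  obtain K where K: "K > 0" "\<And>a b. norm (prod a b) \<le> norm a * norm b * K"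
    using pos_bounded by blast
  have "((\<lambda>t. prod (f t - f x) (g t)) has_derivative (\<lambda>h. 0)) (at x)"
    unfolding has_derivative_at_alt
  proof (intro conjI allI impI)
    fix e :: real assume e: "e > 0"
    \<comment> \<open>Near x the factor \<open>g\<close> is bounded by (B + 1) times the distance: B
      comes from its derivative, and 1 from applying differentiability with tolerance 1. This
      \<open>e'\<close> makes the product of all bounds equal to e.\<close>
    define e' where "e' = e / ((B + 1) * K)"
    have e': "e' > 0" using e B K by (simp add: e'_def)
    obtain d1 where d1: "d1 > 0" "\<And>y. norm (y - x) < d1 \<Longrightarrow> norm (f y - f x) < e'"
      using f e' unfolding continuous_at_eps_delta dist_norm by blast
    obtain d2 where d2: "d2 > 0" "\<And>y. norm (y - x) < d2 \<Longrightarrow> norm (g y - g x - g' (y - x)) \<le> 1 * norm (y - x)"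
      using g unfolding has_derivative_at_alt by (meson zero_less_one)
    show "\<exists>d>0. \<forall>y. norm (y - x) < d \<longrightarrow>
        norm (prod (f y - f x) (g y) - prod (f x - f x) (g x) - 0) \<le> e * norm (y - x)"
    proof (intro exI[of _ "min d1 d2"] conjI allI impI)
      fix y assume y: "norm (y - x) < min d1 d2"
      have "norm (g y) \<le> norm (g y - g x - g' (y - x)) + norm (g' (y - x))"
        using norm_triangle_ineq[of "g y - g x - g' (y - x)" "g' (y - x)"] 0 by simp
      also have "\<dots> \<le> norm (y - x) * (B + 1)"
        using d2(2)[of y] B(2)[of "y - x"] y by (simp add: algebra_simps)
      finally have gy: "norm (g y) \<le> norm (y - x) * (B + 1)" .
      have "norm (prod (f y - f x) (g y)) \<le> norm (f y - f x) * norm (g y) * K" by (rule K)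
      also have "\<dots> \<le> e' * (norm (y - x) * (B + 1)) * K"
        using d1(2)[of y] y gy K e' by (intro mult_right_mono mult_mono) auto
      also have "\<dots> = e * norm (y - x)" using B K by (simp add: e'_def)
      finally show "norm (prod (f y - f x) (g y) - prod (f x - f x) (g x) - 0) \<le> e * norm (y - x)"
        using 0 by (simp add: zero_right)
    qed (use d1 d2 in auto)
  qed simp
  moreover have "((\<lambda>t. prod (f x) (g t)) has_derivative (\<lambda>h. prod (f x) (g' h))) (at x)"
    using bounded_linear.has_derivative[OF bounded_linear_right g] .
  ultimately have "((\<lambda>t. prod (f x) (g t) + prod (f t - f x) (g t)) has_derivative (\<lambda>h. prod (f x) (g' h) + 0)) (at x)"
    by (intro has_derivative_add)
  then show ?thesis by (simp add: diff_left)
qed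

lemmas has_derivative_matmul_vanishing =
  bounded_bilinear.has_derivative_vanishing[OF bounded_bilinear_matmul]

section \<open>Continuity and derivatives of inverses and determinants\<close>

lemma continuous_entry: "continuous F f \<Longrightarrow> continuous F (\<lambda>x. f x $ i $ j)"
  by (intro continuous_component)

lemma continuous_matI:
  fixes f :: "'b::t2_space \<Rightarrow> 'a::topological_space^'n^'m"
  shows "(\<And>i j. continuous F (\<lambda>x. f x $ i $ j)) \<Longrightarrow> continuous F f"
  unfolding continuous_def by (intro vec_tendstoI) auto

lemma continuous_det:
  fixes M :: "'b::t2_space \<Rightarrow> 'a::real_normed_field^'n^'n::finite"
  assumes "continuous F M" shows "continuous F (\<lambda>x. det (M x))"
  unfolding det_def by (intro continuous_intros continuous_prod continuous_entry assms)

lemma isCont_matrix_inv: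
  fixes M :: "'b::t2_space \<Rightarrow> 'a::real_normed_field^'n^'n::finite"
  assumes M: "isCont M x" and d: "det (M x) \<noteq> 0"
  shows "isCont (\<lambda>x. matrix_inv (M x)) x"
proof (rule continuous_matI)
  fix k j
  have "isCont (\<lambda>x. det (M x)) x" using M by (rule continuous_det)
  then have "\<forall>\<^sub>F y in at x. det (M y) \<noteq> 0"
    using d unfolding isCont_def by (rule tendsto_imp_eventually_ne)
  then have ev: "\<forall>\<^sub>F y in nhds x. det (M y) \<noteq> 0"
    using d by (simp add: eventually_nhds_conv_at)
  have *: "isCont (\<lambda>x. if c then f x else g x) x" if "isCont f x" "isCont g x"
    for c and f g :: "'b \<Rightarrow> 'a" using that by (cases c) auto
  have cq: "isCont (\<lambda>x. det (\<chi> i l. if l = k then mat 1 $ i $ j else M x $ i $ l) / det (M x)) x"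
    by (intro isCont_divide continuous_det continuous_matI M d)
      (simp, intro * continuous_const continuous_entry M)
  then show "isCont (\<lambda>x. matrix_inv (M x) $ k $ j) x"
  proof -
    have "\<forall>\<^sub>F y in nhds x. det (\<chi> i l. if l = k then mat 1 $ i $ j else M y $ i $ l) / det (M y)
        = matrix_inv (M y) $ k $ j"
      using ev by eventually_elim (simp add: matrix_inv_entry)
    from isCont_cong[OF this] show ?thesis using cq by blast
  qed
qed

text \<open>The inverse at t equals G - M(t)^-1 (M(t) - M(x)) G with G the inverse at x. The last
  product vanishes at x, so mere continuity of the inverse yields its differentiability.\<close>

lemma has_derivative_matrix_inv:
  fixes M :: "'b::real_normed_vector \<Rightarrow> 'a::{real_normed_field, euclidean_space}^'n^'n::finite"
  assumes M: "(M has_derivative M') (at x)" and d: "det (M x) \<noteq> 0"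
  shows "((\<lambda>x. matrix_inv (M x)) has_derivative (\<lambda>h. - (matrix_inv (M x) ** M' h ** matrix_inv (M x)))) (at x)"
proof -
  let ?G = "matrix_inv (M x)"
  have c: "isCont M x" using M has_derivative_continuous by blast
  have ic: "isCont (\<lambda>x. - matrix_inv (M x)) x" by (intro continuous_minus isCont_matrix_inv c d)
  have G: "M x ** ?G = mat 1" "?G ** M x = mat 1"
    using matrix_inv_props d invertible_det_nz by blast+
  have vd: "((\<lambda>t. (M t - M x) ** ?G) has_derivative (\<lambda>h. M' h ** ?G)) (at x)"
    by (rule has_derivative_eq_rhs[OF has_derivative_matmul[OF has_derivative_diff[OF M has_derivative_const]
            has_derivative_const]]) simp
  have D: "((\<lambda>t. ?G + (- matrix_inv (M t)) ** ((M t - M x) ** ?G)) has_derivative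
      (\<lambda>h. 0 + (- ?G) ** (M' h ** ?G))) (at x)"
    by (intro has_derivative_add has_derivative_const has_derivative_matmul_vanishing[OF ic vd]) simp
  have "isCont (\<lambda>x. det (M x)) x" using c by (rule continuous_det)
  then have "\<forall>\<^sub>F y in at x. det (M y) \<noteq> 0"
    using d unfolding isCont_def by (rule tendsto_imp_eventually_ne)
  then have ev: "\<forall>\<^sub>F t in at x. ?G + (- matrix_inv (M t)) ** ((M t - M x) ** ?G) = matrix_inv (M t)"
  proof eventually_elim
    case (elim t)
    then have "matrix_inv (M t) ** M t = mat 1" using matrix_inv_props invertible_det_nz by blast
    then have "matrix_inv (M t) ** (M t ** ?G) = ?G" by (simp add: matrix_mul_assoc)
    then show ?case using G by (simp add: mat_expand)
  qed
  show ?thesis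
    by (rule has_derivative_transform_eventually[OF has_derivative_eq_rhs[OF D] ev])
      (use G in \<open>simp_all add: mat_expand\<close>)
qed

text \<open>In the Leibniz formula differentiated at the identity, the product over all indices
  except i vanishes unless the permutation fixes each of them. Such a permutation fixes i as well,
  so only the identity contributes.\<close>

lemma has_derivative_det_id:
  fixes M :: "'b::real_normed_vector \<Rightarrow> 'a::real_normed_field^'n^'n::finite"
  assumes M: "(M has_derivative M') (at x)" and 1: "M x = mat 1"
  shows "((\<lambda>x. det (M x)) has_derivative (\<lambda>h. trace (M' h))) (at x)"
proof -
  have e: "((\<lambda>x. M x $ i $ j) has_derivative (\<lambda>h. M' h $ i $ j)) (at x)" for i j
    by (intro bounded_linear.has_derivative[OF bounded_linear_vec_nth] M)
  have D: "((\<lambda>x. det (M x)) has_derivative (\<lambda>h. \<Sum>p | p permutes UNIV. of_int (sign p) *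
      (\<Sum>i\<in>UNIV. M' h $ i $ p i * (\<Prod>j\<in>UNIV - {i}. M x $ j $ p j)))) (at x)"
    unfolding det_def
    by (intro has_derivative_sum has_derivative_mult_right has_derivative_prod e)
  have "(\<Sum>p | p permutes UNIV. of_int (sign p) *
      (\<Sum>i\<in>UNIV. M' h $ i $ p i * (\<Prod>j\<in>UNIV - {i}. M x $ j $ p j))) = trace (M' h)" for h
  proof -
    have z: "(\<Prod>j\<in>UNIV - {i}. M x $ j $ p j) = (if p = id then 1 else 0)"
      if p: "p permutes UNIV" for p i
    proof (cases "p = id")
      case False
      have "\<exists>j. j \<noteq> i \<and> p j \<noteq> j"
      proof (rule ccontr)
        assume "\<not> ?thesis"
        then have *: "\<And>j. j \<noteq> i \<Longrightarrow> p j = j" by auto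
        have "p i = i" using *[of "p i"] permutes_inj[OF p] by (auto dest: injD)
        with * have "p j = j" for j by (cases "j = i") auto
        with False show False by auto
      qed
      then obtain j where "j \<noteq> i" "p j \<noteq> j" by blast
      then have "(\<Prod>j\<in>UNIV - {i}. M x $ j $ p j) = 0"
        by (intro prod_zero) (auto simp: 1 mat_def intro!: bexI[of _ j])
      then show ?thesis using False by simp
    qed (simp add: 1 mat_def)
    have "(\<Sum>p | p permutes UNIV. of_int (sign p) *
      (\<Sum>i\<in>UNIV. M' h $ i $ p i * (\<Prod>j\<in>UNIV - {i}. M x $ j $ p j)))
      = (\<Sum>p | p permutes (UNIV :: 'n set). if p = id then trace (M' h) else 0)"
      by (intro sum.cong) (auto simp: z sign_id trace_def)
    also have "\<dots> = trace (M' h)" by (simp add: permutes_id finite_permutations)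
    finally show ?thesis .
  qed
  then show ?thesis using D by simp
qed

text \<open>Multiplying by the inverse at x reduces to the derivative at the identity.\<close>

lemma has_derivative_det:
  fixes M :: "'b::real_normed_vector \<Rightarrow> 'a::{real_normed_field, euclidean_space}^'n^'n::finite"
  assumes M: "(M has_derivative M') (at x)" and d: "det (M x) \<noteq> 0"
  shows "((\<lambda>x. det (M x)) has_derivative (\<lambda>h. det (M x) * trace (matrix_inv (M x) ** M' h))) (at x)"
proof -
  let ?G = "matrix_inv (M x)"
  have G: "M x ** ?G = mat 1" "?G ** M x = mat 1"
    using matrix_inv_props d invertible_det_nz by blast+
  have "((\<lambda>t. ?G ** M t) has_derivative (\<lambda>h. ?G ** M' h)) (at x)"
    by (rule has_derivative_eq_rhs[OF has_derivative_matmul[OF has_derivative_const M]]) simp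
  from has_derivative_mult_right[OF has_derivative_det_id[OF this G(2)], of "det (M x)"]
  show ?thesis by (simp add: det_mul[symmetric] matrix_mul_assoc G)
qed

section \<open>Self-adjoint matrices for an inner product and their square roots\<close>

lemma inner_transpose: "x \<bullet> (A *v y) = (transpose A *v x) \<bullet> (y :: real^'n)"
  by (simp add: dot_lmul_matrix)

lemma symmetric_inner: "transpose A = A \<Longrightarrow> x \<bullet> (A *v y) = y \<bullet> (A *v (x :: real^'n))"
  using inner_transpose[of x A y] by (simp add: inner_commute)

lemma det_nonzero_ker:
  fixes A :: "'a::field^'n^'n::finite"
  assumes "\<And>x. A *v x = 0 \<Longrightarrow> x = 0" shows "det A \<noteq> 0"
  using assms by (metis invertible_det_nz invertible_left_inverse matrix_left_invertible_ker)

lemma pos_def_mult_det: "pos_def (g ** M) \<Longrightarrow> det M \<noteq> 0"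
  by (rule det_nonzero_ker) (auto simp: pos_def_def matrix_vector_mul_assoc[symmetric])

lemma pos_def_det: "pos_def g \<Longrightarrow> det g \<noteq> 0"
  by (rule det_nonzero_ker) (auto simp: pos_def_def)

lemma pos_def_bound:
  fixes g :: "real^'n^'n::finite"
  assumes "pos_def g" shows "\<exists>c>0. \<forall>x. c * (norm x)\<^sup>2 \<le> x \<bullet> (g *v x)"
proof -
  have "continuous_on (sphere 0 1) (\<lambda>x. x \<bullet> (g *v x))" by (intro continuous_intros)
  then obtain x0 where x0: "norm x0 = 1" "\<And>x. norm x = 1 \<Longrightarrow> x0 \<bullet> (g *v x0) \<le> x \<bullet> (g *v x)"
    using continuous_attains_inf[of "sphere (0::real^'n) 1" "\<lambda>x. x \<bullet> (g *v x)"] by auto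
  have "x0 \<noteq> 0" using x0 by auto
  then have "x0 \<bullet> (g *v x0) > 0" using assms by (simp add: pos_def_def)
  moreover have "x0 \<bullet> (g *v x0) * (norm x)\<^sup>2 \<le> x \<bullet> (g *v x)" for x
  proof (cases "x = 0")
    case False
    have "x0 \<bullet> (g *v x0) \<le> (inverse (norm x) *\<^sub>R x) \<bullet> (g *v (inverse (norm x) *\<^sub>R x))"
      using False by (intro x0) simp
    also have "\<dots> = (x \<bullet> (g *v x)) / (norm x)\<^sup>2"
      by (simp add: matrix_vector_mult_scaleR power2_eq_square field_simps)
    finally show ?thesis using False by (simp add: field_simps)
  qed simp
  ultimately show ?thesis by blast
qed

definition diag_mat :: "('n \<Rightarrow> 'a::zero) \<Rightarrow> 'a^'n^'n::finite" where
  "diag_mat d = (\<chi> i j. if i = j then d i else 0)"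

lemma mult_diag_mat: "(A ** diag_mat d) $ i $ j = A $ i $ j * (d j :: 'a::semiring_1)"
  by (simp add: matrix_matrix_mult_def diag_mat_def if_distrib sum.delta cong: if_cong)

lemma diag_mat_mult: "(diag_mat d ** A) $ i $ j = (d i :: 'a::semiring_1) * A $ i $ j"
  by (simp add: matrix_matrix_mult_def diag_mat_def if_distrib[of "\<lambda>x. x * _"] sum.delta cong: if_cong)

lemma quadratic_bound_zero:
  fixes a c :: real assumes "\<And>t. 2 * t * a \<le> t\<^sup>2 * c" shows "a = 0"
proof -
  let ?m = "\<bar>c\<bar> + 1"
  \<comment> \<open>The choice t = a / (|c| + 1) turns the hypothesis into 2 a^2 / m \<le> a^2 /
    m.\<close>
  have "2 * (a / ?m) * a \<le> (a / ?m)\<^sup>2 * c" by (rule assms)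
  also have "\<dots> \<le> (a / ?m)\<^sup>2 * ?m" by (intro mult_left_mono) auto
  also have "\<dots> = a\<^sup>2 / ?m" by (simp add: power2_eq_square)
  finally have "2 * a\<^sup>2 / ?m \<le> a\<^sup>2 / ?m" by (simp add: power2_eq_square mult.assoc)
  then have "a\<^sup>2 / ?m \<le> 0" by simp
  then show ?thesis using abs_ge_zero[of c] by (auto simp: divide_le_0_iff)
qed

text \<open>The next eigenvector maximizes the quadratic form of \<open>M\<close> on the unit sphere of the
  \<open>g\<close>-orthogonal complement of the previous ones.\<close>

lemma orthonormal_eigenvectors:
  fixes g M :: "real^'n^'n::finite"
  assumes g: "pos_def g" "transpose g = g" and M: "transpose (g ** M) = g ** M" and I: "finite (I :: 'n set)"
  shows "\<exists>v l. (\<forall>i\<in>I. M *v v i = l i *\<^sub>R v i) \<and>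
      (\<forall>i\<in>I. \<forall>j\<in>I. v i \<bullet> (g *v v j) = (if i = j then 1 else 0))"
  using I
proof (induction I rule: finite_induct)
  case (insert k I)
  then obtain v l where v: "\<And>i. i \<in> I \<Longrightarrow> M *v v i = l i *\<^sub>R v i"
    "\<And>i j. i \<in> I \<Longrightarrow> j \<in> I \<Longrightarrow> v i \<bullet> (g *v v j) = (if i = j then 1 else 0)" by blast
  define W where "W = {x. \<forall>i\<in>I. v i \<bullet> (g *v x) = 0}"
  define q where "q x = x \<bullet> (g *v (M *v x))" for x
  define b where "b x = x \<bullet> (g *v x)" for x
  have Mg: "x \<bullet> (g *v (M *v y)) = (M *v x) \<bullet> (g *v y)" for x y
    using symmetric_inner[OF M, of x y] symmetric_inner[OF g(2), of "M *v x" y]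
    by (simp add: matrix_vector_mul_assoc)
  have Wlin: "x + t *\<^sub>R y \<in> W" "t *\<^sub>R x \<in> W" if "x \<in> W" "y \<in> W" for x y t
    using that by (auto simp: W_def matrix_vector_right_distrib matrix_vector_mult_scaleR inner_add_right)
  have WM: "M *v x \<in> W" if "x \<in> W" for x
    using that v(1) by (auto simp: W_def Mg)
  obtain c where c: "c > 0" "\<And>x. c * (norm x)\<^sup>2 \<le> b x" using pos_def_bound[OF g(1)] unfolding b_def by blast
  have bpos: "b x > 0" if "x \<noteq> 0" for x using g(1) that by (simp add: b_def pos_def_def)
  have scale: "q (t *\<^sub>R x) = t\<^sup>2 * q x" "b (t *\<^sub>R x) = t\<^sup>2 * b x" for t x
    by (simp_all add: q_def b_def matrix_vector_mult_scaleR power2_eq_square)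
  \<comment> \<open>Fewer than n eigenvectors have been found, so some nonzero vector is
    g-orthogonal to all of them and the set over which q is maximized is not empty.\<close>
  have "dim ((\<lambda>i. g *v v i) ` I) \<le> card I"
    using dim_le_card[of "(\<lambda>i. g *v v i) ` I" "(\<lambda>i. g *v v i) ` I"] insert.hyps card_image_le[of I "\<lambda>i. g *v v i"]
    by (metis dim_le_card' finite_imageI order_trans)
  also have "card I < card (insert k I)" using insert.hyps by simp
  also have "\<dots> \<le> DIM(real^'n)" by (simp add: card_mono)
  finally obtain x1 where x1: "x1 \<noteq> 0" "\<And>y. y \<in> span ((\<lambda>i. g *v v i) ` I) \<Longrightarrow> orthogonal x1 y"
    using orthogonal_to_subspace_exists by blast
  have x1W: "x1 \<in> W"
    using x1(2)[OF span_base] symmetric_inner[OF g(2)] by (auto simp: W_def orthogonal_def)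
  define K where "K = {x \<in> W. b x = 1}"
  have normb: "(1 / sqrt (b x)) *\<^sub>R x \<in> K" if "x \<in> W" "x \<noteq> 0" for x
    using that bpos[of x] Wlin[OF that(1) that(1)]
    by (auto simp: K_def scale power_divide real_sqrt_pow2 less_imp_le)
  have "K \<noteq> {}" using normb[OF x1W x1(1)] by blast
  moreover have "compact K"
  proof -
    have "closed K"
      unfolding K_def W_def b_def mem_Collect_eq Ball_def
      by (intro closed_Collect_conj closed_Collect_all closed_Collect_imp open_Collect_const
          closed_Collect_eq continuous_intros)
    moreover have "norm x \<le> sqrt (1 / c)" if "x \<in> K" for x
      using c(2)[of x] c(1) that by (intro real_le_rsqrt) (simp add: K_def field_simps)
    ultimately show ?thesis by (auto simp: compact_eq_bounded_closed bounded_iff)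
  qed
  moreover have "continuous_on K q" unfolding q_def matrix_vector_mul_assoc by (intro continuous_intros)
  ultimately have "\<exists>x\<in>K. \<forall>y\<in>K. q y \<le> q x"
    by (intro continuous_attains_sup)
  then obtain x where x: "x \<in> K" "\<And>y. y \<in> K \<Longrightarrow> q y \<le> q x" by blast
  have xW: "x \<in> W" "b x = 1" using x by (auto simp: K_def)
  have qb: "q y \<le> q x * b y" if "y \<in> W" for y
  proof (cases "y = 0")
    case False
    have "q ((1 / sqrt (b y)) *\<^sub>R y) \<le> q x" using x(2) normb[OF that False] by blast
    then show ?thesis using bpos[OF False]
      by (simp add: scale power_divide real_sqrt_pow2 field_simps less_imp_le)
  qed (simp add: q_def b_def)
  \<comment> \<open>Up to a factor this is the gradient of q - q(x) b at the maximizer x, taken with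
    respect to g. It lies in W, so moving x along z is admissible, and maximality forces the g-norm
    of z to vanish.\<close>
  define z where "z = M *v x - q x *\<^sub>R x"
  have zW: "z \<in> W" using Wlin(1)[OF WM[OF xW(1)] xW(1), of "- q x"] by (simp add: z_def)
  have "z \<bullet> (g *v z) = 0"
  proof (rule quadratic_bound_zero)
    fix t
    have "q (x + t *\<^sub>R z) \<le> q x * b (x + t *\<^sub>R z)" using qb Wlin(1)[OF xW(1) zW] by blast
    moreover have "q (x + t *\<^sub>R z) = q x + 2 * t * (z \<bullet> (g *v (M *v x))) + t\<^sup>2 * q z"
      using Mg[of x z] symmetric_inner[OF g(2), of "M *v x" z]
      by (simp add: q_def matrix_vector_right_distrib matrix_vector_mult_scaleR inner_add_left
          inner_add_right power2_eq_square algebra_simps)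
    moreover have "b (x + t *\<^sub>R z) = 1 + 2 * t * (z \<bullet> (g *v x)) + t\<^sup>2 * b z"
      using xW(2) symmetric_inner[OF g(2), of x z]
      by (simp add: b_def matrix_vector_right_distrib matrix_vector_mult_scaleR inner_add_left
          inner_add_right power2_eq_square algebra_simps)
    ultimately have i: "q x + 2 * t * (z \<bullet> (g *v (M *v x))) + t\<^sup>2 * q z
        \<le> q x * (1 + 2 * t * (z \<bullet> (g *v x)) + t\<^sup>2 * b z)" by simp
    have e: "z \<bullet> (g *v z) = z \<bullet> (g *v (M *v x)) - q x * (z \<bullet> (g *v x))"
      by (subst (2) z_def)
        (simp add: matrix_vector_mult_diff_distrib matrix_vector_mult_scaleR inner_diff_right)
    show "2 * t * (z \<bullet> (g *v z)) \<le> t\<^sup>2 * (q x * b z - q z)"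
      unfolding e using i by (simp add: algebra_simps)
  qed
  then have "z = 0" using bpos[of z] by (auto simp: b_def)
  then have eig: "M *v x = q x *\<^sub>R x" by (simp add: z_def)
  let ?v = "v(k := x)" and ?l = "l(k := q x)"
  have "v i \<bullet> (g *v x) = 0" "x \<bullet> (g *v v i) = 0" if "i \<in> I" for i
    using xW that symmetric_inner[OF g(2)] by (auto simp: W_def)
  then have "(\<forall>i\<in>insert k I. M *v ?v i = ?l i *\<^sub>R ?v i) \<and>
      (\<forall>i\<in>insert k I. \<forall>j\<in>insert k I. ?v i \<bullet> (g *v ?v j) = (if i = j then 1 else 0))"
    using v eig xW(2) insert.hyps by (auto simp: b_def)
  then show ?case by blast
qed auto

section \<open>Functional calculus of a self-adjoint matrix in an orthonormal eigenbasis\<close>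

locale self_adjoint =
  fixes g M S :: "real^'n^'n::finite" and l :: "'n \<Rightarrow> real"
  assumes g: "pos_def g" "transpose g = g"
    and orth: "transpose S ** g ** S = mat 1" and eig: "M ** S = S ** diag_mat l"

lemma self_adjoint_exists:
  fixes g M :: "real^'n^'n::finite"
  assumes g: "pos_def g" "transpose g = g" and M: "transpose (g ** M) = g ** M"
  shows "\<exists>S l. self_adjoint g M S l"
proof -
  obtain v :: "'n \<Rightarrow> real^'n" and l where "(\<forall>i\<in>UNIV. M *v v i = l i *\<^sub>R v i) \<and>
      (\<forall>i\<in>UNIV. \<forall>j\<in>UNIV. v i \<bullet> (g *v v j) = (if i = j then 1 else 0))"
    using orthonormal_eigenvectors[OF assms finite, of UNIV] by blast
  then have v: "\<And>i. M *v v i = l i *\<^sub>R v i" "\<And>i j. v i \<bullet> (g *v v j) = (if i = j then 1 else 0)"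
    by simp_all
  define S where "S = (\<chi> a i. v i $ a)"
  have "(transpose S ** g ** S) $ i $ j = v i \<bullet> (g *v v j)" for i j
    unfolding matrix_mul_assoc[symmetric]
    by (simp add: S_def matrix_matrix_mult_def matrix_vector_mult_def transpose_def inner_vec_def)
  then have 1: "transpose S ** g ** S = mat 1" by (simp add: vec_eq_iff v mat_def)
  have "(M ** S) $ a $ i = (M *v v i) $ a" for a i
    by (simp add: S_def matrix_matrix_mult_def matrix_vector_mult_def)
  then have 2: "M ** S = S ** diag_mat l" by (simp add: vec_eq_iff v mult_diag_mat S_def mult.commute)
  show ?thesis using 1 2 g unfolding self_adjoint_def by blast
qed

context self_adjoint
begin

definition "T = transpose S ** g"

lemma TS: "T ** S = mat 1" and ST: "S ** T = mat 1"
  using orth matrix_left_right_inverse by (auto simp: T_def)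

lemma TS_assoc: "T ** (S ** X) = X" and ST_assoc: "S ** (T ** X) = X"
  using TS ST by (simp_all add: matrix_mul_assoc)

definition fn :: "(real \<Rightarrow> real) \<Rightarrow> real^'n^'n" where
  "fn f = S ** (diag_mat (\<lambda>i. f (l i)) ** T)"

lemma fn_id: "fn (\<lambda>x. x) = M"
proof -
  have "fn (\<lambda>x. x) = (M ** S) ** T" by (simp add: fn_def eig matrix_mul_assoc)
  then show ?thesis by (simp add: matrix_mul_assoc[symmetric] ST)
qed

lemma fn_cong: "(\<And>i. f (l i) = h (l i)) \<Longrightarrow> fn f = fn h"
  by (simp add: fn_def)

lemma diag_mult: "diag_mat d ** diag_mat d' = diag_mat (\<lambda>i. d i * d' i :: real)"
  by (simp add: vec_eq_iff mult_diag_mat) (simp add: diag_mat_def)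

lemma fn_mult: "fn f ** fn h = fn (\<lambda>x. f x * h x)"
  by (simp add: fn_def matrix_mul_assoc[symmetric] TS_assoc diag_mult)
    (simp add: matrix_mul_assoc diag_mult)

lemma fn_const: "fn (\<lambda>x. c) = c *\<^sub>R mat 1"
proof -
  have "diag_mat (\<lambda>i. c) = c *\<^sub>R (mat 1 :: real^'n^'n)" by (simp add: diag_mat_def mat_def vec_eq_iff)
  then show ?thesis by (simp add: fn_def matmul_scaleR_left matmul_scaleR_right ST)
qed

lemma fn_add: "fn (\<lambda>x. f x + h x) = fn f + fn h"
proof -
  have "diag_mat (\<lambda>i. f (l i) + h (l i)) = diag_mat (\<lambda>i. f (l i)) + diag_mat (\<lambda>i. h (l i))"
    by (simp add: diag_mat_def vec_eq_iff)
  then show ?thesis by (simp add: fn_def matmul_add_left matrix_add_ldistrib)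
qed

lemma fn_scale: "fn (\<lambda>x. c * f x) = c *\<^sub>R fn f"
  using fn_mult[of "\<lambda>x. c" f] by (simp add: fn_const matmul_scaleR_left)

lemma fn_sum: "finite I \<Longrightarrow> fn (\<lambda>x. \<Sum>i\<in>I. f i x) = (\<Sum>i\<in>I. fn (f i))"
proof (induction I rule: finite_induct)
  case empty
  then show ?case using fn_const[of 0] by simp
qed (simp add: fn_add)

text \<open>In the eigenbasis, commuting with M means that the entry (i,j) vanishes unless the
  eigenvalues i and j agree. The same entries then commute with any function of the
  eigenvalues.\<close>

lemma fn_commute:
  assumes "X ** M = M ** X" shows "X ** fn f = fn f ** X"
proof -
  define Y where "Y = T ** X ** S"
  have "Y ** diag_mat l = T ** (X ** M) ** S"
    by (simp add: Y_def eig matrix_mul_assoc[symmetric])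
  also have "\<dots> = diag_mat l ** Y"
    unfolding assms by (metis Y_def TS eig matrix_mul_assoc ST matrix_mul_lid matrix_mul_rid)
  finally have *: "Y $ i $ j * l j = l i * Y $ i $ j" for i j
    by (metis diag_mat_mult mult_diag_mat)
  have "Y $ i $ j * f (l j) = f (l i) * Y $ i $ j" for i j
    using *[of i j] by (cases "Y $ i $ j = 0") auto
  then have "Y ** diag_mat (\<lambda>i. f (l i)) = diag_mat (\<lambda>i. f (l i)) ** Y"
    by (simp add: vec_eq_iff diag_mat_mult mult_diag_mat)
  then have "S ** (Y ** diag_mat (\<lambda>i. f (l i))) ** T = S ** (diag_mat (\<lambda>i. f (l i)) ** Y) ** T" by simp
  then show ?thesis
    by (simp add: Y_def fn_def matrix_mul_assoc[symmetric] ST_assoc ST)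
qed

lemma fn_symmetric: "transpose (g ** fn f) = g ** fn f"
proof -
  have "transpose (diag_mat (\<lambda>i. f (l i))) = diag_mat (\<lambda>i. f (l i))"
    by (auto simp: diag_mat_def transpose_def vec_eq_iff)
  then show ?thesis
    by (simp add: fn_def T_def matrix_transpose_mul g matrix_mul_assoc)
qed

lemma fn_pos_def:
  assumes "\<And>i. 0 < f (l i)" shows "pos_def (g ** fn f)"
  unfolding pos_def_def
proof (intro allI impI)
  fix v :: "real^'n" assume v: "v \<noteq> 0"
  define w where "w = T *v v"
  have "S *v w = v" by (simp add: w_def matrix_vector_mul_assoc ST)
  then have w: "w \<noteq> 0" using v by auto
  then obtain i where i: "w $ i \<noteq> 0" by (auto simp: vec_eq_iff)
  have "v \<bullet> (g ** fn f *v v) = v \<bullet> (transpose T *v (diag_mat (\<lambda>i. f (l i)) *v w))"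
    by (simp add: fn_def T_def w_def matrix_transpose_mul g matrix_vector_mul_assoc matrix_mul_assoc
        del: transpose_matrix_vector)
  also have "\<dots> = w \<bullet> (diag_mat (\<lambda>i. f (l i)) *v w)"
    unfolding inner_transpose w_def by simp
  also have "\<dots> = (\<Sum>i\<in>UNIV. f (l i) * (w $ i)\<^sup>2)"
    by (simp add: inner_vec_def matrix_vector_mult_def diag_mat_def if_distrib[of "\<lambda>x. x * _"]
        sum.delta power2_eq_square mult.left_commute cong: if_cong)
  also have "\<dots> > 0"
    using i assms less_imp_le[OF assms] by (intro sum_pos2[of _ i]) auto
  finally show "0 < v \<bullet> (g ** fn f *v v)" .
qed

lemma fn_trace: "trace (fn f) = (\<Sum>i\<in>UNIV. f (l i))"
proof -
  have "trace (fn f) = trace (diag_mat (\<lambda>i. f (l i)) ** (T ** S))"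
    unfolding fn_def by (subst trace_mul_sym) (simp add: matrix_mul_assoc)
  then show ?thesis by (simp add: TS trace_def diag_mat_def)
qed

lemma fn_det: "det (fn f) = (\<Prod>i\<in>UNIV. f (l i))"
proof -
  have "det S * det T = 1" using ST by (metis det_I det_mul)
  moreover have "det (diag_mat (\<lambda>i. f (l i))) = (\<Prod>i\<in>UNIV. f (l i))"
    by (subst det_diagonal) (auto simp: diag_mat_def)
  ultimately show ?thesis by (simp add: fn_def det_mul mult.left_commute mult.commute)
qed

lemma self_adjoint_fn: "self_adjoint g (fn f) S (\<lambda>i. f (l i))"
  using g orth by unfold_locales (simp_all add: fn_def matrix_mul_assoc[symmetric] TS)

lemma eigenvector: "M *v column i S = l i *\<^sub>R column i S"
proof -
  have "(M *v column i S) $ a = (M ** S) $ a $ i" for a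
    by (simp add: column_def matrix_matrix_mult_def matrix_vector_mult_def)
  then show ?thesis by (simp add: vec_eq_iff eig mult_diag_mat column_def mult.commute)
qed

lemma column_nonzero: "column i S \<noteq> 0"
proof
  assume "column i S = 0"
  then have "(T ** S) $ i $ i = 0"
    by (simp add: matrix_matrix_mult_def column_def vec_eq_iff)
  then show False by (simp add: TS mat_def)
qed

end

section \<open>Square roots depending on a parameter\<close>

lemma has_derivative_vec_lambda:
  assumes "\<And>i. (f i has_derivative f' i) (at x)"
  shows "((\<lambda>x. \<chi> i. f i x) has_derivative (\<lambda>h. \<chi> i. f' i h)) (at x)"
proof -
  have "((\<lambda>x. \<Sum>i\<in>UNIV. axis i (f i x)) has_derivative (\<lambda>h. \<Sum>i\<in>UNIV. axis i (f' i h))) (at x)"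
    by (intro has_derivative_sum bounded_linear.has_derivative[OF bounded_linear_axis] assms)
  moreover have "(\<Sum>i\<in>UNIV. axis i (f i x)) = (\<chi> i. f i x)" "(\<Sum>i\<in>UNIV. axis i (f' i x)) = (\<chi> i. f' i x)" for x
    using vec_axis_sum[of "\<chi> i. f i x"] vec_axis_sum[of "\<chi> i. f' i x"] by simp_all
  ultimately show ?thesis by simp
qed

lemma bounded_bilinear_matvec: "bounded_bilinear ((*v) :: real^'n::finite^'m::finite \<Rightarrow> _)"
proof -
  have "bilinear ((*v) :: real^'n^'m \<Rightarrow> _)"
    unfolding bilinear_def
    by (intro conjI allI linearI)
      (simp_all add: matrix_vector_mult_def vec_eq_iff algebra_simps sum.distrib sum_distrib_left)
  then show ?thesis by (simp add: bilinear_conv_bounded_bilinear)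
qed

text \<open>From R'^2 - R^2 = R' (R' - R) + (R' - R) R, evaluated on an eigenvector of R. It is a
  linear equation for (R' - R) s with coefficient R' + r, which is invertible when r and R' are
  positive. Uniqueness, continuity and differentiability of square roots all come from it.\<close>

lemma sqrt_difference:
  fixes R R' B B' :: "real^'n^'n::finite"
  assumes "R' ** R' = B'" "R ** R = B" "R *v s = r *\<^sub>R s"
  shows "R' *v ((R' - R) *v s) + r *\<^sub>R ((R' - R) *v s) = (B' - B) *v s"
  unfolding assms(1,2)[symmetric]
  by (simp add: matrix_vector_mult_diff_rdistrib matrix_vector_mult_diff_distrib
      matrix_vector_mul_assoc[symmetric] assms(3) matrix_vector_mult_scaleR algebra_simps)

lemma (in self_adjoint) eigenvalue_pos:
  assumes "pos_def (g ** M)" shows "0 < l i"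
proof -
  have "0 < column i S \<bullet> (g ** M *v column i S)"
    using assms column_nonzero by (simp add: pos_def_def)
  also have "\<dots> = l i * (column i S \<bullet> (g *v column i S))"
    by (simp add: matrix_vector_mul_assoc[symmetric] eigenvector matrix_vector_mult_scaleR)
  finally show ?thesis
    using g(1) column_nonzero[of i] by (simp add: pos_def_def zero_less_mult_iff) (meson less_asym)
qed

lemma mult_columns: "(A ** S) $ a $ i = (A *v column i S) $ a"
  by (simp add: column_def matrix_matrix_mult_def matrix_vector_mult_def)

lemma pos_def_add:
  fixes g R :: "real^'n^'n::finite"
  assumes "pos_def g" "pos_def (g ** R)" "0 < r"
  shows "pos_def (g ** (R + r *\<^sub>R mat 1))"
  unfolding pos_def_def
proof (intro allI impI)
  fix v :: "real^'n" assume "v \<noteq> 0"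
  then have "v \<bullet> (g *v v) > 0" "v \<bullet> (g ** R *v v) > 0"
    using assms by (simp_all add: pos_def_def)
  then have "v \<bullet> (g ** R *v v) + r * (v \<bullet> (g *v v)) > 0" using assms(3) by (simp add: add_pos_pos)
  then show "0 < v \<bullet> (g ** (R + r *\<^sub>R mat 1) *v v)"
    by (simp add: matrix_add_ldistrib matmul_scaleR_right matrix_vector_mult_add_rdistrib inner_add_right
        scaleR_matrix_vector_assoc[symmetric])
qed

text \<open>The lower bound for the quadratic form is uniform near x, as the estimate for square
  roots of nearby matrices requires.\<close>

lemma pos_def_eventually:
  fixes g :: "'b::real_normed_vector \<Rightarrow> real^'n^'n::finite"
  assumes g: "isCont g x" "pos_def (g x)"
  shows "\<exists>c>0. \<forall>\<^sub>F t in nhds x. \<forall>v. c * (norm v)\<^sup>2 \<le> v \<bullet> (g t *v v)"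
proof -
  obtain c where c: "c > 0" "\<And>v. c * (norm v)\<^sup>2 \<le> v \<bullet> (g x *v v)" using pos_def_bound[OF g(2)] by blast
  obtain K where K: "K > 0" "\<And>A v. norm ((A :: real^'n^'n) *v v) \<le> norm A * norm v * K"
    using bounded_bilinear.pos_bounded[OF bounded_bilinear_matvec] by blast
  have "(g \<longlongrightarrow> g x) (nhds x)" using g(1) by (simp add: isCont_def tendsto_at_iff_tendsto_nhds)
  then have "\<forall>\<^sub>F t in nhds x. norm (g t - g x) < c / (2 * K)"
    using c K by (auto simp: tendsto_iff dist_norm)
  then have "\<forall>\<^sub>F t in nhds x. \<forall>v. c / 2 * (norm v)\<^sup>2 \<le> v \<bullet> (g t *v v)"
  proof eventually_elim
    case (elim t)
    show ?case
    proof
      fix v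
      have "\<bar>v \<bullet> ((g t - g x) *v v)\<bar> \<le> norm v * norm ((g t - g x) *v v)" by (rule Cauchy_Schwarz_ineq2)
      also have "\<dots> \<le> norm v * (norm (g t - g x) * norm v * K)" by (intro mult_left_mono K) simp
      also have "\<dots> \<le> norm v * (c / (2 * K) * norm v * K)"
        using elim K by (intro mult_left_mono mult_right_mono) auto
      also have "\<dots> = c / 2 * (norm v)\<^sup>2" using K by (simp add: power2_eq_square)
      finally have "\<bar>v \<bullet> (g t *v v) - v \<bullet> (g x *v v)\<bar> \<le> c / 2 * (norm v)\<^sup>2"
        by (simp only: matrix_vector_mult_diff_rdistrib inner_diff_right)
      moreover have "c * (norm v)\<^sup>2 = 2 * (c / 2 * (norm v)\<^sup>2)" by simp
      ultimately show "c / 2 * (norm v)\<^sup>2 \<le> v \<bullet> (g t *v v)"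
        using c(2)[of v] by linarith
    qed
  qed
  then show ?thesis using c(1) by (intro exI[of _ "c / 2"]) auto
qed

lemma pos_def_eventually_pos_def:
  fixes g :: "'b::real_normed_vector \<Rightarrow> real^'n^'n::finite"
  assumes "isCont g x" "pos_def (g x)"
  shows "\<forall>\<^sub>F t in nhds x. pos_def (g t)"
proof -
  obtain c where c: "c > 0" "\<forall>\<^sub>F t in nhds x. \<forall>v. c * (norm v)\<^sup>2 \<le> v \<bullet> (g t *v v)"
    using pos_def_eventually[OF assms] by blast
  from c(2) show ?thesis
    by eventually_elim (use c(1) in \<open>auto simp: pos_def_def intro: less_le_trans[rotated]\<close>)
qed

text \<open>Symmetry is required at x only, where an eigenbasis is taken. At nearby parameters
  positivity of the quadratic form of \<open>g t ** R t\<close> is enough.\<close>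

locale sqrt_family =
  fixes g R B :: "'b::real_normed_vector \<Rightarrow> real^'n^'n::finite" and x :: 'b
  assumes g: "isCont g x" "pos_def (g x)" "transpose (g x) = g x"
    and B: "isCont B x"
    and R: "\<forall>\<^sub>F t in nhds x. R t ** R t = B t \<and> pos_def (g t ** R t)"
    and sym: "transpose (g x ** R x) = g x ** R x"
begin

lemma at_x: "R x ** R x = B x" "pos_def (g x ** R x)"
  using eventually_nhds_x_imp_x[OF R] by blast+

lemma spectral: obtains S r where "self_adjoint (g x) (R x) S r" "\<And>i. 0 < r i"
  using self_adjoint_exists[OF g(2,3) sym] self_adjoint.eigenvalue_pos[OF _ at_x(2)] by blast

text \<open>Let s be an eigenvector of R(x) with eigenvalue r, and v = (R(t) - R(x)) s. Pairing the
  equation (R(t) + r) v = (B(t) - B(x)) s with v under g(t), and dropping the nonnegative term of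
  R(t), bounds r c |v| by the norm of g(t) (B(t) - B(x)) s.\<close>

lemma continuous: "isCont R x"
proof -
  obtain S r where "self_adjoint (g x) (R x) S r" and r: "\<And>i. 0 < r i" using spectral by blast
  then interpret S: self_adjoint "g x" "R x" S r by simp
  obtain c where c: "c > 0" "\<forall>\<^sub>F t in nhds x. \<forall>v. c * (norm v)\<^sup>2 \<le> v \<bullet> (g t *v v)"
    using pos_def_eventually[OF g(1,2)] by blast
  have col: "((\<lambda>t. (R t - R x) *v column i S) \<longlongrightarrow> 0) (at x)" for i
  proof (rule Lim_null_comparison)
    let ?s = "column i S"
    show "\<forall>\<^sub>F t in at x. norm ((R t - R x) *v ?s) \<le> 1 / (r i * c) * norm (g t *v ((B t - B x) *v ?s))"
      using c(2)[THEN eventually_nhds_conv_at[THEN iffD1, THEN conjunct1]]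
        R[THEN eventually_nhds_conv_at[THEN iffD1, THEN conjunct1]]
    proof eventually_elim
      case (elim t)
      define v where "v = (R t - R x) *v ?s"
      have "R t *v v + r i *\<^sub>R v = (B t - B x) *v ?s"
        unfolding v_def by (rule sqrt_difference[OF _ at_x(1) S.eigenvector]) (use elim in simp)
      then have "v \<bullet> (g t *v ((B t - B x) *v ?s)) = v \<bullet> (g t ** R t *v v) + r i * (v \<bullet> (g t *v v))"
        by (metis inner_add_right inner_scaleR_right matrix_vector_mul_assoc matrix_vector_mult_scaleR matrix_vector_right_distrib)
      moreover have "v \<bullet> (g t ** R t *v v) \<ge> 0"
        using elim by (cases "v = 0") (auto simp: pos_def_def less_imp_le)
      moreover have "r i * (c * (norm v)\<^sup>2) \<le> r i * (v \<bullet> (g t *v v))"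
        using elim r[of i] by (intro mult_left_mono) auto
      ultimately have "r i * (c * (norm v)\<^sup>2) \<le> norm v * norm (g t *v ((B t - B x) *v ?s))"
        using norm_cauchy_schwarz[of v "g t *v ((B t - B x) *v ?s)"] by linarith
      then have "norm v * (r i * c * norm v) \<le> norm v * norm (g t *v ((B t - B x) *v ?s))"
        by (simp add: power2_eq_square mult_ac)
      then have "r i * c * norm v \<le> norm (g t *v ((B t - B x) *v ?s))"
        by (cases "v = 0") auto
      then show ?case using r[of i] c(1) unfolding v_def[symmetric] by (simp add: field_simps)
    qed
    have "((\<lambda>t. 1 / (r i * c) * norm (g t *v ((B t - B x) *v ?s))) \<longlongrightarrow>
        1 / (r i * c) * norm (g x *v ((B x - B x) *v ?s))) (at x)"
      using g(1) B unfolding isCont_def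
      by (intro tendsto_intros bounded_bilinear.tendsto[OF bounded_bilinear_matvec])
    then show "((\<lambda>t. 1 / (r i * c) * norm (g t *v ((B t - B x) *v ?s))) \<longlongrightarrow> 0) (at x)" by simp
  qed
  have "((\<lambda>t. (R t - R x) ** S) \<longlongrightarrow> 0) (at x)"
    by (intro vec_tendstoI) (use tendsto_vec_nth[OF col] in \<open>simp add: mult_columns\<close>)
  then have "((\<lambda>t. R x + ((R t - R x) ** S) ** S.T) \<longlongrightarrow> R x + 0 ** S.T) (at x)"
    by (intro tendsto_intros tendsto_matmul)
  then show ?thesis by (simp add: isCont_def matrix_mul_assoc[symmetric] S.ST)
qed

text \<open>On an eigenvector, (R(t) - R(x)) s = (R(t) + r)^-1 (B(t) - B(x)) s. The second factor
  vanishes at x, so the continuity of R just proved suffices for the inverse.\<close>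

lemma differentiable:
  assumes B': "(B has_derivative B') (at x)"
  shows "\<exists>R'. (R has_derivative R') (at x)"
proof -
  obtain S r where "self_adjoint (g x) (R x) S r" and r: "\<And>i. 0 < r i" using spectral by blast
  then interpret S: self_adjoint "g x" "R x" S r by simp
  have gp: "\<forall>\<^sub>F t in nhds x. pos_def (g t)" using pos_def_eventually_pos_def[OF g(1,2)] .
  define Q where "Q i t = matrix_inv (R t + r i *\<^sub>R mat 1)" for i t
  have dt: "\<forall>\<^sub>F t in nhds x. det (R t + r i *\<^sub>R mat 1) \<noteq> 0" for i
    using gp R by eventually_elim (use pos_def_mult_det pos_def_add r in blast)
  have Qc: "isCont (Q i) x" for i
    unfolding Q_def
    using eventually_nhds_x_imp_x[OF dt] by (intro isCont_matrix_inv continuous_intros continuous) auto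
  have Bs: "((\<lambda>t. (B t - B x) *v column i S) has_derivative (\<lambda>h. B' h *v column i S)) (at x)" for i
    by (rule has_derivative_eq_rhs[OF bounded_bilinear.FDERIV[OF bounded_bilinear_matvec
            has_derivative_diff[OF B' has_derivative_const] has_derivative_const]]) simp
  have "((\<lambda>t. Q i t *v ((B t - B x) *v column i S)) has_derivative (\<lambda>h. Q i x *v (B' h *v column i S))) (at x)" for i
    by (rule bounded_bilinear.has_derivative_vanishing[OF bounded_bilinear_matvec Qc Bs]) simp
  then have "((\<lambda>t. \<chi> a i. (Q i t *v ((B t - B x) *v column i S)) $ a) has_derivative
      (\<lambda>h. \<chi> a i. (Q i x *v (B' h *v column i S)) $ a)) (at x)"
    by (intro has_derivative_vec_lambda bounded_linear.has_derivative[OF bounded_linear_vec_nth])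
  then have D: "((\<lambda>t. R x + (\<chi> a i. (Q i t *v ((B t - B x) *v column i S)) $ a) ** S.T) has_derivative
      (\<lambda>h. 0 + ((\<chi> a i. (Q i x *v ((B x - B x) *v column i S)) $ a) ** 0 + (\<chi> a i. (Q i x *v (B' h *v column i S)) $ a) ** S.T))) (at x)"
    by (intro has_derivative_add has_derivative_const has_derivative_matmul)
  have "\<forall>\<^sub>F t in nhds x. \<forall>i. det (R t + r i *\<^sub>R mat 1) \<noteq> 0"
    using dt by (simp add: eventually_all_finite)
  with R have "\<forall>\<^sub>F t in nhds x. R x + (\<chi> a i. (Q i t *v ((B t - B x) *v column i S)) $ a) ** S.T = R t"
  proof eventually_elim
    case (elim t)
    have "Q i t *v ((B t - B x) *v column i S) = (R t - R x) *v column i S" for i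
    proof -
      let ?v = "(R t - R x) *v column i S"
      have "R t *v ?v + r i *\<^sub>R ?v = (B t - B x) *v column i S"
        by (rule sqrt_difference[OF _ at_x(1) S.eigenvector]) (use elim in simp)
      then have "(B t - B x) *v column i S = (R t + r i *\<^sub>R mat 1) *v ?v"
        by (simp add: matrix_vector_mult_add_rdistrib scaleR_matrix_vector_assoc[symmetric])
      moreover have "Q i t ** (R t + r i *\<^sub>R mat 1) = mat 1"
        unfolding Q_def using elim matrix_inv_props(2) invertible_det_nz by blast
      ultimately show ?thesis by (metis matrix_vector_mul_assoc matrix_vector_mul_lid)
    qed
    then have "(\<chi> a i. (Q i t *v ((B t - B x) *v column i S)) $ a) = (R t - R x) ** S"
      by (simp add: vec_eq_iff mult_columns)
    then show ?case by (simp add: matrix_mul_assoc[symmetric] S.ST)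
  qed
  then have ev: "\<forall>\<^sub>F t in at x. R x + (\<chi> a i. (Q i t *v ((B t - B x) *v column i S)) $ a) ** S.T = R t"
    and e0: "R x + (\<chi> a i. (Q i x *v ((B x - B x) *v column i S)) $ a) ** S.T = R x"
    by (simp_all add: eventually_nhds_conv_at)
  show ?thesis
    using has_derivative_transform_eventually[OF D ev e0] by blast
qed

end

text \<open>On an eigenvector s of R the equation reads (R + r) P s = 0, and R + r is positive for
  g.\<close>

lemma sylvester_injective:
  fixes g R P :: "real^'n^'n::finite"
  assumes g: "pos_def g" "transpose g = g" and R: "pos_def (g ** R)" "transpose (g ** R) = g ** R"
    and 0: "R ** P + P ** R = 0"
  shows "P = 0"
proof -
  obtain S r where "self_adjoint g R S r" using self_adjoint_exists[OF g R(2)] by blast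
  then interpret S: self_adjoint g R S r .
  have "P *v column i S = 0" for i
  proof -
    let ?v = "P *v column i S"
    have "(R ** P + P ** R) *v column i S = (R + r i *\<^sub>R mat 1) *v ?v"
      by (simp add: matrix_vector_mult_add_rdistrib matrix_vector_mul_assoc[symmetric] S.eigenvector
          matrix_vector_mult_scaleR scaleR_matrix_vector_assoc[symmetric])
    then have "(g ** (R + r i *\<^sub>R mat 1)) *v ?v = 0"
      by (simp add: 0 matrix_vector_mul_assoc[symmetric])
    then show ?thesis
      using pos_def_add[OF g(1) R(1) S.eigenvalue_pos[OF R(1)], of i] unfolding pos_def_def
      by (metis inner_zero_right less_irrefl)
  qed
  then have "P ** S = 0" by (simp add: vec_eq_iff mult_columns)
  then have "(P ** S) ** S.T = 0" by simp
  then show ?thesis by (simp add: matrix_mul_assoc[symmetric] S.ST)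
qed

lemma sum_pairs: "(\<Sum>p\<in>(UNIV :: ('a::finite \<times> 'b::finite) set). f p) = (\<Sum>a\<in>UNIV. \<Sum>b\<in>UNIV. f (a, b))"
  by (simp add: sum.cartesian_product)

text \<open>Differentiating \<open>R\<^sup>2 = B\<close> gives a Sylvester equation for the derivative of \<open>R\<close>.  By Cramer's rule
  the derivatives of the entries of \<open>R\<close> are rational in the entries of \<open>R\<close> and smooth functions, which
  bootstraps differentiability to smoothness.\<close>

lemma smooth_sqrt:
  fixes g R B :: "real^'k::finite \<Rightarrow> real^'n^'n::finite"
  assumes g: "smooth g" "\<And>y. pos_def (g y)" "\<And>y. transpose (g y) = g y"
    and B: "smooth B"
    and R: "\<And>y. R y ** R y = B y" "\<And>y. pos_def (g y ** R y)" "\<And>y. transpose (g y ** R y) = g y ** R y"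
  shows "smooth R"
proof -
  \<comment> \<open>The entries of R are generators although their smoothness is the goal. It
    suffices that their derivatives are rational in the same generators.\<close>
  let ?\<B> = "{f. smooth f} \<union> {\<lambda>y. R y $ i $ j | i j. True}"
  have "isCont g y" "isCont B y" for y
    using smooth_differentiable[OF g(1)] smooth_differentiable[OF B] differentiable_imp_continuous_within by blast+
  then interpret S: sqrt_family g R B y for y
    using g R by unfold_locales auto
  have Rd: "R differentiable at y" for y
    using S.differentiable smooth_differentiable[OF B, of y] unfolding differentiable_def by blast
  \<comment> \<open>The matrix of the Sylvester operator P \<mapsto> R P + P R, with matrices
    written as vectors indexed by pairs.\<close>
  define T :: "real^'k \<Rightarrow> real^('n \<times> 'n)^('n \<times> 'n)" where
    "T y = (\<chi> p q. (if snd q = snd p then R y $ fst p $ fst q else 0)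
        + (if fst p = fst q then R y $ snd q $ snd p else 0))" for y
  have ifs: "(\<Sum>b\<in>A. if c then h b else 0) = (if c then \<Sum>b\<in>A. h b else (0 :: real))" for c h and A :: "'n set"
    by simp
  have T: "(T y *v (\<chi> q. P $ fst q $ snd q)) $ p = (R y ** P + P ** R y) $ fst p $ snd p" for y P p
    by (simp add: T_def matrix_vector_mult_def matrix_matrix_mult_def sum_pairs algebra_simps sum.distrib
        if_distrib[of "\<lambda>x. _ * x"] ifs sum.delta sum.delta' cong: if_cong)
  have Tdet: "det (T y) \<noteq> 0" for y
  proof (rule det_nonzero_ker)
    fix v assume 0: "T y *v v = 0"
    define P where "P = (\<chi> i j. v $ (i, j))"
    have v: "v = (\<chi> q. P $ fst q $ snd q)" by (simp add: P_def vec_eq_iff)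
    have "(R y ** P + P ** R y) $ i $ j = 0" for i j
      using T[of y P "(i, j)"] 0 by (simp add: v[symmetric])
    then have "R y ** P + P ** R y = 0" by (simp add: vec_eq_iff)
    then have "P = 0" using sylvester_injective g(2,3) R(2,3) by blast
    then show "v = 0" by (simp add: v vec_eq_iff)
  qed
  have pdR: "pd k (\<lambda>y. R y $ i $ j) y = det (\<chi> p q. if q = (i, j) then pd k (\<lambda>y. B y $ fst p $ snd p) y else T y $ p $ q) / det (T y)"
    for k i j y
  proof -
    let ?R' = "frechet_derivative R (at y)"
    have R': "(R has_derivative ?R') (at y)" using Rd frechet_derivative_works by blast
    have "((\<lambda>y. R y ** R y) has_derivative (\<lambda>h. R y ** ?R' h + ?R' h ** R y)) (at y)"
      by (rule has_derivative_matmul[OF R' R'])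
    then have B': "(B has_derivative (\<lambda>h. R y ** ?R' h + ?R' h ** R y)) (at y)" by (simp add: R(1))
    define P where "P = ?R' (axis k 1)"
    have e: "pd k (\<lambda>y. B y $ a $ b) y = (R y ** P + P ** R y) $ a $ b" for a b
      unfolding P_def by (intro pd_eq bounded_linear.has_derivative[OF bounded_linear_vec_nth] B')
    have "T y *v (\<chi> q. P $ fst q $ snd q) = (\<chi> p. pd k (\<lambda>y. B y $ fst p $ snd p) y)"
      unfolding vec_eq_iff T by (simp add: e)
    then have "(\<chi> q. P $ fst q $ snd q) = (\<chi> l. det (\<chi> p q. if q = l then (\<chi> p. pd k (\<lambda>y. B y $ fst p $ snd p) y) $ p else T y $ p $ q) / det (T y))"
      using cramer[OF Tdet] by blast
    then have "(\<chi> q. P $ fst q $ snd q) $ (i, j) = det (\<chi> p q. if q = (i, j) then (\<chi> p. pd k (\<lambda>y. B y $ fst p $ snd p) y) $ p else T y $ p $ q) / det (T y)"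
      by (simp only: vec_lambda_beta)
    moreover have "pd k (\<lambda>y. R y $ i $ j) y = P $ i $ j"
      unfolding P_def by (intro pd_eq bounded_linear.has_derivative[OF bounded_linear_vec_nth] R')
    ultimately show ?thesis by (simp cong: if_cong)
  qed
  have ifc: "(\<lambda>y. if c then f y else h y) \<in> fun_alg B" if "f \<in> fun_alg B" "h \<in> fun_alg B" for c f h B
    using that by (cases c) auto
  have Ra: "(\<lambda>y. R y $ i $ j) \<in> fun_alg ?\<B>" for i j by (rule fun_alg.base) auto
  have Ta: "(\<lambda>y. T y $ p $ q) \<in> fun_alg ?\<B>" for p q
    unfolding T_def vec_lambda_beta by (intro fun_alg.add ifc Ra fun_alg.const)
  have sm: "f \<in> fun_alg ?\<B>" if "smooth f" for f using that by (auto intro: fun_alg.base)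
  have "smooth (\<lambda>y. R y $ i $ j)" for i j
  proof (rule fun_alg_smooth[OF _ _ Ra])
    show "f differentiable at y" if "f \<in> ?\<B>" for f y
    proof -
      have "(\<lambda>y. R y $ i $ j) differentiable at y" for i j
        using differentiable_compose[OF bounded_linear_imp_differentiable[OF bounded_linear_vec_nth]
            differentiable_compose[OF bounded_linear_imp_differentiable[OF bounded_linear_vec_nth] Rd[of y]]] .
      then show ?thesis using that smooth_differentiable by blast
    qed
    show "pd k f \<in> fun_alg ?\<B>" if fB: "f \<in> ?\<B>" for f k
    proof (cases "smooth f")
      case True
      then show ?thesis by (intro sm smooth_in_pd)
    next
      case False
      then obtain i j where f: "f = (\<lambda>y. R y $ i $ j)" using fB by blast
      have "pd k f = (\<lambda>y. det (\<chi> p q. if q = (i, j) then pd k (\<lambda>y. B y $ fst p $ snd p) y else T y $ p $ q) / det (T y))"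
        unfolding f using pdR by blast
      also have "\<dots> \<in> fun_alg ?\<B>"
        by (intro fun_alg_divide fun_alg_det Ta Tdet; unfold vec_lambda_beta)
          (intro ifc Ta sm smooth_in_pd smooth_entry B)+
      finally show ?thesis .
    qed
  qed
  then show ?thesis by (rule smooth_matI)
qed

section \<open>Block matrices\<close>

definition "b11 M = (\<chi> a b. M $ Inl a $ Inl b)"
definition "b12 M = (\<chi> a b. M $ Inl a $ Inr b)"
definition "b21 M = (\<chi> a b. M $ Inr a $ Inl b)"
definition "b22 M = (\<chi> a b. M $ Inr a $ Inr b)"

lemma sum_UNIV_plus: "(\<Sum>i\<in>(UNIV :: ('a::finite + 'b::finite) set). f i) = (\<Sum>a\<in>UNIV. f (Inl a)) + (\<Sum>b\<in>UNIV. f (Inr b))"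
proof -
  have "sum f (UNIV <+> UNIV) = (\<Sum>a\<in>UNIV. f (Inl a)) + (\<Sum>b\<in>UNIV. f (Inr b))"
    by (subst sum.Plus) simp_all
  then show ?thesis by simp
qed

lemma all_plus: "(\<forall>i. P i) \<longleftrightarrow> (\<forall>a. P (Inl a)) \<and> (\<forall>b. P (Inr b))"
proof safe
  fix i assume "\<forall>a. P (Inl a)" "\<forall>b. P (Inr b)"
  then show "P i" by (cases i) simp_all
qed simp_all

lemma block_mat_nth [simp]:
  "block_mat P Q R S $ Inl a $ Inl b = P $ a $ b" "block_mat P Q R S $ Inl a $ Inr b = Q $ a $ b"
  "block_mat P Q R S $ Inr a $ Inl b = R $ a $ b" "block_mat P Q R S $ Inr a $ Inr b = S $ a $ b"
  by (simp_all add: block_mat_def)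

lemma pair_vec_nth [simp]: "pair_vec p q $ Inl a = p $ a" "pair_vec p q $ Inr a = q $ a"
  by (simp_all add: pair_vec_def)

lemma blocks_of_block_mat [simp]:
  "b11 (block_mat P Q R S) = P" "b12 (block_mat P Q R S) = Q"
  "b21 (block_mat P Q R S) = R" "b22 (block_mat P Q R S) = S"
  by (simp_all add: b11_def b12_def b21_def b22_def vec_eq_iff)

lemma block_mat_blocks: "block_mat (b11 M) (b12 M) (b21 M) (b22 M) = M"
  by (simp add: vec_eq_iff all_plus b11_def b12_def b21_def b22_def)

lemma block_mat_eq_iff: "block_mat P Q R S = block_mat P' Q' R' S' \<longleftrightarrow> P = P' \<and> Q = Q' \<and> R = R' \<and> S = S'"
  by (metis blocks_of_block_mat)

lemma block_mat_mult:
  "block_mat P Q R S ** block_mat P' Q' R' S' =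
    block_mat (P ** P' + Q ** R') (P ** Q' + Q ** S') (R ** P' + S ** R') (R ** Q' + S ** S')"
  by (simp add: vec_eq_iff all_plus matrix_matrix_mult_def sum_UNIV_plus)

lemma block_mat_add: "block_mat P Q R S + block_mat P' Q' R' S' = block_mat (P + P') (Q + Q') (R + R') (S + S')"
  and block_mat_diff: "block_mat A B C D - block_mat A' B' C' D' = block_mat (A - A') (B - B') (C - C') (D - D')"
  and block_mat_minus: "- block_mat A B C D = block_mat (- A) (- B) (- C) (- D)"
  by (simp_all add: vec_eq_iff all_plus)

lemma block_mat_scaleR: "c *\<^sub>R block_mat P Q R S = block_mat (c *\<^sub>R P) (c *\<^sub>R Q) (c *\<^sub>R R) (c *\<^sub>R S)"
  and block_mat_cscale: "d *k block_mat P' Q' R' S' = block_mat (d *k P') (d *k Q') (d *k R') (d *k S')"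
  by (simp_all add: vec_eq_iff all_plus)

lemma block_mat_zero: "0 = block_mat 0 0 0 0"
  and block_mat_one: "mat 1 = block_mat (mat 1) 0 0 (mat 1)"
  by (simp_all add: vec_eq_iff all_plus mat_def)

lemma block_mat_transpose:
  "transpose (block_mat P Q R S) = block_mat (transpose P) (transpose R) (transpose Q) (transpose S)"
  by (simp add: vec_eq_iff all_plus transpose_def)

lemma block_mat_map: "map_matrix f (block_mat P Q R S) = block_mat (map_matrix f P) (map_matrix f Q) (map_matrix f R) (map_matrix f S)"
  by (simp add: vec_eq_iff all_plus)

lemma block_mat_cmat: "cmat (block_mat P Q R S) = block_mat (cmat P) (cmat Q) (cmat R) (cmat S)"
  by (simp add: cmat_def block_mat_map)

lemma block_mat_trace: "trace (block_mat P Q R S) = trace P + trace S"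
  by (simp add: trace_def sum_UNIV_plus)

lemma block_mat_vec: "block_mat P Q R S *v pair_vec p q = pair_vec (P *v p + Q *v q) (R *v p + S *v q)"
  by (simp add: vec_eq_iff all_plus matrix_vector_mult_def sum_UNIV_plus)

lemmas block_simps = block_mat_mult block_mat_add block_mat_diff block_mat_minus block_mat_scaleR
  block_mat_cscale block_mat_transpose block_mat_cmat block_mat_eq_iff

lemma pair_vec_exists: "\<exists>p q. v = pair_vec p q"
  by (rule exI[of _ "\<chi> a. v $ Inl a"], rule exI[of _ "\<chi> a. v $ Inr a"]) (simp add: vec_eq_iff all_plus)

lemma pair_vec_eq_iff: "pair_vec p q = pair_vec p' q' \<longleftrightarrow> p = p' \<and> q = q'"
  by (auto simp: vec_eq_iff all_plus)

lemma pair_vec_zero: "pair_vec 0 0 = 0"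
  by (simp add: vec_eq_iff all_plus)

lemma pair_vec_inner: "pair_vec p q \<bullet> pair_vec p' q' = p \<bullet> p' + q \<bullet> (q' :: real^'n)"
  by (simp add: inner_vec_def sum_UNIV_plus)

lemma blocks_linear:
  "b11 (A + B) = b11 A + b11 B" "b12 (A + B) = b12 A + b12 B" "b21 (A + B) = b21 A + b21 B" "b22 (A + B) = b22 A + b22 B"
  "b11 (C - D) = b11 C - b11 D" "b12 (C - D) = b12 C - b12 D" "b21 (C - D) = b21 C - b21 D" "b22 (C - D) = b22 C - b22 D"
  by (simp_all add: b11_def b12_def b21_def b22_def vec_eq_iff)

lemma bounded_linear_blocks:
  "bounded_linear (b11 :: 'a::euclidean_space^('n::finite + 'n)^('n + 'n) \<Rightarrow> _)"
  "bounded_linear (b12 :: 'a::euclidean_space^('n::finite + 'n)^('n + 'n) \<Rightarrow> _)"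
  "bounded_linear (b21 :: 'a::euclidean_space^('n::finite + 'n)^('n + 'n) \<Rightarrow> _)"
  "bounded_linear (b22 :: 'a::euclidean_space^('n::finite + 'n)^('n + 'n) \<Rightarrow> _)"
  unfolding linear_conv_bounded_linear[symmetric]
  by (auto intro!: linearI simp: b11_def b12_def b21_def b22_def vec_eq_iff)

lemma has_derivative_block_mat:
  assumes "(P has_derivative P') (at x)" "(Q has_derivative Q') (at x)"
    "(R has_derivative R') (at x)" "(S has_derivative S') (at x)"
  shows "((\<lambda>x. block_mat (P x) (Q x) (R x) (S x)) has_derivative (\<lambda>h. block_mat (P' h) (Q' h) (R' h) (S' h))) (at x)"
proof -
  have "((\<lambda>x. \<chi> i j. block_mat (P x) (Q x) (R x) (S x) $ i $ j) has_derivative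
      (\<lambda>h. \<chi> i j. block_mat (P' h) (Q' h) (R' h) (S' h) $ i $ j)) (at x)"
  proof (intro has_derivative_vec_lambda)
    fix i j
    show "((\<lambda>x. block_mat (P x) (Q x) (R x) (S x) $ i $ j) has_derivative
      (\<lambda>h. block_mat (P' h) (Q' h) (R' h) (S' h) $ i $ j)) (at x)"
      using assms[THEN bounded_linear.has_derivative[OF bounded_linear_vec_nth],
          THEN bounded_linear.has_derivative[OF bounded_linear_vec_nth]]
      by (cases i; cases j) simp_all
  qed
  then show ?thesis by simp
qed

lemma has_vector_derivative_block_mat:
  assumes "(P has_vector_derivative P') (at x)" "(Q has_vector_derivative Q') (at x)"
    "(R has_vector_derivative R') (at x)" "(S has_vector_derivative S') (at x)"
  shows "((\<lambda>x. block_mat (P x) (Q x) (R x) (S x)) has_vector_derivative block_mat P' Q' R' S') (at x)"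
  using has_derivative_block_mat[OF assms[unfolded has_vector_derivative_def]]
  by (simp add: has_vector_derivative_def block_mat_scaleR)

lemma has_vector_derivative_matrix_inv:
  fixes M :: "real \<Rightarrow> 'a::{real_normed_field, euclidean_space}^'n^'n::finite"
  assumes M: "(M has_vector_derivative M') (at x)" and d: "det (M x) \<noteq> 0"
  shows "((\<lambda>x. matrix_inv (M x)) has_vector_derivative - (matrix_inv (M x) ** M' ** matrix_inv (M x))) (at x)"
  using has_derivative_matrix_inv[OF M[unfolded has_vector_derivative_def] d]
  by (simp add: has_vector_derivative_def matmul_scaleR_left matmul_scaleR_right)

section \<open>Real and complex matrices\<close>

lemma cmat_nth [simp]: "cmat A $ i $ j = of_real (A $ i $ j)"
  by (simp add: cmat_def)

lemma cmat_real [simp]: "cmat (A :: real^'n^'m::finite) = (A :: real^'n::finite^'m)"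
  by (simp add: vec_eq_iff)

lemma cmat_mult: "cmat (A ** B) = cmat A ** (cmat B :: 'a::{real_algebra_1, comm_ring_1}^'p::finite^'n::finite)"
  and cmat_add: "cmat (C + D) = cmat C + cmat D"
  and cmat_diff: "cmat (C - D) = cmat C - cmat D"
  and cmat_minus: "cmat (- D) = - cmat D"
  and cmat_one [simp]: "cmat (mat 1) = mat 1"
  and cmat_zero [simp]: "cmat 0 = 0"
  and cmat_transpose: "transpose (cmat D) = cmat (transpose D)"
  by (simp_all add: vec_eq_iff matrix_matrix_mult_def mat_def transpose_def)

lemma cnj_mat_nth [simp]: "cnj_mat A $ i $ j = cnj (A $ i $ j)"
  by (simp add: cnj_mat_def)

lemma cnj_mat_mult: "cnj_mat (A ** B) = cnj_mat A ** cnj_mat B"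
  and cnj_mat_minus: "cnj_mat (- D) = - cnj_mat D"
  and cnj_mat_cscale: "cnj_mat (c *k D) = cnj c *k cnj_mat D"
  and cnj_mat_cmat [simp]: "cnj_mat (cmat E) = cmat E"
  and cnj_mat_cnj_mat [simp]: "cnj_mat (cnj_mat D) = D"
  and cnj_mat_one [simp]: "cnj_mat (mat 1) = mat 1"
  by (simp_all add: vec_eq_iff matrix_matrix_mult_def mat_def transpose_def)

definition "Rem A = map_matrix Re A"
definition "Imm A = map_matrix Im A"

lemma Rem_nth [simp]: "Rem A $ i $ j = Re (A $ i $ j)" and Imm_nth [simp]: "Imm A $ i $ j = Im (A $ i $ j)"
  by (simp_all add: Rem_def Imm_def)

definition cplx :: "real^'n^'m \<Rightarrow> real^'n^'m \<Rightarrow> complex^'n::finite^'m::finite" where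
  "cplx X Y = cmat X + \<i> *k cmat Y"

lemma cplx_nth [simp]: "cplx X Y $ i $ j = Complex (X $ i $ j) (Y $ i $ j)"
  by (simp add: cplx_def complex_eq_iff)

lemma cplx_Rem_Imm: "cplx (Rem A) (Imm A) = A"
  by (simp add: vec_eq_iff)

lemma Rem_cplx [simp]: "Rem (cplx X Y) = X" and Imm_cplx [simp]: "Imm (cplx X Y) = Y"
  by (simp_all add: vec_eq_iff)

lemma Rem_mult: "Rem (A ** B) = Rem A ** Rem B - Imm A ** Imm B"
  by (simp_all add: vec_eq_iff matrix_matrix_mult_def sum_subtractf sum.distrib)

lemma Rem_add: "Rem (A + B) = Rem A + Rem B"
  and Rem_minus: "Rem (- A) = - Rem A"
  and Rem_diff: "Rem (A - B) = Rem A - Rem B"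
  and Rem_cmat [simp]: "Rem (cmat C) = C" and Imm_cmat [simp]: "Imm (cmat C) = 0"
  and Rem_transpose: "transpose (Rem A) = Rem (transpose A)"
  and Imm_transpose: "transpose (Imm A) = Imm (transpose A)"
  by (simp_all add: vec_eq_iff transpose_def)

lemma Re_trace: "Re (trace A) = trace (Rem A)"
  by (simp_all add: trace_def)

lemma bounded_linear_cscale: "bounded_linear (\<lambda>A :: 'a::{real_normed_field, euclidean_space}^'n::finite^'m::finite. c *k A)"
  unfolding linear_conv_bounded_linear[symmetric]
  by (auto intro!: linearI simp: vec_eq_iff algebra_simps)

lemma bounded_linear_cmat: "bounded_linear (cmat :: real^'n::finite^'m::finite \<Rightarrow> complex^'n^'m)"
  unfolding linear_conv_bounded_linear[symmetric]
  by (auto intro!: linearI simp: vec_eq_iff complex_eq_iff)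

lemma bounded_linear_Rem: "bounded_linear (Rem :: complex^'n::finite^'m::finite \<Rightarrow> _)"
  and bounded_linear_transpose: "bounded_linear (transpose :: 'a::euclidean_space^'n::finite^'m::finite \<Rightarrow> _)"
  unfolding linear_conv_bounded_linear[symmetric]
  by (auto intro!: linearI simp: vec_eq_iff transpose_def)

section \<open>Compatible complex structures as points of the Siegel upper half space\<close>

definition OM :: "('n::finite) endo" where "OM = block_mat 0 (mat 1) (- mat 1) 0"

lemma omega_OM: "omega v w = 2 * (v \<bullet> (OM *v w))"
proof -
  obtain p q where v: "v = pair_vec p q" using pair_vec_exists by blast
  obtain p' q' where w: "w = pair_vec p' q'" using pair_vec_exists by blast
  have m: "(- mat 1) *v p' = - p'"
    by (simp add: vec_eq_iff matrix_vector_mult_def mat_def sum_negf if_distrib[of "\<lambda>x. x * _"] cong: if_cong)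
  show ?thesis unfolding v w
    by (simp add: omega_def OM_def block_mat_vec pair_vec_inner m) (simp add: inner_vec_def sum_subtractf)
qed

lemma bilinear_form_eq:
  fixes A B :: "real^'n^'n::finite"
  shows "(\<forall>v w. v \<bullet> (A *v w) = v \<bullet> (B *v w)) \<longleftrightarrow> A = B"
  by (metis matrix_eq vector_eq_rdot inner_commute)

lemma omega_mult: "omega (A *v v) (B *v w) = 2 * (v \<bullet> (transpose A ** OM ** B *v w))"
  by (simp add: omega_OM inner_transpose[of v] matrix_vector_mul_assoc[symmetric] del: transpose_matrix_vector)

lemma AC_matrix: "J \<in> AC \<longleftrightarrow> J ** J = - mat 1 \<and> transpose J ** OM ** J = OM \<and> pos_def (OM ** J)"
  unfolding AC_def mem_Collect_eq omega_mult omega_OM[of _ "J *v _"]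
  by (simp add: omega_OM bilinear_form_eq pos_def_def matrix_vector_mul_assoc)

lemma tangent_AC_matrix: "B \<in> tangent_AC J \<longleftrightarrow> J ** B + B ** J = 0 \<and> transpose J ** OM ** B + transpose B ** OM ** J = 0"
proof -
  have "omega (J *v v) (B *v w) + omega (B *v v) (J *v w) =
      2 * (v \<bullet> ((transpose J ** OM ** B + transpose B ** OM ** J) *v w))" for v w
    unfolding omega_mult by (simp add: matrix_vector_mult_add_rdistrib inner_add_right)
  then show ?thesis
    unfolding tangent_AC_def using bilinear_form_eq[of "transpose J ** OM ** B + transpose B ** OM ** J" 0] by auto
qed

lemma OM_props: "OM ** OM = - mat 1" "transpose OM = - OM"
  by (simp_all add: OM_def block_simps transpose_minus matmul_minus_left matmul_minus_right block_mat_one)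

lemma AC_symmetric:
  assumes "J \<in> AC" shows "transpose J ** OM = - (OM ** J)" "transpose (OM ** J) = OM ** J"
proof -
  have "transpose J ** OM ** J ** J = OM ** J" using assms by (simp add: AC_matrix)
  then show 1: "transpose J ** OM = - (OM ** J)"
    using assms by (simp add: AC_matrix matrix_mul_assoc[symmetric] matmul_minus_right)
      (metis minus_minus)
  show "transpose (OM ** J) = OM ** J"
    by (simp add: matrix_transpose_mul OM_props matmul_minus_right 1)
qed

lemma tangent_AC_symmetric:
  assumes J: "J \<in> AC" and B: "B \<in> tangent_AC J" shows "transpose (OM ** B) = OM ** B"
proof -
  have JJ: "J ** J = - mat 1" using J by (simp add: AC_matrix)
  have anti: "J ** B = - (B ** J)" using B by (simp add: tangent_AC_matrix eq_neg_iff_add_eq_0)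
  have "transpose J ** OM ** B + transpose B ** OM ** J = 0" using B by (simp add: tangent_AC_matrix)
  then have "(OM ** B + transpose B ** OM) ** J = 0"
    by (simp add: AC_symmetric[OF J] mat_expand anti)
  then have "(OM ** B + transpose B ** OM) ** (J ** J) = 0" by (simp add: matrix_mul_assoc)
  then have "OM ** B + transpose B ** OM = 0"
    by (simp only: JJ matmul_minus_right matrix_mul_rid neg_equal_0_iff_equal)
  then have "transpose B ** OM = - (OM ** B)" by (rule add_eq_0_iff[THEN iffD1])
  then show ?thesis by (simp add: matrix_transpose_mul OM_props matmul_minus_right)
qed

lemma tangent_ACI:
  assumes J: "J \<in> AC" and "J ** B + B ** J = 0" "transpose (OM ** B) = OM ** B"
  shows "B \<in> tangent_AC J"
proof -
  have anti: "J ** B = - (B ** J)" using assms(2) by (simp add: eq_neg_iff_add_eq_0)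
  have "transpose B ** OM = - (OM ** B)"
    using assms(3) by (simp add: matrix_transpose_mul OM_props matmul_minus_right) (metis minus_minus)
  then show ?thesis
    using assms(2) by (simp add: tangent_AC_matrix AC_symmetric[OF J] mat_expand anti)
qed

text \<open>The compatible complex structure with Siegel coordinate X + \<i> Y. Its companion
  \<open>dJm\<close> is the derivative in the direction X' + \<i> Y'.\<close>

definition Jm :: "real^'n^'n \<Rightarrow> real^'n^'n \<Rightarrow> ('n::finite) endo" where
  "Jm X Y = (let G = matrix_inv Y in block_mat (G ** X) (- G) (Y + X ** (G ** X)) (- (X ** G)))"

definition dJm :: "real^'n^'n \<Rightarrow> real^'n^'n \<Rightarrow> real^'n^'n \<Rightarrow> real^'n^'n \<Rightarrow> ('n::finite) endo" where
  "dJm X Y X' Y' = (let G = matrix_inv Y in block_mat (G ** X' - G ** (Y' ** (G ** X))) (G ** (Y' ** G))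
     (Y' + X' ** (G ** X) + X ** (G ** X') - X ** (G ** (Y' ** (G ** X)))) (- (X' ** G) + X ** (G ** (Y' ** G))))"

locale siegel_point =
  fixes X Y :: "real^'n^'n::finite"
  assumes X: "transpose X = X" and Y: "transpose Y = Y" "pos_def Y"
begin

definition "G = matrix_inv Y"

lemma GY: "G ** Y = mat 1" "Y ** G = mat 1"
  unfolding G_def using matrix_inv_props pos_def_det[OF Y(2)] invertible_det_nz by blast+

lemma GY_assoc: "G ** (Y ** Z) = Z" "Y ** (G ** Z) = Z"
  by (simp_all add: matrix_mul_assoc GY)

lemma GY_cmat: "cmat G ** cmat Y = (mat 1 :: complex^'n^'n)" "cmat Y ** cmat G = (mat 1 :: complex^'n^'n)"
  using GY by (metis cmat_mult cmat_one)+

lemma GY_cmat_assoc: "cmat G ** (cmat Y ** (Z :: complex^'n^'n)) = Z" "cmat Y ** (cmat G ** (Z :: complex^'n^'n)) = Z"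
  by (simp_all add: matrix_mul_assoc GY_cmat)

lemmas GY_simps = GY GY_assoc GY_cmat GY_cmat_assoc

lemma G_sym: "transpose G = G"
proof -
  have "transpose (Y ** G) = mat 1" by (simp add: GY)
  then have "transpose G ** Y = mat 1" by (simp add: matrix_transpose_mul Y)
  then have "transpose G ** Y ** G = G" by simp
  then show ?thesis by (simp add: matrix_mul_assoc[symmetric] GY)
qed

lemma G_pos: "pos_def G"
  unfolding pos_def_def
proof (intro allI impI)
  fix v :: "real^'n" assume v: "v \<noteq> 0"
  have "Y *v (G *v v) = v" by (simp add: matrix_vector_mul_assoc GY)
  moreover from this v have "G *v v \<noteq> 0" by auto
  ultimately show "0 < v \<bullet> (G *v v)" using Y(2) unfolding pos_def_def by (metis inner_commute)
qed

lemma Jm_eq: "Jm X Y = block_mat (G ** X) (- G) (Y + X ** (G ** X)) (- (X ** G))"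
  by (simp add: Jm_def G_def Let_def)

lemma dJm_eq: "dJm X Y X' Y' = block_mat (G ** X' - G ** (Y' ** (G ** X))) (G ** (Y' ** G))
     (Y' + X' ** (G ** X) + X ** (G ** X') - X ** (G ** (Y' ** (G ** X)))) (- (X' ** G) + X ** (G ** (Y' ** G)))"
  by (simp add: dJm_def G_def Let_def)

lemma OM_Jm: "OM ** Jm X Y = block_mat (Y + X ** (G ** X)) (- (X ** G)) (- (G ** X)) G"
  by (simp add: Jm_eq OM_def block_simps matmul_minus_left)

lemma Jm_AC: "Jm X Y \<in> AC"
  unfolding AC_matrix
proof (intro conjI)
  show JJ: "Jm X Y ** Jm X Y = - mat 1"
    by (simp add: Jm_eq block_simps block_mat_one mat_expand GY_simps)
  have "transpose (OM ** Jm X Y) = OM ** Jm X Y"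
    by (simp add: OM_Jm block_simps transpose_add transpose_minus matrix_transpose_mul X Y G_sym matrix_mul_assoc)
  then have "transpose (Jm X Y) ** OM = - (OM ** Jm X Y)"
    by (simp add: matrix_transpose_mul OM_props matmul_minus_right) (metis minus_minus)
  then show "transpose (Jm X Y) ** OM ** Jm X Y = OM"
    by (simp add: matmul_minus_left matrix_mul_assoc[symmetric] JJ matmul_minus_right)
  show "pos_def (OM ** Jm X Y)"
    unfolding pos_def_def
  proof (intro allI impI)
    fix v :: "'n vec2" assume v: "v \<noteq> 0"
    obtain p q where pq: "v = pair_vec p q" using pair_vec_exists by blast
    \<comment> \<open>Completing the square: the metric of \<open>Jm X Y\<close> is p Y p + r G
      r.\<close>
    define r where "r = q - X *v p"
    have mv: "(- A) *v x = - (A *v x)" for A :: "real^'n^'n" and x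
      by (simp add: vec_eq_iff matrix_vector_mult_def sum_negf)
    have "v \<bullet> (OM ** Jm X Y *v v) = p \<bullet> (Y *v p) + p \<bullet> (X *v (G *v (X *v p))) - p \<bullet> (X *v (G *v q))
        - q \<bullet> (G *v (X *v p)) + q \<bullet> (G *v q)"
      by (simp add: pq OM_Jm block_mat_vec pair_vec_inner matrix_vector_mult_add_rdistrib mv
          matrix_vector_mul_assoc[symmetric] inner_add_right inner_diff_right)
    also have "\<dots> = p \<bullet> (Y *v p) + r \<bullet> (G *v r)"
      using symmetric_inner[OF X, of p]
      by (simp add: r_def matrix_vector_mult_diff_distrib inner_diff_left inner_diff_right inner_commute)
    also have "\<dots> > 0"
    proof (cases "p = 0")
      case True
      then have "r \<noteq> 0" using v pq pair_vec_zero by (auto simp: r_def)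
      then show ?thesis using G_pos True by (simp add: pos_def_def)
    next
      case False
      then have "p \<bullet> (Y *v p) > 0" using Y(2) by (simp add: pos_def_def)
      moreover have "r \<bullet> (G *v r) \<ge> 0" using G_pos by (cases "r = 0") (auto simp: pos_def_def less_imp_le)
      ultimately show ?thesis by linarith
    qed
    finally show "0 < v \<bullet> (OM ** Jm X Y *v v)" .
  qed
qed

end

section \<open>The chart of compatible complex structures\<close>

lemma has_vector_derivative_eventually:
  fixes f h :: "real \<Rightarrow> 'a::real_normed_vector"
  assumes "(f has_vector_derivative D) (at x)" "\<forall>\<^sub>F t in nhds x. f t = h t"
  shows "(h has_vector_derivative D) (at x)"
  using assms(1) unfolding has_vector_derivative_def
  by (rule has_derivative_transform_eventually)
    (use assms(2) in \<open>simp_all add: eventually_nhds_conv_at\<close>)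

text \<open>The Siegel coordinate written in the upper blocks of J. These expressions make sense for
  matrices near \<open>AC\<close>, so they can be differentiated block by block along any
  curve.\<close>

definition "Ypart J = matrix_inv (- b12 J)"
definition "Xpart J = Ypart J ** b11 J"

text \<open>Restricting the metric to vectors with vanishing y-component shows that
  \<open>- b12 J\<close> is positive definite, so Y is defined. The blocks of J^2 = -1 give the
  symmetry of X and determine the lower left block; the symmetry of the metric determines the lower
  right one.\<close>

lemma AC_siegel_point:
  assumes J: "J \<in> AC"
  shows "siegel_point (Xpart J) (Ypart J)" "J = Jm (Xpart J) (Ypart J)" "det (- b12 J) \<noteq> 0"
proof -
  define a b c d where abcd: "a = b11 J" "b = b12 J" "c = b21 J" "d = b22 J"
  have Jb: "J = block_mat a b c d" by (simp add: abcd block_mat_blocks)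
  have OJ: "OM ** J = block_mat c d (- a) (- b)" by (simp add: Jb OM_def block_simps matmul_minus_left)
  have sym: "transpose c = c" "transpose b = b" "d = - transpose a"
    using AC_symmetric(2)[OF J] by (auto simp: OJ block_simps transpose_minus)
  have JJ: "J ** J = - mat 1" and pos: "pos_def (OM ** J)" using J by (auto simp: AC_matrix)
  define G where "G = - b"
  have Gsym: "transpose G = G" by (simp add: G_def sym transpose_minus)
  have Gpos: "pos_def G"
    unfolding pos_def_def
  proof (intro allI impI)
    fix q :: "real^'a" assume "q \<noteq> 0"
    then have "pair_vec 0 q \<noteq> 0" using pair_vec_eq_iff[of 0 q 0 0] by (simp add: pair_vec_zero)
    then have "0 < pair_vec 0 q \<bullet> (OM ** J *v pair_vec 0 q)" using pos by (simp add: pos_def_def)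
    then show "0 < q \<bullet> (G *v q)" by (simp add: OJ block_mat_vec pair_vec_inner G_def)
  qed
  show det: "det (- b12 J) \<noteq> 0" using pos_def_det[OF Gpos] by (simp add: G_def abcd)
  define Y where "Y = Ypart J"
  have YG: "Y ** G = mat 1" "G ** Y = mat 1"
    using det matrix_inv_props invertible_det_nz unfolding Y_def Ypart_def G_def abcd by blast+
  interpret S: siegel_point 0 G by unfold_locales (use Gsym Gpos in auto)
  have "S.G = Y" unfolding S.G_def Y_def Ypart_def by (simp add: G_def abcd)
  then have Y: "transpose Y = Y" "pos_def Y" using S.G_sym S.G_pos by auto
  have YGa: "Y ** (G ** Z) = Z" "G ** (Y ** Z) = Z" for Z :: "real^'a^'a"
    by (simp_all add: matrix_mul_assoc YG)
  have bG: "b = - G" by (simp add: G_def)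
  have e12: "a ** G = G ** transpose a" and e11: "a ** a - G ** c = - mat 1"
    using JJ by (auto simp: Jb block_simps block_mat_one bG sym matmul_minus_left matmul_minus_right)
  define X where "X = Y ** a"
  have "Y ** (a ** G) ** Y = Y ** (G ** transpose a) ** Y" by (simp add: e12)
  then have "Y ** a = transpose a ** Y"
    by (simp add: matrix_mul_assoc[symmetric] YG YGa)
  then have X: "transpose X = X" by (simp add: X_def matrix_transpose_mul Y)
  have a: "a = G ** X" by (simp add: X_def YGa)
  have ta: "transpose a = X ** G" by (simp add: a matrix_transpose_mul X Gsym)
  have "Y ** (G ** c) = Y ** (a ** a + mat 1)" using e11 by (simp add: algebra_simps)
  then have c: "c = Y + X ** (G ** X)"
    by (simp add: YGa matrix_add_ldistrib a matrix_mul_assoc) (simp add: matrix_mul_assoc[symmetric] YGa)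
  have XJ: "X = Xpart J" by (simp add: X_def Xpart_def Y_def abcd)
  show sp: "siegel_point (Xpart J) (Ypart J)"
    unfolding XJ[symmetric] Y_def[symmetric] by unfold_locales (use X Y in auto)
  interpret SJ: siegel_point X Y using sp by (simp add: XJ Y_def)
  have "SJ.G = SJ.G ** (Y ** G)" by (simp add: YG)
  also have "\<dots> = G" by (simp add: SJ.GY_assoc)
  finally have "SJ.G = G" .
  then show "J = Jm (Xpart J) (Ypart J)"
    unfolding XJ[symmetric] Y_def[symmetric] SJ.Jm_eq by (simp add: Jb a[symmetric] bG c sym ta)
qed

context siegel_point
begin

lemma Ypart_Jm: "Ypart (Jm X Y) = Y"
proof -
  have d: "det G \<noteq> 0" using G_pos by (rule pos_def_det)
  have "matrix_inv G = (Y ** G) ** matrix_inv G" by (simp add: GY)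
  also have "\<dots> = Y ** (G ** matrix_inv G)" by (simp add: matrix_mul_assoc)
  also have "\<dots> = Y" using d matrix_inv_props(1)[of G] invertible_det_nz by (metis matrix_mul_rid)
  finally show ?thesis by (simp add: Ypart_def Jm_eq)
qed

lemma Xpart_Jm: "Xpart (Jm X Y) = X"
  by (simp add: Xpart_def Ypart_Jm) (simp add: Jm_eq GY_assoc)

definition "\<tau> = cplx X Y"

lemma tau_sym: "transpose \<tau> = \<tau>"
  by (simp add: \<tau>_def cplx_def transpose_add transpose_cscale cmat_transpose X Y)

lemma cmat_Jm: "cmat (Jm X Y) = (block_mat (cmat G ** cmat X) (- cmat G) (cmat Y + cmat X ** (cmat G ** cmat X))
    (- (cmat X ** cmat G)) :: complex^('n + 'n)^('n + 'n))"
  by (simp add: Jm_eq block_mat_cmat cmat_mult cmat_minus cmat_add)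

lemma T01_Jm: "pair_vec v w \<in> T01 (Jm X Y) \<longleftrightarrow> w = \<tau> *v v"
proof -
  have mv: "(- A) *v x = - (A *v x)" for A :: "complex^'n^'n" and x
    by (simp add: vec_eq_iff matrix_vector_mult_def sum_negf)
  have iv: "(\<i> *k A) *v x = \<i> *s (A *v x)" for A :: "complex^'n^'n" and x
    by (simp add: vec_eq_iff matrix_vector_mult_def sum_distrib_left mult.assoc)
  have vi: "A *v (c *s x) = c *s (A *v x)" for A :: "complex^'n^'n" and x c
    by (simp add: vec_eq_iff matrix_vector_mult_def sum_distrib_left mult.left_commute)
  have sp: "c *s pair_vec p q = pair_vec (c *s p) (c *s q)" for c :: complex and p q :: "complex^'n"
    by (simp add: vec_eq_iff all_plus)
  have mp: "- pair_vec p q = pair_vec (- p) (- q)" for p q :: "complex^'n"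
    by (simp add: vec_eq_iff all_plus)
  let ?G = "cmat G :: complex^'n^'n" and ?X = "cmat X :: complex^'n^'n" and ?Y = "cmat Y :: complex^'n^'n"
  have GYv: "?G *v (?Y *v x) = x" "?Y *v (?G *v x) = x" for x
    by (simp_all add: matrix_vector_mul_assoc GY_cmat)
  have "pair_vec v w \<in> T01 (Jm X Y) \<longleftrightarrow>
      ?G *v (?X *v v) - ?G *v w = - \<i> *s v \<and>
      ?Y *v v + ?X *v (?G *v (?X *v v)) - ?X *v (?G *v w) = - \<i> *s w"
    by (simp add: T01_def cmat_Jm block_mat_vec sp mp pair_vec_eq_iff mv matrix_vector_mult_add_rdistrib
        matrix_vector_mul_assoc[symmetric])
  also have "\<dots> \<longleftrightarrow> w = ?X *v v + \<i> *s (?Y *v v)"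
  proof
    assume "?G *v (?X *v v) - ?G *v w = - \<i> *s v \<and>
      ?Y *v v + ?X *v (?G *v (?X *v v)) - ?X *v (?G *v w) = - \<i> *s w"
    then have "?Y *v (?G *v (?X *v v) - ?G *v w) = ?Y *v (- \<i> *s v)" by simp
    then have "?X *v v - w = - \<i> *s (?Y *v v)"
      by (simp only: matrix_vector_mult_diff_distrib GYv vi)
    then have "w = ?X *v v - (- \<i> *s (?Y *v v))" by (metis add_diff_cancel_left' diff_add_cancel)
    then show "w = ?X *v v + \<i> *s (?Y *v v)"
      by (simp add: vec_eq_iff)
  next
    assume w: "w = ?X *v v + \<i> *s (?Y *v v)"
    have Gw: "?G *v w = ?G *v (?X *v v) + \<i> *s v"
      by (simp add: w matrix_vector_right_distrib vi GYv)
    show "?G *v (?X *v v) - ?G *v w = - \<i> *s v \<and>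
      ?Y *v v + ?X *v (?G *v (?X *v v)) - ?X *v (?G *v w) = - \<i> *s w"
      unfolding Gw w by (simp add: matrix_vector_right_distrib vi GYv)
  qed
  finally show ?thesis by (simp add: \<tau>_def cplx_def matrix_vector_mult_add_rdistrib iv)
qed

lemma siegel_Jm: "siegel (Jm X Y) = \<tau>"
  unfolding siegel_def T01_Jm by (rule the_equality) (auto simp: matrix_eq)

end

lemma siegel_AC: "J \<in> AC \<Longrightarrow> siegel J = cplx (Xpart J) (Ypart J)"
  using siegel_point.siegel_Jm[OF AC_siegel_point(1)] AC_siegel_point(2)
  by (metis siegel_point.\<tau>_def AC_siegel_point(1))

section \<open>Tangent vectors in Siegel coordinates\<close>

definition "dY J B = Ypart J ** (b12 B ** Ypart J)"
definition "dX J B = dY J B ** b11 J + Ypart J ** b11 B"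

context
  fixes \<gamma> :: "real \<Rightarrow> ('n::finite) endo" and J B
  assumes \<gamma>: "\<gamma> 0 = J" "(\<gamma> has_vector_derivative B) (at 0)" and J: "J \<in> AC"
begin

lemma Ypart_deriv: "((\<lambda>t. Ypart (\<gamma> t)) has_vector_derivative dY J B) (at 0)"
proof -
  have "((\<lambda>t. - b12 (\<gamma> t)) has_vector_derivative - b12 B) (at 0)"
    by (intro has_vector_derivative_minus bounded_linear.has_vector_derivative[OF bounded_linear_blocks(2)] \<gamma>)
  from has_vector_derivative_matrix_inv[OF this] show ?thesis
    using AC_siegel_point(3)[OF J]
    by (simp add: \<gamma> dY_def Ypart_def matmul_minus_left matmul_minus_right matrix_mul_assoc)
qed

lemma Xpart_deriv: "((\<lambda>t. Xpart (\<gamma> t)) has_vector_derivative dX J B) (at 0)"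
  unfolding Xpart_def
  by (rule has_vector_derivative_eq_rhs[OF has_vector_derivative_matmul[OF Ypart_deriv
          bounded_linear.has_vector_derivative[OF bounded_linear_blocks(1) \<gamma>(2)]]])
    (simp add: dX_def \<gamma> add.commute)

lemma cplx_part_deriv: "((\<lambda>t. cplx (Xpart (\<gamma> t)) (Ypart (\<gamma> t))) has_vector_derivative cplx (dX J B) (dY J B)) (at 0)"
  unfolding cplx_def
  by (intro has_vector_derivative_add bounded_linear.has_vector_derivative[OF bounded_linear_cscale]
      bounded_linear.has_vector_derivative[OF bounded_linear_cmat] Xpart_deriv Ypart_deriv)

end

lemma tangent_AC_diff:
  assumes "B \<in> tangent_AC J" "B' \<in> tangent_AC J" shows "B - B' \<in> tangent_AC J"
proof -
  have "J ** (B - B') + (B - B') ** J = (J ** B + B ** J) - (J ** B' + B' ** J)"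
    "transpose J ** OM ** (B - B') + transpose (B - B') ** OM ** J =
      (transpose J ** OM ** B + transpose B ** OM ** J) - (transpose J ** OM ** B' + transpose B' ** OM ** J)"
    by (simp_all add: mat_expand transpose_diff)
  then show ?thesis using assms by (simp add: tangent_AC_matrix)
qed

lemma curve_through_AC_tangent:
  assumes "curve_through AC J B \<gamma>" shows "B \<in> tangent_AC J"
proof -
  have \<gamma>: "\<forall>\<^sub>F t in nhds 0. \<gamma> t \<in> AC" "\<gamma> 0 = J" "(\<gamma> has_vector_derivative B) (at 0)"
    using assms by (auto simp: curve_through_def)
  have J: "J \<in> AC" using eventually_nhds_x_imp_x[OF \<gamma>(1)] \<gamma>(2) by simp
  have const: "D = 0" if "\<forall>\<^sub>F t in nhds 0. f t = c" "(f has_vector_derivative D) (at 0)"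
    for f :: "real \<Rightarrow> 'a endo" and c D
  proof -
    have "((\<lambda>_. c) has_vector_derivative D) (at 0)"
      by (rule has_vector_derivative_eventually[OF that(2,1)])
    then show ?thesis using vector_derivative_unique_at has_vector_derivative_const by blast
  qed
  have "((\<lambda>t. \<gamma> t ** \<gamma> t) has_vector_derivative \<gamma> 0 ** B + B ** \<gamma> 0) (at 0)"
    by (rule has_vector_derivative_matmul[OF \<gamma>(3) \<gamma>(3)])
  moreover have "\<forall>\<^sub>F t in nhds 0. \<gamma> t ** \<gamma> t = - mat 1"
    using \<gamma>(1) by eventually_elim (simp add: AC_matrix)
  ultimately have 1: "J ** B + B ** J = 0" using const by (simp add: \<gamma>)
  have "((\<lambda>t. transpose (OM ** \<gamma> t) - OM ** \<gamma> t) has_vector_derivative transpose (OM ** B) - OM ** B) (at 0)"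
    by (rule has_vector_derivative_eq_rhs[OF has_vector_derivative_diff[OF
            bounded_linear.has_vector_derivative[OF bounded_linear_transpose has_vector_derivative_matmul[OF has_vector_derivative_const \<gamma>(3)]]
            has_vector_derivative_matmul[OF has_vector_derivative_const \<gamma>(3)]]]) simp
  note d2 = this
  have "\<forall>\<^sub>F t in nhds 0. transpose (OM ** \<gamma> t) - OM ** \<gamma> t = 0"
    using \<gamma>(1) by eventually_elim (simp add: AC_symmetric)
  from const[OF this d2] have 2: "transpose (OM ** B) - OM ** B = 0" .
  show ?thesis using tangent_ACI[OF J 1] 2 by simp
qed

context siegel_point
begin

context
  fixes X' Y' :: "real^'n^'n" assumes X': "transpose X' = X'" and Y': "transpose Y' = Y'"
begin

lemma siegel_point_eventually: "\<forall>\<^sub>F t in nhds 0. siegel_point (X + t *\<^sub>R X') (Y + t *\<^sub>R Y')"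
proof -
  have "isCont (\<lambda>t. Y + t *\<^sub>R Y') 0" by (intro continuous_intros)
  from pos_def_eventually_pos_def[OF this] have "\<forall>\<^sub>F t in nhds 0. pos_def (Y + t *\<^sub>R Y')"
    using Y by simp
  then show ?thesis
    by eventually_elim (unfold_locales, simp_all add: X Y X' Y' transpose_add transpose_scalar)
qed

lemma Jm_curve: "curve_through AC (Jm X Y) (dJm X Y X' Y') (\<lambda>t. Jm (X + t *\<^sub>R X') (Y + t *\<^sub>R Y'))"
  unfolding curve_through_def
proof (intro conjI)
  show "\<forall>\<^sub>F t in nhds 0. Jm (X + t *\<^sub>R X') (Y + t *\<^sub>R Y') \<in> AC"
    using siegel_point_eventually by eventually_elim (rule siegel_point.Jm_AC)
  have dXt: "((\<lambda>t. X + t *\<^sub>R X') has_vector_derivative X') (at 0)"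
    and dYt: "((\<lambda>t. Y + t *\<^sub>R Y') has_vector_derivative Y') (at 0)"
    by (auto intro!: derivative_eq_intros)
  have dG: "((\<lambda>t. matrix_inv (Y + t *\<^sub>R Y')) has_vector_derivative - (G ** Y' ** G)) (at 0)"
    using has_vector_derivative_matrix_inv[OF dYt] pos_def_det[OF Y(2)] by (simp add: G_def)
  have dGX: "((\<lambda>t. matrix_inv (Y + t *\<^sub>R Y') ** (X + t *\<^sub>R X')) has_vector_derivative G ** X' - G ** (Y' ** (G ** X))) (at 0)"
    by (rule has_vector_derivative_eq_rhs[OF has_vector_derivative_matmul[OF dG dXt]])
      (simp add: G_def[symmetric] mat_expand)
  have dXGX: "((\<lambda>t. (X + t *\<^sub>R X') ** (matrix_inv (Y + t *\<^sub>R Y') ** (X + t *\<^sub>R X'))) has_vector_derivative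
      X' ** (G ** X) + X ** (G ** X') - X ** (G ** (Y' ** (G ** X)))) (at 0)"
    by (rule has_vector_derivative_eq_rhs[OF has_vector_derivative_matmul[OF dXt dGX]])
      (simp add: G_def[symmetric] mat_expand)
  have dXG: "((\<lambda>t. (X + t *\<^sub>R X') ** matrix_inv (Y + t *\<^sub>R Y')) has_vector_derivative
      X' ** G - X ** (G ** (Y' ** G))) (at 0)"
    by (rule has_vector_derivative_eq_rhs[OF has_vector_derivative_matmul[OF dXt dG]])
      (simp add: G_def[symmetric] mat_expand)
  show "((\<lambda>t. Jm (X + t *\<^sub>R X') (Y + t *\<^sub>R Y')) has_vector_derivative dJm X Y X' Y') (at 0)"
    unfolding Jm_def Let_def
    by (rule has_vector_derivative_eq_rhs[OF has_vector_derivative_block_mat[OF dGX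
            has_vector_derivative_minus[OF dG] has_vector_derivative_add[OF dYt dXGX] has_vector_derivative_minus[OF dXG]]])
      (simp add: dJm_eq mat_expand block_mat_eq_iff algebra_simps)
qed simp

lemma dJm_tangent: "dJm X Y X' Y' \<in> tangent_AC (Jm X Y)"
  using Jm_curve by (rule curve_through_AC_tangent)

end

lemma dY_dJm: "dY (Jm X Y) (dJm X Y X' Y') = Y'"
  by (simp add: dY_def Ypart_Jm) (simp add: dJm_eq GY_simps mat_expand)

lemma dX_dJm: "dX (Jm X Y) (dJm X Y X' Y') = X'"
  by (simp add: dX_def dY_dJm Ypart_Jm) (simp add: dJm_eq Jm_eq GY_simps mat_expand)

text \<open>The derivatives X' and Y' are read off from the upper blocks of B, so B and
  \<open>dJm X Y X' Y'\<close> have the same upper blocks. A tangent vector with vanishing upper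
  blocks is zero: symmetry kills its lower right block, anticommuting with J the lower left
  one.\<close>

lemma tangent_dJm:
  assumes B: "B \<in> tangent_AC (Jm X Y)"
  shows "transpose (dX (Jm X Y) B) = dX (Jm X Y) B" "transpose (dY (Jm X Y) B) = dY (Jm X Y) B"
    "B = dJm X Y (dX (Jm X Y) B) (dY (Jm X Y) B)"
proof -
  let ?J = "Jm X Y"
  have ind: "B11 = B11' \<Longrightarrow> transpose B11 = transpose B11'" for B11 B11' :: "real^'n^'n" by simp
  define p q r s where pqrs: "p = b11 B" "q = b12 B" "r = b21 B" "s = b22 B"
  have Bb: "B = block_mat p q r s" by (simp add: pqrs block_mat_blocks)
  have OB: "OM ** B = block_mat r s (- p) (- q)" by (simp add: Bb OM_def block_simps matmul_minus_left)
  have sym: "transpose q = q" "transpose s = - p" "s = - transpose p"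
    using tangent_AC_symmetric[OF Jm_AC B] by (auto simp: OB block_simps transpose_minus)
  have JB: "?J ** B + B ** ?J = 0" using B by (simp add: tangent_AC_matrix)
  have e: "G ** (X ** q) + G ** transpose p - (p ** G + q ** (X ** G)) = 0"
    using JB unfolding block_mat_zero
    by (simp add: Bb Jm_eq block_simps mat_expand sym(3) algebra_simps)
  let ?Y' = "dY ?J B" and ?X' = "dX ?J B"
  have Y': "?Y' = Y ** (q ** Y)" by (simp add: dY_def Ypart_Jm pqrs)
  have X': "?X' = Y ** (q ** X) + Y ** p"
    by (simp add: dX_def dY_def Ypart_Jm pqrs mat_expand) (simp add: Jm_eq GY_simps)
  show tY: "transpose ?Y' = ?Y'" by (simp add: Y' matrix_transpose_mul Y sym matrix_mul_assoc)
  have "Y ** (G ** (X ** q) + G ** transpose p - (p ** G + q ** (X ** G))) ** Y = 0" by (simp add: e)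
  then have "X ** (q ** Y) + transpose p ** Y = Y ** p + Y ** (q ** X)"
    by (simp add: mat_expand GY_simps)
  then show tX: "transpose ?X' = ?X'"
    by (simp add: X' transpose_add matrix_transpose_mul sym X Y matrix_mul_assoc[symmetric] add.commute)
  let ?D = "B - dJm X Y ?X' ?Y'"
  have D: "?D = block_mat 0 0 (b21 ?D) (b22 ?D)"
    by (subst block_mat_blocks[symmetric])
      (simp add: block_mat_eq_iff blocks_linear dJm_eq X' Y' pqrs[symmetric] mat_expand GY_simps)
  have "?D \<in> tangent_AC ?J"
    using tangent_AC_diff[OF B dJm_tangent[OF tX tY]] .
  note T = this tangent_AC_symmetric[OF Jm_AC this]
  define r' s' where rs: "r' = b21 ?D" "s' = b22 ?D"
  have D': "?D = block_mat 0 0 r' s'" using D by (simp add: rs)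
  have "OM ** ?D = block_mat r' s' 0 0" by (simp add: D' OM_def block_simps)
  then have s: "s' = 0" using T(2) by (simp add: block_simps)
  have "?J ** ?D + ?D ** ?J = 0" using T(1) by (simp add: tangent_AC_matrix)
  then have "G ** r' = 0"
    unfolding D' s block_mat_zero by (simp add: Jm_eq block_simps mat_expand)
  then have "Y ** (G ** r') = 0" by simp
  then have "r' = 0" by (simp add: GY_simps)
  then have "?D = 0" using D' s block_mat_zero by simp
  then show "B = dJm X Y ?X' ?Y'" by simp
qed

end

lemma differential_siegel:
  assumes J: "J \<in> AC" and B: "B \<in> tangent_AC J"
  shows "differential AC siegel J B = cplx (dX J B) (dY J B)"
proof -
  interpret S: siegel_point "Xpart J" "Ypart J" using J by (rule AC_siegel_point)
  have JJ: "Jm (Xpart J) (Ypart J) = J" using AC_siegel_point(2)[OF J] by simp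
  have der: "((\<lambda>t. siegel (\<gamma> t)) has_vector_derivative cplx (dX J B) (dY J B)) (at 0)"
    if c: "curve_through AC J B \<gamma>" for \<gamma>
  proof -
    have \<gamma>: "\<forall>\<^sub>F t in nhds 0. \<gamma> t \<in> AC" "\<gamma> 0 = J" "(\<gamma> has_vector_derivative B) (at 0)"
      using c by (auto simp: curve_through_def)
    have ev: "\<forall>\<^sub>F t in nhds 0. cplx (Xpart (\<gamma> t)) (Ypart (\<gamma> t)) = siegel (\<gamma> t)"
      using \<gamma>(1) by eventually_elim (simp add: siegel_AC)
    show ?thesis by (rule has_vector_derivative_eventually[OF cplx_part_deriv[OF \<gamma>(2,3) J] ev])
  qed
  note T = S.tangent_dJm[unfolded JJ, OF B]
  \<comment> \<open>If no curve had velocity B, every value would satisfy the description of the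
    differential.\<close>
  have c: "\<exists>\<gamma>. curve_through AC J B \<gamma>"
    using S.Jm_curve[OF T(1,2)] T(3) by (auto simp: JJ)
  show ?thesis
    unfolding differential_def
  proof (rule the_equality)
    fix d assume "\<forall>\<gamma>. curve_through AC J B \<gamma> \<longrightarrow> ((\<lambda>t. siegel (\<gamma> t)) has_vector_derivative d) (at 0)"
    then show "d = cplx (dX J B) (dY J B)"
      using c der vector_derivative_unique_at by blast
  qed (use der in blast)
qed

section \<open>The holomorphic cotangent bundle in Siegel coordinates\<close>

text \<open>The dual of a cotangent vector at \<open>\<tau>\<close> vanishes on the graph of \<open>\<tau>\<close> and takes values in it, so it
  is determined by its upper right block \<open>n\<close>.\<close>

definition nf :: "complex^'n^'n \<Rightarrow> complex^'n^'n \<Rightarrow> ('n::finite) cendo" where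
  "nf \<tau> n = block_mat (- (n ** \<tau>)) n (- (\<tau> ** (n ** \<tau>))) (\<tau> ** n)"

text \<open>The derivative of \<open>nf\<close> at (\<tau>, n) in the direction (\<tau>',
  n').\<close>

definition dnf :: "complex^'n^'n \<Rightarrow> complex^'n^'n \<Rightarrow> complex^'n^'n \<Rightarrow> complex^'n^'n \<Rightarrow> ('n::finite) cendo" where
  "dnf \<tau> n \<tau>' n' = block_mat (- (n' ** \<tau> + n ** \<tau>')) n'
     (- (\<tau>' ** (n ** \<tau>) + \<tau> ** (n' ** \<tau> + n ** \<tau>'))) (\<tau>' ** n + \<tau> ** n')"

lemma real_endo_eq: "real_endo \<alpha> = 2 *\<^sub>R Rem (transpose \<alpha>)"
  by (simp add: real_endo_def dual_endo_def vec_eq_iff)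

lemma has_vector_derivative_nf:
  assumes "(T has_vector_derivative \<tau>') (at 0)" "(N has_vector_derivative n') (at 0)"
  shows "((\<lambda>t. nf (T t) (N t)) has_vector_derivative dnf (T 0) (N 0) \<tau>' n') (at (0 :: real))"
proof -
  note NT = has_vector_derivative_matmul[OF assms(2,1)]
  show ?thesis
    unfolding nf_def
    by (rule has_vector_derivative_eq_rhs[OF has_vector_derivative_block_mat[OF
            has_vector_derivative_minus[OF NT] assms(2) has_vector_derivative_minus[OF has_vector_derivative_matmul[OF assms(1) NT]]
            has_vector_derivative_matmul[OF assms]]])
      (simp add: dnf_def block_mat_eq_iff algebra_simps)
qed

context siegel_point
begin

lemma T10_Jm: "pair_vec v w \<in> T10 (Jm X Y) \<longleftrightarrow> w = cnj_mat \<tau> *v v"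
proof -
  have c: "cnj_vec (pair_vec a b) = pair_vec (cnj_vec a) (cnj_vec b)" for a b :: "complex^'n"
    by (simp add: cnj_vec_def vec_eq_iff all_plus)
  have cm: "cnj_vec (A *v x) = cnj_mat A *v cnj_vec x" for A :: "complex^'p::finite^'p" and x
    by (simp add: cnj_vec_def matrix_vector_mult_def vec_eq_iff)
  have cs: "cnj_vec (a *s x) = cnj a *s cnj_vec x" and cc: "cnj_vec (cnj_vec x) = x" for x :: "complex^'p" and a
    by (simp_all add: cnj_vec_def vec_eq_iff)
  have "u \<in> T10 (Jm X Y) \<longleftrightarrow> cnj_vec (cmat (Jm X Y) *v u) = cnj_vec (\<i> *s u)" for u
    unfolding T10_def by simp (metis cc)
  then have "u \<in> T10 (Jm X Y) \<longleftrightarrow> cnj_vec u \<in> T01 (Jm X Y)" for u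
    by (simp add: T01_def cm cs)
  then have "pair_vec v w \<in> T10 (Jm X Y) \<longleftrightarrow> cnj_vec w = \<tau> *v cnj_vec v"
    by (simp add: c T01_Jm)
  also have "\<dots> \<longleftrightarrow> w = cnj_mat \<tau> *v v"
    by (metis cc cm cnj_mat_cnj_mat)
  finally show ?thesis .
qed

lemma tau_expand: "\<tau> = cmat X + \<i> *k cmat Y"
  by (simp add: \<tau>_def cplx_def)

lemma cotangent_nf:
  assumes \<alpha>: "\<alpha> \<in> cotangent_AC (Jm X Y)"
  shows "transpose \<alpha> = nf \<tau> (b12 (transpose \<alpha>))" "transpose (b12 (transpose \<alpha>)) = b12 (transpose \<alpha>)"
proof -
  define N where "N = transpose \<alpha>"
  define a b c d where abcd: "a = b11 N" "b = b12 N" "c = b21 N" "d = b22 N"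
  have Nb: "N = block_mat a b c d" by (simp add: abcd block_mat_blocks)
  have N10: "N *v v \<in> T01 (Jm X Y)" if "v \<in> T10 (Jm X Y)" for v
    using \<alpha> that by (simp add: cotangent_AC_def dual_endo_def N_def del: transpose_matrix_vector)
  have N01: "N *v v = 0" if "v \<in> T01 (Jm X Y)" for v
    using \<alpha> that by (simp add: cotangent_AC_def dual_endo_def N_def del: transpose_matrix_vector)
  have k: "a *v v + b *v (\<tau> *v v) = 0" "c *v v + d *v (\<tau> *v v) = 0" for v
    using N01[of "pair_vec v (\<tau> *v v)"] pair_vec_eq_iff[of _ _ 0 0]
    by (auto simp: T01_Jm Nb block_mat_vec pair_vec_zero)
  have "a + b ** \<tau> = 0" "c + d ** \<tau> = 0"
    unfolding matrix_eq using k by (simp_all add: matrix_vector_mult_add_rdistrib matrix_vector_mul_assoc)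
  then have ac: "a = - (b ** \<tau>)" "c = - (d ** \<tau>)" by (simp_all add: eq_neg_iff_add_eq_0)
  have "d *v q = \<tau> *v (b *v q)" for q
  proof -
    \<comment> \<open>With this v, the vector (0, q) is the (1,0) vector over v minus the (0,1)
      vector over v, since cnj \<tau> - \<tau> = -2 \<i> Y. The second is annihilated, so N (0, q)
      is of type (0,1), which determines d.\<close>
    define v where "v = ((\<i> / 2) *k cmat G) *v q"
    have "(cnj_mat \<tau> - \<tau>) ** ((\<i> / 2) *k cmat G) = mat 1"
    proof -
      have "cnj_mat \<tau> - \<tau> = (- 2 * \<i>) *k cmat Y" by (simp add: vec_eq_iff \<tau>_def complex_eq_iff)
      then show ?thesis by (simp add: cscale_mult_left cscale_mult_right cscale_cscale GY_cmat)
    qed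
    then have "(cnj_mat \<tau> - \<tau>) *v v = q" by (simp add: v_def matrix_vector_mul_assoc)
    then have "pair_vec 0 q = pair_vec v (cnj_mat \<tau> *v v) - pair_vec v (\<tau> *v v)"
      by (simp add: vec_eq_iff all_plus matrix_vector_mult_diff_rdistrib)
    then have "N *v pair_vec 0 q = N *v pair_vec v (cnj_mat \<tau> *v v)"
      using N01[of "pair_vec v (\<tau> *v v)"] by (simp add: matrix_vector_mult_diff_distrib T01_Jm)
    then have "N *v pair_vec 0 q \<in> T01 (Jm X Y)" using N10 by (simp add: T10_Jm)
    then show ?thesis by (simp add: Nb block_mat_vec T01_Jm)
  qed
  then have d: "d = \<tau> ** b" by (simp add: matrix_eq matrix_vector_mul_assoc)
  show nfN: "transpose \<alpha> = nf \<tau> (b12 (transpose \<alpha>))"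
    unfolding N_def[symmetric] abcd(2)[symmetric] by (simp add: Nb nf_def ac d matrix_mul_assoc)
  have "real_endo \<alpha> \<in> tangent_AC (Jm X Y)" using \<alpha> by (simp add: cotangent_AC_def)
  from tangent_AC_symmetric[OF Jm_AC this]
  have sym: "transpose (OM ** Rem N) = OM ** Rem N"
    by (simp add: real_endo_eq N_def[symmetric] matmul_scaleR_right transpose_scalar)
  have "Rem N = block_mat (Rem a) (Rem b) (Rem c) (Rem d)"
    by (simp add: Nb Rem_def block_mat_map)
  then have "OM ** Rem N = block_mat (Rem c) (Rem d) (- Rem a) (- Rem b)"
    by (simp add: OM_def block_simps matmul_minus_left)
  with sym have s: "transpose (Rem b) = Rem b" "Rem d = - transpose (Rem a)"
    by (auto simp: block_simps transpose_minus)
  \<comment> \<open>Tangency of the real part only gives real equations: the real parts of m and of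
    \<tau> m vanish. Since Y is invertible, they force the imaginary part of m to vanish
    too.\<close>
  define m where "m = b - transpose b"
  have m0: "Rem m = 0" using s(1) by (simp add: m_def Rem_diff Rem_transpose[symmetric])
  have "Rem d = Rem (transpose (b ** \<tau>))" using s(2) by (simp add: ac Rem_transpose Rem_minus transpose_minus)
  then have "Rem (\<tau> ** m) = 0"
    by (simp add: d matrix_transpose_mul tau_sym m_def matmul_diff_right Rem_diff)
  then have "Y ** Imm m = 0" by (simp add: Rem_mult m0 \<tau>_def)
  then have "G ** (Y ** Imm m) = 0" by simp
  then have "Imm m = 0" by (simp add: GY_assoc)
  then have "m = 0" using m0 cplx_Rem_Imm[of m] by (simp add: cplx_def)
  then show "transpose (b12 (transpose \<alpha>)) = b12 (transpose \<alpha>)"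
    by (simp add: m_def abcd N_def)
qed

text \<open>The image of \<open>nf \<tau> n\<close> is of type (0,1), where J is -\<i>. Its kernel
  contains the (0,1) vectors, and J is \<i> on the (1,0) vectors that remain.\<close>

lemma nf_J:
  "cmat (Jm X Y) ** nf \<tau> n = - (\<i> *k nf \<tau> n)" "nf \<tau> n ** cmat (Jm X Y) = \<i> *k nf \<tau> n"
  by (simp_all add: cmat_Jm nf_def block_simps mat_expand tau_expand GY_cmat GY_cmat_assoc algebra_simps)

lemma OM_nf_sym:
  assumes n: "transpose n = n" shows "transpose (cmat OM ** nf \<tau> n) = cmat OM ** nf \<tau> n"
  by (simp add: OM_def nf_def block_simps cmat_minus mat_expand matrix_transpose_mul transpose_minus tau_sym n)

lemma nf_cotangent:
  assumes n: "transpose n = n"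
  shows "transpose (nf \<tau> n) \<in> cotangent_AC (Jm X Y)"
  unfolding cotangent_AC_def mem_Collect_eq dual_endo_def transpose_transpose
proof (intro conjI ballI)
  fix u :: "'n cvec2"
  obtain v w where u: "u = pair_vec v w" using pair_vec_exists by blast
  have mv: "(- A) *v x = - (A *v x)" for A :: "complex^'n^'n" and x
    by (simp add: vec_eq_iff matrix_vector_mult_def sum_negf)
  have "nf \<tau> n *v pair_vec v w \<in> T01 (Jm X Y)"
    by (simp add: nf_def block_mat_vec T01_Jm matrix_vector_right_distrib matrix_vector_mul_assoc[symmetric] mv
        matrix_vector_mult_diff_distrib)
  then show "nf \<tau> n *v u \<in> T01 (Jm X Y)" by (simp add: u)
  assume "u \<in> T01 (Jm X Y)"
  then show "nf \<tau> n *v u = 0"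
    by (simp add: u T01_Jm nf_def block_mat_vec matrix_vector_mul_assoc[symmetric] mv pair_vec_zero)
next
  have "Jm X Y ** Rem (nf \<tau> n) = Rem (cmat (Jm X Y) ** nf \<tau> n)" by (simp add: Rem_mult)
  also have "\<dots> = - Rem (nf \<tau> n ** cmat (Jm X Y))" by (simp add: nf_J Rem_minus)
  also have "\<dots> = - (Rem (nf \<tau> n) ** Jm X Y)" by (simp add: Rem_mult)
  finally have anti: "Jm X Y ** Rem (nf \<tau> n) = - (Rem (nf \<tau> n) ** Jm X Y)" .
  have "OM ** Rem (nf \<tau> n) = Rem (cmat OM ** nf \<tau> n)" by (simp add: Rem_mult)
  then have "transpose (OM ** Rem (nf \<tau> n)) = OM ** Rem (nf \<tau> n)"
    by (simp add: Rem_transpose OM_nf_sym n)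
  then show "real_endo (transpose (nf \<tau> n)) \<in> tangent_AC (Jm X Y)"
    by (intro tangent_ACI[OF Jm_AC])
      (simp_all add: real_endo_eq matmul_scaleR_left matmul_scaleR_right transpose_scalar anti)
qed

text \<open>The trace against \<open>nf \<tau> n\<close> sees B only through r + s \<tau> - \<tau>
  (p + q \<tau>), the amount by which B moves the graph of \<tau> out of itself, which is -2\<i>
  d\<tau>. With the factor 1/2 of the pairing, -\<i> n is the fibre coordinate dual to
  \<tau>.\<close>

lemma pairing_nf:
  assumes B: "B \<in> tangent_AC (Jm X Y)"
  shows "pairing (transpose (nf \<tau> n)) B = trace ((- (\<i> *k n)) ** cplx (dX (Jm X Y) B) (dY (Jm X Y) B))"
proof -
  define X' Y' where XY': "X' = dX (Jm X Y) B" "Y' = dY (Jm X Y) B"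
  have B': "B = dJm X Y X' Y'" using tangent_dJm(3)[OF B] by (simp add: XY')
  let ?R = "\<lambda>A. cmat A :: complex^'n^'n"
  define p q r s where pqrs: "p = ?R (b11 B)" "q = ?R (b12 B)" "r = ?R (b21 B)" "s = ?R (b22 B)"
  have cB: "cmat B = block_mat p q r s"
    unfolding pqrs block_mat_cmat[symmetric] by (simp add: block_mat_blocks)
  have e: "- (\<tau> ** (p + q ** \<tau>)) + (r + s ** \<tau>) = (- 2 * \<i>) *k cplx X' Y'"
  proof -
    have 1: "p + q ** \<tau> = ?R G ** ?R X' + \<i> *k (?R G ** ?R Y')"
      by (simp add: pqrs B' dJm_eq cmat_diff cmat_mult mat_expand tau_expand GY_cmat_assoc GY_cmat)
    have 2: "r + s ** \<tau> = ?R Y' + ?R X ** (?R G ** ?R X') - \<i> *k ?R X' + \<i> *k (?R X ** (?R G ** ?R Y'))"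
      by (simp add: pqrs B' dJm_eq cmat_diff cmat_add cmat_minus cmat_mult mat_expand tau_expand GY_cmat_assoc GY_cmat)
    have "- (\<tau> ** (p + q ** \<tau>)) + (r + s ** \<tau>) = ?R Y' - \<i> *k ?R X' - \<i> *k ?R X' + ?R Y'"
      unfolding 1 2 by (simp add: mat_expand tau_expand GY_cmat_assoc)
    also have "\<dots> = (- 2 * \<i>) *k cplx X' Y'" by (simp add: vec_eq_iff complex_eq_iff)
    finally show ?thesis .
  qed
  have t1: "trace (n ** (\<tau> ** p)) = trace (p ** (n ** \<tau>))" for p :: "complex^'n^'n"
    by (metis matrix_mul_assoc trace_mul_sym)
  have "trace (nf \<tau> n ** cmat B) = trace (n ** (- (\<tau> ** (p + q ** \<tau>)) + (r + s ** \<tau>)))"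
  proof -
    have "trace (nf \<tau> n ** cmat B) = - trace (n ** (\<tau> ** p)) + trace (n ** r) - trace (\<tau> ** (n ** (\<tau> ** q))) + trace (\<tau> ** (n ** s))"
      by (simp add: cB nf_def block_mat_mult block_mat_trace mat_expand trace_add trace_sub trace_minus)
    also have "trace (\<tau> ** (n ** (\<tau> ** q))) = trace (n ** (\<tau> ** (q ** \<tau>)))"
      by (subst trace_mul_sym) (simp add: matrix_mul_assoc)
    also have "trace (\<tau> ** (n ** s)) = trace (n ** (s ** \<tau>))"
      by (subst trace_mul_sym) (simp add: matrix_mul_assoc)
    finally show ?thesis by (simp add: mat_expand trace_add trace_sub trace_minus)
  qed
  also have "\<dots> = - 2 * \<i> * trace (n ** cplx X' Y')"
    unfolding e by (simp only: cscale_mult_right trace_cscale)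
  finally show ?thesis
    by (simp add: pairing_def dual_endo_def XY'[symmetric] matmul_minus_left cscale_mult_left trace_minus trace_cscale)
qed

end

text \<open>For symmetric D this trace is the sum of the squared moduli of the entries.\<close>

lemma trace_cnj_zero:
  fixes D :: "complex^'n^'n::finite"
  assumes "transpose D = D" "trace (D ** cnj_mat D) = 0" shows "D = 0"
proof -
  have t: "D $ j $ i = D $ i $ j" for i j
    using arg_cong[OF assms(1), of "\<lambda>M. M $ i $ j"] by (simp add: transpose_def)
  have "trace (D ** cnj_mat D) = of_real (\<Sum>i\<in>UNIV. \<Sum>j\<in>UNIV. (cmod (D $ i $ j))\<^sup>2)"
    unfolding trace_def matrix_matrix_mult_def vec_lambda_beta cnj_mat_nth of_real_sum complex_norm_square
    by (intro sum.cong refl) (metis t)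
  then have "(\<Sum>i\<in>UNIV. \<Sum>j\<in>UNIV. (cmod (D $ i $ j))\<^sup>2) = 0" using assms(2) by (metis of_real_eq_0_iff)
  then have "(\<Sum>j\<in>UNIV. (cmod (D $ i $ j))\<^sup>2) = 0" for i
    using sum_nonneg_eq_0_iff[of UNIV "\<lambda>i. \<Sum>j\<in>UNIV. (cmod (D $ i $ j))\<^sup>2"] by (simp add: sum_nonneg)
  then have "(cmod (D $ i $ j))\<^sup>2 = 0" for i j
    using sum_nonneg_eq_0_iff[of UNIV "\<lambda>j. (cmod (D $ i $ j))\<^sup>2"] by simp
  then show ?thesis by (simp add: vec_eq_iff)
qed

abbreviation "bdl \<equiv> cotangent_bundle_AC"

lemma fibre_coord_eq:
  assumes "(J, \<alpha>) \<in> bdl"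
  shows "fibre_coord (J, \<alpha>) = - (\<i> *k b12 (transpose \<alpha>))"
proof -
  have J: "J \<in> AC" and \<alpha>: "\<alpha> \<in> cotangent_AC J" using assms by (auto simp: cotangent_bundle_AC_def)
  interpret S: siegel_point "Xpart J" "Ypart J" using J by (rule AC_siegel_point)
  have JJ: "Jm (Xpart J) (Ypart J) = J" using AC_siegel_point(2)[OF J] by simp
  define n where "n = b12 (transpose \<alpha>)"
  have n: "transpose \<alpha> = nf S.\<tau> n" "transpose n = n" using S.cotangent_nf[unfolded JJ, OF \<alpha>] by (simp_all add: n_def)
  have \<alpha>n: "\<alpha> = transpose (nf S.\<tau> n)" using n(1) by (metis transpose_transpose)
  have p: "pairing \<alpha> B = trace ((- (\<i> *k n)) ** differential AC siegel J B)" if "B \<in> tangent_AC J" for B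
    using S.pairing_nf[unfolded JJ, OF that] differential_siegel[OF J that] by (simp add: \<alpha>n)
  show ?thesis
    unfolding fibre_coord_def prod.case n_def[symmetric]
  proof (rule the_equality)
    show "transpose (- (\<i> *k n)) = - (\<i> *k n) \<and>
      (\<forall>B\<in>tangent_AC J. pairing \<alpha> B = trace (- (\<i> *k n) ** differential AC siegel J B))"
      using p n(2) by (simp add: transpose_minus transpose_cscale)
  next
    fix \<zeta> assume \<zeta>: "transpose \<zeta> = \<zeta> \<and> (\<forall>B\<in>tangent_AC J. pairing \<alpha> B = trace (\<zeta> ** differential AC siegel J B))"
    define D where "D = \<zeta> - (- (\<i> *k n))"
    have D: "transpose D = D" using \<zeta> n(2) by (simp add: D_def transpose_diff transpose_minus transpose_cscale transpose_add)
    have 1: "transpose (Rem D) = Rem D" "transpose (- Imm D) = - Imm D"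
      by (simp_all add: Rem_transpose Imm_transpose transpose_minus D)
    note B = S.dJm_tangent[OF 1, unfolded JJ]
    \<comment> \<open>Testing with the tangent vector whose d\<tau> is cnj D turns the equality of
      the two covectors into the vanishing of the norm of their difference D.\<close>
    let ?B = "dJm (Xpart J) (Ypart J) (Rem D) (- Imm D)"
    have "differential AC siegel J ?B = cnj_mat D"
      using differential_siegel[OF J B] S.dX_dJm[of "Rem D" "- Imm D"] S.dY_dJm[of "Rem D" "- Imm D"]
      by (simp add: JJ vec_eq_iff complex_eq_iff)
    then have "trace (D ** cnj_mat D) = trace (\<zeta> ** differential AC siegel J ?B) - trace ((- (\<i> *k n)) ** differential AC siegel J ?B)"
      by (simp only: D_def matmul_diff_left trace_sub)
    also have "\<dots> = 0" using \<zeta> B p by simp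
    finally have "D = 0" using trace_cnj_zero D by blast
    then show "\<zeta> = - (\<i> *k n)" by (simp add: D_def eq_neg_iff_add_eq_0)
  qed
qed

lemma bundle_curve:
  assumes c: "curve_through bdl (J, \<alpha>) (B, \<beta>) \<gamma>"
  shows "J \<in> AC" "curve_through AC J B (\<lambda>t. fst (\<gamma> t))" "((\<lambda>t. snd (\<gamma> t)) has_vector_derivative \<beta>) (at 0)"
    "snd (\<gamma> 0) = \<alpha>"
proof -
  have \<gamma>: "\<forall>\<^sub>F t in nhds 0. \<gamma> t \<in> bdl" "\<gamma> 0 = (J, \<alpha>)" "(\<gamma> has_vector_derivative (B, \<beta>)) (at 0)"
    using c by (auto simp: curve_through_def)
  have 1: "\<forall>\<^sub>F t in nhds 0. fst (\<gamma> t) \<in> AC"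
    using \<gamma>(1) by eventually_elim (auto simp: cotangent_bundle_AC_def)
  then show "J \<in> AC" using eventually_nhds_x_imp_x[OF 1] \<gamma>(2) by simp
  show "curve_through AC J B (\<lambda>t. fst (\<gamma> t))" "((\<lambda>t. snd (\<gamma> t)) has_vector_derivative \<beta>) (at 0)"
    using 1 \<gamma>(2) bounded_linear.has_vector_derivative[OF bounded_linear_fst \<gamma>(3)] bounded_linear.has_vector_derivative[OF bounded_linear_snd \<gamma>(3)]
    by (auto simp: curve_through_def)
  show "snd (\<gamma> 0) = \<alpha>" using \<gamma>(2) by simp
qed

lemma bundle_nf:
  assumes "(J, \<alpha>) \<in> bdl"
  shows "transpose \<alpha> = nf (cplx (Xpart J) (Ypart J)) (b12 (transpose \<alpha>))"
proof -
  have J: "J \<in> AC" and \<alpha>: "\<alpha> \<in> cotangent_AC J" using assms by (auto simp: cotangent_bundle_AC_def)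
  interpret S: siegel_point "Xpart J" "Ypart J" using J by (rule AC_siegel_point)
  show ?thesis using S.cotangent_nf(1) \<alpha> AC_siegel_point(2)[OF J] by (simp add: S.\<tau>_def)
qed

text \<open>A curve in the bundle equals \<open>nf\<close> of its own coordinates, so its velocity
  is \<open>dnf\<close> of the velocities of the coordinates. The fibre coordinate is linear in the
  upper right block, which makes its differential explicit.\<close>

lemma tangent_bundle:
  assumes w: "(B, \<beta>) \<in> tangent_vectors bdl (J, \<alpha>)"
  shows "J \<in> AC" "B \<in> tangent_AC J"
    "transpose \<beta> = dnf (cplx (Xpart J) (Ypart J)) (b12 (transpose \<alpha>)) (cplx (dX J B) (dY J B)) (b12 (transpose \<beta>))"
    "differential bdl fibre_coord (J, \<alpha>) (B, \<beta>) = - (\<i> *k b12 (transpose \<beta>))"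
proof -
  have fc: "((\<lambda>t. fibre_coord (\<gamma> t)) has_vector_derivative - (\<i> *k b12 (transpose \<beta>))) (at 0)"
    if c: "curve_through bdl (J, \<alpha>) (B, \<beta>) \<gamma>" for \<gamma>
  proof (rule has_vector_derivative_eventually)
    show "((\<lambda>t. - (\<i> *k b12 (transpose (snd (\<gamma> t))))) has_vector_derivative - (\<i> *k b12 (transpose \<beta>))) (at 0)"
      by (intro has_vector_derivative_minus bounded_linear.has_vector_derivative[OF bounded_linear_cscale]
          bounded_linear.has_vector_derivative[OF bounded_linear_blocks(2)] bounded_linear.has_vector_derivative[OF bounded_linear_transpose]
          bundle_curve(3)[OF c])
    have "\<forall>\<^sub>F t in nhds 0. \<gamma> t \<in> bdl" using c by (simp add: curve_through_def)
    then show "\<forall>\<^sub>F t in nhds 0. - (\<i> *k b12 (transpose (snd (\<gamma> t)))) = fibre_coord (\<gamma> t)"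
      by eventually_elim (metis fibre_coord_eq prod.collapse)
  qed
  obtain \<gamma> where c: "curve_through bdl (J, \<alpha>) (B, \<beta>) \<gamma>" using w by (auto simp: tangent_vectors_def)
  note \<gamma> = bundle_curve[OF c]
  show "J \<in> AC" "B \<in> tangent_AC J" using \<gamma>(1) curve_through_AC_tangent[OF \<gamma>(2)] by auto
  have g2: "fst (\<gamma> 0) = J" "((\<lambda>t. fst (\<gamma> t)) has_vector_derivative B) (at 0)"
    using \<gamma>(2) by (auto simp: curve_through_def)
  have "((\<lambda>t. nf (cplx (Xpart (fst (\<gamma> t))) (Ypart (fst (\<gamma> t)))) (b12 (transpose (snd (\<gamma> t)))))
      has_vector_derivative dnf (cplx (Xpart (fst (\<gamma> 0))) (Ypart (fst (\<gamma> 0)))) (b12 (transpose (snd (\<gamma> 0))))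
        (cplx (dX J B) (dY J B)) (b12 (transpose \<beta>))) (at 0)"
    by (intro has_vector_derivative_nf cplx_part_deriv[OF g2 \<gamma>(1)]
        bounded_linear.has_vector_derivative[OF bounded_linear_blocks(2)] bounded_linear.has_vector_derivative[OF bounded_linear_transpose] \<gamma>(3))
  moreover have "\<forall>\<^sub>F t in nhds 0. nf (cplx (Xpart (fst (\<gamma> t))) (Ypart (fst (\<gamma> t)))) (b12 (transpose (snd (\<gamma> t))))
      = transpose (snd (\<gamma> t))"
  proof -
    have "\<forall>\<^sub>F t in nhds 0. \<gamma> t \<in> bdl" using c by (simp add: curve_through_def)
    then show ?thesis by eventually_elim (metis bundle_nf prod.collapse)
  qed
  ultimately have "((\<lambda>t. transpose (snd (\<gamma> t))) has_vector_derivative dnf (cplx (Xpart J) (Ypart J)) (b12 (transpose \<alpha>))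
        (cplx (dX J B) (dY J B)) (b12 (transpose \<beta>))) (at 0)"
    unfolding g2 \<gamma>(4) by (rule has_vector_derivative_eventually)
  moreover have "((\<lambda>t. transpose (snd (\<gamma> t))) has_vector_derivative transpose \<beta>) (at 0)"
    by (rule bounded_linear.has_vector_derivative[OF bounded_linear_transpose \<gamma>(3)])
  ultimately show "transpose \<beta> = dnf (cplx (Xpart J) (Ypart J)) (b12 (transpose \<alpha>)) (cplx (dX J B) (dY J B)) (b12 (transpose \<beta>))"
    using vector_derivative_unique_at by blast
  show "differential bdl fibre_coord (J, \<alpha>) (B, \<beta>) = - (\<i> *k b12 (transpose \<beta>))"
    unfolding differential_def
  proof (rule the_equality)
    fix d assume "\<forall>\<gamma>. curve_through bdl (J, \<alpha>) (B, \<beta>) \<gamma> \<longrightarrow> ((\<lambda>t. fibre_coord (\<gamma> t)) has_vector_derivative d) (at 0)"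
    then show "d = - (\<i> *k b12 (transpose \<beta>))" using c fc vector_derivative_unique_at by blast
  qed (use fc in blast)
qed

context siegel_point
begin

lemma Jm_bundle: "transpose n = n \<Longrightarrow> (Jm X Y, transpose (nf \<tau> n)) \<in> bdl"
  using Jm_AC nf_cotangent by (simp add: cotangent_bundle_AC_def)

lemma tangent_bundleI:
  assumes X': "transpose X' = X'" and Y': "transpose Y' = Y'" and n: "transpose n = n" and n': "transpose n' = n'"
  shows "(dJm X Y X' Y', transpose (dnf \<tau> n (cplx X' Y') n')) \<in> tangent_vectors bdl (Jm X Y, transpose (nf \<tau> n))"
proof -
  define \<gamma> where "\<gamma> t = (Jm (X + t *\<^sub>R X') (Y + t *\<^sub>R Y'), transpose (nf (cplx (X + t *\<^sub>R X') (Y + t *\<^sub>R Y')) (n + t *\<^sub>R n')))" for t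
  have "\<forall>\<^sub>F t in nhds 0. \<gamma> t \<in> bdl"
    using siegel_point_eventually[OF X' Y']
  proof eventually_elim
    case (elim t)
    have "transpose (n + t *\<^sub>R n') = n + t *\<^sub>R n'" using n n' by (simp add: transpose_add transpose_scalar)
    from siegel_point.Jm_bundle[OF elim this] show ?case
      by (simp add: \<gamma>_def siegel_point.\<tau>_def[OF elim])
  qed
  moreover have "\<gamma> 0 = (Jm X Y, transpose (nf \<tau> n))" by (simp add: \<gamma>_def \<tau>_def)
  moreover have "(\<gamma> has_vector_derivative (dJm X Y X' Y', transpose (dnf \<tau> n (cplx X' Y') n'))) (at 0)"
  proof -
    have 1: "((\<lambda>t. cplx (X + t *\<^sub>R X') (Y + t *\<^sub>R Y')) has_vector_derivative cplx X' Y') (at 0)"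
      unfolding cplx_def
      by (intro has_vector_derivative_add bounded_linear.has_vector_derivative[OF bounded_linear_cscale] bounded_linear.has_vector_derivative[OF bounded_linear_cmat])
        (auto intro!: derivative_eq_intros)
    have 2: "((\<lambda>t. n + t *\<^sub>R n') has_vector_derivative n') (at 0)"
      by (auto intro!: derivative_eq_intros)
    have "((\<lambda>t. nf (cplx (X + t *\<^sub>R X') (Y + t *\<^sub>R Y')) (n + t *\<^sub>R n')) has_vector_derivative dnf \<tau> n (cplx X' Y') n') (at 0)"
      using has_vector_derivative_nf[OF 1 2] by (simp add: \<tau>_def)
    then show ?thesis
      unfolding \<gamma>_def
      by (intro has_vector_derivative_Pair bounded_linear.has_vector_derivative[OF bounded_linear_transpose])
        (use Jm_curve[OF X' Y'] in \<open>simp_all add: curve_through_def\<close>)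
  qed
  ultimately show ?thesis by (auto simp: tangent_vectors_def curve_through_def)
qed

text \<open>Multiplication of B by J is multiplication of d\<tau> by \<i>: the Siegel coordinate is
  holomorphic.\<close>

lemma J_dJm: "Jm X Y ** dJm X Y X' Y' = dJm X Y (- Y') X'"
  by (simp add: Jm_eq dJm_eq block_simps mat_expand GY_simps algebra_simps)

text \<open>In the coordinates (\<tau>, n) the complex structure is multiplication by \<i> on both
  velocities. Uniqueness holds because a tangent vector to the bundle is determined by its base
  component and its upper right block.\<close>

lemma cplx_I_eq:
  assumes X': "transpose X' = X'" and Y': "transpose Y' = Y'" and n: "transpose n = n" and n': "transpose n' = n'"
  shows "cplx_I (Jm X Y, transpose (nf \<tau> n)) (dJm X Y X' Y', transpose (dnf \<tau> n (cplx X' Y') n')) =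
    (dJm X Y (- Y') X', transpose (dnf \<tau> n (cplx (- Y') X') (\<i> *k n')))"
proof -
  let ?p = "(Jm X Y, transpose (nf \<tau> n))"
  have tY: "transpose (- Y') = - Y'" and tn: "transpose (\<i> *k n') = \<i> *k n'"
    using Y' n' by (simp_all add: transpose_minus transpose_cscale)
  note v = tangent_bundleI[OF X' Y' n n'] and w = tangent_bundleI[OF tY X' n tn]
  have dv: "differential bdl fibre_coord ?p (dJm X Y X' Y', transpose (dnf \<tau> n (cplx X' Y') n')) = - (\<i> *k n')"
    using tangent_bundle(4)[OF v] by (simp add: dnf_def)
  have dw: "differential bdl fibre_coord ?p (dJm X Y (- Y') X', transpose (dnf \<tau> n (cplx (- Y') X') (\<i> *k n'))) = - (\<i> *k \<i> *k n')"
    using tangent_bundle(4)[OF w] by (simp add: dnf_def)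
  show ?thesis
    unfolding cplx_I_def
  proof (rule the_equality)
    show "(dJm X Y (- Y') X', transpose (dnf \<tau> n (cplx (- Y') X') (\<i> *k n'))) \<in> tangent_vectors bdl ?p \<and>
      fst (dJm X Y (- Y') X', transpose (dnf \<tau> n (cplx (- Y') X') (\<i> *k n'))) =
        fst ?p ** fst (dJm X Y X' Y', transpose (dnf \<tau> n (cplx X' Y') n')) \<and>
      differential bdl fibre_coord ?p (dJm X Y (- Y') X', transpose (dnf \<tau> n (cplx (- Y') X') (\<i> *k n'))) =
        map_matrix (\<lambda>c. \<i> * c) (differential bdl fibre_coord ?p (dJm X Y X' Y', transpose (dnf \<tau> n (cplx X' Y') n')))"
      using w unfolding dv dw by (simp add: J_dJm map_matrix_cscale cscale_minus)
  next
    fix z assume z: "z \<in> tangent_vectors bdl ?p \<and>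
      fst z = fst ?p ** fst (dJm X Y X' Y', transpose (dnf \<tau> n (cplx X' Y') n')) \<and>
      differential bdl fibre_coord ?p z =
        map_matrix (\<lambda>c. \<i> * c) (differential bdl fibre_coord ?p (dJm X Y X' Y', transpose (dnf \<tau> n (cplx X' Y') n')))"
    obtain B \<beta> where zz: "z = (B, \<beta>)" by force
    have B: "B = dJm X Y (- Y') X'" using z by (simp add: zz J_dJm)
    have t: "(B, \<beta>) \<in> tangent_vectors bdl ?p" using conjunct1[OF z] unfolding zz .
    have "- (\<i> *k b12 (transpose \<beta>)) = \<i> *k (- (\<i> *k n'))"
      using z tangent_bundle(4)[OF t] by (simp add: zz dv map_matrix_cscale)
    then have "n' = - (\<i> *k b12 (transpose \<beta>))"
      by (simp add: vec_eq_iff)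
    then have b: "b12 (transpose \<beta>) = \<i> *k n'"
      by (simp only:) (simp add: vec_eq_iff)
    have "transpose \<beta> = dnf \<tau> n (cplx (- Y') X') (\<i> *k n')"
      using tangent_bundle(3)[OF t] unfolding b B dX_dJm dY_dJm Xpart_Jm Ypart_Jm transpose_transpose
      by (simp add: \<tau>_def nf_def)
    then show "z = (dJm X Y (- Y') X', transpose (dnf \<tau> n (cplx (- Y') X') (\<i> *k n')))"
      unfolding zz B by (metis transpose_transpose)
  qed
qed

end

section \<open>The Biquard--Gauduchon function\<close>

text \<open>Applying L - a to the sum removes the term of eigenvalue a and rescales the others by
  nonzero factors, so the induction hypothesis applies to them.\<close>

lemma eigenvector_sum_zero:
  fixes L :: "'v::real_vector \<Rightarrow> 'v"
  assumes L: "linear L" and fin: "finite \<Lambda>"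
  shows "(\<And>l. l \<in> \<Lambda> \<Longrightarrow> L (D l) = l *\<^sub>R D l) \<Longrightarrow> (\<Sum>l\<in>\<Lambda>. D l) = 0 \<Longrightarrow> \<forall>l\<in>\<Lambda>. D l = 0"
  using fin
proof (induction \<Lambda> arbitrary: D rule: finite_induct)
  case (insert a \<Lambda>)
  have "L (\<Sum>l\<in>insert a \<Lambda>. D l) - a *\<^sub>R (\<Sum>l\<in>insert a \<Lambda>. D l) = 0"
    using insert.prems(2) linear_0[OF L] by simp
  then have "(\<Sum>l\<in>insert a \<Lambda>. (l - a) *\<^sub>R D l) = 0"
    unfolding linear_sum[OF L] scaleR_sum_right sum_subtractf[symmetric]
    by (subst sum.cong[OF refl, of _ "\<lambda>l. (l - a) *\<^sub>R D l" "\<lambda>l. L (D l) - a *\<^sub>R D l"])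
      (use insert.prems(1) in \<open>simp_all add: scaleR_diff_left\<close>)
  then have "(\<Sum>l\<in>\<Lambda>. (l - a) *\<^sub>R D l) = 0" using insert.hyps by simp
  moreover have "L ((l - a) *\<^sub>R D l) = l *\<^sub>R ((l - a) *\<^sub>R D l)" if "l \<in> \<Lambda>" for l
    using insert.prems(1)[of l] that by (simp add: linear_cmul[OF L] mult.commute)
  ultimately have "\<forall>l\<in>\<Lambda>. (l - a) *\<^sub>R D l = 0" by (intro insert.IH)
  then have 0: "\<forall>l\<in>\<Lambda>. D l = 0" using insert.hyps by auto
  then have "D a = 0" using insert.prems(2) insert.hyps by simp
  with 0 show ?case by simp
qed simp

text \<open>Two decompositions are compared on the union of their index sets, padded with zero
  vectors. Their differences are eigenvectors with sum zero, hence vanish, so the description has a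
  unique value.\<close>

lemma fun_calc_eq:
  fixes L :: "'v::real_vector \<Rightarrow> 'v"
  assumes L: "linear L" and fin: "finite \<Lambda>" and E: "\<And>l. l \<in> \<Lambda> \<Longrightarrow> E l \<in> S \<and> L (E l) = l *\<^sub>R E l"
  shows "fun_calc S f L (\<Sum>l\<in>\<Lambda>. E l) = (\<Sum>l\<in>\<Lambda>. f l *\<^sub>R E l)"
  unfolding fun_calc_def
proof (rule the_equality)
  fix C assume "\<exists>\<Lambda>' E'. finite \<Lambda>' \<and> (\<forall>l\<in>\<Lambda>'. E' l \<in> S \<and> L (E' l) = l *\<^sub>R E' l) \<and>
      (\<Sum>l\<in>\<Lambda>. E l) = (\<Sum>l\<in>\<Lambda>'. E' l) \<and> C = (\<Sum>l\<in>\<Lambda>'. f l *\<^sub>R E' l)"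
  then obtain \<Lambda>' E' where E': "finite \<Lambda>'" "\<And>l. l \<in> \<Lambda>' \<Longrightarrow> L (E' l) = l *\<^sub>R E' l"
    "(\<Sum>l\<in>\<Lambda>. E l) = (\<Sum>l\<in>\<Lambda>'. E' l)" "C = (\<Sum>l\<in>\<Lambda>'. f l *\<^sub>R E' l)" by blast
  define F where "F l = (if l \<in> \<Lambda> then E l else 0)" for l
  define F' where "F' l = (if l \<in> \<Lambda>' then E' l else 0)" for l
  let ?U = "\<Lambda> \<union> \<Lambda>'"
  have sF: "(\<Sum>l\<in>?U. h l *\<^sub>R F l) = (\<Sum>l\<in>\<Lambda>. h l *\<^sub>R E l)" for h :: "real \<Rightarrow> real"
    by (rule sum.mono_neutral_cong_right) (auto simp: F_def fin E')
  have sF': "(\<Sum>l\<in>?U. h l *\<^sub>R F' l) = (\<Sum>l\<in>\<Lambda>'. h l *\<^sub>R E' l)" for h :: "real \<Rightarrow> real"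
    by (rule sum.mono_neutral_cong_right) (auto simp: F'_def fin E')
  have "\<forall>l\<in>?U. F l - F' l = 0"
  proof (rule eigenvector_sum_zero[OF L])
    show "L (F l - F' l) = l *\<^sub>R (F l - F' l)" for l
      using E E' linear_0[OF L] by (auto simp: linear_diff[OF L] F_def F'_def scaleR_diff_right)
    show "(\<Sum>l\<in>?U. F l - F' l) = 0"
      using sF[of "\<lambda>_. 1"] sF'[of "\<lambda>_. 1"] E'(3) by (simp add: sum_subtractf)
  qed (use fin E' in simp)
  then have "(\<Sum>l\<in>?U. f l *\<^sub>R F l) = (\<Sum>l\<in>?U. f l *\<^sub>R F' l)" by (intro sum.cong) auto
  then show "C = (\<Sum>l\<in>\<Lambda>. f l *\<^sub>R E l)" by (simp add: sF sF' E')
qed (use fin E in blast)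

definition is_sqrt :: "real^'n^'n \<Rightarrow> real^'n^'n \<Rightarrow> real^'n^'n::finite \<Rightarrow> bool" where
  "is_sqrt g B R \<longleftrightarrow> R ** R = B \<and> pos_def (g ** R) \<and> transpose (g ** R) = g ** R"

definition "msqrt g B = (SOME R. is_sqrt g B R)"

text \<open>The difference equation with equal right-hand sides says that R' + r annihilates (R' -
  R) s for each eigenvector s of R. Positivity makes R' + r injective.\<close>

lemma is_sqrt_unique:
  assumes g: "pos_def g" "transpose g = g" and R: "is_sqrt g B R" "is_sqrt g B R'"
  shows "R' = R"
proof -
  obtain S r where "self_adjoint g R S r" using self_adjoint_exists[OF g, of R] R(1) unfolding is_sqrt_def by blast
  then interpret S: self_adjoint g R S r .
  have "(R' - R) *v column i S = 0" for i
  proof -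
    let ?v = "(R' - R) *v column i S"
    have "R' *v ?v + r i *\<^sub>R ?v = (B - B) *v column i S"
      by (rule sqrt_difference[OF _ _ S.eigenvector]) (use R in \<open>simp_all add: is_sqrt_def\<close>)
    then have "(R' + r i *\<^sub>R mat 1) *v ?v = 0"
      by (simp add: matrix_vector_mult_add_rdistrib scaleR_matrix_vector_assoc[symmetric])
    then have "(g ** (R' + r i *\<^sub>R mat 1)) *v ?v = 0" by (metis matrix_vector_mul_assoc matrix_vector_mult_0_right)
    moreover have "0 < r i" using S.eigenvalue_pos R(1) by (simp add: is_sqrt_def)
    ultimately show ?thesis
      using pos_def_add[OF g(1), of R' "r i"] R(2) unfolding pos_def_def is_sqrt_def
      by (metis inner_zero_right less_irrefl)
  qed
  then have "(R' - R) ** S = 0" by (simp add: vec_eq_iff mult_columns)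
  then have "((R' - R) ** S) ** S.T = 0" by simp
  then show ?thesis by (simp add: matrix_mul_assoc[symmetric] S.ST)
qed

lemma msqrt_eq: "pos_def g \<Longrightarrow> transpose g = g \<Longrightarrow> is_sqrt g B R \<Longrightarrow> msqrt g B = R"
  unfolding msqrt_def by (metis is_sqrt_unique someI_ex)

text \<open>The argument is -x because an eigenvalue x of A^2 appears as the eigenvalue -x of
  \<open>Xi A\<close>. The outer factor x is the A^2 that the trace in the Biquard--Gauduchon
  function contributes.\<close>

lemma f0_value:
  assumes "0 \<le> x" "x < 1" shows "x * f0 (- x) = 1 - sqrt (1 - x) + ln ((1 + sqrt (1 - x)) / 2)"
  using assms by (cases "x = 0") (simp_all add: f0_def)

lemma linear_Xi: "linear (Xi A)"
  by (rule linearI) (simp_all add: Xi_def mat_expand algebra_simps)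

section \<open>Spectral theory at a point of the cotangent bundle\<close>

locale tangent_point =
  fixes J A :: "('n::finite) endo"
  assumes J: "J \<in> AC" and A: "A \<in> tangent_AC J"
begin

definition "g = OM ** J"

lemma g: "pos_def g" "transpose g = g"
  using J AC_symmetric(2)[OF J] by (simp_all add: g_def AC_matrix)

lemma anti: "J ** A = - (A ** J)"
  using A by (simp add: tangent_AC_matrix eq_neg_iff_add_eq_0)

lemma gA: "transpose (g ** A) = g ** A"
proof -
  have "transpose A ** OM = - (OM ** A)"
    using tangent_AC_symmetric[OF J A] by (simp add: matrix_transpose_mul OM_props matmul_minus_right)
      (metis minus_minus)
  moreover have "transpose (g ** A) = transpose A ** OM ** J"
    by (simp add: matrix_transpose_mul g) (simp add: g_def matrix_mul_assoc)
  ultimately show ?thesis by (simp add: g_def mat_expand anti)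
qed

lemma gAA: "transpose (g ** (A ** A)) = g ** (A ** A)"
proof -
  have "transpose A ** g = g ** A" using gA by (simp add: matrix_transpose_mul g)
  then show ?thesis by (metis matrix_mul_assoc matrix_transpose_mul g(2))
qed

end

text \<open>The spectral radius condition as positivity of 1 - A^2 for the metric of J. In this form
  it is visibly open in (J, A), so it persists along curves.\<close>

locale higgs_point = tangent_point +
  assumes small: "pos_def (OM ** J ** (mat 1 - A ** A))"
begin

text \<open>A is self-adjoint for the metric, so the quadratic form of A^2 at s is the squared
  length of A s and the eigenvalues are nonnegative. The upper bound is the hypothesis
  \<open>small\<close>.\<close>

lemma spectral_data: "\<exists>S l. self_adjoint g (A ** A) S l \<and> (\<forall>i. 0 \<le> l i \<and> l i < 1)"
proof -
  obtain S l where "self_adjoint g (A ** A) S l" using self_adjoint_exists[OF g gAA] by blast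
  then interpret S: self_adjoint g "A ** A" S l .
  have "0 \<le> l i \<and> l i < 1" for i
  proof -
    let ?s = "column i S"
    have b: "0 < ?s \<bullet> (g *v ?s)" using g(1) S.column_nonzero by (simp add: pos_def_def)
    have 1: "?s \<bullet> (g ** (A ** A) *v ?s) = l i * (?s \<bullet> (g *v ?s))"
      by (metis S.eigenvector inner_scaleR_right matrix_vector_mul_assoc matrix_vector_mult_scaleR)
    have "?s \<bullet> (g ** (A ** A) *v ?s) = ?s \<bullet> ((g ** A) *v (A *v ?s))"
      by (simp add: matrix_vector_mul_assoc matrix_mul_assoc)
    also have "\<dots> = (A *v ?s) \<bullet> (g *v (A *v ?s))"
      using symmetric_inner[OF gA, of ?s "A *v ?s"] by (simp add: matrix_vector_mul_assoc)
    also have "\<dots> \<ge> 0" using g(1) by (cases "A *v ?s = 0") (auto simp: pos_def_def less_imp_le)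
    finally have "0 \<le> l i" using 1 b by (simp add: zero_le_mult_iff)
    have "0 < ?s \<bullet> (g ** (mat 1 - A ** A) *v ?s)" using small S.column_nonzero by (simp add: pos_def_def g_def)
    also have "\<dots> = (1 - l i) * (?s \<bullet> (g *v ?s))"
      using 1 by (simp add: matmul_diff_right matrix_vector_mult_diff_rdistrib inner_diff_right algebra_simps)
    finally have "l i < 1" using b by (simp add: zero_less_mult_iff)
    with \<open>0 \<le> l i\<close> show ?thesis by simp
  qed
  then show ?thesis using \<open>self_adjoint g (A ** A) S l\<close> by blast
qed

definition "R = msqrt g (mat 1 - A ** A)"

lemma R_fn:
  assumes "self_adjoint g (A ** A) S l" "\<forall>i. 0 \<le> l i \<and> l i < 1"
  shows "R = self_adjoint.fn g S l (\<lambda>x. sqrt (1 - x))"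
    "is_sqrt g (mat 1 - A ** A) (self_adjoint.fn g S l (\<lambda>x. sqrt (1 - x)))"
proof -
  interpret S: self_adjoint g "A ** A" S l by fact
  have "S.fn (\<lambda>x. sqrt (1 - x)) ** S.fn (\<lambda>x. sqrt (1 - x)) = S.fn (\<lambda>x. 1 + (- 1) * x)"
    unfolding S.fn_mult by (rule S.fn_cong) (use assms(2) in \<open>simp add: less_imp_le\<close>)
  also have "\<dots> = mat 1 - A ** A" unfolding S.fn_add S.fn_scale S.fn_const S.fn_id by simp
  finally show "is_sqrt g (mat 1 - A ** A) (S.fn (\<lambda>x. sqrt (1 - x)))"
    unfolding is_sqrt_def using S.fn_pos_def[of "\<lambda>x. sqrt (1 - x)"] S.fn_symmetric assms(2) by simp
  then show "R = S.fn (\<lambda>x. sqrt (1 - x))" unfolding R_def using msqrt_eq g by blast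
qed

lemma R_sqrt: "is_sqrt g (mat 1 - A ** A) R"
  using spectral_data R_fn by metis

lemma R_commute:
  assumes "Z ** (A ** A) = A ** A ** Z" shows "Z ** R = R ** Z"
proof -
  obtain S l where S: "self_adjoint g (A ** A) S l" "\<forall>i. 0 \<le> l i \<and> l i < 1" using spectral_data by blast
  then interpret S: self_adjoint g "A ** A" S l by simp
  show ?thesis unfolding R_fn(1)[OF S] using assms by (rule S.fn_commute)
qed

lemma R_A: "A ** R = R ** A" by (rule R_commute) (simp add: matrix_mul_assoc)

lemma J_AA: "J ** (A ** A) = A ** A ** J"
proof -
  have "J ** (A ** A) = (J ** A) ** A" by (simp only: matrix_mul_assoc)
  also have "\<dots> = - ((A ** J) ** A)" by (simp only: anti matmul_minus_left)
  also have "\<dots> = - (A ** (J ** A))" by (simp only: matrix_mul_assoc)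
  also have "\<dots> = A ** A ** J" by (simp only: anti matmul_minus_right minus_minus matrix_mul_assoc)
  finally show "J ** (A ** A) = A ** A ** J" .
qed

lemma R_J: "J ** R = R ** J"
  by (rule R_commute[OF J_AA])

text \<open>\<open>Xi A\<close> multiplies A f(A^2) by -A^2, hence f0(Xi A) A = A f0(-A^2). The
  function becomes half the trace of A^2 f0(-A^2), to be summed over the eigenvalues of A^2; the
  logarithms combine into a determinant.\<close>

lemma R_det: "0 < det ((1 / 2) *\<^sub>R (mat 1 + R))"
  and BG_value: "\<And>\<alpha>. real_endo \<alpha> = A \<Longrightarrow>
    BG (J, \<alpha>) = (trace (mat 1 - R) + ln (det ((1 / 2) *\<^sub>R (mat 1 + R)))) / 2"
proof -
  obtain S l where S: "self_adjoint g (A ** A) S l" and l: "\<forall>i. 0 \<le> l i \<and> l i < 1" using spectral_data by blast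
  interpret S: self_adjoint g "A ** A" S l by fact
  let ?s = "\<lambda>x. sqrt (1 - x)"
  have h: "(1 / 2) *\<^sub>R (mat 1 + R) = S.fn (\<lambda>x. (1 / 2) * (1 + ?s x))"
    unfolding S.fn_scale S.fn_add S.fn_const R_fn(1)[OF S l] by simp
  have pos: "0 < 1 / 2 * (1 + ?s (l i))" for i
    using l by (simp add: add_pos_nonneg less_imp_le)
  show "0 < det ((1 / 2) *\<^sub>R (mat 1 + R))" unfolding h S.fn_det by (intro prod_pos) (use pos in auto)
  fix \<alpha> assume \<alpha>: "real_endo \<alpha> = A"
  \<comment> \<open>The functional calculus is taken on the tangent space, so each spectral
    component A f(A^2) has to be shown tangent.\<close>
  have tan: "A ** S.fn f \<in> tangent_AC J" for f
  proof (rule tangent_ACI[OF J])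
    have Jf: "J ** S.fn f = S.fn f ** J" by (rule S.fn_commute[OF J_AA])
    have Af: "A ** S.fn f = S.fn f ** A" by (rule S.fn_commute) (simp add: matrix_mul_assoc)
    have "J ** (A ** S.fn f) = - (A ** (J ** S.fn f))" by (simp add: matrix_mul_assoc anti matmul_minus_left)
    also have "\<dots> = - ((A ** S.fn f) ** J)" by (simp add: Jf matrix_mul_assoc)
    finally show anti': "J ** (A ** S.fn f) + (A ** S.fn f) ** J = 0" by simp
    have "transpose (g ** (A ** S.fn f)) = transpose (S.fn f) ** transpose (g ** A)"
      by (simp add: matrix_mul_assoc matrix_transpose_mul)
    also have "\<dots> = transpose (S.fn f) ** (g ** A)" by (simp only: gA)
    also have "\<dots> = transpose (g ** S.fn f) ** A" by (simp add: matrix_transpose_mul g matrix_mul_assoc)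
    also have "\<dots> = g ** (A ** S.fn f)" by (simp add: S.fn_symmetric Af matrix_mul_assoc)
    finally have sym: "transpose (g ** (A ** S.fn f)) = g ** (A ** S.fn f)" .
    let ?E = "A ** S.fn f"
    have E: "?E = - (J ** (J ** ?E))" using J by (simp add: AC_matrix matrix_mul_assoc matmul_minus_left)
    have "OM ** ?E = - (g ** (J ** ?E))" by (subst E) (simp add: g_def matmul_minus_right matrix_mul_assoc)
    also have "\<dots> = g ** (?E ** J)" using anti' by (simp add: eq_neg_iff_add_eq_0[symmetric] matmul_minus_right)
    also have "\<dots> = transpose (g ** ?E) ** J" unfolding sym by (simp only: matrix_mul_assoc)
    also have "\<dots> = transpose ?E ** (g ** J)" by (simp add: matrix_transpose_mul g matrix_mul_assoc)
    also have "g ** J = - OM" using J by (simp add: g_def AC_matrix matrix_mul_assoc[symmetric] matmul_minus_right)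
    finally have e: "OM ** ?E = - (transpose ?E ** OM)" by (simp add: matmul_minus_right)
    have "transpose (OM ** ?E) = - (transpose ?E ** OM)"
      by (simp only: matrix_transpose_mul[of OM] OM_props matmul_minus_right)
    then show "transpose (OM ** ?E) = OM ** ?E" by (rule trans[OF _ e[symmetric]])
  qed
  define \<Lambda> where "\<Lambda> = (\<lambda>i. - l i) ` UNIV"
  \<comment> \<open>The component of A in the eigenspace of A^2 with eigenvalue -\<mu>. The index
    set is an image, so equal eigenvalues are grouped and each \<mu> occurs once.\<close>
  define E where "E \<mu> = A ** S.fn (\<lambda>x. if - x = \<mu> then 1 else 0)" for \<mu>
  have fin: "finite \<Lambda>" by (simp add: \<Lambda>_def)
  have XE: "Xi A (E \<mu>) = \<mu> *\<^sub>R E \<mu>" for \<mu>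
  proof -
    let ?f = "S.fn (\<lambda>x. if - x = \<mu> then 1 else 0)"
    have c: "(A ** A) ** ?f = ?f ** (A ** A)" by (rule S.fn_commute) simp
    have e: "?f ** (A ** A) = (- \<mu>) *\<^sub>R ?f"
      using S.fn_mult[of "\<lambda>x. if - x = \<mu> then 1 else 0" "\<lambda>x. x"] S.fn_scale[of "- \<mu>" "\<lambda>x. if - x = \<mu> then 1 else 0"]
        S.fn_cong[of "\<lambda>x. (if - x = \<mu> then 1 else 0) * x" "\<lambda>x. - \<mu> * (if - x = \<mu> then 1 else 0)"]
      by (simp add: S.fn_id)
    have "A ** A ** E \<mu> = A ** ((A ** A) ** ?f)" by (simp add: E_def matrix_mul_assoc)
    also have "\<dots> = (- \<mu>) *\<^sub>R E \<mu>" unfolding c e by (simp add: E_def matmul_scaleR_right matmul_minus_right)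
    finally have 1: "A ** A ** E \<mu> = (- \<mu>) *\<^sub>R E \<mu>" .
    have "E \<mu> ** (A ** A) = A ** (?f ** (A ** A))" by (simp add: E_def matrix_mul_assoc)
    also have "\<dots> = (- \<mu>) *\<^sub>R E \<mu>" unfolding e by (simp add: E_def matmul_scaleR_right matmul_minus_right)
    finally have 2: "E \<mu> ** (A ** A) = (- \<mu>) *\<^sub>R E \<mu>" .
    show ?thesis unfolding Xi_def 1 2 by (simp add: vec_eq_iff)
  qed
  have sumE: "(\<Sum>\<mu>\<in>\<Lambda>. h \<mu> *\<^sub>R E \<mu>) = A ** S.fn (\<lambda>x. h (- x))" for h
  proof -
    have "(\<Sum>\<mu>\<in>\<Lambda>. h \<mu> *\<^sub>R E \<mu>) = A ** S.fn (\<lambda>x. \<Sum>\<mu>\<in>\<Lambda>. h \<mu> * (if - x = \<mu> then 1 else 0))"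
      unfolding S.fn_sum[OF fin] S.fn_scale E_def
      by (simp add: bounded_bilinear.sum_right[OF bounded_bilinear_matmul] matmul_scaleR_right)
    also have "S.fn (\<lambda>x. \<Sum>\<mu>\<in>\<Lambda>. h \<mu> * (if - x = \<mu> then 1 else 0)) = S.fn (\<lambda>x. h (- x))"
      by (rule S.fn_cong) (use fin in \<open>auto simp: \<Lambda>_def if_distrib sum.delta' cong: if_cong\<close>)
    finally show ?thesis .
  qed
  have "(\<Sum>\<mu>\<in>\<Lambda>. E \<mu>) = A" using sumE[of "\<lambda>_. 1"] by (simp add: S.fn_const)
  then have "fun_calc (tangent_AC J) f0 (Xi A) A = (\<Sum>\<mu>\<in>\<Lambda>. f0 \<mu> *\<^sub>R E \<mu>)"
    using fun_calc_eq[OF linear_Xi fin, of E "tangent_AC J" A f0] tan XE by (auto simp: E_def)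
  also have "\<dots> = A ** S.fn (\<lambda>x. f0 (- x))" by (rule sumE)
  finally have "BG (J, \<alpha>) = trace (A ** S.fn (\<lambda>x. f0 (- x)) ** A) / 2"
    by (simp add: BG_def \<alpha>)
  also have "trace (A ** S.fn (\<lambda>x. f0 (- x)) ** A) = trace ((A ** A) ** S.fn (\<lambda>x. f0 (- x)))"
    by (metis matrix_mul_assoc trace_mul_sym)
  also have "(A ** A) ** S.fn (\<lambda>x. f0 (- x)) = S.fn (\<lambda>x. x * f0 (- x))"
    using S.fn_mult[of "\<lambda>x. x"] by (simp add: S.fn_id)
  also have "trace \<dots> = (\<Sum>i\<in>UNIV. (1 + (- 1) * ?s (l i)) + ln (1 / 2 * (1 + ?s (l i))))"
    unfolding S.fn_trace by (intro sum.cong) (use l in \<open>simp_all add: f0_value\<close>)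
  also have "\<dots> = trace (S.fn (\<lambda>x. 1 + (- 1) * ?s x)) + ln (det (S.fn (\<lambda>x. (1 / 2) * (1 + ?s x))))"
    unfolding S.fn_trace S.fn_det sum.distrib using pos less_imp_neq[OF pos] by (subst ln_prod) auto
  also have "S.fn (\<lambda>x. 1 + (- 1) * ?s x) = mat 1 - R"
    unfolding S.fn_add S.fn_scale S.fn_const R_fn(1)[OF S l] by simp
  finally show "BG (J, \<alpha>) = (trace (mat 1 - R) + ln (det ((1 / 2) *\<^sub>R (mat 1 + R)))) / 2"
    by (simp add: h)
qed

definition "C = matrix_inv (mat 1 + R)"

lemma C: "C ** (mat 1 + R) = mat 1" "(mat 1 + R) ** C = mat 1" "det (mat 1 + R) \<noteq> 0"
proof -
  have "pos_def (g ** (R + 1 *\<^sub>R mat 1))"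
    by (rule pos_def_add) (use g R_sqrt in \<open>auto simp: is_sqrt_def\<close>)
  then have "det (R + 1 *\<^sub>R mat 1) \<noteq> 0" by (rule pos_def_mult_det)
  then show d: "det (mat 1 + R) \<noteq> 0" by (simp add: add.commute)
  show "C ** (mat 1 + R) = mat 1" "(mat 1 + R) ** C = mat 1"
    unfolding C_def using matrix_inv_props d invertible_det_nz by blast+
qed

lemma C_commute:
  assumes "Z ** R = R ** Z" shows "Z ** C = C ** Z"
proof -
  have "C ** ((mat 1 + R) ** Z) ** C = C ** (Z ** (mat 1 + R)) ** C"
    by (simp add: assms matmul_add_left matrix_add_ldistrib)
  moreover have "C ** ((mat 1 + R) ** Z) ** C = Z ** C" by (simp add: matrix_mul_assoc C)
  moreover have "C ** (Z ** (mat 1 + R)) ** C = C ** Z" by (simp add: matrix_mul_assoc[symmetric] C)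
  ultimately show ?thesis by simp
qed

lemma C_AA: "C ** (A ** A) = mat 1 - R"
proof -
  have "A ** A = (mat 1 + R) ** (mat 1 - R)"
    using R_sqrt by (simp add: is_sqrt_def matmul_add_left matmul_diff_right algebra_simps)
  then show ?thesis by (simp add: matrix_mul_assoc C)
qed

text \<open>The infinitesimal form of conjugation invariance: C commutes with A, so the trace
  against any commutator of E with A vanishes. No condition on E is involved.\<close>

lemma trace_bracket: "trace (C ** A ** (E ** A - A ** E)) = 0"
proof -
  have c: "A ** C = C ** A" using C_commute[OF R_A] .
  have "trace (C ** A ** (A ** E)) = trace ((C ** A ** A) ** E)" by (simp add: matrix_mul_assoc)
  also have "\<dots> = trace ((A ** (C ** A)) ** E)" by (metis c matrix_mul_assoc)
  also have "\<dots> = trace (C ** A ** (E ** A))" by (metis trace_mul_sym matrix_mul_assoc)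
  finally show ?thesis by (simp add: matmul_diff_right trace_sub)
qed

end

lemma trace_scaleR: "trace (c *\<^sub>R A) = c *\<^sub>R trace (A :: 'a::real_algebra_1^'n^'n::finite)"
  by (simp add: trace_def scaleR_sum_right)

text \<open>The derivative of tr(1 - R) + ln det((1 + R)/2) is -tr R' + tr(C R'), which equals -tr(C
  R R') since 1 = C (1 + R). As C commutes with R and A, the equation R R' + R' R = -(A A' + A' A)
  turns it into tr(C A A'). The variation of J leaves no separate term: locally J enters only by
  selecting the square root.\<close>

lemma BG_derivative:
  assumes c: "curve_through bdl (J, \<alpha>) (B, \<beta>) \<gamma>" and hp: "higgs_point J (real_endo \<alpha>)"
  shows "((\<lambda>t. BG (\<gamma> t)) has_vector_derivative
    trace (matrix_inv (mat 1 + higgs_point.R J (real_endo \<alpha>)) ** real_endo \<alpha> ** real_endo \<beta>) / 2) (at 0)"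
proof -
  define A where "A = real_endo \<alpha>"
  define A' where "A' = real_endo \<beta>"
  interpret P: higgs_point J A using hp by (simp add: A_def)
  note \<gamma> = bundle_curve[OF c]
  define Jt where "Jt t = fst (\<gamma> t)" for t
  define At where "At t = real_endo (snd (\<gamma> t))" for t
  have Jd: "Jt 0 = J" "(Jt has_vector_derivative B) (at 0)"
    using \<gamma>(2) by (auto simp: curve_through_def Jt_def[abs_def])
  have Ad: "At 0 = A" "(At has_vector_derivative A') (at 0)"
    unfolding At_def A_def A'_def \<gamma>(4) real_endo_eq
    by (auto intro!: bounded_linear.has_vector_derivative[OF bounded_linear_scaleR_right] bounded_linear.has_vector_derivative[OF bounded_linear_Rem]
        bounded_linear.has_vector_derivative[OF bounded_linear_transpose] \<gamma>(3))
  have Jc: "isCont Jt 0" and Ac: "isCont At 0"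
    using Jd(2) Ad(2) has_derivative_continuous unfolding has_vector_derivative_def by blast+
  define Rt where "Rt t = msqrt (OM ** Jt t) (mat 1 - At t ** At t)" for t
  have "isCont (\<lambda>t. OM ** Jt t ** (mat 1 - At t ** At t)) 0"
    by (intro continuous_matmul continuous_intros Jc Ac)
  from pos_def_eventually_pos_def[OF this] have "\<forall>\<^sub>F t in nhds 0. pos_def (OM ** Jt t ** (mat 1 - At t ** At t))"
    using P.small by (simp add: Jd Ad)
  moreover have bdl: "\<forall>\<^sub>F t in nhds 0. \<gamma> t \<in> bdl" using c by (simp add: curve_through_def)
  ultimately have hpt: "\<forall>\<^sub>F t in nhds 0. higgs_point (Jt t) (At t)"
  proof eventually_elim
    case (elim t)
    then show ?case
      by (unfold_locales) (auto simp: cotangent_bundle_AC_def cotangent_AC_def Jt_def At_def)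
  qed
  have R0: "Rt 0 = P.R" by (simp add: Rt_def Jd Ad P.R_def P.g_def)
  interpret F: sqrt_family "\<lambda>t. OM ** Jt t" Rt "\<lambda>t. mat 1 - At t ** At t" 0
  proof
    show "isCont (\<lambda>t. OM ** Jt t) 0" "isCont (\<lambda>t. mat 1 - At t ** At t) 0"
      by (intro continuous_matmul continuous_intros Jc Ac)+
    show "pos_def (OM ** Jt 0)" "transpose (OM ** Jt 0) = OM ** Jt 0"
      using P.g by (simp_all add: Jd P.g_def)
    show "transpose (OM ** Jt 0 ** Rt 0) = OM ** Jt 0 ** Rt 0"
      using P.R_sqrt by (simp add: R0 Jd is_sqrt_def P.g_def)
    show "\<forall>\<^sub>F t in nhds 0. Rt t ** Rt t = mat 1 - At t ** At t \<and> pos_def (OM ** Jt t ** Rt t)"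
      using hpt
    proof eventually_elim
      case (elim t)
      then interpret Q: higgs_point "Jt t" "At t" .
      show ?case using Q.R_sqrt by (simp add: is_sqrt_def Q.R_def Q.g_def Rt_def)
    qed
  qed
  have Bd: "((\<lambda>t. mat 1 - At t ** At t) has_vector_derivative 0 - (A ** A' + A' ** A)) (at 0)"
    by (rule has_vector_derivative_eq_rhs[OF has_vector_derivative_diff[OF has_vector_derivative_const
            has_vector_derivative_matmul[OF Ad(2) Ad(2)]]]) (simp add: Ad)
  obtain R'' where "(Rt has_derivative R'') (at 0)"
    using F.differentiable[OF Bd[unfolded has_vector_derivative_def]] by blast
  then obtain R' where R': "(Rt has_vector_derivative R') (at 0)"
    using that differentiableI vector_derivative_works by blast
  have "((\<lambda>t. Rt t ** Rt t) has_vector_derivative P.R ** R' + R' ** P.R) (at 0)"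
    using has_vector_derivative_matmul[OF R' R'] by (simp add: R0)
  moreover have "\<forall>\<^sub>F t in nhds 0. Rt t ** Rt t = mat 1 - At t ** At t"
    using F.R by (rule eventually_mono) simp
  ultimately have "((\<lambda>t. mat 1 - At t ** At t) has_vector_derivative P.R ** R' + R' ** P.R) (at 0)"
    by (rule has_vector_derivative_eventually)
  then have RR': "P.R ** R' + R' ** P.R = - (A ** A' + A' ** A)"
    using vector_derivative_unique_at[OF Bd] by simp
  define M where "M t = (1 / 2) *\<^sub>R (mat 1 + Rt t)" for t
  have Md: "(M has_vector_derivative (1 / 2) *\<^sub>R R') (at 0)"
    unfolding M_def
    by (rule has_vector_derivative_eq_rhs[OF bounded_linear.has_vector_derivative[OF bounded_linear_scaleR_right
            has_vector_derivative_add[OF has_vector_derivative_const R']]]) simp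
  have Mpos: "det (M 0) > 0" using P.R_det by (simp add: M_def R0)
  have C: "matrix_inv (M 0) = 2 *\<^sub>R P.C"
  proof -
    have "matrix_inv (M 0) ** M 0 = mat 1"
      using Mpos matrix_inv_props(2)[of "M 0"] invertible_det_nz[of "M 0"] by simp
    then have "(1 / 2) *\<^sub>R (matrix_inv (M 0) ** (mat 1 + P.R)) = mat 1"
      by (simp add: M_def R0 matmul_scaleR_right)
    then have "matrix_inv (M 0) ** (mat 1 + P.R) = 2 *\<^sub>R mat 1"
      by (metis (no_types, lifting) divide_self_if eq_numeral_simps(2) mult_2 nonzero_mult_div_cancel_left
          scaleR_one scaleR_scaleR times_divide_eq_right zero_neq_numeral)
    then have "matrix_inv (M 0) ** ((mat 1 + P.R) ** P.C) = 2 *\<^sub>R P.C"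
      by (simp only: matrix_mul_assoc matmul_scaleR_left matrix_mul_lid)
    then show ?thesis by (simp add: P.C)
  qed
  have "((\<lambda>t. det (M t)) has_vector_derivative det (M 0) * trace (matrix_inv (M 0) ** ((1 / 2) *\<^sub>R R'))) (at 0)"
    using has_derivative_det[OF Md[unfolded has_vector_derivative_def]] Mpos
    by (simp add: has_vector_derivative_def matmul_scaleR_right trace_scaleR mult_ac)
  then have dd: "((\<lambda>t. det (M t)) has_real_derivative det (M 0) * trace (P.C ** R')) (at 0)"
    by (simp add: C has_real_derivative_iff_has_vector_derivative matmul_scaleR_left matmul_scaleR_right)
  have dl: "((\<lambda>t. ln (det (M t))) has_vector_derivative trace (P.C ** R')) (at 0)"
    unfolding has_real_derivative_iff_has_vector_derivative[symmetric]
    by (rule DERIV_cong[OF DERIV_ln_divide[THEN DERIV_chain2, OF Mpos dd]]) (use Mpos in simp)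
  have dt: "((\<lambda>t. trace (mat 1 - Rt t)) has_vector_derivative - trace R') (at 0)"
    by (rule has_vector_derivative_eq_rhs[OF bounded_linear.has_vector_derivative[OF bounded_linear_trace
            has_vector_derivative_diff[OF has_vector_derivative_const R']]]) (simp add: trace_minus)
  have val: "\<forall>\<^sub>F t in nhds 0. (1 / 2) *\<^sub>R (trace (mat 1 - Rt t) + ln (det (M t))) = BG (\<gamma> t)"
    using hpt
  proof eventually_elim
    case (elim t)
    then interpret Q: higgs_point "Jt t" "At t" .
    have "BG (\<gamma> t) = BG (Jt t, snd (\<gamma> t))" by (simp add: Jt_def)
    then show ?case using Q.BG_value[of "snd (\<gamma> t)"]
      by (simp add: At_def[symmetric] M_def Rt_def Q.R_def Q.g_def)
  qed
  have tr: "- trace R' + trace (P.C ** R') = trace (P.C ** A ** A')"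
  proof -
    have RC: "P.R ** P.C = P.C ** P.R" by (rule P.C_commute) simp
    have AC: "A ** P.C = P.C ** A" by (rule P.C_commute[OF P.R_A])
    have "trace R' = trace ((P.C ** (mat 1 + P.R)) ** R')" by (simp add: P.C)
    then have 1: "trace R' = trace (P.C ** R') + trace (P.C ** (P.R ** R'))"
      by (simp add: matrix_add_ldistrib matmul_add_left trace_add matrix_mul_assoc)
    have 2: "trace (P.C ** (P.R ** R')) = trace (P.C ** (R' ** P.R))"
      by (metis RC matrix_mul_assoc trace_mul_sym)
    have 3: "trace (P.C ** (A ** A')) = trace (P.C ** (A' ** A))"
      by (metis AC matrix_mul_assoc trace_mul_sym)
    have "2 * trace (P.C ** (P.R ** R')) = trace (P.C ** (P.R ** R' + R' ** P.R))"
      by (simp add: 2 matrix_add_ldistrib trace_add)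
    also have "\<dots> = - (2 * trace (P.C ** (A ** A')))"
      unfolding RR' by (simp add: 3 matrix_add_ldistrib matmul_minus_right matmul_diff_right trace_add trace_minus trace_sub)
    finally show ?thesis using 1 by (simp add: matrix_mul_assoc)
  qed
  have "((\<lambda>t. (1 / 2) *\<^sub>R (trace (mat 1 - Rt t) + ln (det (M t)))) has_vector_derivative (1 / 2) *\<^sub>R (- trace R' + trace (P.C ** R'))) (at 0)"
    by (intro bounded_linear.has_vector_derivative[OF bounded_linear_scaleR_right] has_vector_derivative_add dt dl)
  from has_vector_derivative_eventually[OF this val, unfolded tr]
  show ?thesis by (simp add: P.C_def A_def[symmetric] A'_def[symmetric])
qed

lemma differential_BG:
  assumes v: "(B, \<beta>) \<in> tangent_vectors bdl (J, \<alpha>)" and hp: "higgs_point J (real_endo \<alpha>)"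
  shows "differential bdl BG (J, \<alpha>) (B, \<beta>) =
    trace (matrix_inv (mat 1 + higgs_point.R J (real_endo \<alpha>)) ** real_endo \<alpha> ** real_endo \<beta>) / 2"
proof -
  obtain \<gamma> where c: "curve_through bdl (J, \<alpha>) (B, \<beta>) \<gamma>" using v by (auto simp: tangent_vectors_def)
  show ?thesis
    unfolding differential_def
  proof (rule the_equality)
    fix d assume "\<forall>\<gamma>. curve_through bdl (J, \<alpha>) (B, \<beta>) \<gamma> \<longrightarrow> ((\<lambda>t. BG (\<gamma> t)) has_vector_derivative d) (at 0)"
    then show "d = trace (matrix_inv (mat 1 + higgs_point.R J (real_endo \<alpha>)) ** real_endo \<alpha> ** real_endo \<beta>) / 2"
      using c BG_derivative[OF c hp] vector_derivative_unique_at by blast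
  qed (use BG_derivative[OF _ hp] in blast)
qed

section \<open>The differential of the Biquard--Gauduchon function at purely imaginary
  \<tau>\<close>

locale potential_point = siegel_point "0 :: real^'n^'n" H for H :: "real^'n^'n::finite" +
  fixes n :: "complex^'n^'n"
  assumes n: "transpose n = n" and hp: "higgs_point (Jm 0 H) (2 *\<^sub>R Rem (nf (cplx 0 H) n))"
begin

definition "A = 2 *\<^sub>R Rem (nf \<tau> n)"

sublocale P: higgs_point "Jm 0 H" A
  using hp by (simp add: A_def \<tau>_def)

lemma tau0: "\<tau> = \<i> *k cmat H"
  by (simp add: \<tau>_def cplx_def)

text \<open>The infinitesimal symplectic transformations with the blocks \<open>E\<close> below do not change the
  Biquard--Gauduchon function, which leaves the multiplication by \<open>diag (G X') (X' G)\<close> and the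
  variation of the fibre coordinate.\<close>

lemma dnf_decompose:
  "dnf \<tau> n (cplx (- Y') X') n' =
    (cmat (block_mat 0 0 (- Y') (X' ** G)) ** nf \<tau> n - nf \<tau> n ** cmat (block_mat 0 0 (- Y') (X' ** G)))
    + nf \<tau> n ** cmat (block_mat (G ** X') 0 0 (X' ** G)) + nf \<tau> n'"
  by (simp add: dnf_def nf_def block_simps tau0 cplx_def cmat_mult cmat_minus mat_expand GY_cmat GY_cmat_assoc)

text \<open>In the decomposition of the rotated tangent vector the commutator with E drops out by
  \<open>trace_bracket\<close>. The right multiplication by D contributes tr(C A^2 D) = tr((1 - R)
  D). The last term is the fibre variation.\<close>

lemma dc_BG_eq:
  assumes v: "(B, \<beta>) \<in> tangent_vectors bdl (Jm 0 H, transpose (nf \<tau> n))"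
    and n': "transpose (b12 (transpose \<beta>)) = b12 (transpose \<beta>)"
  shows "dc_BG (Jm 0 H, transpose (nf \<tau> n)) (B, \<beta>) =
    - trace ((mat 1 - P.R) ** block_mat (b11 B) 0 0 (H ** b11 B ** G)) / 2
    - Re (trace (cmat (P.C ** A) ** nf \<tau> (\<i> *k b12 (transpose \<beta>))))"
proof -
  let ?J = "Jm 0 H" and ?p = "(Jm 0 H, transpose (nf \<tau> n))"
  note T = tangent_dJm[OF tangent_bundle(2)[OF v]]
  define X' Y' where XY: "X' = dX ?J B" "Y' = dY ?J B"
  define n' where "n' = b12 (transpose \<beta>)"
  have b12p: "b12 (transpose (transpose (nf \<tau> n))) = n" by (simp add: nf_def)
  have \<beta>: "\<beta> = transpose (dnf \<tau> n (cplx X' Y') n')"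
    using tangent_bundle(3)[OF v] unfolding b12p Xpart_Jm Ypart_Jm XY[symmetric] n'_def[symmetric]
    by (metis \<tau>_def transpose_transpose)
  have B: "B = dJm 0 H X' Y'" using T(3) by (simp add: XY)
  have sX: "transpose X' = X'" and sY: "transpose (- Y') = - Y'" and sn: "transpose (\<i> *k n') = \<i> *k n'"
    using T n' by (simp_all add: XY transpose_minus transpose_cscale n'_def)
  have w: "cplx_I ?p (B, \<beta>) = (dJm 0 H (- Y') X', transpose (dnf \<tau> n (cplx (- Y') X') (\<i> *k n')))"
    unfolding B \<beta> by (rule cplx_I_eq) (use T n' n in \<open>simp_all add: XY n'_def\<close>)
  have tv: "(dJm 0 H (- Y') X', transpose (dnf \<tau> n (cplx (- Y') X') (\<i> *k n'))) \<in> tangent_vectors bdl ?p"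
    by (rule tangent_bundleI[OF sY sX n sn])
  have rA: "real_endo (transpose (nf \<tau> n)) = A" by (simp add: real_endo_eq A_def)
  define E where "E = block_mat 0 0 (- Y') (X' ** G)"
  define D where "D = block_mat (G ** X') 0 0 (X' ** G)"
  have "real_endo (transpose (dnf \<tau> n (cplx (- Y') X') (\<i> *k n'))) =
      (E ** A - A ** E) + A ** D + 2 *\<^sub>R Rem (nf \<tau> (\<i> *k n'))"
    unfolding real_endo_eq transpose_transpose dnf_decompose E_def[symmetric] D_def[symmetric]
    by (simp add: Rem_add Rem_diff Rem_mult A_def matmul_scaleR_left matmul_scaleR_right algebra_simps)
  then have "dc_BG ?p (B, \<beta>) = - trace (P.C ** A ** ((E ** A - A ** E) + A ** D + 2 *\<^sub>R Rem (nf \<tau> (\<i> *k n')))) / 2"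
    unfolding dc_BG_def w using differential_BG[OF tv] P.higgs_point_axioms by (simp add: rA P.C_def)
  also have "\<dots> = - trace (P.C ** A ** (A ** D)) / 2 - trace (P.C ** A ** Rem (nf \<tau> (\<i> *k n')))"
    using P.trace_bracket[of E]
    by (simp add: matrix_add_ldistrib trace_add matmul_scaleR_right trace_scaleR)
  also have "P.C ** A ** (A ** D) = (P.C ** (A ** A)) ** D" by (simp only: matrix_mul_assoc)
  also have "\<dots> = (mat 1 - P.R) ** D" by (simp only: P.C_AA)
  also have "trace (P.C ** A ** Rem (nf \<tau> (\<i> *k n'))) = Re (trace (cmat (P.C ** A) ** nf \<tau> (\<i> *k n')))"
    by (simp add: Re_trace Rem_mult)
  also have "D = block_mat (b11 B) 0 0 (H ** b11 B ** G)"
    by (simp add: D_def B dJm_eq block_mat_eq_iff matrix_mul_assoc GY)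
  finally show ?thesis by (simp add: n'_def)
qed

end

section \<open>The square root on the holomorphic side\<close>

lemma cscale_vec: "(c *k A) *v x = c *s (A *v (x :: 'a::comm_ring_1^'n::finite))"
  and matvec_scale: "A' *v (c *s x) = c *s (A' *v x)"
  and matvec_minus: "(- A) *v x = - (A *v x)"
  and matvec_minus_right: "A' *v (- x) = - (A' *v x)"
  by (simp_all add: vec_eq_iff matrix_vector_mult_def sum_distrib_left mult.assoc mult.left_commute sum_negf)

lemma (in self_adjoint) complex_eigenvalue:
  fixes z :: "complex^'n"
  assumes z: "cmat M *v z = c *s z" "z \<noteq> 0" shows "\<exists>i. c = of_real (l i)"
proof -
  define w where "w = cmat T *v z"
  have "cmat S *v w = (cmat (S ** T)) *v z" by (simp add: w_def matrix_vector_mul_assoc cmat_mult)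
  then have Sw: "cmat S *v w = z" by (simp add: ST)
  then obtain i where i: "w $ i \<noteq> 0" using z(2) by (metis matrix_vector_mult_0_right vec_eq_iff zero_index)
  have "cmat (diag_mat l) *v w = cmat (T ** (S ** diag_mat l)) *v w" by (simp add: TS_assoc)
  also have "\<dots> = cmat T *v (cmat M *v z)"
    by (simp add: eig[symmetric] cmat_mult matrix_vector_mul_assoc[symmetric] Sw)
  also have "\<dots> = c *s w" by (simp add: z(1) matvec_scale w_def)
  finally have "(cmat (diag_mat l) *v w) $ i = c * w $ i" by simp
  moreover have "(cmat (diag_mat l) *v w) $ i = of_real (l i) * w $ i"
    by (simp add: matrix_vector_mult_def diag_mat_def if_distrib[of of_real] if_distrib[of "\<lambda>x. x * _"] sum.delta cong: if_cong)
  ultimately show ?thesis using i by auto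
qed

section \<open>Endomorphisms commuting with J, acting on the (0,1) space\<close>

locale potential_matrix = siegel_point "0 :: real^'n^'n" H for H :: "real^'n^'n::finite"
begin

text \<open>A real endomorphism commuting with J preserves the (0,1) space, the graph of \<tau> =
  \<i> H. This is its matrix there, with the graph identified with its first component.\<close>

definition "act M = cmat (b11 M) + \<i> *k cmat (b12 M ** H)"

text \<open>The first component of the (0,1) part (s + \<i> J s) / 2 of a real vector s.\<close>

definition proj :: "'n vec2 \<Rightarrow> complex^'n" where
  "proj s = (\<chi> a. Complex (s $ Inl a / 2) (- ((G *v (\<chi> b. s $ Inr b)) $ a / 2)))"

lemma J0: "Jm 0 H = block_mat 0 (- G) H 0"
  by (simp add: Jm_eq)

lemma tauH: "\<tau> = \<i> *k cmat H"
  by (simp add: \<tau>_def cplx_def)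

lemma commute_blocks:
  assumes "M ** Jm 0 H = Jm 0 H ** M"
  shows "b21 M = - (H ** (b12 M ** H))" "b22 M = H ** (b11 M ** G)"
proof -
  define p q r s where pqrs: "p = b11 M" "q = b12 M" "r = b21 M" "s = b22 M"
  have Mb: "M = block_mat p q r s" by (simp add: pqrs block_mat_blocks)
  have e: "q ** H = - (G ** r)" "- (p ** G) = - (G ** s)"
    using assms by (simp_all add: Mb J0 block_simps matmul_minus_left matmul_minus_right)
  have "H ** (q ** H) = - (H ** (G ** r))" unfolding e matmul_minus_right ..
  then show "b21 M = - (H ** (b12 M ** H))" by (simp add: pqrs[symmetric] GY_assoc)
  have "H ** (p ** G) = H ** (G ** s)" using e(2) by simp
  then show "b22 M = H ** (b11 M ** G)" by (simp add: pqrs[symmetric] GY_assoc)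
qed

lemma act_T01:
  assumes M: "M ** Jm 0 H = Jm 0 H ** M"
  shows "cmat M *v pair_vec v (\<tau> *v v) = pair_vec (act M *v v) (\<tau> *v (act M *v v))"
proof -
  have Mb: "cmat M = block_mat (cmat (b11 M)) (cmat (b12 M)) (cmat (b21 M)) (cmat (b22 M) :: complex^'n^'n)"
    unfolding block_mat_cmat[symmetric] block_mat_blocks ..
  have 1: "cmat (b11 M) + cmat (b12 M) ** \<tau> = act M"
    by (simp add: act_def tauH cmat_mult cscale_mult_right)
  have 2: "cmat (b21 M) + cmat (b22 M) ** \<tau> = \<tau> ** act M"
    unfolding commute_blocks[OF M] by (simp add: act_def tauH cmat_mult cmat_minus mat_expand GY_cmat)
  have "cmat M *v pair_vec v (\<tau> *v v) = pair_vec ((cmat (b11 M) + cmat (b12 M) ** \<tau>) *v v)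
      ((cmat (b21 M) + cmat (b22 M) ** \<tau>) *v v)"
    by (subst Mb) (simp add: block_mat_vec matrix_vector_mult_add_rdistrib matrix_vector_mul_assoc)
  then show ?thesis unfolding 1 2 by (simp add: matrix_vector_mul_assoc)
qed

lemma act_proj:
  assumes M: "M ** Jm 0 H = Jm 0 H ** M"
  shows "proj (M *v s) = act M *v proj s"
proof -
  obtain p q where s: "s = pair_vec p q" using pair_vec_exists by blast
  have pr: "proj (pair_vec p q) = (\<chi> a. Complex (p $ a / 2) (- ((G *v q) $ a / 2)))" for p q
    by (simp add: proj_def vec_eq_iff complex_eq_iff)
  have cv: "cmat A *v (\<chi> a. Complex (x $ a) (y $ a)) = (\<chi> a. Complex ((A *v x) $ a) ((A *v y) $ a))"
    for A :: "real^'n^'n" and x y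
    by (simp add: vec_eq_iff matrix_vector_mult_def complex_eq_iff)
  have mr: "B *v (- x) = - (B *v x)" for B :: "real^'n^'n" and x
    by (simp add: vec_eq_iff matrix_vector_mult_def sum_negf)
  have pr': "proj (pair_vec p q) = (\<chi> a. Complex (((1/2) *\<^sub>R p) $ a) (((- 1/2) *\<^sub>R (G *v q)) $ a))" for p q
    by (simp add: pr vec_eq_iff)
  have "M *v s = pair_vec (b11 M *v p + b12 M *v q) (b21 M *v p + b22 M *v q)"
    unfolding s block_mat_vec[symmetric] block_mat_blocks ..
  moreover have "G *v (b21 M *v p + b22 M *v q) = - (b12 M *v (H *v p)) + b11 M *v (G *v q)"
  proof -
    have "G ** b21 M = - (b12 M ** H)" "G ** b22 M = b11 M ** G"
      unfolding commute_blocks[OF M] by (simp_all add: matmul_minus_right GY_assoc)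
    then show ?thesis by (simp add: matrix_vector_right_distrib matrix_vector_mul_assoc matvec_minus)
  qed
  ultimately have "proj (M *v s) = (\<chi> a. Complex ((b11 M *v p + b12 M *v q) $ a / 2)
      (- ((- (b12 M *v (H *v p)) + b11 M *v (G *v q)) $ a / 2)))" by (simp add: pr)
  also have "\<dots> = act M *v proj s"
    unfolding act_def s pr' matrix_vector_mult_add_rdistrib cscale_vec cv
    by (simp add: vec_eq_iff complex_eq_iff matrix_vector_mult_scaleR matrix_vector_mul_assoc[symmetric] add_divide_distrib)
      (simp add: mr matrix_vector_mult_scaleR matrix_vector_mul_assoc matrix_mul_assoc[symmetric] GY matvec_minus diff_divide_distrib)
  finally show ?thesis .
qed

lemma act_mult:
  assumes M: "M ** Jm 0 H = Jm 0 H ** M" and M': "M' ** Jm 0 H = Jm 0 H ** M'"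
  shows "act (M ** M') = act M ** act M'"
proof -
  have MM: "(M ** M') ** Jm 0 H = Jm 0 H ** (M ** M')" by (metis M M' matrix_mul_assoc)
  have "pair_vec (act (M ** M') *v v) (\<tau> *v (act (M ** M') *v v)) = pair_vec (act M *v (act M' *v v)) (\<tau> *v (act M *v (act M' *v v)))" for v
    unfolding act_T01[OF M, symmetric] act_T01[OF M', symmetric] act_T01[OF MM, symmetric]
    by (simp add: cmat_mult matrix_vector_mul_assoc)
  then show ?thesis by (simp add: matrix_eq pair_vec_eq_iff matrix_vector_mul_assoc[symmetric])
qed

lemma proj_surj: "\<exists>s. p = proj s"
proof -
  define q where "q = - (2 *\<^sub>R (H *v (\<chi> a. Im (p $ a))))"
  have "G *v (H *v x) = x" for x by (simp add: matrix_vector_mul_assoc GY)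
  then have "G *v q = - (2 *\<^sub>R (\<chi> a. Im (p $ a)))"
    by (simp add: q_def matrix_vector_mult_scaleR vec.neg)
  then have "p = proj (pair_vec (\<chi> a. 2 * Re (p $ a)) q)"
    by (simp add: proj_def vec_eq_iff complex_eq_iff)
  then show ?thesis by blast
qed

lemma proj_zero: "proj s = 0 \<Longrightarrow> s = 0"
proof -
  assume 0: "proj s = 0"
  obtain p q where s: "s = pair_vec p q" using pair_vec_exists by blast
  have e: "Complex (p $ a / 2) (- ((G *v q) $ a / 2)) = 0" for a
    using arg_cong[OF 0, of "\<lambda>x. x $ a"] by (simp add: proj_def s)
  have p: "p = 0" using e by (simp add: vec_eq_iff complex_eq_iff)
  have "G *v q = 0" using e by (simp add: vec_eq_iff complex_eq_iff)
  then have "H *v (G *v q) = 0" by simp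
  then have "q = 0" by (simp add: matrix_vector_mul_assoc GY)
  then show "s = 0" using p by (simp add: s pair_vec_zero)
qed

lemma linear_proj: "linear proj"
  by (rule linearI) (simp_all add: proj_def vec_eq_iff complex_eq_iff matrix_vector_mult_def algebra_simps
      sum.distrib sum_distrib_left add_divide_distrib)

end

section \<open>The Higgs tensor at one point\<close>

locale higgs_matrix = potential_matrix H for H :: "real^'n^'n::finite" +
  fixes \<xi> :: "complex^'n^'n"
  assumes \<xi>: "transpose \<xi> = \<xi>"
    and radius: "spectral_radius (\<xi> ** cmat H ** cnj_mat \<xi> ** cmat H) < 1"
begin

text \<open>The factor comes from comparing components of the dual of \<alpha> on the frame
  \<open>Z_a\<close>; see \<open>transpose_\<alpha>\<close>.\<close>

definition "n = (\<i> / 2) *k \<xi>"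
definition "A = 2 *\<^sub>R Rem (nf \<tau> n)"
definition "K = \<xi> ** cmat H ** cnj_mat \<xi> ** cmat H"

lemma n_sym: "transpose n = n"
  by (simp add: n_def transpose_cscale \<xi>)

lemma A_tangent: "A \<in> tangent_AC (Jm 0 H)"
  using nf_cotangent[OF n_sym] by (simp add: cotangent_AC_def real_endo_eq A_def)

sublocale Q: tangent_point "Jm 0 H" A
  using Jm_AC A_tangent by unfold_locales

lemma AA_J: "(A ** A) ** Jm 0 H = Jm 0 H ** (A ** A)"
proof -
  have a: "Jm 0 H ** A = - (A ** Jm 0 H)" by (rule Q.anti)
  have "Jm 0 H ** (A ** A) = (Jm 0 H ** A) ** A" by (simp only: matrix_mul_assoc)
  also have "\<dots> = - (A ** (Jm 0 H ** A))" by (simp only: a matmul_minus_left matrix_mul_assoc[symmetric] matmul_minus_right)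
  also have "\<dots> = (A ** A) ** Jm 0 H" by (simp only: a matmul_minus_right minus_minus matrix_mul_assoc)
  finally show ?thesis by simp
qed

text \<open>A interchanges the two types. In first components it sends a (0,1) vector v to the (1,0)
  vector cnj(\<xi>) H v, and a (1,0) vector v to the (0,1) vector \<xi> H v. Its square on the (0,1)
  space is therefore K.\<close>

lemma act_AA: "act (A ** A) = K"
proof -
  let ?N = "nf \<tau> n" and ?H = "cmat H :: complex^'n^'n"
  have cA: "cmat A = ?N + cnj_mat ?N" by (simp add: A_def vec_eq_iff complex_eq_iff)
  have N: "?N = block_mat (- ((\<i> / 2) *k (\<xi> ** \<tau>))) ((\<i> / 2) *k \<xi>) (- ((\<i> / 2) *k (\<tau> ** (\<xi> ** \<tau>)))) ((\<i> / 2) *k (\<tau> ** \<xi>))"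
    by (simp add: nf_def n_def mat_expand)
  have cN: "cnj_mat ?N = block_mat (- ((- \<i> / 2) *k (cnj_mat \<xi> ** cnj_mat \<tau>))) ((- \<i> / 2) *k cnj_mat \<xi>)
      (- ((- \<i> / 2) *k (cnj_mat \<tau> ** (cnj_mat \<xi> ** cnj_mat \<tau>)))) ((- \<i> / 2) *k (cnj_mat \<tau> ** cnj_mat \<xi>))"
    unfolding N by (simp add: cnj_mat_def block_mat_map)
      (simp add: cnj_mat_def[symmetric] cnj_mat_mult cnj_mat_cscale cnj_mat_minus)
  have cA2: "cmat A = block_mat (- ((\<i> / 2) *k (\<xi> ** \<tau>))) ((\<i> / 2) *k \<xi>) (- ((\<i> / 2) *k (\<tau> ** (\<xi> ** \<tau>)))) ((\<i> / 2) *k (\<tau> ** \<xi>))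
    + block_mat (- ((- \<i> / 2) *k (cnj_mat \<xi> ** cnj_mat \<tau>))) ((- \<i> / 2) *k cnj_mat \<xi>)
      (- ((- \<i> / 2) *k (cnj_mat \<tau> ** (cnj_mat \<xi> ** cnj_mat \<tau>)))) ((- \<i> / 2) *k (cnj_mat \<tau> ** cnj_mat \<xi>))"
    using cA N cN by simp
  have ct: "cnj_mat \<tau> = - \<tau>" by (simp add: tauH cnj_mat_cscale cscale_minus_left)
  have ii: "\<i> * (\<i> * z) = - z" for z by (simp add: mult.assoc[symmetric])
  have "pair_vec (act (A ** A) *v v) (\<tau> *v (act (A ** A) *v v)) = pair_vec (K *v v) (\<tau> *v (K *v v))" for v
  proof -
    let ?u = "cnj_mat \<xi> *v (?H *v v)"
    have 1: "cmat A *v pair_vec v (\<tau> *v v) = pair_vec ?u ((- \<tau>) *v ?u)"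
      unfolding cA2 ct block_mat_add block_mat_vec pair_vec_eq_iff
      by (simp add: matvec_minus mat_expand tauH matrix_vector_mult_add_rdistrib matrix_vector_mult_diff_rdistrib
          cscale_vec matvec_scale matvec_minus_right) (simp add: vec_eq_iff matrix_vector_mul_assoc matrix_mul_assoc ii)
    have 2: "cmat A *v pair_vec u ((- \<tau>) *v u) = pair_vec (\<xi> *v (?H *v u)) (\<tau> *v (\<xi> *v (?H *v u)))" for u
      unfolding cA2 ct block_mat_add block_mat_vec pair_vec_eq_iff
      by (simp add: matvec_minus mat_expand tauH matrix_vector_mult_add_rdistrib matrix_vector_mult_diff_rdistrib
          cscale_vec matvec_scale matvec_minus_right) (simp add: vec_eq_iff matrix_vector_mul_assoc matrix_mul_assoc ii)
    have "pair_vec (act (A ** A) *v v) (\<tau> *v (act (A ** A) *v v)) = cmat A *v (cmat A *v pair_vec v (\<tau> *v v))"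
      unfolding act_T01[OF AA_J, symmetric] by (simp add: cmat_mult matrix_vector_mul_assoc)
    also have "\<dots> = pair_vec (K *v v) (\<tau> *v (K *v v))"
      unfolding 1 2 by (simp add: K_def matrix_vector_mul_assoc matrix_mul_assoc)
    finally show ?thesis .
  qed
  then show ?thesis by (simp add: matrix_eq pair_vec_eq_iff)
qed

lemma K_eigenvalue:
  assumes S: "self_adjoint Q.g (A ** A) S l" shows "of_real (l i) \<in> eigenvalues K"
proof -
  interpret S: self_adjoint Q.g "A ** A" S l by fact
  have "K *v proj (column i S) = proj ((A ** A) *v column i S)"
    using act_proj[OF AA_J] by (simp add: act_AA)
  also have "\<dots> = of_real (l i) *s proj (column i S)"
    unfolding S.eigenvector linear_cmul[OF linear_proj] by (simp add: vec_eq_iff complex_eq_iff)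
  finally show ?thesis
    using proj_zero[of "column i S"] S.column_nonzero by (auto simp: eigenvalues_def)
qed

text \<open>The spectral radius is a \<open>Max\<close>, which bounds its members only for a finite
  set. An eigenvector v of K gives the eigenvector (v, \<tau> v) of the complexified A^2, whose
  eigenvalues are the finitely many real ones.\<close>

lemma eigenvalues_K_finite: "finite (eigenvalues K)"
proof -
  obtain S l where "self_adjoint Q.g (A ** A) S l" using self_adjoint_exists[OF Q.g Q.gAA] by blast
  then interpret S: self_adjoint Q.g "A ** A" S l .
  have "eigenvalues K \<subseteq> (\<lambda>i. of_real (l i)) ` UNIV"
  proof
    fix c assume "c \<in> eigenvalues K"
    then obtain v where v: "v \<noteq> 0" "K *v v = c *s v" by (auto simp: eigenvalues_def)
    have "cmat (A ** A) *v pair_vec v (\<tau> *v v) = c *s pair_vec v (\<tau> *v v)"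
      unfolding act_T01[OF AA_J] act_AA v(2) by (simp add: matvec_scale vec_eq_iff all_plus)
    moreover have "pair_vec v (\<tau> *v v) \<noteq> 0" using v(1) pair_vec_eq_iff[of v _ 0 0] by (simp add: pair_vec_zero)
    ultimately show "c \<in> (\<lambda>i. of_real (l i)) ` UNIV" using S.complex_eigenvalue by blast
  qed
  then show ?thesis by (rule finite_subset) simp
qed

sublocale P: higgs_point "Jm 0 H" A
proof unfold_locales
  obtain S l where S: "self_adjoint Q.g (A ** A) S l" using self_adjoint_exists[OF Q.g Q.gAA] by blast
  then interpret S: self_adjoint Q.g "A ** A" S l .
  have "l i < 1" for i
  proof -
    have "cmod (of_real (l i)) \<le> spectral_radius K"
      unfolding spectral_radius_def using eigenvalues_K_finite K_eigenvalue[OF S] by (intro Max_ge) blast+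
    then show ?thesis using radius by (simp add: K_def)
  qed
  then have "pos_def (Q.g ** S.fn (\<lambda>x. 1 + (- 1) * x))" by (intro S.fn_pos_def) simp
  then show "pos_def (OM ** Jm 0 H ** (mat 1 - A ** A))"
    unfolding S.fn_add S.fn_scale S.fn_const S.fn_id by (simp add: Q.g_def)
qed

lemma potential_point: "potential_point H n"
  by (rule potential_point.intro[OF siegel_point_axioms], rule potential_point_axioms.intro)
    (use n_sym P.higgs_point_axioms in \<open>simp_all add: A_def \<tau>_def\<close>)

lemma R_J: "P.R ** Jm 0 H = Jm 0 H ** P.R" using P.R_J by simp

text \<open>Since \<open>act\<close> is multiplicative on endomorphisms commuting with J,
  \<open>act P.R\<close> is a root, and its eigenvalues are among those of R. For uniqueness it
  suffices to compare with another root on the projections of an eigenbasis of R, which span the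
  (0,1) space.\<close>

lemma matrix_sqrt_act: "matrix_sqrt (mat 1 - K) = act P.R"
  unfolding matrix_sqrt_def
proof (rule the_equality)
  obtain S l where S: "self_adjoint Q.g (A ** A) S l" and l: "\<forall>i. 0 \<le> l i \<and> l i < 1" using P.spectral_data by blast
  interpret S: self_adjoint Q.g "A ** A" S l by fact
  have R: "P.R = S.fn (\<lambda>x. sqrt (1 - x))" by (rule P.R_fn(1)[OF S l])
  interpret SR: self_adjoint Q.g P.R S "\<lambda>i. sqrt (1 - l i)" unfolding R by (rule S.self_adjoint_fn)
  have "act (P.R ** P.R) = act (mat 1 - A ** A)" using P.R_sqrt by (simp add: is_sqrt_def)
  also have "\<dots> = mat 1 - act (A ** A)"
    by (simp add: act_def blocks_linear block_mat_one matmul_diff_left matmul_minus_left cmat_diff cmat_minus cscale_diff cscale_minus)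
  finally have "act P.R ** act P.R = mat 1 - K" by (simp add: act_mult[OF R_J R_J] act_AA)
  moreover have "c \<in> \<real> \<and> 0 < Re c" if "c \<in> eigenvalues (act P.R)" for c
  proof -
    obtain v where v: "v \<noteq> 0" "act P.R *v v = c *s v" using \<open>c \<in> _\<close> by (auto simp: eigenvalues_def)
    have "cmat P.R *v pair_vec v (\<tau> *v v) = c *s pair_vec v (\<tau> *v v)"
      unfolding act_T01[OF R_J] v(2) by (simp add: matvec_scale vec_eq_iff all_plus)
    moreover have "pair_vec v (\<tau> *v v) \<noteq> 0" using v(1) pair_vec_eq_iff[of v _ 0 0] by (simp add: pair_vec_zero)
    ultimately obtain i where "c = of_real (sqrt (1 - l i))" using SR.complex_eigenvalue by blast
    then show ?thesis using l by simp
  qed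
  ultimately show "act P.R ** act P.R = mat 1 - K \<and> (\<forall>c\<in>eigenvalues (act P.R). c \<in> \<real> \<and> 0 < Re c)" by blast
  fix R' assume R': "R' ** R' = mat 1 - K \<and> (\<forall>c\<in>eigenvalues R'. c \<in> \<real> \<and> 0 < Re c)"
  have col: "(R' - act P.R) *v proj (column i S) = 0" for i
  proof -
    define v where "v = proj (column i S)"
    define r where "r = sqrt (1 - l i)"
    have r: "0 < r" using l by (simp add: r_def)
    have sc: "c *\<^sub>R x = of_real c *s x" for c and x :: "complex^'n"
      by (simp add: vec_eq_iff complex_eq_iff)
    have Rv: "act P.R *v v = of_real r *s v"
      unfolding v_def act_proj[OF R_J, symmetric] SR.eigenvector linear_cmul[OF linear_proj] sc r_def ..
    have "R' *v (R' *v v) = (act P.R ** act P.R) *v v"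
      using R' \<open>act P.R ** act P.R = mat 1 - K\<close> by (simp add: matrix_vector_mul_assoc)
    also have "\<dots> = of_real r *s (of_real r *s v)" by (simp add: matrix_vector_mul_assoc[symmetric] Rv matvec_scale)
    finally have RR: "R' *v (R' *v v) = of_real r *s (of_real r *s v)" .
    \<comment> \<open>From R'^2 v = r^2 v it follows that R' x = - r x. A root with positive
      eigenvalues has no eigenvalue - r, so x = 0.\<close>
    define x where "x = R' *v v - of_real r *s v"
    have "R' *v x = (- of_real r) *s x"
      unfolding x_def matrix_vector_mult_diff_distrib RR matvec_scale by (simp add: vec_eq_iff algebra_simps)
    then have "x \<noteq> 0 \<Longrightarrow> - of_real r \<in> eigenvalues R'" unfolding eigenvalues_def by blast
    then have "x = 0" using R' r by force
    then show ?thesis unfolding v_def[symmetric] by (simp add: matrix_vector_mult_diff_rdistrib Rv x_def)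
  qed
  have "(R' - act P.R) *v p = 0" for p
  proof -
    obtain s where p: "p = proj s" using proj_surj by blast
    have "s = S *v (S.T *v s)" by (simp add: matrix_vector_mul_assoc S.ST)
    also have "\<dots> = (\<Sum>i\<in>UNIV. (S.T *v s) $ i *\<^sub>R column i S)"
      by (simp add: matrix_mult_sum scalar_mult_eq_scaleR)
    finally have "proj s = (\<Sum>i\<in>UNIV. (S.T *v s) $ i *\<^sub>R proj (column i S))"
      by (metis (no_types, lifting) linear_sum[OF linear_proj] linear_cmul[OF linear_proj] sum.cong)
    then have "(R' - act P.R) *v p = (\<Sum>i\<in>UNIV. (S.T *v s) $ i *\<^sub>R ((R' - act P.R) *v proj (column i S)))"
      unfolding p by (simp add: linear_sum[OF matrix_vector_mul_linear] linear_cmul[OF matrix_vector_mul_linear])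
    then show ?thesis by (simp add: col)
  qed
  then have "R' - act P.R = 0" by (simp add: matrix_eq)
  then show "R' = act P.R" by simp
qed

text \<open>Symmetry of R for the metric relates its two off-diagonal blocks through a transpose,
  and commuting with J relates them without one. This block is the imaginary part of \<sigma> G, so
  antisymmetry makes its double divergence vanish.\<close>

lemma b12_R_antisym: "transpose (b12 P.R) = - b12 P.R"
proof -
  have OJ: "OM ** Jm 0 H = block_mat H 0 0 G" by (simp add: OM_Jm)
  define p q r s where pqrs: "p = b11 P.R" "q = b12 P.R" "r = b21 P.R" "s = b22 P.R"
  have Rb: "P.R = block_mat p q r s" by (simp add: pqrs block_mat_blocks)
  have "transpose (OM ** Jm 0 H ** P.R) = OM ** Jm 0 H ** P.R" using P.R_sqrt by (simp add: is_sqrt_def Q.g_def)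
  then have "transpose (H ** q) = G ** r"
    unfolding OJ Rb by (simp add: block_simps)
  also have "G ** r = - (q ** H)"
    using commute_blocks(1)[OF R_J] by (simp add: pqrs[symmetric] matmul_minus_right GY_assoc)
  finally have "transpose q ** H = - (q ** H)" by (simp add: matrix_transpose_mul Y)
  then have "(transpose q ** H) ** G = - (q ** H) ** G" by simp
  then show ?thesis by (simp add: pqrs[symmetric] matmul_minus_left matrix_mul_assoc[symmetric] GY)
qed

lemma sqrt_G: "matrix_sqrt (mat 1 - K) ** cmat G = cmat (b11 P.R ** G) + \<i> *k cmat (b12 P.R)"
  unfolding matrix_sqrt_act act_def
  by (simp add: matmul_add_left cscale_mult_left cmat_mult[symmetric] matrix_mul_assoc[symmetric] GY)

text \<open>The two diagonal blocks contribute equally, since commuting with J makes the lower one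
  conjugate to the upper one by H. The resulting 2 cancels the 1/2 in
  \<open>dc_BG_eq\<close>.\<close>

lemma trace_R: "trace ((mat 1 - P.R) ** block_mat Z 0 0 (H ** Z ** G)) = 2 * trace ((mat 1 - b11 P.R) ** Z)"
proof -
  have Rb: "P.R = block_mat (b11 P.R) (b12 P.R) (b21 P.R) (b22 P.R)" by (simp add: block_mat_blocks)
  have "trace ((mat 1 - P.R) ** block_mat Z 0 0 (H ** Z ** G)) = trace ((mat 1 - b11 P.R) ** Z) + trace ((mat 1 - b22 P.R) ** (H ** Z ** G))"
    by (subst Rb) (simp add: block_mat_one block_mat_diff block_mat_mult block_mat_trace)
  also have "(mat 1 - b22 P.R) ** (H ** Z ** G) = H ** ((mat 1 - b11 P.R) ** Z ** G)"
    unfolding commute_blocks(2)[OF R_J] by (simp add: mat_expand GY_assoc)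
  also have "trace (H ** ((mat 1 - b11 P.R) ** Z ** G)) = trace ((mat 1 - b11 P.R) ** Z)"
    by (subst trace_mul_sym) (simp add: matrix_mul_assoc[symmetric] GY)
  finally show ?thesis by simp
qed

lemma dc_BG_potential:
  assumes v: "(B, \<beta>) \<in> tangent_vectors bdl (Jm 0 H, transpose (nf \<tau> n))"
    and n': "transpose (b12 (transpose \<beta>)) = b12 (transpose \<beta>)"
  shows "dc_BG (Jm 0 H, transpose (nf \<tau> n)) (B, \<beta>) =
    - trace ((mat 1 - b11 P.R) ** b11 B) - Re (trace (cmat (P.C ** A) ** nf \<tau> (\<i> *k b12 (transpose \<beta>))))"
  using potential_point.dc_BG_eq[OF potential_point v n']
  unfolding potential_point.A_def[OF potential_point] A_def[symmetric] by (simp add: trace_R)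

end

section \<open>Scalar curvature\<close>

lemma pos_def_det_pos: assumes "pos_def H" "transpose H = H" shows "0 < det H"
proof -
  have one: "pos_def (mat 1 :: real^'n^'n)" by (simp add: pos_def_def)
  obtain S l where "self_adjoint (mat 1) H S l"
    using self_adjoint_exists[OF one, of H] assms(2) by auto
  then interpret S: self_adjoint "mat 1" H S l .
  have "det H = (\<Prod>i\<in>UNIV. l i)" using S.fn_det[of "\<lambda>x. x"] by (simp add: S.fn_id)
  also have "\<dots> > 0" using S.eigenvalue_pos assms(1) by (intro prod_pos) auto
  finally show ?thesis .
qed

lemma matvec_axis: "A *v axis a 1 = column a (A :: 'a::semiring_1^'n^'m::finite)"
  by (simp add: vec_eq_iff matrix_vector_mult_def axis_def column_def if_distrib[of "\<lambda>x. _ * x"] sum.delta cong: if_cong)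

lemma differentiable_cong_open:
  assumes "open U" "x \<in> U" "\<And>y. y \<in> U \<Longrightarrow> f y = g y" "g differentiable at x"
  shows "f differentiable at x"
  using assms has_derivative_transform_within_open[OF _ assms(1,2), of g _ UNIV f]
  unfolding differentiable_def by (metis assms(3))

lemma frechet_sum_pd:
  fixes f :: "real^'m::finite \<Rightarrow> 'b::real_normed_vector"
  assumes "f differentiable at x"
  shows "frechet_derivative f (at x) v = (\<Sum>k\<in>UNIV. (v $ k) *\<^sub>R pd k f x)"
proof -
  have lin: "linear (frechet_derivative f (at x))" using assms by (rule linear_frechet_derivative)
  have "v = (\<Sum>k\<in>UNIV. (v $ k) *\<^sub>R axis k 1)"
    by (simp add: vec_eq_iff axis_def if_distrib sum.delta cong: if_cong)
  then have "frechet_derivative f (at x) v = frechet_derivative f (at x) (\<Sum>k\<in>UNIV. (v $ k) *\<^sub>R axis k 1)" by simp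
  then show ?thesis unfolding linear_sum[OF lin] linear_cmul[OF lin] pd_def .
qed

text \<open>That H is locally a Hessian enters through the symmetry \<open>dH\<close> of its first
  derivatives, so the curvature computation does not mention a potential.\<close>

locale kaehler_potential =
  fixes H :: "real^'n::finite \<Rightarrow> real^'n^'n"
  assumes H: "smooth H" "\<And>y. transpose (H y) = H y" "\<And>y. pos_def (H y)"
    and dH: "\<And>y i j k. pd k (\<lambda>y. H y $ i $ j) y = pd j (\<lambda>y. H y $ i $ k) y"
begin

definition "G y = matrix_inv (H y)"

lemma siegel: "siegel_point 0 (H y)"
  using H by unfold_locales auto

lemma GH: "G y ** H y = mat 1" "H y ** G y = mat 1"
  using siegel_point.GY[OF siegel] by (simp_all add: G_def siegel_point.G_def[OF siegel])

lemma G_sym: "transpose (G y) = G y"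
  using siegel_point.G_sym[OF siegel] by (simp add: G_def siegel_point.G_def[OF siegel])

lemma smooth_G: "smooth G"
  unfolding G_def[abs_def] by (intro smooth_matrix_inv H pos_def_det)

lemma pd_entry:
  fixes M :: "real^'m::finite \<Rightarrow> 'a::real_normed_vector^'k::finite^'l::finite"
  shows "M differentiable at x \<Longrightarrow> pd k (\<lambda>y. M y $ i $ j) x = pd k M x $ i $ j"
  by (rule pd_bounded_linear[where L = "\<lambda>M. M $ i $ j", OF bounded_linear_compose[OF bounded_linear_vec_nth bounded_linear_vec_nth]])

lemma H_entry_sym: "H y $ i $ j = H y $ j $ i"
  using arg_cong[OF H(2)[of y], of "\<lambda>M. M $ j $ i"] by (simp add: transpose_def)

lemma G_entry_sym: "G y $ i $ j = G y $ j $ i"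
  using arg_cong[OF G_sym[of y], of "\<lambda>M. M $ j $ i"] by (simp add: transpose_def)

lemma pd_G: "pd k G y = - (G y ** pd k H y ** G y)"
proof -
  have "(H has_derivative frechet_derivative H (at y)) (at y)"
    using smooth_differentiable[OF H(1)] frechet_derivative_works by blast
  from has_derivative_matrix_inv[OF this pos_def_det[OF H(3)]]
  show ?thesis unfolding G_def[abs_def] by (subst pd_eq) (auto simp: pd_def)
qed

lemma pd_lndet: "pd k (\<lambda>y. - ln (det (H y))) y = - trace (G y ** pd k H y)"
proof -
  have "(H has_derivative frechet_derivative H (at y)) (at y)"
    using smooth_differentiable[OF H(1)] frechet_derivative_works by blast
  from has_derivative_det[OF this pos_def_det[OF H(3)]]
  have "((\<lambda>y. - ln (det (H y))) has_derivative
      (\<lambda>h. - (det (H y) * trace (matrix_inv (H y) ** frechet_derivative H (at y) h) * inverse (det (H y))))) (at y)"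
    using pos_def_det_pos[OF H(3,2), of y]
    by (auto intro!: derivative_eq_intros simp: divide_inverse)
  from pd_eq[OF this, of k] show ?thesis using pos_def_det[OF H(3), of y] by (simp add: pd_def G_def)
qed

text \<open>By symmetry of the third derivatives, \<open>\<Sum>\<^sub>e G\<^sub>c\<^sub>e \<partial>\<^sub>e (- ln det H)\<close> is the divergence of \<open>G\<close>.\<close>

lemma divergence_G:
  "(\<Sum>e\<in>UNIV. G y $ c $ e * pd e (\<lambda>y. - ln (det (H y))) y) = (\<Sum>j\<in>UNIV. pd j (\<lambda>y. G y $ j $ c) y)"
proof -
  let ?H' = "\<lambda>e i j. pd e H y $ i $ j"
  have sH: "?H' e i j = ?H' j i e" for e i j
    using dH[of e i j y] smooth_differentiable[OF H(1), of y] by (simp add: pd_entry)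
  have key: "G y $ c $ e * (G y $ i $ j * ?H' e j i) = (G y $ i $ j * ?H' i j e) * G y $ e $ c" for e i j
    unfolding sH[of e j i] G_entry_sym[of y c e] by (simp add: mult_ac)
  have "(\<Sum>e\<in>UNIV. G y $ c $ e * pd e (\<lambda>y. - ln (det (H y))) y)
      = - (\<Sum>e\<in>UNIV. \<Sum>i\<in>UNIV. \<Sum>j\<in>UNIV. G y $ c $ e * (G y $ i $ j * ?H' e j i))"
    by (simp add: pd_lndet trace_def matrix_matrix_mult_def sum_distrib_left sum_negf)
  also have "\<dots> = - (\<Sum>i\<in>UNIV. \<Sum>e\<in>UNIV. \<Sum>j\<in>UNIV. (G y $ i $ j * ?H' i j e) * G y $ e $ c)"
    unfolding key by (rule arg_cong[where f=uminus], rule sum.swap)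
  also have "\<dots> = (\<Sum>j\<in>UNIV. pd j (\<lambda>y. G y $ j $ c) y)"
    by (simp add: pd_entry smooth_differentiable[OF smooth_G] pd_G matrix_matrix_mult_def sum_distrib_right sum_negf)
  finally show ?thesis .
qed

text \<open>With s = -\<i> this is the derivative along \<open>Z_c\<close>, with s = \<i> along its
  conjugate. Holomorphy is the vanishing of the latter for every c.\<close>

definition Dop :: "complex \<Rightarrow> 'n \<Rightarrow> ('n vec2 \<Rightarrow> complex) \<Rightarrow> 'n vec2 \<Rightarrow> complex" where
  "Dop s c f q = (1 / 2) * ((\<Sum>e\<in>UNIV. of_real (G (y_part q) $ c $ e) * pd (Inl e) f q) + s * pd (Inr c) f q)"

lemma Dop_const: "Dop s c (\<lambda>q. k) q = 0" by (simp add: Dop_def)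

lemma Dop_cong: "open U \<Longrightarrow> q \<in> U \<Longrightarrow> (\<And>x. x \<in> U \<Longrightarrow> f x = h x) \<Longrightarrow> Dop s c f q = Dop s c h q"
  unfolding Dop_def using pd_cong_open[of U q f h] by simp

lemma Dop_add:
  assumes "f differentiable at q" "h differentiable at q"
  shows "Dop s c (\<lambda>q. f q + h q) q = Dop s c f q + Dop s c h q"
  by (simp add: Dop_def pd_add[OF assms] algebra_simps sum.distrib)

lemma Dop_mult:
  assumes "f differentiable at q" "h differentiable at q"
  shows "Dop s c (\<lambda>q. f q * h q) q = f q * Dop s c h q + Dop s c f q * h q"
  by (simp add: Dop_def pd_mult[OF assms] algebra_simps sum.distrib sum_distrib_left sum_distrib_right)

lemma Dop_sum:
  assumes "\<And>i. i \<in> I \<Longrightarrow> f i differentiable at q"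
  shows "Dop s c (\<lambda>q. \<Sum>i\<in>I. f i q) q = (\<Sum>i\<in>I. Dop s c (f i) q)"
  using assms
proof (induction I rule: infinite_finite_induct)
  case (insert i I)
  then have "(\<lambda>q. \<Sum>i\<in>I. f i q) differentiable at q" by (intro differentiable_sum) auto
  then show ?case using insert by (simp add: Dop_add)
qed (simp_all add: Dop_const)

lemma Dop_cnj:
  assumes "f differentiable at q" shows "Dop s c (\<lambda>q. cnj (f q)) q = cnj (Dop (cnj s) c f q)"
  by (simp add: Dop_def pd_bounded_linear[OF bounded_linear_cnj assms])

lemma differentiable_cnj: "f differentiable at q \<Longrightarrow> (\<lambda>q. cnj (f q)) differentiable at q"
  by (rule differentiable_compose[OF bounded_linear_imp_differentiable[OF bounded_linear_cnj]])

lemma Gy_differentiable: "(\<lambda>q. complex_of_real (G (y_part q) $ c $ e)) differentiable at q"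
  by (intro smooth_differentiable smooth_of_real smooth_y_part smooth_entry smooth_G)

lemma pd_Gy: "pd (Inr a) (\<lambda>q. complex_of_real (G (y_part q) $ c $ e)) q = 0"
  using pd_y_part(2)[of "\<lambda>y. complex_of_real (G y $ c $ e)" q a]
    smooth_differentiable[OF smooth_of_real[OF smooth_entry[OF smooth_G]]] by blast

text \<open>The coefficients of the frame depend on y only. Consequently w-derivatives of
  holomorphic functions are holomorphic, which supplies all holomorphic functions needed
  below.\<close>

lemma Dop_pd_w:
  assumes U: "open U" "q \<in> U" and f: "smooth_in U f"
  shows "Dop s c (pd (Inr a) f) q = pd (Inr a) (Dop s c f) q"
proof -
  have d: "pd k f differentiable at q" for k using smooth_in_differentiable[OF smooth_in_pd[OF f] U] .
  let ?g = "\<lambda>e q. complex_of_real (G (y_part q) $ c $ e)"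
  have 1: "(\<lambda>q. ?g e q * pd (Inl e) f q) differentiable at q" for e
    by (intro differentiable_mult Gy_differentiable d)
  have ds: "(\<lambda>q. \<Sum>e\<in>I. ?g e q * pd (Inl e) f q) differentiable at q" if "finite I" for I
    by (intro differentiable_sum that) (use 1 in blast)
  have 2: "pd (Inr a) (\<lambda>q. \<Sum>e\<in>I. ?g e q * pd (Inl e) f q) q = (\<Sum>e\<in>I. ?g e q * pd (Inr a) (pd (Inl e) f) q)"
    if "finite I" for I
    using that
  proof (induction I rule: finite_induct)
    case (insert e I)
    have "pd (Inr a) (\<lambda>q. ?g e q * pd (Inl e) f q) q = ?g e q * pd (Inr a) (pd (Inl e) f) q"
      by (simp add: pd_mult[OF Gy_differentiable d] pd_Gy)
    then show ?case using insert by (simp add: pd_add[OF 1 ds])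
  qed simp
  have m: "pd k (\<lambda>q. cc * h q) q = cc * pd k h q" if "h differentiable at q" for cc k and h :: "'n vec2 \<Rightarrow> complex"
    using pd_bounded_linear[OF bounded_linear_mult_right that] .
  have dm: "(\<lambda>q. cc * h q) differentiable at q" if "h differentiable at q" for cc and h :: "'n vec2 \<Rightarrow> complex"
    by (intro differentiable_mult differentiable_const that)
  have "pd (Inr a) (Dop s c f) q = (1 / 2) * ((\<Sum>e\<in>UNIV. ?g e q * pd (Inr a) (pd (Inl e) f) q) + s * pd (Inr a) (pd (Inr c) f) q)"
  proof -
    have A: "(\<lambda>q. (\<Sum>e\<in>UNIV. ?g e q * pd (Inl e) f q) + s * pd (Inr c) f q) differentiable at q"
      by (intro differentiable_add ds dm d) simp
    show ?thesis
      unfolding Dop_def[abs_def] m[OF A] pd_add[OF ds[OF finite] dm[OF d]] m[OF d] 2[OF finite] ..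
  qed
  then show ?thesis by (simp add: Dop_def pd_commute[OF f U])
qed

definition "JH q = Jm 0 (H (y_part q))"

lemma JH_block: "JH q = block_mat 0 (- G (y_part q)) (H (y_part q)) 0"
  using potential_matrix.J0[of "H (y_part q)"] siegel[of "y_part q"]
  by (simp add: JH_def potential_matrix_def G_def siegel_point.G_def)

end

section \<open>Scalar curvature in an arbitrary holomorphic chart\<close>

locale kaehler_chart = kaehler_potential H for H :: "real^'n::finite \<Rightarrow> real^'n^'n" +
  fixes U :: "'n vec2 set" and z :: "'n vec2 \<Rightarrow> complex^'n"
  assumes chart: "holomorphic_chart JH U z"
begin

lemma U: "open U" and z: "smooth_in U z"
  using chart by (simp_all add: holomorphic_chart_def)

text \<open>Differentiability of z is known on U only, so derivatives of components are identified
  with components of derivatives on U, one order at a time, by locality of derivatives on open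
  sets.\<close>

lemma zb: "smooth_in U (\<lambda>x. z x $ b)"
proof -
  have eq: "\<forall>x\<in>U. foldr pd ks (\<lambda>x. z x $ b) x = foldr pd ks z x $ b" for ks
  proof (induction ks)
    case (Cons k ks)
    have d: "foldr pd ks z differentiable at x" if "x \<in> U" for x
      using z that U by (auto simp: smooth_in_def differentiable_on_eq_differentiable_at)
    show ?case
    proof
      fix x assume x: "x \<in> U"
      have "pd k (foldr pd ks (\<lambda>x. z x $ b)) x = pd k (\<lambda>x. foldr pd ks z x $ b) x"
        by (rule pd_cong_open[OF U x]) (use Cons in blast)
      then show "foldr pd (k # ks) (\<lambda>x. z x $ b) x = foldr pd (k # ks) z x $ b"
        using pd_bounded_linear[OF bounded_linear_vec_nth d[OF x]] by simp
    qed
  qed simp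
  have "(\<lambda>x. foldr pd ks z x $ b) differentiable at x" if "x \<in> U" for ks x
  proof -
    have "foldr pd ks z differentiable at x"
      using z U that by (auto simp: smooth_in_def differentiable_on_eq_differentiable_at)
    then show ?thesis
      by (rule differentiable_compose[OF bounded_linear_imp_differentiable[OF bounded_linear_vec_nth]])
  qed
  note d = this
  show ?thesis
    unfolding smooth_in_def differentiable_on_eq_differentiable_at[OF U]
  proof (intro allI ballI)
    fix ks x assume x: "x \<in> U"
    show "foldr pd ks (\<lambda>x. z x $ b) differentiable at x"
      by (rule differentiable_cong_open[OF U x _ d[OF x]]) (use eq in blast)
  qed
qed

text \<open>The Jacobian of the chart in the frame, with entries \<open>Z_c\<close> applied to the
  coordinate b. By the Cauchy--Riemann equations it is expressed through w-derivatives
  alone.\<close>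

definition "Ph x = (\<chi> b c. - \<i> * pd (Inr c) (\<lambda>x. z x $ b) x)"

lemma pd_z_w: "pd (Inr c) (\<lambda>x. z x $ b) x = \<i> * Ph x $ b $ c"
  by (simp add: Ph_def)

text \<open>Complex linearity of the derivative of z, evaluated on \<partial>/\<partial>w.\<close>

lemma Db_z: "q \<in> U \<Longrightarrow> Dop \<i> c (\<lambda>x. z x $ b) q = 0"
proof -
  assume q: "q \<in> U"
  have d: "z differentiable at q" using smooth_in_differentiable[OF z U q] .
  have z': "frechet_derivative z (at q) v $ b = (\<Sum>k\<in>UNIV. of_real (v $ k) * pd k (\<lambda>x. z x $ b) q)" for v
    by (simp add: frechet_sum_pd[OF d] pd_bounded_linear[OF bounded_linear_vec_nth d]
        scaleR_conv_of_real[where 'a=complex])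
  have "frechet_derivative z (at q) (JH q *v axis (Inr c) 1) = \<i> *s frechet_derivative z (at q) (axis (Inr c) 1)"
    using chart q by (simp add: holomorphic_chart_def)
  then have "frechet_derivative z (at q) (JH q *v axis (Inr c) 1) $ b = \<i> * frechet_derivative z (at q) (axis (Inr c) 1) $ b"
    by simp
  moreover have "(JH q *v axis (Inr c) 1) $ Inl e = - G (y_part q) $ c $ e" "(JH q *v axis (Inr c) 1) $ Inr e = 0" for e
    using G_entry_sym[of "y_part q" e c]
    by (simp_all add: JH_block matrix_vector_mult_def sum_UNIV_plus axis_def if_distrib[of "\<lambda>x. _ * x"] sum.delta cong: if_cong)
  ultimately have "- (\<Sum>e\<in>UNIV. of_real (G (y_part q) $ c $ e) * pd (Inl e) (\<lambda>x. z x $ b) q) = \<i> * pd (Inr c) (\<lambda>x. z x $ b) q"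
    by (simp add: z' sum_UNIV_plus sum_negf) (simp add: axis_def if_distrib[of of_real] if_distrib[of "\<lambda>x. x * _"] sum.delta cong: if_cong)
  then have e: "(\<Sum>e\<in>UNIV. of_real (G (y_part q) $ c $ e) * pd (Inl e) (\<lambda>x. z x $ b) q) + \<i> * pd (Inr c) (\<lambda>x. z x $ b) q = 0"
    by (simp add: neg_eq_iff_add_eq_0)
  show ?thesis unfolding Dop_def e by simp
qed

lemma pd_z_y:
  assumes q: "q \<in> U" shows "pd (Inl e) (\<lambda>x. z x $ b) q = (\<Sum>c\<in>UNIV. of_real (H (y_part q) $ e $ c) * Ph q $ b $ c)"
proof -
  define v where "v = (\<chi> e. pd (Inl e) (\<lambda>x. z x $ b) q)"
  have "cmat (G (y_part q)) *v v = Ph q $ b"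
  proof -
    have "(cmat (G (y_part q)) *v v) $ c = Ph q $ b $ c" for c
      using Db_z[OF q, of c b] pd_z_w[of c b q]
      by (simp add: Dop_def v_def matrix_vector_mult_def mult.assoc[symmetric] add_eq_0_iff2)
    then show ?thesis by (simp add: vec_eq_iff)
  qed
  then have "cmat (H (y_part q)) *v (cmat (G (y_part q)) *v v) = cmat (H (y_part q)) *v Ph q $ b" by simp
  then have "v = cmat (H (y_part q)) *v Ph q $ b"
    by (simp add: matrix_vector_mul_assoc cmat_mult[symmetric] GH)
  then have "v $ e = (cmat (H (y_part q)) *v Ph q $ b) $ e" by simp
  then show ?thesis by (simp add: v_def matrix_vector_mult_def)
qed

lemma Ph_smooth: "smooth_in U (\<lambda>x. pd (Inr c) (\<lambda>x. z x $ b) x)"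
  using smooth_in_pd[OF zb] .

lemma Ph_differentiable: "q \<in> U \<Longrightarrow> (\<lambda>x. Ph x $ b $ c) differentiable at q"
  using smooth_in_differentiable[OF Ph_smooth U, of q c b]
  by (simp add: Ph_def differentiable_mult)

lemma Db_w: "q \<in> U \<Longrightarrow> smooth_in U f \<Longrightarrow> (\<And>x. x \<in> U \<Longrightarrow> Dop s d f x = 0) \<Longrightarrow> Dop s d (pd (Inr c) f) q = 0"
  using Dop_pd_w[OF U, of q f s d c] pd_cong_open[OF U, of q "Dop s d f" "\<lambda>_. 0" "Inr c"] by simp

lemma Db_Ph: "q \<in> U \<Longrightarrow> Dop \<i> d (\<lambda>x. Ph x $ b $ c) q = 0"
  using Db_w[OF _ zb Db_z, of q d c b] Dop_mult[OF differentiable_const smooth_in_differentiable[OF Ph_smooth U], of q \<i> d "- \<i>" c b]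
  by (simp add: Ph_def Dop_const)

text \<open>The derivative of the chart sends the real vector (G Re x, Im x) to
  \<open>Ph q *v x\<close>, and it is injective on real vectors.\<close>

lemma Ph_inv: assumes q: "q \<in> U" shows "det (Ph q) \<noteq> 0"
proof (rule det_nonzero_ker)
  fix x assume 0: "Ph q *v x = 0"
  have d: "z differentiable at q" using smooth_in_differentiable[OF z U q] .
  define p where "p = pair_vec (G (y_part q) *v (\<chi> a. Re (x $ a))) (\<chi> a. Im (x $ a))"
  have "frechet_derivative z (at q) p $ b = (Ph q *v x) $ b" for b
  proof -
    have z': "frechet_derivative z (at q) v $ b = (\<Sum>k\<in>UNIV. of_real (v $ k) * pd k (\<lambda>x. z x $ b) q)" for v
      by (simp add: frechet_sum_pd[OF d] pd_bounded_linear[OF bounded_linear_vec_nth d]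
          scaleR_conv_of_real[where 'a=complex])
    have hg: "H (y_part q) *v (G (y_part q) *v r) = r" for r by (simp add: matrix_vector_mul_assoc GH)
    note sH = H_entry_sym[of "y_part q"]
    have "(\<Sum>e\<in>UNIV. of_real (p $ Inl e) * pd (Inl e) (\<lambda>x. z x $ b) q)
        = (\<Sum>c\<in>UNIV. Ph q $ b $ c * of_real ((H (y_part q) *v (\<chi> e. p $ Inl e)) $ c))"
      unfolding pd_z_y[OF q]
      by (simp add: sum_distrib_left matrix_vector_mult_def)
        (subst sum.swap, simp add: sH mult_ac)
    also have "H (y_part q) *v (\<chi> e. p $ Inl e) = (\<chi> a. Re (x $ a))"
      by (simp add: p_def hg)
    finally have 1: "(\<Sum>e\<in>UNIV. of_real (p $ Inl e) * pd (Inl e) (\<lambda>x. z x $ b) q) = (\<Sum>c\<in>UNIV. Ph q $ b $ c * of_real (Re (x $ c)))"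
      by simp
    have "frechet_derivative z (at q) p $ b = (\<Sum>c\<in>UNIV. Ph q $ b $ c * of_real (Re (x $ c)))
       + (\<Sum>c\<in>UNIV. Ph q $ b $ c * (\<i> * of_real (Im (x $ c))))"
      unfolding z' sum_UNIV_plus 1 by (simp add: p_def pd_z_w mult_ac)
    also have "\<dots> = (Ph q *v x) $ b"
      unfolding sum.distrib[symmetric] distrib_left[symmetric] complex_eq[symmetric]
      by (simp add: matrix_vector_mult_def)
    finally show ?thesis .
  qed
  then have "frechet_derivative z (at q) p = frechet_derivative z (at q) 0"
    using 0 linear_0[OF linear_frechet_derivative[OF d]] by (simp add: vec_eq_iff)
  then have "p = 0" using chart q by (auto simp: holomorphic_chart_def dest: injD)
  then have g0: "G (y_part q) *v (\<chi> a. Re (x $ a)) = 0" and i0: "(\<chi> a. Im (x $ a)) = 0"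
    using pair_vec_eq_iff[of _ _ 0 0] by (auto simp: p_def pair_vec_zero)
  have "Im (x $ a) = 0" for a using arg_cong[OF i0, of "\<lambda>v. v $ a"] by simp
  moreover have "H (y_part q) *v (G (y_part q) *v (\<chi> a. Re (x $ a))) = 0" unfolding g0 by simp
  then have "(\<chi> a. Re (x $ a)) = 0" by (simp add: matrix_vector_mul_assoc GH)
  ultimately have "(\<chi> a. Re (x $ a)) = 0" "\<And>a. Im (x $ a) = 0" by simp_all
  then show "x = 0" by (simp add: vec_eq_iff complex_eq_iff)
qed

definition "Ps q = matrix_inv (Ph q)"

lemma PhPs: "q \<in> U \<Longrightarrow> Ph q ** Ps q = mat 1" "q \<in> U \<Longrightarrow> Ps q ** Ph q = mat 1"
  unfolding Ps_def using matrix_inv_props Ph_inv invertible_det_nz by blast+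

lemma Ph_mat_differentiable: "q \<in> U \<Longrightarrow> Ph differentiable at q"
proof -
  assume q: "q \<in> U"
  have "((\<lambda>x. \<chi> b c. Ph x $ b $ c) has_derivative (\<lambda>h. \<chi> b c. frechet_derivative (\<lambda>x. Ph x $ b $ c) (at q) h)) (at q)"
    by (intro has_derivative_vec_lambda) (use Ph_differentiable[OF q] frechet_derivative_works in blast)
  then show ?thesis unfolding differentiable_def by auto
qed

lemma Ps_deriv: "q \<in> U \<Longrightarrow> Ps differentiable at q" "q \<in> U \<Longrightarrow> pd k Ps q = - (Ps q ** pd k Ph q ** Ps q)"
proof -
  assume q: "q \<in> U"
  have "(Ph has_derivative frechet_derivative Ph (at q)) (at q)"
    using Ph_mat_differentiable[OF q] frechet_derivative_works by blast
  from has_derivative_matrix_inv[OF this Ph_inv[OF q]]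
  have D: "(Ps has_derivative (\<lambda>h. - (Ps q ** frechet_derivative Ph (at q) h ** Ps q))) (at q)"
    unfolding Ps_def[abs_def] .
  show "Ps differentiable at q" using D unfolding differentiable_def by blast
  show "pd k Ps q = - (Ps q ** pd k Ph q ** Ps q)" using pd_eq[OF D] by (simp add: pd_def)
qed

lemma Ps_differentiable: "q \<in> U \<Longrightarrow> (\<lambda>x. Ps x $ b $ c) differentiable at q"
  by (rule differentiable_compose[OF bounded_linear_imp_differentiable[OF bounded_linear_vec_nth]
        differentiable_compose[OF bounded_linear_imp_differentiable[OF bounded_linear_vec_nth] Ps_deriv(1)]])

lemma Dop_matrix: "M differentiable at q \<Longrightarrow> Dop s d (\<lambda>x. M x $ b $ c) q
   = ((1 / 2) *k ((\<Sum>e\<in>UNIV. of_real (G (y_part q) $ d $ e) *k pd (Inl e) M q) + s *k pd (Inr d) M q)) $ b $ c"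
  for M :: "'n vec2 \<Rightarrow> complex^'k::finite^'l::finite"
  by (simp add: Dop_def pd_entry)

lemma Db_Ps: assumes q: "q \<in> U" shows "Dop \<i> d (\<lambda>x. Ps x $ b $ c) q = 0"
proof -
  let ?D = "\<lambda>M. (1 / 2) *k ((\<Sum>e\<in>UNIV. of_real (G (y_part q) $ d $ e) *k pd (Inl e) M q) + \<i> *k pd (Inr d) M q)"
  have "?D Ph = 0" using Db_Ph[OF q, of d] by (simp add: Dop_matrix[OF Ph_mat_differentiable[OF q]] vec_eq_iff)
  then have "Ps q ** ?D Ph ** Ps q = 0" by simp
  moreover have "?D Ps = - (Ps q ** ?D Ph ** Ps q)"
    unfolding Ps_deriv(2)[OF q]
    by (simp add: mat_expand cscale_minus sum_negf bounded_bilinear.sum_right[OF bounded_bilinear_matmul]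
        bounded_bilinear.sum_left[OF bounded_bilinear_matmul])
  ultimately show ?thesis by (simp add: Dop_matrix[OF Ps_deriv(1)[OF q]])
qed

text \<open>The coordinate field is the combination of the \<open>Z_c\<close> with coefficients from
  column a of the inverse Jacobian. The two systems of dual equations separate into one for H P +
  \<i> Q and one for H P - \<i> Q.\<close>

lemma coord_field_eq:
  assumes q: "q \<in> U"
  shows "coord_field z a q = pair_vec ((1 / 2) *s (cmat (G (y_part q)) *v column a (Ps q))) ((- \<i> / 2) *s column a (Ps q))"
proof -
  let ?G = "cmat (G (y_part q)) :: complex^'n^'n" and ?H = "cmat (H (y_part q)) :: complex^'n^'n"
  note sH = H_entry_sym[of "y_part q"]
  have s1: "(\<Sum>k\<in>UNIV. pair_vec P Q $ k * pd k (\<lambda>x. z x $ b) q) = (Ph q *v (?H *v P + \<i> *s Q)) $ b" for P Q b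
  proof -
    have "(\<Sum>k\<in>UNIV. pair_vec P Q $ k * pd k (\<lambda>x. z x $ b) q)
      = (\<Sum>e\<in>UNIV. \<Sum>c\<in>UNIV. P $ e * (of_real (H (y_part q) $ e $ c) * Ph q $ b $ c)) + (\<Sum>c\<in>UNIV. Q $ c * (\<i> * Ph q $ b $ c))"
      by (simp add: sum_UNIV_plus pd_z_y[OF q] pd_z_w sum_distrib_left)
    also have "(\<Sum>e\<in>UNIV. \<Sum>c\<in>UNIV. P $ e * (of_real (H (y_part q) $ e $ c) * Ph q $ b $ c)) =
      (\<Sum>c\<in>UNIV. Ph q $ b $ c * (?H *v P) $ c)"
      by (subst sum.swap) (simp add: matrix_vector_mult_def sum_distrib_left sH mult_ac)
    finally show ?thesis
      by (simp add: matrix_vector_mult_def[of "Ph q"] algebra_simps sum.distrib)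
  qed
  have s2: "(\<Sum>k\<in>UNIV. pair_vec P Q $ k * cnj (pd k (\<lambda>x. z x $ b) q)) = (cnj_mat (Ph q) *v (?H *v P - \<i> *s Q)) $ b" for P Q b
  proof -
    have "(\<Sum>k\<in>UNIV. pair_vec P Q $ k * cnj (pd k (\<lambda>x. z x $ b) q))
      = cnj (\<Sum>k\<in>UNIV. pair_vec (cnj_vec P) (cnj_vec Q) $ k * pd k (\<lambda>x. z x $ b) q)"
      by (simp add: sum_UNIV_plus cnj_vec_def)
    also have "\<dots> = (cnj_mat (Ph q) *v (?H *v P - \<i> *s Q)) $ b"
      unfolding s1 by (simp add: matrix_vector_mult_def cnj_vec_def algebra_simps sum.distrib sum_subtractf sum_negf)
    finally show ?thesis .
  qed
  have inj: "cnj_mat (Ph q) *v x = 0 \<longleftrightarrow> x = 0" for x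
  proof
    assume "cnj_mat (Ph q) *v x = 0"
    then have "cnj_mat (Ps q) *v (cnj_mat (Ph q) *v x) = 0" by simp
    then show "x = 0" by (simp add: matrix_vector_mul_assoc cnj_mat_mult[symmetric] PhPs[OF q])
  qed simp
  have ax: "axis a 1 $ b = (if a = b then 1 else (0::complex))" for b by (auto simp: axis_def)
  have cond: "(\<forall>b. (\<Sum>k\<in>UNIV. pair_vec P Q $ k * pd k (\<lambda>x. z x $ b) q) = (if a = b then 1 else 0) \<and>
     (\<Sum>k\<in>UNIV. pair_vec P Q $ k * cnj (pd k (\<lambda>x. z x $ b) q)) = 0) \<longleftrightarrow>
     P = (1 / 2) *s (?G *v column a (Ps q)) \<and> Q = (- \<i> / 2) *s column a (Ps q)" (is "?L \<longleftrightarrow> ?R") for P Q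
  proof -
    have "?L \<longleftrightarrow> Ph q *v (?H *v P + \<i> *s Q) = axis a 1 \<and> cnj_mat (Ph q) *v (?H *v P - \<i> *s Q) = 0"
      unfolding s1 s2 vec_eq_iff ax by auto
    also have "\<dots> \<longleftrightarrow> ?H *v P + \<i> *s Q = column a (Ps q) \<and> ?H *v P - \<i> *s Q = 0"
    proof -
      have "Ph q *v x = axis a 1 \<longleftrightarrow> x = column a (Ps q)" for x
      proof
        assume "Ph q *v x = axis a 1"
        then have "Ps q *v (Ph q *v x) = Ps q *v axis a 1" by simp
        then show "x = column a (Ps q)" by (simp add: matrix_vector_mul_assoc PhPs[OF q] matvec_axis)
      next
        assume "x = column a (Ps q)"
        then have "Ph q *v x = Ph q *v (Ps q *v axis a 1)" by (simp add: matvec_axis)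
        then show "Ph q *v x = axis a 1" by (simp add: matrix_vector_mul_assoc PhPs[OF q])
      qed
      then show ?thesis by (simp only: inj)
    qed
    also have "\<dots> \<longleftrightarrow> ?R"
    proof
      assume *: "?H *v P + \<i> *s Q = column a (Ps q) \<and> ?H *v P - \<i> *s Q = 0"
      then have HP: "?H *v P = \<i> *s Q" by simp
      with * have "column a (Ps q) = (2 * \<i>) *s Q" by (auto simp: vec_eq_iff algebra_simps)
      then have Q: "Q = (- \<i> / 2) *s column a (Ps q)" by (simp add: vec_eq_iff)
      have "?G *v (?H *v P) = ?G *v (\<i> *s Q)" by (simp add: HP)
      then have "P = ?G *v (\<i> *s Q)" by (simp add: matrix_vector_mul_assoc cmat_mult[symmetric] GH)
      also have "\<i> *s Q = (1 / 2) *s column a (Ps q)" by (simp add: Q vec_eq_iff)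
      finally show ?R using Q by (simp add: matvec_scale)
    next
      assume R: ?R
      have HP: "?H *v P = (1 / 2) *s column a (Ps q)"
        using R by (simp add: matvec_scale matrix_vector_mul_assoc cmat_mult[symmetric] GH)
      show "?H *v P + \<i> *s Q = column a (Ps q) \<and> ?H *v P - \<i> *s Q = 0"
        unfolding HP conjunct2[OF R] by (simp add: vec_eq_iff)
    qed
    finally show ?thesis .
  qed
  show ?thesis
    unfolding coord_field_def
  proof (rule the_equality)
    fix Z assume Z: "\<forall>b. (\<Sum>k\<in>UNIV. Z $ k * pd k (\<lambda>x. z x $ b) q) = (if a = b then 1 else 0) \<and>
       (\<Sum>k\<in>UNIV. Z $ k * cnj (pd k (\<lambda>x. z x $ b) q)) = 0"
    obtain P Q where PQ: "Z = pair_vec P Q" using pair_vec_exists by blast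
    show "Z = pair_vec ((1 / 2) *s (?G *v column a (Ps q))) ((- \<i> / 2) *s column a (Ps q))"
      using Z unfolding PQ cond pair_vec_eq_iff .
  qed (use cond in blast)
qed

end

lemma det_cmat: "det (cmat A :: 'a::{real_algebra_1, comm_ring_1}^'n^'n::finite) = of_real (det A)"
  by (simp add: det_def)

lemma det_cnj_mat: "det (cnj_mat A) = cnj (det A)"
  by (simp add: det_def)

lemma matrix_inv_eqI:
  fixes A :: "'a::field^'n^'n::finite"
  assumes "A ** B = mat 1" shows "matrix_inv A = B"
proof -
  have "B ** A = mat 1" using assms matrix_left_right_inverse by blast
  then have "invertible A" using assms invertible_def by blast
  then have "matrix_inv A ** (A ** B) = B" by (simp add: matrix_mul_assoc matrix_inv_props)
  then show ?thesis by (simp add: assms)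
qed

context kaehler_chart
begin

lemma dz_eq:
  assumes q: "q \<in> U" shows "dz z a f q = (\<Sum>c\<in>UNIV. Ps q $ c $ a * Dop (- \<i>) c f q)"
proof -
  have "(\<Sum>c\<in>UNIV. Ps q $ c $ a * Dop (- \<i>) c f q) =
     (\<Sum>c\<in>UNIV. \<Sum>e\<in>UNIV. Ps q $ c $ a * (1 / 2) * (of_real (G (y_part q) $ c $ e) * pd (Inl e) f q))
     + (\<Sum>c\<in>UNIV. (- \<i> / 2) * Ps q $ c $ a * pd (Inr c) f q)"
    by (simp add: Dop_def sum.distrib[symmetric] sum_distrib_left algebra_simps)
  also have "(\<Sum>c\<in>UNIV. \<Sum>e\<in>UNIV. Ps q $ c $ a * (1 / 2) * (of_real (G (y_part q) $ c $ e) * pd (Inl e) f q)) =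
    (\<Sum>e\<in>UNIV. (1 / 2) * (cmat (G (y_part q)) *v column a (Ps q)) $ e * pd (Inl e) f q)"
    by (subst sum.swap) (simp add: matrix_vector_mult_def column_def sum_distrib_left sum_distrib_right sum_divide_distrib
        G_entry_sym[of "y_part q"] mult_ac)
  finally show ?thesis
    unfolding dz_def vec_deriv_def coord_field_eq[OF q] sum_UNIV_plus pair_vec_nth vector_smult_component
    by (simp add: column_def)
qed

lemma dzbar_eq:
  assumes q: "q \<in> U" shows "dzbar z a f q = (\<Sum>c\<in>UNIV. cnj (Ps q $ c $ a) * Dop \<i> c f q)"
proof -
  have "(\<Sum>c\<in>UNIV. cnj (Ps q $ c $ a) * Dop \<i> c f q) =
     (\<Sum>c\<in>UNIV. \<Sum>e\<in>UNIV. cnj (Ps q $ c $ a) * (1 / 2) * (of_real (G (y_part q) $ c $ e) * pd (Inl e) f q))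
     + (\<Sum>c\<in>UNIV. (\<i> / 2) * cnj (Ps q $ c $ a) * pd (Inr c) f q)"
    by (simp add: Dop_def sum.distrib[symmetric] sum_distrib_left algebra_simps)
  also have "(\<Sum>c\<in>UNIV. \<Sum>e\<in>UNIV. cnj (Ps q $ c $ a) * (1 / 2) * (of_real (G (y_part q) $ c $ e) * pd (Inl e) f q)) =
    (\<Sum>e\<in>UNIV. cnj ((1 / 2) * (cmat (G (y_part q)) *v column a (Ps q)) $ e) * pd (Inl e) f q)"
    by (subst sum.swap) (simp add: matrix_vector_mult_def column_def sum_distrib_left sum_distrib_right sum_divide_distrib
        G_entry_sym[of "y_part q"] mult_ac)
  finally show ?thesis
    unfolding dzbar_def vec_deriv_def coord_field_eq[OF q] sum_UNIV_plus cnj_vec_def vec_lambda_beta pair_vec_nth vector_smult_component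
    by (simp add: column_def)
qed

text \<open>In the frame the metric is G: the factor 2 of the symplectic form meets two equal terms,
  each with the factor 1/4 from the two halves in the frame. The inverse Jacobian then changes the
  frame.\<close>

lemma metric_eq:
  assumes q: "q \<in> U"
  shows "metric_mat JH z q = transpose (Ps q) ** (cmat (G (y_part q)) ** cnj_mat (Ps q))"
proof -
  let ?G = "cmat (G (y_part q)) :: complex^'n^'n" and ?H = "cmat (H (y_part q)) :: complex^'n^'n"
  have "omega (coord_field z a q) (cmat (JH q) *v cnj_vec (coord_field z b q)) =
    (transpose (Ps q) ** (?G ** cnj_mat (Ps q))) $ a $ b" for a b
  proof -
    define A where "A = column a (Ps q)"
    define B where "B = cnj_vec (column b (Ps q))"
    have "cnj_vec (coord_field z b q) = pair_vec ((1 / 2) *s (?G *v B)) ((\<i> / 2) *s B)"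
      unfolding coord_field_eq[OF q] B_def
      by (simp add: vec_eq_iff all_plus cnj_vec_def matrix_vector_mult_def)
    moreover have "cmat (JH q) = block_mat 0 (- ?G) ?H 0" by (simp add: JH_block block_mat_cmat cmat_minus)
    ultimately have w: "cmat (JH q) *v cnj_vec (coord_field z b q) = pair_vec ((- \<i> / 2) *s (?G *v B)) ((1 / 2) *s B)"
      by (simp add: block_mat_vec matvec_scale matvec_minus matrix_vector_mul_assoc cmat_mult[symmetric] GH)
    have "omega (coord_field z a q) (cmat (JH q) *v cnj_vec (coord_field z b q)) =
      2 * (\<Sum>c\<in>UNIV. (1 / 4) * ((?G *v A) $ c * B $ c) + (1 / 4) * (A $ c * (?G *v B) $ c))"
      unfolding w unfolding coord_field_eq[OF q] A_def[symmetric] omega_def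
      by (intro arg_cong[where f = "\<lambda>x. 2 * x"] sum.cong refl) (simp add: algebra_simps)
    also have "\<dots> = (1 / 2) * ((\<Sum>c\<in>UNIV. (?G *v A) $ c * B $ c) + (\<Sum>c\<in>UNIV. A $ c * (?G *v B) $ c))"
      by (simp add: sum.distrib sum_divide_distrib[symmetric] sum_distrib_left[symmetric])
    also have "(\<Sum>c\<in>UNIV. (?G *v A) $ c * B $ c) = (\<Sum>c\<in>UNIV. A $ c * (?G *v B) $ c)"
      by (simp add: matrix_vector_mult_def sum_distrib_left sum_distrib_right)
        (subst sum.swap, simp add: G_entry_sym[of "y_part q"] mult_ac)
    also have "(1 / 2) * ((\<Sum>c\<in>UNIV. A $ c * (?G *v B) $ c) + (\<Sum>c\<in>UNIV. A $ c * (?G *v B) $ c)) = (\<Sum>c\<in>UNIV. A $ c * (?G *v B) $ c)"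
      by simp
    also have "\<dots> = (transpose (Ps q) ** (?G ** cnj_mat (Ps q))) $ a $ b"
      by (simp add: A_def B_def column_def cnj_vec_def matrix_matrix_mult_def matrix_vector_mult_def transpose_def)
    finally show ?thesis .
  qed
  then show ?thesis by (simp add: metric_mat_def vec_eq_iff)
qed

lemma det_H: "0 < det (H y)" using pos_def_det_pos H by blast

definition "D q = det (Ph q)"

lemma D: "q \<in> U \<Longrightarrow> D q \<noteq> 0" by (simp add: D_def Ph_inv)

text \<open>The determinant is det G times |det Ps|^2, a positive real number, so the principal
  logarithm is the real one and no branch is crossed.\<close>

lemma Ln_det_metric:
  assumes q: "q \<in> U"
  shows "Ln (det (metric_mat JH z q)) = of_real (- ln (det (H (y_part q)))) - of_real (ln ((cmod (D q))\<^sup>2))"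
proof -
  have "det (Ph q) * det (Ps q) = 1" using PhPs[OF q] by (metis det_I det_mul)
  then have dPs: "det (Ps q) = inverse (D q)" using D[OF q] by (simp add: D_def field_simps)
  have "det (G (y_part q)) * det (H (y_part q)) = 1" using GH by (metis det_I det_mul)
  then have dG: "det (G (y_part q)) = inverse (det (H (y_part q)))" using det_H[of "y_part q"] by (simp add: field_simps)
  have "det (metric_mat JH z q) = of_real (inverse (det (H (y_part q)))) * (inverse (D q) * cnj (inverse (D q)))"
    unfolding metric_eq[OF q] by (simp add: det_mul det_cmat det_cnj_mat dPs dG)
  also have "inverse (D q) * cnj (inverse (D q)) = of_real (inverse ((cmod (D q))\<^sup>2))"
    unfolding complex_norm_square[symmetric] by (simp add: norm_inverse power_inverse)
  finally have "det (metric_mat JH z q) = of_real (inverse (det (H (y_part q))) * inverse ((cmod (D q))\<^sup>2))" by simp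
  moreover have "0 < inverse (det (H (y_part q))) * inverse ((cmod (D q))\<^sup>2)"
    using det_H D[OF q] by (intro mult_pos_pos positive_imp_inverse_positive) auto
  ultimately have "Ln (det (metric_mat JH z q)) = of_real (ln (inverse (det (H (y_part q))) * inverse ((cmod (D q))\<^sup>2)))"
    by (simp only: Ln_of_real)
  also have "ln (inverse (det (H (y_part q))) * inverse ((cmod (D q))\<^sup>2)) = - ln (det (H (y_part q))) - ln ((cmod (D q))\<^sup>2)"
    using det_H[of "y_part q"] D[OF q] by (subst ln_mult) (auto simp: ln_inverse)
  finally show ?thesis by simp
qed

text \<open>The logarithmic derivative of det Ph in direction k.\<close>

definition "tk k q = trace (Ps q ** pd k Ph q)"

lemma tr_real_ln:
  assumes q: "q \<in> U"
  shows "(\<lambda>q. complex_of_real (ln ((cmod (D q))\<^sup>2))) differentiable at q"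
    "pd k (\<lambda>q. complex_of_real (ln ((cmod (D q))\<^sup>2))) q = tk k q + cnj (tk k q)"
proof -
  let ?D' = "\<lambda>h. D q * trace (Ps q ** frechet_derivative Ph (at q) h)"
  have "(Ph has_derivative frechet_derivative Ph (at q)) (at q)"
    using Ph_mat_differentiable[OF q] frechet_derivative_works by blast
  from has_derivative_det[OF this Ph_inv[OF q]]
  have dD: "(D has_derivative ?D') (at q)" by (simp add: D_def[abs_def] Ps_def)
  have dc: "((\<lambda>q. cnj (D q)) has_derivative (\<lambda>h. cnj (?D' h))) (at q)"
    by (rule bounded_linear.has_derivative[OF bounded_linear_cnj dD])
  let ?r' = "\<lambda>h. D q * cnj (?D' h) + ?D' h * cnj (D q)"
  have "((\<lambda>q. Re (D q * cnj (D q))) has_derivative (\<lambda>h. Re (?r' h))) (at q)"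
    by (rule bounded_linear.has_derivative[OF bounded_linear_Re has_derivative_mult[OF dD dc]])
  moreover have "Re (D q * cnj (D q)) = (cmod (D q))\<^sup>2" for q
    by (metis Re_complex_of_real complex_norm_square)
  ultimately have dr: "((\<lambda>q. (cmod (D q))\<^sup>2) has_derivative (\<lambda>h. Re (?r' h))) (at q)" by simp
  have pos: "0 < (cmod (D q))\<^sup>2" using D[OF q] by simp
  have dl: "((\<lambda>q. ln ((cmod (D q))\<^sup>2)) has_derivative (\<lambda>h. Re (?r' h) * inverse ((cmod (D q))\<^sup>2))) (at q)"
    using has_derivative_compose[OF dr DERIV_ln[OF pos, unfolded has_field_derivative_def]] by (simp add: mult.commute)
  have df: "((\<lambda>q. complex_of_real (ln ((cmod (D q))\<^sup>2))) has_derivative (\<lambda>h. of_real (Re (?r' h) * inverse ((cmod (D q))\<^sup>2)))) (at q)"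
    by (rule bounded_linear.has_derivative[OF bounded_linear_of_real dl])
  show "(\<lambda>q. complex_of_real (ln ((cmod (D q))\<^sup>2))) differentiable at q"
    using df unfolding differentiable_def by blast
  have "of_real (Re (?r' h)) = ?r' h" for h by (simp add: complex_eq_iff algebra_simps)
  then have "pd k (\<lambda>q. complex_of_real (ln ((cmod (D q))\<^sup>2))) q = ?r' (axis k 1) * inverse (D q * cnj (D q))"
    unfolding pd_eq[OF df] of_real_mult of_real_inverse complex_norm_square by simp
  also have "\<dots> = tk k q + cnj (tk k q)"
    using D[OF q] by (simp add: tk_def pd_def field_simps)
  finally show "pd k (\<lambda>q. complex_of_real (ln ((cmod (D q))\<^sup>2))) q = tk k q + cnj (tk k q)" .
qed

lemma Db_tk:
  assumes q: "q \<in> U" shows "(\<Sum>e\<in>UNIV. of_real (G (y_part q) $ c $ e) * tk (Inl e) q) + \<i> * tk (Inr c) q = 0"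
proof -
  let ?D = "\<lambda>M. (1 / 2) *k ((\<Sum>e\<in>UNIV. of_real (G (y_part q) $ c $ e) *k pd (Inl e) M q) + \<i> *k pd (Inr c) M q)"
  have "?D Ph = 0" using Db_Ph[OF q, of c] by (simp add: Dop_matrix[OF Ph_mat_differentiable[OF q]] vec_eq_iff)
  then have "trace (Ps q ** (2 *k ?D Ph)) = 0" by simp
  then show ?thesis
    by (simp add: cscale_cscale tk_def matrix_add_ldistrib trace_add cscale_mult_right trace_cscale
        bounded_bilinear.sum_right[OF bounded_bilinear_matmul] linear_sum[OF bounded_linear.linear[OF bounded_linear_trace]])
qed

definition "psi c y = (\<Sum>j\<in>UNIV. pd j (\<lambda>y. G y $ j $ c) y)"

lemma psi_smooth: "smooth (psi c)"
  unfolding psi_def[abs_def] by (intro smooth_sum smooth_in_pd smooth_entry smooth_G)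

lemma psi_y: "(\<lambda>q. complex_of_real (psi c (y_part q))) differentiable at q"
  by (intro smooth_differentiable smooth_of_real smooth_y_part psi_smooth)

lemma lndet_y: "(\<lambda>y. - ln (det (H y))) differentiable at y"
proof -
  have "(\<lambda>y. det (H y)) differentiable at y" by (intro smooth_differentiable smooth_det H)
  then obtain d' where "((\<lambda>y. det (H y)) has_derivative d') (at y)" unfolding differentiable_def by blast
  from has_derivative_minus[OF has_derivative_compose[OF this DERIV_ln[OF det_H, unfolded has_field_derivative_def]]]
  show ?thesis unfolding differentiable_def by blast
qed

text \<open>The term -ln det H gives half the divergence of G. In ln |D|^2 the holomorphic half is
  annihilated and the conjugate half leaves a conjugated logarithmic w-derivative.\<close>

lemma Db_Ln_det:
  assumes q: "q \<in> U"
  shows "Dop \<i> c (\<lambda>q. Ln (det (metric_mat JH z q))) q = (1 / 2) * of_real (psi c (y_part q)) - \<i> * cnj (tk (Inr c) q)"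
proof -
  let ?A = "\<lambda>q. complex_of_real (- ln (det (H (y_part q))))" and ?B = "\<lambda>q. complex_of_real (ln ((cmod (D q))\<^sup>2))"
  have dA: "(\<lambda>y. complex_of_real (- ln (det (H y)))) differentiable at y" for y
    by (rule differentiable_compose[OF bounded_linear_imp_differentiable[OF bounded_linear_of_real] lndet_y])
  have pA: "pd (Inl e) ?A q = of_real (pd e (\<lambda>y. - ln (det (H y))) (y_part q))" "pd (Inr e) ?A q = 0" for e
    using pd_y_part[OF dA] pd_bounded_linear[OF bounded_linear_of_real lndet_y] by simp_all
  have dAy: "?A differentiable at q"
    by (rule differentiable_compose[OF dA bounded_linear_imp_differentiable[OF bounded_linear_y_part]])
  have DA: "Dop \<i> c ?A q = (1 / 2) * of_real (psi c (y_part q))"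
    unfolding Dop_def pA psi_def divergence_G[symmetric] by simp
  have DB: "Dop \<i> c ?B q = \<i> * cnj (tk (Inr c) q)"
  proof -
    have 1: "(\<Sum>e\<in>UNIV. of_real (G (y_part q) $ c $ e) * tk (Inl e) q) = - \<i> * tk (Inr c) q"
      using Db_tk[OF q, of c] by (simp add: add_eq_0_iff2)
    have 2: "(\<Sum>e\<in>UNIV. of_real (G (y_part q) $ c $ e) * cnj (tk (Inl e) q)) = \<i> * cnj (tk (Inr c) q)"
      using arg_cong[OF 1, of cnj] by simp
    show ?thesis unfolding Dop_def tr_real_ln(2)[OF q] distrib_left sum.distrib 1 2 by simp
  qed
  have "Dop \<i> c (\<lambda>q. Ln (det (metric_mat JH z q))) q = Dop \<i> c (\<lambda>q. ?A q + (- 1) * ?B q) q"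
    by (rule Dop_cong[OF U q]) (simp add: Ln_det_metric)
  also have "\<dots> = Dop \<i> c ?A q - Dop \<i> c ?B q"
    using Dop_add[OF dAy differentiable_mult[OF differentiable_const tr_real_ln(1)[OF q]], of \<i> c "- 1"]
      Dop_mult[OF differentiable_const tr_real_ln(1)[OF q], of \<i> c "- 1"] by (simp add: Dop_const)
  finally show ?thesis by (simp only: DA DB)
qed

lemma tk_eq: "q \<in> U \<Longrightarrow> tk (Inr c) q = (\<Sum>b\<in>UNIV. \<Sum>a\<in>UNIV. Ps q $ b $ a * (- \<i> * pd (Inr c) (pd (Inr b) (\<lambda>x. z x $ a)) q))"
proof -
  assume q: "q \<in> U"
  have "pd (Inr c) Ph q $ a $ b = - \<i> * pd (Inr c) (pd (Inr b) (\<lambda>x. z x $ a)) q" for a b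
    using pd_entry[OF Ph_mat_differentiable[OF q], of "Inr c" a b]
      pd_bounded_linear[OF bounded_linear_mult_right smooth_in_differentiable[OF Ph_smooth U q], of "Inr c" "- \<i>" b a]
    by (simp add: Ph_def)
  then show ?thesis by (simp add: tk_def trace_def matrix_matrix_mult_def)
qed

text \<open>It is a sum of products of entries of Ps and w-derivatives of Ph, all of them
  holomorphic.\<close>

lemma tk_hol:
  assumes q: "q \<in> U"
  shows "tk (Inr c) differentiable at q" "Dop \<i> d (tk (Inr c)) q = 0"
proof -
  let ?w = "\<lambda>a b q. pd (Inr c) (pd (Inr b) (\<lambda>x. z x $ a)) q"
  let ?t = "\<lambda>q. \<Sum>b\<in>UNIV. \<Sum>a\<in>UNIV. Ps q $ b $ a * (- \<i> * ?w a b q)"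
  have dw: "?w a b differentiable at q" for a b
    using smooth_in_differentiable[OF smooth_in_pd[OF smooth_in_pd[OF zb]] U q] .
  have Dw: "Dop \<i> d (?w a b) q = 0" for a b
    by (rule Db_w[OF q smooth_in_pd[OF zb] Db_w[OF _ zb Db_z]])
  have dm: "(\<lambda>q. - \<i> * ?w a b q) differentiable at q" for a b
    by (intro differentiable_mult differentiable_const dw)
  have dterm: "(\<lambda>q. Ps q $ b $ a * (- \<i> * ?w a b q)) differentiable at q" for a b
    by (intro differentiable_mult Ps_differentiable q dm)
  have Dterm: "Dop \<i> d (\<lambda>q. Ps q $ b $ a * (- \<i> * ?w a b q)) q = 0" for a b
    by (simp only: Dop_mult[OF Ps_differentiable[OF q] dm] Db_Ps[OF q] Dop_mult[OF differentiable_const dw] Dw Dop_const)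
      simp
  have dsum: "(\<lambda>q. \<Sum>a\<in>UNIV. Ps q $ b $ a * (- \<i> * ?w a b q)) differentiable at q" for b
    by (intro differentiable_sum) (use dterm in auto)
  have dt: "?t differentiable at q" by (intro differentiable_sum) (use dsum in auto)
  have Dt: "Dop \<i> d ?t q = 0"
    by (subst Dop_sum[OF dsum], subst Dop_sum[OF dterm]) (simp only: Dterm sum.neutral_const)
  show "tk (Inr c) differentiable at q"
    by (rule differentiable_cong_open[OF U q _ dt]) (rule tk_eq)
  show "Dop \<i> d (tk (Inr c)) q = 0"
    using Dop_cong[OF U q tk_eq] Dt by simp
qed

text \<open>The chart-dependent part of the first derivative is conjugate holomorphic, so the second
  operator annihilates it. What remains carries a factor 1/2 from each operator. The Jacobians in
  the inverse metric cancel those of the coordinate fields, leaving the trace of H T, in which H and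
  G cancel.\<close>

lemma scalar_curvature_chart:
  assumes p: "p \<in> U"
  shows "(\<Sum>a\<in>UNIV. \<Sum>b\<in>UNIV. matrix_inv (metric_mat JH z p) $ b $ a *
      dz z a (dzbar z b (\<lambda>q. Ln (det (metric_mat JH z q)))) p) = of_real ((1 / 4) * (\<Sum>c\<in>UNIV. pd c (psi c) (y_part p)))"
proof -
  let ?F = "\<lambda>q. Ln (det (metric_mat JH z q))"
  let ?w = "\<lambda>c q. (1 / 2) * complex_of_real (psi c (y_part q)) + (- \<i>) * cnj (tk (Inr c) q)"
  let ?G = "cmat (G (y_part p)) :: complex^'n^'n" and ?H = "cmat (H (y_part p)) :: complex^'n^'n"
  have d1: "(\<lambda>q. (1 / 2) * complex_of_real (psi c (y_part q))) differentiable at p" for c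
    by (intro differentiable_mult differentiable_const psi_y)
  have d2: "(\<lambda>q. (- \<i>) * cnj (tk (Inr c) q)) differentiable at p" for c
    by (intro differentiable_mult differentiable_const differentiable_cnj tk_hol p)
  have dw: "?w c differentiable at p" for c by (intro differentiable_add d1 d2)
  define T where "T = (\<chi> d c. Dop (- \<i>) d (?w c) p)"
  have T: "T $ d $ c = (1 / 4) * (\<Sum>e\<in>UNIV. of_real (G (y_part p) $ d $ e * pd e (psi c) (y_part p)))" for d c
  proof -
    have ds: "(\<lambda>y. complex_of_real (psi c y)) differentiable at y" for y
      by (intro smooth_differentiable smooth_of_real psi_smooth)
    have pp: "pd (Inl e) (\<lambda>q. complex_of_real (psi c (y_part q))) p = of_real (pd e (psi c) (y_part p))"
      "pd (Inr e) (\<lambda>q. complex_of_real (psi c (y_part q))) p = 0" for e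
      using pd_y_part[OF ds] pd_bounded_linear[OF bounded_linear_of_real smooth_differentiable[OF psi_smooth]] by simp_all
    have "T $ d $ c = Dop (- \<i>) d (\<lambda>q. (1 / 2) * complex_of_real (psi c (y_part q))) p + Dop (- \<i>) d (\<lambda>q. (- \<i>) * cnj (tk (Inr c) q)) p"
      unfolding T_def vec_lambda_beta by (rule Dop_add[OF d1 d2])
    also have "Dop (- \<i>) d (\<lambda>q. (- \<i>) * cnj (tk (Inr c) q)) p = 0"
      using Dop_mult[OF differentiable_const differentiable_cnj[OF tk_hol(1)[OF p]], of "- \<i>" d "- \<i>" c]
        Dop_cnj[OF tk_hol(1)[OF p], of "- \<i>" d c] tk_hol(2)[OF p, of d c] by (simp add: Dop_const)
    also have "Dop (- \<i>) d (\<lambda>q. (1 / 2) * complex_of_real (psi c (y_part q))) p = (1 / 2) * Dop (- \<i>) d (\<lambda>q. complex_of_real (psi c (y_part q))) p"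
      by (simp only: Dop_mult[OF differentiable_const psi_y] Dop_const) simp
    also have "Dop (- \<i>) d (\<lambda>q. complex_of_real (psi c (y_part q))) p = (1 / 2) * (\<Sum>e\<in>UNIV. of_real (G (y_part p) $ d $ e * pd e (psi c) (y_part p)))"
      unfolding Dop_def pp by simp
    finally show ?thesis by simp
  qed
  have dzb: "dzbar z b ?F q = (\<Sum>c\<in>UNIV. cnj (Ps q $ c $ b) * ?w c q)" if "q \<in> U" for q b
    unfolding dzbar_eq[OF that] Db_Ln_det[OF that] by simp
  have Dz: "Dop (- \<i>) d (dzbar z b ?F) p = (\<Sum>c\<in>UNIV. cnj (Ps p $ c $ b) * T $ d $ c)" for d b
  proof -
    have dp: "(\<lambda>q. cnj (Ps q $ c $ b)) differentiable at p" for c by (intro differentiable_cnj Ps_differentiable p)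
    have dpz: "Dop (- \<i>) d (\<lambda>q. cnj (Ps q $ c $ b)) p = 0" for c
      using Dop_cnj[OF Ps_differentiable[OF p], of "- \<i>" d c b] Db_Ps[OF p, of d c b] by simp
    have "Dop (- \<i>) d (dzbar z b ?F) p = Dop (- \<i>) d (\<lambda>q. \<Sum>c\<in>UNIV. cnj (Ps q $ c $ b) * ?w c q) p"
      by (rule Dop_cong[OF U p dzb])
    also have "\<dots> = (\<Sum>c\<in>UNIV. Dop (- \<i>) d (\<lambda>q. cnj (Ps q $ c $ b) * ?w c q) p)"
      by (rule Dop_sum) (rule differentiable_mult[OF dp dw])
    finally show ?thesis by (simp only: Dop_mult[OF dp dw] dpz T_def vec_lambda_beta) simp
  qed
  have Y: "dz z a (dzbar z b ?F) p = (transpose (Ps p) ** (T ** cnj_mat (Ps p))) $ a $ b" for a b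
    unfolding dz_eq[OF p] Dz
    by (simp add: matrix_matrix_mult_def transpose_def mult.commute)
  have "metric_mat JH z p ** (cnj_mat (Ph p) ** (?H ** transpose (Ph p))) = mat 1"
  proof -
    have 1: "cnj_mat (Ps p) ** cnj_mat (Ph p) = mat 1" by (simp add: cnj_mat_mult[symmetric] PhPs[OF p])
    have 2: "?G ** ?H = mat 1" by (simp add: cmat_mult[symmetric] GH)
    have 3: "transpose (Ps p) ** transpose (Ph p) = mat 1" by (simp add: matrix_transpose_mul[symmetric] PhPs[OF p])
    have "metric_mat JH z p ** (cnj_mat (Ph p) ** (?H ** transpose (Ph p))) =
      transpose (Ps p) ** (?G ** ((cnj_mat (Ps p) ** cnj_mat (Ph p)) ** (?H ** transpose (Ph p))))"
      unfolding metric_eq[OF p] by (simp only: matrix_mul_assoc)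
    also have "\<dots> = transpose (Ps p) ** ((?G ** ?H) ** transpose (Ph p))" by (simp only: 1 matrix_mul_lid matrix_mul_assoc)
    finally show ?thesis by (simp add: 2 3)
  qed
  then have X: "matrix_inv (metric_mat JH z p) = cnj_mat (Ph p) ** (?H ** transpose (Ph p))" by (rule matrix_inv_eqI)
  have "(\<Sum>a\<in>UNIV. \<Sum>b\<in>UNIV. matrix_inv (metric_mat JH z p) $ b $ a * dz z a (dzbar z b ?F) p)
     = trace ((cnj_mat (Ph p) ** (?H ** transpose (Ph p))) ** (transpose (Ps p) ** (T ** cnj_mat (Ps p))))"
    unfolding X Y by (subst sum.swap) (simp add: trace_def matrix_matrix_mult_def)
  also have "\<dots> = trace ((?H ** transpose (Ph p)) ** (transpose (Ps p) ** (T ** cnj_mat (Ps p))) ** cnj_mat (Ph p))"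
    by (metis matrix_mul_assoc trace_mul_sym)
  also have "(?H ** transpose (Ph p)) ** (transpose (Ps p) ** (T ** cnj_mat (Ps p))) ** cnj_mat (Ph p)
     = ?H ** ((transpose (Ph p) ** transpose (Ps p)) ** (T ** (cnj_mat (Ps p) ** cnj_mat (Ph p))))"
    by (simp only: matrix_mul_assoc)
  also have "\<dots> = ?H ** T"
    by (simp add: cnj_mat_mult[symmetric] matrix_transpose_mul[symmetric] PhPs[OF p])
  also have "trace (?H ** T) = of_real ((1 / 4) * (\<Sum>c\<in>UNIV. pd c (psi c) (y_part p)))"
  proof -
    have HG: "(\<Sum>d\<in>UNIV. H (y_part p) $ c $ d * G (y_part p) $ d $ e) = (if c = e then 1 else 0)" for c e
      using arg_cong[OF GH(2)[of "y_part p"], of "\<lambda>M. M $ c $ e"] by (simp add: matrix_matrix_mult_def mat_def)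
    have "trace (?H ** T) = (1 / 4) * of_real (\<Sum>c\<in>UNIV. \<Sum>d\<in>UNIV. \<Sum>e\<in>UNIV. H (y_part p) $ c $ d * G (y_part p) $ d $ e * pd e (psi c) (y_part p))"
      by (simp add: trace_def matrix_matrix_mult_def T sum_distrib_left mult_ac sum_divide_distrib)
    also have "(\<Sum>c\<in>UNIV. \<Sum>d\<in>UNIV. \<Sum>e\<in>UNIV. H (y_part p) $ c $ d * G (y_part p) $ d $ e * pd e (psi c) (y_part p))
      = (\<Sum>c\<in>UNIV. \<Sum>e\<in>UNIV. (\<Sum>d\<in>UNIV. H (y_part p) $ c $ d * G (y_part p) $ d $ e) * pd e (psi c) (y_part p))"
      unfolding sum_distrib_right by (intro sum.cong refl sum.swap)
    also have "\<dots> = (\<Sum>c\<in>UNIV. pd c (psi c) (y_part p))"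
      by (simp add: HG if_distrib[of "\<lambda>x. x * _"] sum.delta' cong: if_cong)
    finally show ?thesis by simp
  qed
  finally show ?thesis .
qed

end

text \<open>Every chart around p gives this value, hence uniqueness; the existence of one chart is
  the hypothesis.\<close>

lemma (in kaehler_potential) scalar_curvature_eq:
  assumes "\<exists>U z. holomorphic_chart JH U z \<and> p \<in> U"
  shows "scalar_curvature JH p = - (1 / 4) * (\<Sum>c\<in>UNIV. \<Sum>j\<in>UNIV. pd c (pd j (\<lambda>y. G y $ j $ c)) (y_part p))"
proof -
  have v: "- (\<Sum>a\<in>UNIV. \<Sum>b\<in>UNIV. matrix_inv (metric_mat JH z p) $ b $ a *
      dz z a (dzbar z b (\<lambda>q. Ln (det (metric_mat JH z q)))) p) =
      complex_of_real (- (1 / 4) * (\<Sum>c\<in>UNIV. \<Sum>j\<in>UNIV. pd c (pd j (\<lambda>y. G y $ j $ c)) (y_part p)))"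
    if "holomorphic_chart JH U z" "p \<in> U" for U z
  proof -
    interpret C: kaehler_chart H U z by unfold_locales fact
    have "pd c (C.psi c) (y_part p) = (\<Sum>j\<in>UNIV. pd c (pd j (\<lambda>y. G y $ j $ c)) (y_part p))" for c
    proof -
      have d: "pd j (\<lambda>y. G y $ j $ c) differentiable at (y_part p)" for j
        by (intro smooth_differentiable smooth_in_pd smooth_entry smooth_G)
      have "pd c (\<lambda>y. \<Sum>j\<in>I. pd j (\<lambda>y. G y $ j $ c) y) (y_part p) = (\<Sum>j\<in>I. pd c (pd j (\<lambda>y. G y $ j $ c)) (y_part p))"
        if "finite I" for I
        using that
      proof (induction I rule: finite_induct)
        case (insert j I)
        have "(\<lambda>y. \<Sum>j\<in>I. pd j (\<lambda>y. G y $ j $ c) y) differentiable at (y_part p)"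
          by (intro differentiable_sum insert.hyps) (use d in blast)
        then show ?case using insert by (simp add: pd_add[OF d])
      qed simp
      then show ?thesis unfolding C.psi_def[abs_def] by simp
    qed
    then show ?thesis using C.scalar_curvature_chart[OF that(2)] by simp
  qed
  show ?thesis
    unfolding scalar_curvature_def
  proof (rule the_equality)
    show "\<exists>U z. holomorphic_chart JH U z \<and> p \<in> U \<and>
      complex_of_real (- (1 / 4) * (\<Sum>c\<in>UNIV. \<Sum>j\<in>UNIV. pd c (pd j (\<lambda>y. G y $ j $ c)) (y_part p))) =
      - (\<Sum>a\<in>UNIV. \<Sum>b\<in>UNIV. matrix_inv (metric_mat JH z p) $ b $ a *
        dz z a (dzbar z b (\<lambda>q. Ln (det (metric_mat JH z q)))) p)"
    proof -
      obtain U z where U: "holomorphic_chart JH U z" "p \<in> U" using assms by blast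
      show ?thesis using v[OF U, symmetric] U by blast
    qed
  next
    fix s assume "\<exists>U z. holomorphic_chart JH U z \<and> p \<in> U \<and> complex_of_real s =
      - (\<Sum>a\<in>UNIV. \<Sum>b\<in>UNIV. matrix_inv (metric_mat JH z p) $ b $ a *
        dz z a (dzbar z b (\<lambda>q. Ln (det (metric_mat JH z q)))) p)"
    then obtain U z where U: "holomorphic_chart JH U z" "p \<in> U" and s: "complex_of_real s =
      - (\<Sum>a\<in>UNIV. \<Sum>b\<in>UNIV. matrix_inv (metric_mat JH z p) $ b $ a *
        dz z a (dzbar z b (\<lambda>q. Ln (det (metric_mat JH z q)))) p)" by blast
    show "s = - (1 / 4) * (\<Sum>c\<in>UNIV. \<Sum>j\<in>UNIV. pd c (pd j (\<lambda>y. G y $ j $ c)) (y_part p))"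
      using s unfolding v[OF U] of_real_eq_iff .
  qed
qed

section \<open>Symplectic potentials and the Legendre chart\<close>

lemma smooth_id: "smooth (\<lambda>x. x)"
proof (rule smooth_coinduct[where Q = "insert (\<lambda>x. x) (range (\<lambda>c x. c))"], goal_cases)
  case (3 g k)
  have "pd k (\<lambda>x. x) = (\<lambda>x. axis k 1)" by (rule ext, rule pd_eq) (rule has_derivative_ident)
  then show ?case using 3 by auto
qed auto

lemma smooth_norm2: "smooth (\<lambda>y :: real^'n::finite. (norm y)\<^sup>2 / 2)"
proof -
  have "(\<lambda>y :: real^'n. (norm y)\<^sup>2 / 2) = (\<lambda>y. \<Sum>i\<in>UNIV. (1 / 2) * (y $ i * y $ i))"
    by (simp add: power2_norm_eq_inner inner_vec_def sum_divide_distrib)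
  moreover have "smooth (\<lambda>y :: real^'n. \<Sum>i\<in>UNIV. (1 / 2) * (y $ i * y $ i))"
    by (intro smooth_sum smooth_mult smooth_const smooth_nth smooth_id)
  ultimately show ?thesis by simp
qed

lemma pd_norm2: "pd a (\<lambda>y :: real^'n::finite. (norm y)\<^sup>2 / 2) = (\<lambda>y. y $ a)"
proof
  fix y :: "real^'n"
  have "((\<lambda>y :: real^'n. (y \<bullet> y) / 2) has_derivative (\<lambda>h. y \<bullet> h)) (at y)"
    by (rule has_derivative_eq_rhs) (auto intro!: derivative_eq_intros simp: inner_commute)
  then have "((\<lambda>y :: real^'n. (norm y)\<^sup>2 / 2) has_derivative (\<lambda>h. y \<bullet> h)) (at y)"
    by (simp add: power2_norm_eq_inner)
  from pd_eq[OF this] show "pd a (\<lambda>y. (norm y)\<^sup>2 / 2) y = y $ a" by (simp add: cart_eq_inner_axis)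
qed

locale potential =
  fixes u :: "real^'n::finite \<Rightarrow> real"
  assumes u: "symplectic_potential u"
begin

lemma smooth_u: "smooth u"
proof -
  obtain \<phi> where "smooth \<phi>" "u = (\<lambda>y. (norm y)\<^sup>2 / 2 + \<phi> y)" using u by (auto simp: symplectic_potential_def)
  then show ?thesis using smooth_add[OF smooth_norm2] by simp
qed

lemma hessian_entry: "hessian u y $ a $ b = pd b (pd a u) y"
  by (simp add: hessian_def)

lemma smooth_hessian: "smooth (hessian u)"
  by (rule smooth_matI) (simp add: hessian_entry smooth_in_pd smooth_u)

lemma hessian_sym: "transpose (hessian u y) = hessian u y"
  using pd_commute[OF smooth_u, of y] by (simp add: vec_eq_iff transpose_def hessian_entry)

text \<open>The quadratic part of u is not periodic but its Hessian is the identity, so the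
  remaining dependence on y comes from \<phi>.\<close>

lemma hessian_periodic: "lattice_periodic (hessian u)"
proof -
  obtain \<phi> where \<phi>: "smooth \<phi>" "lattice_periodic \<phi>" "u = (\<lambda>y. (norm y)\<^sup>2 / 2 + \<phi> y)"
    using u by (auto simp: symplectic_potential_def)
  have 1: "pd a u = (\<lambda>y. y $ a + pd a \<phi> y)" for a
    unfolding \<phi>(3) using pd_add[OF smooth_differentiable[OF smooth_norm2] smooth_differentiable[OF \<phi>(1)]]
    by (simp add: pd_norm2 fun_eq_iff)
  have 2: "pd b (pd a u) y = axis b 1 $ a + pd b (pd a \<phi>) y" for a b y
  proof -
    have "((\<lambda>y. y $ a) has_derivative (\<lambda>h. h $ a)) (at y)" for y :: "real^'n"
      by (rule bounded_linear_imp_has_derivative[OF bounded_linear_vec_nth])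
    from pd_eq[OF this, of b y] have "pd b (\<lambda>y. y $ a) y = axis b 1 $ a" .
    then show ?thesis
      unfolding 1 using pd_add[OF smooth_differentiable[OF smooth_nth[OF smooth_id]] smooth_differentiable[OF smooth_in_pd[OF \<phi>(1)]]]
      by simp
  qed
  show ?thesis
    using lattice_periodic_pd[OF lattice_periodic_pd[OF \<phi>(2)]]
    by (simp add: lattice_periodic_def vec_eq_iff hessian_entry 2)
qed

sublocale kaehler_potential "hessian u"
proof
  show "pd k (\<lambda>y. hessian u y $ i $ j) y = pd j (\<lambda>y. hessian u y $ i $ k) y" for y i j k
    using pd_commute[OF smooth_in_pd[OF smooth_u], of y k j i] by (simp add: hessian_entry)
qed (use u smooth_hessian hessian_sym in \<open>auto simp: symplectic_potential_def\<close>)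

lemma J_of_eq: "J_of u = JH"
  by (simp add: fun_eq_iff J_of_def JH_block G_def Let_def)

text \<open>The Legendre transform \<open>z = \<nabla>u + i w\<close> is a global holomorphic chart of the universal cover.\<close>

definition "leg q = (\<chi> a. of_real (pd a u (y_part q)) + \<i> * of_real (q $ Inr a))"

lemma leg_smooth: "smooth leg"
  unfolding leg_def
  by (rule smooth_vecI)
    (simp, intro smooth_add smooth_mult smooth_const smooth_of_real smooth_y_part smooth_in_pd smooth_u smooth_nth smooth_id)

lemma leg_deriv: "frechet_derivative leg (at q) v = (\<chi> a. Complex ((hessian u (y_part q) *v y_part v) $ a) (v $ Inr a))"
proof -
  have d: "leg differentiable at q" using smooth_differentiable leg_smooth by blast
  have "(leg has_derivative (\<lambda>v. \<chi> a. of_real (frechet_derivative (pd a u) (at (y_part q)) (y_part v)) + \<i> * of_real (v $ Inr a))) (at q)"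
    unfolding leg_def
  proof (intro has_derivative_vec_lambda has_derivative_add bounded_linear.has_derivative[OF bounded_linear_of_real]
        has_derivative_mult_right bounded_linear_imp_has_derivative[OF bounded_linear_vec_nth])
    fix a
    have "(pd a u has_derivative frechet_derivative (pd a u) (at (y_part q))) (at (y_part q))"
      using smooth_differentiable[OF smooth_in_pd[OF smooth_u]] frechet_derivative_works by blast
    from has_derivative_compose[OF bounded_linear_imp_has_derivative[OF bounded_linear_y_part] this]
    show "((\<lambda>x. pd a u (y_part x)) has_derivative (\<lambda>x. frechet_derivative (pd a u) (at (y_part q)) (y_part x))) (at q)" .
  qed
  then have "frechet_derivative leg (at q) v = (\<chi> a. of_real (frechet_derivative (pd a u) (at (y_part q)) (y_part v)) + \<i> * of_real (v $ Inr a))"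
    by (simp only: frechet_derivative_at[symmetric])
  then show ?thesis
    by (simp add: vec_eq_iff complex_eq_iff frechet_sum_pd[OF smooth_differentiable[OF smooth_in_pd[OF smooth_u]]]
        matrix_vector_mult_def hessian_entry mult.commute)
qed

text \<open>Along the segment from x to y the derivative of d \<bullet> \<nabla>u is d \<bullet>
  (D^2 u) d > 0, which by the mean value theorem excludes equal gradients at the endpoints.\<close>

lemma gradient_inj:
  assumes "\<And>a. pd a u x = pd a u y" shows "x = y"
proof (rule ccontr)
  assume "x \<noteq> y"
  define d where "d = y - x"
  have d: "d \<noteq> 0" using \<open>x \<noteq> y\<close> by (simp add: d_def)
  define g where "g t = (\<Sum>a\<in>UNIV. d $ a * pd a u (x + t *\<^sub>R d))" for t
  have der: "(g has_real_derivative d \<bullet> (hessian u (x + t *\<^sub>R d) *v d)) (at t)" for t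
  proof -
    have "((\<lambda>t. pd a u (x + t *\<^sub>R d)) has_derivative (\<lambda>h. h * (hessian u (x + t *\<^sub>R d) *v d) $ a)) (at t)" for a
    proof -
      let ?p = "x + t *\<^sub>R d"
      have da: "pd a u differentiable at ?p" using smooth_differentiable[OF smooth_in_pd[OF smooth_u]] .
      then have "(pd a u has_derivative frechet_derivative (pd a u) (at ?p)) (at ?p)"
        using frechet_derivative_works by blast
      moreover have "((\<lambda>t. x + t *\<^sub>R d) has_derivative (\<lambda>h. h *\<^sub>R d)) (at t)" by (auto intro!: derivative_eq_intros)
      ultimately have "((\<lambda>t. pd a u (x + t *\<^sub>R d)) has_derivative (\<lambda>h. frechet_derivative (pd a u) (at ?p) (h *\<^sub>R d))) (at t)"
        using has_derivative_compose by blast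
      moreover have "frechet_derivative (pd a u) (at ?p) (h *\<^sub>R d) = h * (hessian u ?p *v d) $ a" for h
        by (simp add: frechet_sum_pd[OF da] matrix_vector_mult_def hessian_entry sum_distrib_left mult_ac)
      ultimately show ?thesis by simp
    qed
    then have "(g has_derivative (\<lambda>h. \<Sum>a\<in>UNIV. d $ a * (h * (hessian u (x + t *\<^sub>R d) *v d) $ a))) (at t)"
      unfolding g_def by (intro has_derivative_sum has_derivative_mult_right)
    then show ?thesis
      by (simp add: has_field_derivative_def inner_vec_def sum_distrib_left[symmetric] mult.left_commute mult_commute_abs)
  qed
  obtain t where "g 1 - g 0 = (1 - 0) * (d \<bullet> (hessian u (x + t *\<^sub>R d) *v d))"
    using MVT2[of 0 1 g "\<lambda>t. d \<bullet> (hessian u (x + t *\<^sub>R d) *v d)"] der by auto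
  moreover have "g 1 = g 0" using assms by (simp add: g_def d_def)
  moreover have "d \<bullet> (hessian u (x + t *\<^sub>R d) *v d) > 0" using H(3) d by (simp add: pos_def_def)
  ultimately show False by simp
qed

lemma leg_chart: "holomorphic_chart JH UNIV leg"
  unfolding holomorphic_chart_def
proof (intro conjI ballI allI)
  show "inj leg"
  proof (rule injI)
    fix x y assume e: "leg x = leg y"
    have c: "complex_of_real (pd a u (y_part x)) + \<i> * of_real (x $ Inr a) = of_real (pd a u (y_part y)) + \<i> * of_real (y $ Inr a)" for a
      using arg_cong[OF e, of "\<lambda>v. v $ a"] by (simp add: leg_def)
    have "pd a u (y_part x) = pd a u (y_part y)" "x $ Inr a = y $ Inr a" for a
      using arg_cong[OF c[of a], of Re] arg_cong[OF c[of a], of Im] by simp_all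
    moreover from this(1) have "y_part x = y_part y" by (rule gradient_inj)
    ultimately show "x = y" by (simp add: vec_eq_iff all_plus y_part_def)
  qed
next
  fix q :: "'n vec2"
  show "inj (frechet_derivative leg (at q))"
  proof (rule injI)
    fix v w assume e: "frechet_derivative leg (at q) v = frechet_derivative leg (at q) w"
    have h: "(hessian u (y_part q) *v y_part v) $ a = (hessian u (y_part q) *v y_part w) $ a" and i: "v $ Inr a = w $ Inr a" for a
      using arg_cong[OF e, of "\<lambda>v. v $ a"] by (simp_all add: leg_deriv)
    have "hessian u (y_part q) *v y_part v = hessian u (y_part q) *v y_part w" using h by (simp add: vec_eq_iff)
    then have "G (y_part q) *v (hessian u (y_part q) *v y_part v) = G (y_part q) *v (hessian u (y_part q) *v y_part w)" by simp
    then have "y_part v = y_part w" by (simp add: matrix_vector_mul_assoc GH)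
    with i show "v = w" by (simp add: vec_eq_iff all_plus y_part_def)
  qed
  fix v :: "'n vec2"
  obtain p r where v: "v = pair_vec p r" using pair_vec_exists by blast
  have yp: "y_part (pair_vec a b) = a" for a b :: "real^'n" by (simp add: y_part_def vec_eq_iff)
  have Jv: "JH q *v v = pair_vec (- (G (y_part q) *v r)) (hessian u (y_part q) *v p)"
    by (simp add: v JH_block block_mat_vec matvec_minus)
  have hr: "hessian u (y_part q) *v (- (G (y_part q) *v r)) = - r"
    by (simp add: matvec_minus_right matrix_vector_mul_assoc GH)
  show "frechet_derivative leg (at q) (JH q *v v) = \<i> *s frechet_derivative leg (at q) v"
    unfolding Jv leg_deriv yp hr by (simp add: v yp vec_eq_iff complex_eq_iff)
qed (simp_all add: leg_smooth)

lemma scalar_curvature_J: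
  "scalar_curvature (J_of u) p = - (1 / 4) * (\<Sum>c\<in>UNIV. \<Sum>j\<in>UNIV. pd c (pd j (\<lambda>y. G y $ j $ c)) (y_part p))"
  unfolding J_of_eq by (rule scalar_curvature_eq) (use leg_chart in blast)

end

section \<open>Integration over the torus\<close>

text \<open>Functions with zero integral against every periodic function of y. They form a module
  over such functions and contain the w-derivatives of periodic functions, so terms with a
  w-derivative of h can be discarded without being written out.\<close>

definition w_exact :: "(('n::finite) vec2 \<Rightarrow> complex) \<Rightarrow> bool" where
  "w_exact F \<longleftrightarrow> smooth F \<and> (\<forall>c. smooth c \<longrightarrow> lattice_periodic c \<longrightarrow> integral (cbox 0 One) (\<lambda>p. c (y_part p) * F p) = 0)"

lemma lattice_periodic_y_part: "lattice_periodic c \<Longrightarrow> lattice_periodic (\<lambda>p. c (y_part p))"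
  unfolding lattice_periodic_def y_part_add by (auto simp: y_part_def)

lemma w_exact_pd:
  assumes k: "smooth k" "lattice_periodic k" shows "w_exact (pd (Inr a) k)"
  unfolding w_exact_def
proof (intro conjI allI impI)
  fix c :: "real^'a \<Rightarrow> complex" assume c: "smooth c" "lattice_periodic c"
  have "pd (Inr a) (\<lambda>p. c (y_part p)) = (\<lambda>p. 0)"
    using pd_y_part(2)[OF smooth_differentiable[OF c(1)]] by blast
  then show "integral (cbox 0 One) (\<lambda>p. c (y_part p) * pd (Inr a) k p) = 0"
    using integral_by_parts[OF smooth_y_part[OF c(1)] lattice_periodic_y_part[OF c(2)] k, of "Inr a"] by simp
qed (use k smooth_in_pd in blast)

lemma w_exact_add: "w_exact F \<Longrightarrow> w_exact F' \<Longrightarrow> w_exact (\<lambda>p. F p + F' p)"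
  unfolding w_exact_def
  by (auto simp: algebra_simps intro: smooth_add
      intro!: Henstock_Kurzweil_Integration.integral_add[THEN trans] integrable_smooth smooth_mult smooth_y_part)

lemma w_exact_mult:
  assumes "w_exact F" "smooth c" "lattice_periodic c" shows "w_exact (\<lambda>p. c (y_part p) * F p)"
  unfolding w_exact_def
proof (intro conjI allI impI)
  show "smooth (\<lambda>p. c (y_part p) * F p)"
    using assms by (intro smooth_mult smooth_y_part) (auto simp: w_exact_def)
  fix d :: "real^'a \<Rightarrow> complex" assume d: "smooth d" "lattice_periodic d"
  have "smooth (\<lambda>y. d y * c y)" "lattice_periodic (\<lambda>y. d y * c y)"
    using smooth_mult[OF d(1) assms(2)] d(2) assms(3) by auto
  then show "integral (cbox 0 One) (\<lambda>p. d (y_part p) * (c (y_part p) * F p)) = 0"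
    using assms(1)[unfolded w_exact_def, THEN conjunct2, rule_format, of "\<lambda>y. d y * c y"]
    by (simp add: mult.assoc)
qed

lemma w_exact_cmult: "w_exact F \<Longrightarrow> w_exact (\<lambda>p. c * F p)"
  using w_exact_mult[of F "\<lambda>_. c"] by (simp add: lattice_periodic_def)

lemma w_exact_zero: "w_exact (\<lambda>p. 0)"
  by (simp add: w_exact_def)

lemma w_exact_sum: "(\<And>i. i \<in> I \<Longrightarrow> w_exact (F i)) \<Longrightarrow> w_exact (\<lambda>p. \<Sum>i\<in>I. F i p)"
  by (induction I rule: infinite_finite_induct) (auto intro: w_exact_add w_exact_zero)

definition "w_exact_mat M \<longleftrightarrow> (\<forall>i j. w_exact (\<lambda>p. M p $ i $ j))"

lemma w_exact_mat_add: "w_exact_mat M \<Longrightarrow> w_exact_mat N \<Longrightarrow> w_exact_mat (\<lambda>p. M p + N p)"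
  by (simp add: w_exact_mat_def w_exact_add)

lemma w_exact_mat_cscale: "w_exact_mat M \<Longrightarrow> w_exact_mat (\<lambda>p. c *k M p)"
  by (simp add: w_exact_mat_def w_exact_cmult)

lemma w_exact_mat_minus: "w_exact_mat M \<Longrightarrow> w_exact_mat (\<lambda>p. - M p)"
  using w_exact_mat_cscale[of M "- 1"] by (simp add: cscale_minus_left)

lemma w_exact_mat_diff: "w_exact_mat M \<Longrightarrow> w_exact_mat N \<Longrightarrow> w_exact_mat (\<lambda>p. M p - N p)"
  using w_exact_mat_add[OF _ w_exact_mat_minus, of M N] by simp

lemma w_exact_mat_left:
  assumes "w_exact_mat M" "smooth C" "lattice_periodic C" shows "w_exact_mat (\<lambda>p. C (y_part p) ** M p)"
  unfolding w_exact_mat_def matrix_matrix_mult_def vec_lambda_beta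
proof (intro allI w_exact_sum)
  fix i j k
  have "smooth (\<lambda>y. C y $ i $ k)" "lattice_periodic (\<lambda>y. C y $ i $ k)"
    using assms smooth_entry by (auto simp: lattice_periodic_def)
  then show "w_exact (\<lambda>p. C (y_part p) $ i $ k * M p $ k $ j)"
    using assms(1) unfolding w_exact_mat_def by (intro w_exact_mult[where c = "\<lambda>y. C y $ i $ k"]) auto
qed

lemma w_exact_mat_right:
  assumes "w_exact_mat M" "smooth C" "lattice_periodic C" shows "w_exact_mat (\<lambda>p. M p ** C (y_part p))"
  unfolding w_exact_mat_def matrix_matrix_mult_def vec_lambda_beta
proof (intro allI w_exact_sum)
  fix i j k
  have "smooth (\<lambda>y. C y $ k $ j)" "lattice_periodic (\<lambda>y. C y $ k $ j)"
    using assms smooth_entry by (auto simp: lattice_periodic_def)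
  then have "w_exact (\<lambda>p. C (y_part p) $ k $ j * M p $ i $ k)"
    using assms(1) unfolding w_exact_mat_def by (intro w_exact_mult[where c = "\<lambda>y. C y $ k $ j"]) auto
  then show "w_exact (\<lambda>p. M p $ i $ k * C (y_part p) $ k $ j)" by (simp add: mult.commute)
qed

lemma w_exact_mat_transpose: "w_exact_mat M \<Longrightarrow> w_exact_mat (\<lambda>p. transpose (M p))"
  by (simp add: w_exact_mat_def transpose_def)

lemma w_exact_mat_block:
  assumes "w_exact_mat P" "w_exact_mat Q" "w_exact_mat R" "w_exact_mat S"
  shows "w_exact_mat (\<lambda>p. block_mat (P p) (Q p) (R p) (S p))"
  unfolding w_exact_mat_def all_plus using assms by (simp add: w_exact_mat_def)

lemma w_exact_trace: "w_exact_mat M \<Longrightarrow> w_exact (\<lambda>p. trace (M p))"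
  unfolding trace_def w_exact_mat_def by (intro w_exact_sum) blast

lemma w_exact_integral: "w_exact F \<Longrightarrow> integral (cbox 0 One) F = 0"
  unfolding w_exact_def by (auto dest: spec[of _ "\<lambda>_. 1"] simp: lattice_periodic_def)

text \<open>Two integrations by parts in y for each pair of indices.\<close>

lemma integral_double_divergence:
  fixes M :: "real^'n::finite \<Rightarrow> complex^'n^'n"
  assumes M: "smooth M" "lattice_periodic M" and h: "smooth h" "lattice_periodic h"
  shows "integral (cbox 0 One) (\<lambda>p. trace (M (y_part p) ** (\<chi> b a. pd (Inl a) (pd (Inl b) h) p)))
    = integral (cbox 0 One) (\<lambda>p. double_divergence M (y_part p) * h p)"
proof -
  have Mp: "smooth (\<lambda>y. M y $ a $ b)" "lattice_periodic (\<lambda>y. M y $ a $ b)" for a b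
    using M smooth_entry by (auto simp: lattice_periodic_def)
  have sp: "smooth (\<lambda>p. M (y_part p) $ a $ b * pd (Inl a) (pd (Inl b) h) p)" for a b
    by (intro smooth_mult smooth_y_part Mp smooth_in_pd h)
  have sq: "smooth (\<lambda>p. pd b (pd a (\<lambda>x. M x $ a $ b)) (y_part p) * h p)" for a b
    by (intro smooth_mult smooth_y_part smooth_in_pd Mp h)
  have t: "integral (cbox 0 One) (\<lambda>p. M (y_part p) $ a $ b * pd (Inl a) (pd (Inl b) h) p)
     = integral (cbox 0 One) (\<lambda>p. pd b (pd a (\<lambda>x. M x $ a $ b)) (y_part p) * h p)" for a b
  proof -
    have 1: "pd (Inl a) (\<lambda>p. M (y_part p) $ a $ b) = (\<lambda>p. pd a (\<lambda>x. M x $ a $ b) (y_part p))"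
      using pd_y_part(1)[OF smooth_differentiable[OF Mp(1)]] by blast
    have 2: "pd (Inl b) (\<lambda>p. pd a (\<lambda>x. M x $ a $ b) (y_part p)) = (\<lambda>p. pd b (pd a (\<lambda>x. M x $ a $ b)) (y_part p))"
      using pd_y_part(1)[OF smooth_differentiable[OF smooth_in_pd[OF Mp(1)]]] by blast
    show ?thesis
      using integral_by_parts[OF smooth_y_part[OF Mp(1)] lattice_periodic_y_part[OF Mp(2)] smooth_in_pd[OF h(1)] lattice_periodic_pd[OF h(2)], of a b "Inl a" "Inl b"]
        integral_by_parts[OF smooth_y_part[OF smooth_in_pd[OF Mp(1)]] lattice_periodic_y_part[OF lattice_periodic_pd[OF Mp(2)]] h, of a a b "Inl b"]
      by (simp add: 1 2)
  qed
  have "integral (cbox 0 One) (\<lambda>p. trace (M (y_part p) ** (\<chi> b a. pd (Inl a) (pd (Inl b) h) p)))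
    = integral (cbox 0 One) (\<lambda>p. \<Sum>a\<in>UNIV. \<Sum>b\<in>UNIV. M (y_part p) $ a $ b * pd (Inl a) (pd (Inl b) h) p)"
    by (simp add: trace_def matrix_matrix_mult_def)
  also have "\<dots> = (\<Sum>a\<in>UNIV. \<Sum>b\<in>UNIV. integral (cbox 0 One) (\<lambda>p. M (y_part p) $ a $ b * pd (Inl a) (pd (Inl b) h) p))"
    by (simp add: integral_sum integrable_smooth sp smooth_sum)
  also have "\<dots> = (\<Sum>a\<in>UNIV. \<Sum>b\<in>UNIV. integral (cbox 0 One) (\<lambda>p. pd b (pd a (\<lambda>x. M x $ a $ b)) (y_part p) * h p))"
    by (simp only: t)
  also have "\<dots> = integral (cbox 0 One) (\<lambda>p. double_divergence M (y_part p) * h p)"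
    by (simp add: integral_sum integrable_smooth sq smooth_sum double_divergence_def sum_distrib_right)
  finally show ?thesis .
qed

lemma smooth_double_divergence: "smooth M \<Longrightarrow> smooth (double_divergence M)"
  unfolding double_divergence_def[abs_def] by (intro smooth_sum smooth_in_pd smooth_entry)

lemma periodic_double_divergence: "lattice_periodic M \<Longrightarrow> lattice_periodic (double_divergence M)"
proof -
  assume M: "lattice_periodic M"
  have "lattice_periodic (\<lambda>x. M x $ a $ b)" for a b using M by (auto simp: lattice_periodic_def)
  from lattice_periodic_pd[OF lattice_periodic_pd[OF this]]
  show ?thesis by (simp add: lattice_periodic_def double_divergence_def)
qed

text \<open>The converse direction tests against the real and imaginary part of the double divergence itself.\<close>

lemma double_divergence_vanishes_iff:
  fixes M :: "real^'n::finite \<Rightarrow> complex^'n^'n"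
  assumes M: "smooth M" "lattice_periodic M"
  shows "(\<forall>h\<in>ham. integral (cbox 0 One) (\<lambda>p. double_divergence M (y_part p) * of_real (h p)) = 0) \<longleftrightarrow>
    (\<forall>y. double_divergence M y = 0)"
proof
  assume *: "\<forall>h\<in>ham. integral (cbox 0 One) (\<lambda>p. double_divergence M (y_part p) * of_real (h p)) = 0"
  let ?f = "\<lambda>p :: 'n vec2. double_divergence M (y_part p)"
  have f: "smooth ?f" "lattice_periodic ?f"
    using smooth_y_part[OF smooth_double_divergence[OF M(1)]] lattice_periodic_y_part[OF periodic_double_divergence[OF M(2)]] by auto
  have one: "smooth (\<lambda>p :: 'n vec2. 1 :: complex)" "lattice_periodic (\<lambda>p :: 'n vec2. 1 :: complex)"
    by (simp_all add: lattice_periodic_def)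
  have "pd k (\<lambda>p :: 'n vec2. 1 :: complex) = (\<lambda>p. 0)" for k by simp
  \<comment> \<open>Testing against the constant 1 gives mean zero, which admits the real and
    imaginary parts of the double divergence as test functions in \<open>ham\<close>.\<close>
  then have int0: "integral (cbox 0 One) ?f = 0"
    using integral_double_divergence[OF M one] by (simp add: trace_def matrix_matrix_mult_def)
  \<comment> \<open>L stands for Re or Im. Both commute with multiplication by real functions, so
    testing against L of the double divergence gives the integral of a square.\<close>
  have vanish: "L (?f p) = 0"
    if L: "bounded_linear (L :: complex \<Rightarrow> real)" and LL: "\<And>z r. L (z * of_real r) = L z * r" for L p
  proof -
    let ?h = "\<lambda>p. L (?f p)"
    have h: "smooth ?h" "lattice_periodic ?h"
      using smooth_bounded_linear[OF L f(1)] f(2) by (auto simp: lattice_periodic_def)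
    have lin: "integral (cbox 0 One) (\<lambda>p. L (g p)) = L (integral (cbox 0 One) g)" if "smooth g" for g :: "'n vec2 \<Rightarrow> complex"
      using integral_linear[OF integrable_smooth[OF that] L] by (simp add: o_def)
    have "?h \<in> ham" using h lin[OF f(1)] int0 linear_0[OF bounded_linear.linear[OF L]] by (simp add: ham_def integral_M_def)
    from bspec[OF * this] have "integral (cbox 0 One) (\<lambda>p. ?f p * of_real (?h p)) = 0" .
    then have "integral (cbox 0 One) (\<lambda>p. ?h p * ?h p) = 0"
      using lin[OF smooth_mult[OF f(1) smooth_of_real[OF h(1)]]] linear_0[OF bounded_linear.linear[OF L]] by (simp add: LL)
    then show ?thesis by (rule periodic_square_integral_zero[OF smooth_continuous[OF h(1)] h(2)])
  qed
  show "\<forall>y. double_divergence M y = 0"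
  proof
    fix y :: "real^'n"
    have y: "y = y_part (pair_vec y 0)" by (simp add: y_part_def vec_eq_iff)
    have "Re (double_divergence M y) = 0" by (subst y, rule vanish[OF bounded_linear_Re]) simp
    moreover have "Im (double_divergence M y) = 0" by (subst y, rule vanish[OF bounded_linear_Im]) simp
    ultimately show "double_divergence M y = 0" by (simp add: complex_eq_iff)
  qed
qed simp

section \<open>The moment maps\<close>

lemma smooth_cscale: "smooth M \<Longrightarrow> smooth (\<lambda>x. c *k M x)" for M :: "_ \<Rightarrow> 'a::{real_normed_field, euclidean_space}^'k::finite^'l::finite"
  by (rule smooth_bounded_linear[OF bounded_linear_cscale])

lemma smooth_nf:
  assumes "smooth t" "smooth m" shows "smooth (\<lambda>y. nf (t y) (m y))"
  unfolding nf_def by (intro smooth_block_mat smooth_minus smooth_matrix_mult assms)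

lemma smooth_b: "smooth M \<Longrightarrow> smooth (\<lambda>y. b11 (M y))" "smooth M \<Longrightarrow> smooth (\<lambda>y. b12 (M y))"
  for M :: "_ \<Rightarrow> 'a::euclidean_space^('n::finite + 'n)^('n + 'n)"
  by (rule smooth_bounded_linear[OF bounded_linear_blocks(1)], simp) (rule smooth_bounded_linear[OF bounded_linear_blocks(2)], simp)

lemma has_derivative_nf:
  assumes T: "(T has_derivative T') (at x)" and N: "(N has_derivative N') (at x)"
  shows "((\<lambda>t. nf (T t) (N t)) has_derivative (\<lambda>h. dnf (T x) (N x) (T' h) (N' h))) (at x)"
proof -
  note NT = has_derivative_matmul[OF N T]
  show ?thesis
    unfolding nf_def
    by (rule has_derivative_eq_rhs[OF has_derivative_block_mat[OF has_derivative_minus[OF NT] N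
            has_derivative_minus[OF has_derivative_matmul[OF T NT]] has_derivative_matmul[OF T N]]])
      (simp add: dnf_def block_mat_eq_iff algebra_simps fun_eq_iff)
qed

lemma frechet_y_part:
  assumes "(T has_derivative T') (at (y_part p))"
  shows "frechet_derivative (\<lambda>q. T (y_part q)) (at p) v = T' (y_part v)"
  using frechet_derivative_at[OF has_derivative_compose[OF bounded_linear_imp_has_derivative[OF bounded_linear_y_part] assms], symmetric]
  by simp

section \<open>Hamiltonian vector fields and Lie derivatives\<close>

lemma ham_field_eq:
  assumes h: "smooth h"
  shows "ham_field h p = pair_vec (\<chi> i. - (1 / 2) * pd (Inr i) h p) (\<chi> i. (1 / 2) * pd (Inl i) h p)"
proof -
  have h': "frechet_derivative h (at p) v = (\<Sum>a\<in>UNIV. v $ Inl a * pd (Inl a) h p) + (\<Sum>a\<in>UNIV. v $ Inr a * pd (Inr a) h p)" for v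
    by (simp add: frechet_sum_pd[OF smooth_differentiable[OF h]] sum_UNIV_plus)
  show ?thesis
    unfolding ham_field_def
  proof (rule the_equality)
    show "\<forall>v. omega (pair_vec (\<chi> i. - (1 / 2) * pd (Inr i) h p) (\<chi> i. (1 / 2) * pd (Inl i) h p)) v = - frechet_derivative h (at p) v"
      by (simp add: h' omega_def sum_distrib_left sum_subtractf sum.distrib sum_negf mult_ac)
  next
    fix X assume X: "\<forall>v. omega X v = - frechet_derivative h (at p) v"
    have "X $ Inl i = - (1 / 2) * pd (Inr i) h p" for i
      using X[rule_format, of "axis (Inr i) 1"]
      by (simp add: h' omega_def) (simp add: axis_def if_distrib[of "\<lambda>x. _ * x"] if_distrib[of "\<lambda>x. x * _"] sum.delta cong: if_cong)
    moreover have "X $ Inr i = (1 / 2) * pd (Inl i) h p" for i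
      using X[rule_format, of "axis (Inl i) 1"]
      by (simp add: h' omega_def) (simp add: axis_def if_distrib[of "\<lambda>x. _ * x"] if_distrib[of "\<lambda>x. x * _"] sum.delta sum_negf cong: if_cong)
    ultimately show "X = pair_vec (\<chi> i. - (1 / 2) * pd (Inr i) h p) (\<chi> i. (1 / 2) * pd (Inl i) h p)"
      by (simp add: vec_eq_iff all_plus)
  qed
qed

text \<open>Blocks of the derivative of the Hamiltonian field. Blocks A and B contain a w-derivative
  of h and integrate away; block C, half the Hessian of h in y, carries the moment maps. The factors
  1/2 invert the 2 in the symplectic form.\<close>

definition hA :: "(('n::finite) vec2 \<Rightarrow> real) \<Rightarrow> 'n vec2 \<Rightarrow> real^'n^'n" where
  "hA h p = (\<chi> i j. - (1 / 2) * pd (Inl j) (pd (Inr i) h) p)"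
definition hB :: "(('n::finite) vec2 \<Rightarrow> real) \<Rightarrow> 'n vec2 \<Rightarrow> real^'n^'n" where
  "hB h p = (\<chi> i j. - (1 / 2) * pd (Inr j) (pd (Inr i) h) p)"
definition hC :: "(('n::finite) vec2 \<Rightarrow> real) \<Rightarrow> 'n vec2 \<Rightarrow> real^'n^'n" where
  "hC h p = (\<chi> i j. (1 / 2) * pd (Inl j) (pd (Inl i) h) p)"

lemma hB_sym: "smooth h \<Longrightarrow> transpose (hB h p) = hB h p"
  and hC_sym: "smooth h \<Longrightarrow> transpose (hC h p) = hC h p"
  using pd_commute[of UNIV h p] by (simp_all add: hB_def hC_def transpose_def vec_eq_iff)

lemma ham_field_matrix:
  assumes h: "smooth h"
  shows "matrix (frechet_derivative (ham_field h) (at p)) = block_mat (hA h p) (hB h p) (hC h p) (- transpose (hA h p))"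
proof -
  let ?X = "\<lambda>p. pair_vec (\<chi> i. - (1 / 2) * pd (Inr i) h p) (\<chi> i. (1 / 2) * pd (Inl i) h p)"
  have X: "ham_field h = ?X" using ham_field_eq[OF h] by blast
  have sX: "smooth (ham_field h)"
  proof (rule smooth_vecI)
    fix k
    show "smooth (\<lambda>p. ham_field h p $ k)"
      unfolding X by (cases k) (simp_all only: pair_vec_nth vec_lambda_beta, (intro smooth_mult smooth_const smooth_in_pd h)+)
  qed
  have e: "matrix (frechet_derivative (ham_field h) (at p)) $ k $ l = pd l (\<lambda>p. ham_field h p $ k) p" for k l
    using pd_bounded_linear[OF bounded_linear_vec_nth smooth_differentiable[OF sX]]
    by (simp add: matrix_def pd_def)
  have m: "pd l (\<lambda>p. c * pd k h p) p = c * pd l (pd k h) p" for l k c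
    using pd_bounded_linear[OF bounded_linear_mult_right smooth_differentiable[OF smooth_in_pd[OF h]]] by blast
  show ?thesis
    unfolding vec_eq_iff all_plus e
    unfolding X pair_vec_nth vec_lambda_beta block_mat_nth m
    using pd_commute[OF h, of p] by (simp add: hA_def hB_def hC_def transpose_def)
qed

lemma pd_of_real: "smooth f \<Longrightarrow> pd k (\<lambda>p. complex_of_real (f p)) = (\<lambda>p. of_real (pd k f p))"
  using pd_bounded_linear[OF bounded_linear_of_real smooth_differentiable] by blast

lemma w_exact_real_pd:
  assumes f: "smooth f" "lattice_periodic f"
  shows "w_exact (\<lambda>p. complex_of_real (- (1 / 2) * pd (Inr a) f p))"
proof -
  have "w_exact (pd (Inr a) (\<lambda>p. complex_of_real (f p)))"
    using f by (intro w_exact_pd smooth_of_real) (auto simp: lattice_periodic_def)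
  from w_exact_cmult[OF this, of "- 1 / 2"] show ?thesis by (simp add: pd_of_real[OF f(1)])
qed

lemma w_exact_hB: "smooth h \<Longrightarrow> lattice_periodic h \<Longrightarrow> w_exact_mat (\<lambda>p. cmat (hB h p))"
  unfolding w_exact_mat_def hB_def cmat_nth vec_lambda_beta
  by (intro allI w_exact_real_pd smooth_in_pd lattice_periodic_pd)

lemma w_exact_hA: "smooth h \<Longrightarrow> lattice_periodic h \<Longrightarrow> w_exact_mat (\<lambda>p. cmat (hA h p))"
proof -
  assume h: "smooth h" "lattice_periodic h"
  have "pd (Inl j) (pd (Inr i) h) p = pd (Inr i) (pd (Inl j) h) p" for i j p
    using pd_commute[OF h(1)] by simp
  then show ?thesis
    unfolding w_exact_mat_def hA_def cmat_nth vec_lambda_beta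
    by (simp only:) (intro allI w_exact_real_pd smooth_in_pd lattice_periodic_pd h)
qed

context siegel_point
begin

lemma dnf_add: "dnf \<tau> n (s + t) (m + l) = dnf \<tau> n s m + dnf \<tau> n t l"
  by (simp add: dnf_def block_mat_add mat_expand block_mat_eq_iff algebra_simps)

end

context potential_matrix
begin

text \<open>Here K stands for the derivative of H along the field. The result says that \<tau>
  changes by \<i> K - c + \<open>transpose a\<close> \<tau> + \<tau> a + \<tau> b \<tau>, the
  infinitesimal action on the Siegel space.\<close>

lemma lie_J:
  "block_mat 0 (G ** (K ** G)) K 0 - block_mat a b c (- transpose a) ** Jm 0 H + Jm 0 H ** block_mat a b c (- transpose a)
    = dJm 0 H (- (c + H ** (b ** H))) (K + H ** a + transpose a ** H)"
  by (simp add: J0 dJm_eq block_simps mat_expand GY_simps algebra_simps)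

text \<open>The same base velocity as in \<open>lie_J\<close> appears. This makes the two Lie
  derivatives together a tangent vector of the bundle, with an explicit fibre velocity.\<close>

lemma lie_N:
  "dnf \<tau> n (\<i> *k cmat K) m - cmat (block_mat a b c (- transpose a)) ** nf \<tau> n + nf \<tau> n ** cmat (block_mat a b c (- transpose a))
    = dnf \<tau> n (cplx (- (c + H ** (b ** H))) (K + H ** a + transpose a ** H))
        (m - cmat a ** n - cmat b ** (\<tau> ** n) - n ** (\<tau> ** cmat b) - n ** cmat (transpose a))"
proof -
  have t: "cplx (- (c + H ** (b ** H))) (K + H ** a + transpose a ** H) = \<i> *k cmat K +
      (- cmat c + cmat (transpose a) ** \<tau> + \<tau> ** cmat a + \<tau> ** (cmat b ** \<tau>))"
    by (simp add: cplx_def tauH cmat_add cmat_diff cmat_minus cmat_mult mat_expand algebra_simps)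
  have m: "m - cmat a ** n - cmat b ** (\<tau> ** n) - n ** (\<tau> ** cmat b) - n ** cmat (transpose a) =
      m + (- (cmat a ** n) - cmat b ** (\<tau> ** n) - n ** (\<tau> ** cmat b) - n ** cmat (transpose a))" by simp
  have "- cmat (block_mat a b c (- transpose a)) ** nf \<tau> n + nf \<tau> n ** cmat (block_mat a b c (- transpose a)) =
      dnf \<tau> n (- cmat c + cmat (transpose a) ** \<tau> + \<tau> ** cmat a + \<tau> ** (cmat b ** \<tau>))
        (- (cmat a ** n) - cmat b ** (\<tau> ** n) - n ** (\<tau> ** cmat b) - n ** cmat (transpose a))"
    by (simp add: nf_def dnf_def block_simps cmat_minus mat_expand algebra_simps)
  then show ?thesis unfolding t m dnf_add by (simp add: matmul_minus_left)
qed

end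

section \<open>The invariant Higgs field as a family over y\<close>

locale higgs_field = potential u for u :: "real^'n::finite \<Rightarrow> real" +
  fixes \<alpha> :: "'n vec2 \<Rightarrow> 'n cendo" and \<xi> :: "real^'n \<Rightarrow> complex^'n^'n"
  assumes cotangent: "cotangent_field (J_of u) \<alpha>"
    and higgs: "higgs_tensor u \<alpha> \<xi>"
    and radius: "\<And>y. spectral_radius (higgs_square u \<xi> y) < 1"
begin

lemma xi: "smooth \<xi>" "lattice_periodic \<xi>" "transpose (\<xi> y) = \<xi> y"
  using higgs by (simp_all add: higgs_tensor_def)

lemma hm: "higgs_matrix (hessian u y) (\<xi> y)"
proof -
  interpret S: siegel_point 0 "hessian u y" by (rule siegel)
  show ?thesis
    by unfold_locales (use xi radius[of y] in \<open>simp_all add: higgs_square_def\<close>)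
qed

definition "tau y = \<i> *k cmat (hessian u y)"
definition "nn y = (\<i> / 2) *k \<xi> y"
definition "N0 y = nf (tau y) (nn y)"
definition "A0 y = 2 *\<^sub>R Rem (N0 y)"
definition "J0 y = Jm 0 (hessian u y)"
text \<open>Written through \<open>msqrt\<close> as a function of y, so that smoothness and
  periodicity in y can be stated. \<open>Q_eqs\<close> identifies it with the pointwise square
  root.\<close>

definition "R0 y = msqrt (OM ** J0 y) (mat 1 - A0 y ** A0 y)"
definition "C0 y = matrix_inv (mat 1 + R0 y)"

context
  fixes y :: "real^'n"
begin

interpretation Q: higgs_matrix "hessian u y" "\<xi> y" by (rule hm)

lemma Q_eqs: "Q.\<tau> = tau y" "Q.n = nn y" "Q.A = A0 y" "higgs_point.R (Jm 0 (hessian u y)) (A0 y) = R0 y"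
    "higgs_point.C (Jm 0 (hessian u y)) (A0 y) = C0 y" "Q.G = G y"
proof -
  show t: "Q.\<tau> = tau y" by (simp add: Q.tauH tau_def)
  show n: "Q.n = nn y" by (simp add: Q.n_def nn_def)
  show a: "Q.A = A0 y" by (simp add: Q.A_def A0_def N0_def t n)
  show r: "higgs_point.R (Jm 0 (hessian u y)) (A0 y) = R0 y"
    using Q.P.R_def unfolding R0_def Q.Q.g_def J0_def a .
  show "higgs_point.C (Jm 0 (hessian u y)) (A0 y) = C0 y" using Q.P.C_def unfolding a r C0_def .
  show "Q.G = G y" by (simp add: Q.G_def G_def)
qed

lemma R0_sqrt: "R0 y ** R0 y = mat 1 - A0 y ** A0 y" "pos_def (OM ** J0 y ** R0 y)"
    "transpose (OM ** J0 y ** R0 y) = OM ** J0 y ** R0 y"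
  using Q.P.R_sqrt unfolding is_sqrt_def Q.Q.g_def Q_eqs J0_def by blast+

lemma J0_g: "pos_def (OM ** J0 y)" "transpose (OM ** J0 y) = OM ** J0 y"
  using Q.Q.g unfolding Q.Q.g_def J0_def by blast+

lemma R0_det: "det (mat 1 + R0 y) \<noteq> 0"
  using Q.P.C(3) unfolding Q_eqs .

lemma J0_block: "J0 y = block_mat 0 (- G y) (hessian u y) 0"
  by (simp add: J0_def Q.J0 Q_eqs)

lemma nn_sym: "transpose (nn y) = nn y"
  using Q.n_sym by (simp only: Q_eqs)

lemma sqrt_G: "matrix_sqrt (mat 1 - higgs_square u \<xi> y) ** cmat (matrix_inv (hessian u y)) =
    cmat (b11 (R0 y) ** G y) + \<i> *k cmat (b12 (R0 y))"
  using Q.sqrt_G by (simp only: Q_eqs Q.K_def higgs_square_def G_def)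

lemma b12_R0: "transpose (b12 (R0 y)) = - b12 (R0 y)"
  using Q.b12_R_antisym by (simp only: Q_eqs)

text \<open>Both descriptions of the dual of \<alpha> are evaluated on \<open>Z_a\<close>. The
  y-components are -\<i> m in terms of the upper right block and \<xi> / 2 in terms of the Higgs
  tensor, whence m = (\<i> / 2) \<xi>.\<close>

lemma transpose_\<alpha>:
  assumes y: "y = y_part p" shows "transpose (\<alpha> p) = N0 y"
proof -
  have JJ: "J_of u p = Jm 0 (hessian u y)" by (simp add: J_of_eq JH_def y)
  have \<alpha>: "\<alpha> p \<in> cotangent_AC (Jm 0 (hessian u y))" using cotangent JJ by (simp add: cotangent_field_def) metis
  define m where "m = b12 (transpose (\<alpha> p))"
  have nf: "transpose (\<alpha> p) = nf (tau y) m" using Q.cotangent_nf(1)[OF \<alpha>] by (simp only: Q_eqs m_def)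
  have "m $ j $ a = nn y $ j $ a" for j a
  proof -
    define g where "g = (\<chi> b. complex_of_real (G y $ a $ b))"
    have Hg: "cmat (hessian u y) *v g = axis a 1"
    proof -
      have "g = cmat (G y) *v axis a 1" by (simp add: matvec_axis column_def g_def vec_eq_iff G_entry_sym[of y a])
      then show ?thesis by (simp add: matrix_vector_mul_assoc cmat_mult[symmetric] GH)
    qed
    have Z: "Z_frame u a p = (1 / 2) *s pair_vec g (- \<i> *s axis a 1)"
      by (simp add: Z_frame_def g_def G_def y)
    have c: "(c *s pair_vec q r) $ Inl j = c * q $ j" for c :: complex and q r :: "complex^'n" by simp
    have "(dual_endo (\<alpha> p) *v Z_frame u a p) $ Inl j = (1 / 2) * ((- (m ** tau y)) *v g + m *v (- \<i> *s axis a 1)) $ j"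
      unfolding Z dual_endo_def nf nf_def matvec_scale block_mat_vec by simp
    also have "(- (m ** tau y)) *v g = - \<i> *s (m *v axis a 1)"
      unfolding tau_def by (simp add: cscale_mult_right matvec_minus cscale_vec matrix_vector_mul_assoc[symmetric] Hg vec_eq_iff)
    also have "(1 / 2) * (- \<i> *s (m *v axis a 1) + m *v (- \<i> *s axis a 1)) $ j = - \<i> * m $ j $ a"
      by (simp add: matvec_scale matvec_axis column_def matvec_minus_right)
    finally have 1: "(dual_endo (\<alpha> p) *v Z_frame u a p) $ Inl j = - \<i> * m $ j $ a" .
    have "(dual_endo (\<alpha> p) *v Z_frame u a p) = (\<Sum>b\<in>UNIV. \<Sum>c\<in>UNIV.
          (complex_of_real (hessian u y $ b $ c) * \<xi> y $ c $ a) *s cnj_vec (Z_frame u b p))"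
      using higgs by (simp add: higgs_tensor_def y)
    also have "\<dots> $ Inl j = (\<Sum>b\<in>UNIV. \<Sum>c\<in>UNIV. (1 / 2) * (of_real (G y $ j $ b) * (of_real (hessian u y $ b $ c) * \<xi> y $ c $ a)))"
      by (simp add: Z_frame_def cnj_vec_def G_def[symmetric] y[symmetric] G_entry_sym[of y j] mult_ac)
    also have "\<dots> = (1 / 2) * (cmat (G y) ** (cmat (hessian u y) ** \<xi> y)) $ j $ a"
      by (simp add: matrix_matrix_mult_def sum_distrib_left sum_divide_distrib)
    also have "cmat (G y) ** (cmat (hessian u y) ** \<xi> y) = \<xi> y"
      by (simp add: matrix_mul_assoc cmat_mult[symmetric] GH)
    finally have "- \<i> * m $ j $ a = (1 / 2) * \<xi> y $ j $ a" using 1 by simp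
    then have "\<xi> y $ j $ a = - (\<i> * m $ j $ a * 2)" by simp
    then show ?thesis by (simp add: nn_def)
  qed
  then have "m = nn y" by (simp add: vec_eq_iff)
  then show ?thesis by (simp add: nf N0_def)
qed

lemma tangent_pair:
  assumes X': "transpose X' = X'" and Y': "transpose Y' = Y'" and n': "transpose n' = n'"
    and B: "B = dJm 0 (hessian u y) X' Y'" and \<beta>: "transpose \<beta> = dnf (tau y) (nn y) (cplx X' Y') n'"
  shows "dc_BG (J0 y, transpose (N0 y)) (B, \<beta>) =
    - trace ((mat 1 - b11 (R0 y)) ** (G y ** X')) - Re (trace (cmat (C0 y ** A0 y) ** nf (tau y) (\<i> *k n')))"
    and "pairing (transpose (N0 y)) B = (1 / 2) * trace (\<xi> y ** cplx X' Y')"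
proof -
  have \<beta>': "\<beta> = transpose (dnf (tau y) (nn y) (cplx X' Y') n')" using \<beta> by (metis transpose_transpose)
  have v: "(B, \<beta>) \<in> tangent_vectors bdl (Jm 0 (hessian u y), transpose (nf (tau y) (nn y)))"
    using Q.tangent_bundleI[OF X' Y' Q.n_sym n'] by (simp only: Q_eqs B \<beta>')
  have b: "b12 (transpose \<beta>) = n'" by (simp add: \<beta> dnf_def)
  show "dc_BG (J0 y, transpose (N0 y)) (B, \<beta>) =
    - trace ((mat 1 - b11 (R0 y)) ** (G y ** X')) - Re (trace (cmat (C0 y ** A0 y) ** nf (tau y) (\<i> *k n')))"
    using Q.dc_BG_potential[unfolded Q_eqs, OF v] n'
    by (simp add: b J0_def N0_def) (simp add: B Q.dJm_eq Q_eqs)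
  have Bt: "B \<in> tangent_AC (Jm 0 (hessian u y))" unfolding B by (rule Q.dJm_tangent[OF X' Y'])
  have "- (\<i> *k nn y) = (1 / 2) *k \<xi> y" by (simp add: nn_def vec_eq_iff)
  then show "pairing (transpose (N0 y)) B = (1 / 2) * trace (\<xi> y ** cplx X' Y')"
    using Q.pairing_nf[OF Bt, of "nn y"]
    by (simp add: Q_eqs N0_def B Q.dX_dJm Q.dY_dJm cscale_mult_left trace_cscale)
qed

lemma lie_J0:
  "block_mat 0 (G y ** (K ** G y)) K 0 - block_mat a b c (- transpose a) ** J0 y + J0 y ** block_mat a b c (- transpose a)
    = dJm 0 (hessian u y) (- (c + hessian u y ** (b ** hessian u y))) (K + hessian u y ** a + transpose a ** hessian u y)"
  using Q.lie_J by (simp only: Q_eqs J0_def)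

lemma lie_N0:
  "dnf (tau y) (nn y) (\<i> *k cmat K) m - cmat (block_mat a b c (- transpose a)) ** N0 y + N0 y ** cmat (block_mat a b c (- transpose a))
    = dnf (tau y) (nn y) (cplx (- (c + hessian u y ** (b ** hessian u y))) (K + hessian u y ** a + transpose a ** hessian u y))
        (m - cmat a ** nn y - cmat b ** (tau y ** nn y) - nn y ** (tau y ** cmat b) - nn y ** cmat (transpose a))"
  using Q.lie_N by (simp only: Q_eqs N0_def)

end

lemma J_eq: "J_of u = (\<lambda>q. J0 (y_part q))"
  by (simp add: J_of_eq JH_def fun_eq_iff J0_def)

lemma N_eq: "(\<lambda>q. dual_endo (\<alpha> q)) = (\<lambda>q. N0 (y_part q))"
  using transpose_\<alpha> by (simp add: dual_endo_def)

lemma \<alpha>_eq: "\<alpha> q = transpose (N0 (y_part q))"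
  using transpose_\<alpha>[OF refl, of q] by (metis transpose_transpose)

text \<open>X1 + \<i> Y1 is the velocity of \<tau> along the Hamiltonian field. Only X1 contains the
  y-Hessian of h; Y1 and the fibre velocity \<open>n1\<close> consist of terms with w-derivatives of
  h.\<close>

definition "X1 h p = - (hC h p + hessian u (y_part p) ** (hB h p ** hessian u (y_part p)))"
definition "dxi h p = frechet_derivative \<xi> (at (y_part p)) (\<chi> i. - (1 / 2) * pd (Inr i) h p)"
definition "dhs h p = frechet_derivative (hessian u) (at (y_part p)) (\<chi> i. - (1 / 2) * pd (Inr i) h p)"
definition "Y1 h p = dhs h p + hessian u (y_part p) ** hA h p + transpose (hA h p) ** hessian u (y_part p)"
definition "n1 h p = (\<i> / 2) *k dxi h p - cmat (hA h p) ** nn (y_part p) - cmat (hB h p) ** (tau (y_part p) ** nn (y_part p))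
    - nn (y_part p) ** (tau (y_part p) ** cmat (hB h p)) - nn (y_part p) ** cmat (transpose (hA h p))"

lemma lie_derivatives:
  assumes h: "smooth h"
  shows "lie_endo (ham_field h) (J_of u) p = dJm 0 (hessian u (y_part p)) (X1 h p) (Y1 h p)"
    "lie_endo (ham_field h) (\<lambda>q. dual_endo (\<alpha> q)) p = dnf (tau (y_part p)) (nn (y_part p)) (cplx (X1 h p) (Y1 h p)) (n1 h p)"
    "transpose (X1 h p) = X1 h p" "transpose (Y1 h p) = Y1 h p" "transpose (n1 h p) = n1 h p"
proof -
  let ?y = "y_part p" and ?D = "block_mat (hA h p) (hB h p) (hC h p) (- transpose (hA h p))"
  define H' where "H' = frechet_derivative (hessian u) (at ?y)"
  define \<xi>' where "\<xi>' = frechet_derivative \<xi> (at ?y)"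
  have dH: "(hessian u has_derivative H') (at ?y)" and d\<xi>: "(\<xi> has_derivative \<xi>') (at ?y)"
    unfolding H'_def \<xi>'_def using smooth_differentiable[OF smooth_hessian] smooth_differentiable[OF xi(1)] frechet_derivative_works by blast+
  define x where "x = y_part (ham_field h p)"
  have x: "x = (\<chi> i. - (1 / 2) * pd (Inr i) h p)" by (simp add: x_def ham_field_eq[OF h] y_part_def vec_eq_iff)
  have symK: "transpose (H' v) = H' v" for v
  proof -
    have "((\<lambda>y. transpose (hessian u y)) has_derivative (\<lambda>v. transpose (H' v))) (at ?y)"
      by (rule bounded_linear.has_derivative[OF bounded_linear_transpose dH])
    then have "(hessian u has_derivative (\<lambda>v. transpose (H' v))) (at ?y)" by (simp add: hessian_sym)
    then show ?thesis using has_derivative_unique[OF dH] by metis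
  qed
  have sym\<xi>: "transpose (\<xi>' v) = \<xi>' v" for v
  proof -
    have "((\<lambda>y. transpose (\<xi> y)) has_derivative (\<lambda>v. transpose (\<xi>' v))) (at ?y)"
      by (rule bounded_linear.has_derivative[OF bounded_linear_transpose d\<xi>])
    then have "(\<xi> has_derivative (\<lambda>v. transpose (\<xi>' v))) (at ?y)" by (simp add: xi)
    then show ?thesis using has_derivative_unique[OF d\<xi>] by metis
  qed
  have dJ: "(J0 has_derivative (\<lambda>v. block_mat 0 (G ?y ** (H' v ** G ?y)) (H' v) 0)) (at ?y)"
  proof -
    have "(G has_derivative (\<lambda>v. - (G ?y ** H' v ** G ?y))) (at ?y)"
      unfolding G_def[abs_def] by (rule has_derivative_matrix_inv[OF dH pos_def_det[OF H(3)]])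
    from has_derivative_block_mat[OF has_derivative_const has_derivative_minus[OF this] dH has_derivative_const]
    show ?thesis by (simp add: J0_block[abs_def] matrix_mul_assoc)
  qed
  have dN: "(N0 has_derivative (\<lambda>v. dnf (tau ?y) (nn ?y) (\<i> *k cmat (H' v)) ((\<i> / 2) *k \<xi>' v))) (at ?y)"
    unfolding N0_def[abs_def]
    by (intro has_derivative_nf) (auto simp: tau_def[abs_def] nn_def[abs_def]
        intro!: bounded_linear.has_derivative[OF bounded_linear_cscale] bounded_linear.has_derivative[OF bounded_linear_cmat] dH d\<xi>)
  have J: "lie_endo (ham_field h) (J_of u) p = block_mat 0 (G ?y ** (H' x ** G ?y)) (H' x) 0 - ?D ** J0 ?y + J0 ?y ** ?D"
    unfolding lie_endo_def Let_def J_eq frechet_y_part[OF dJ] ham_field_matrix[OF h] cmat_real x_def ..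
  have N: "lie_endo (ham_field h) (\<lambda>q. dual_endo (\<alpha> q)) p = dnf (tau ?y) (nn ?y) (\<i> *k cmat (H' x)) ((\<i> / 2) *k \<xi>' x) - cmat ?D ** N0 ?y + N0 ?y ** cmat ?D"
    unfolding lie_endo_def Let_def N_eq frechet_y_part[OF dN] ham_field_matrix[OF h] x_def ..
  have n1: "n1 h p = (\<i> / 2) *k \<xi>' x - cmat (hA h p) ** nn ?y - cmat (hB h p) ** (tau ?y ** nn ?y)
    - nn ?y ** (tau ?y ** cmat (hB h p)) - nn ?y ** cmat (transpose (hA h p))"
    unfolding n1_def dxi_def \<xi>'_def x ..
  have Y1: "Y1 h p = H' x + hessian u ?y ** hA h p + transpose (hA h p) ** hessian u ?y"
    unfolding Y1_def dhs_def H'_def x ..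
  show "transpose (Y1 h p) = Y1 h p"
    by (simp add: Y1 transpose_add matrix_transpose_mul symK hessian_sym algebra_simps)
  show "lie_endo (ham_field h) (J_of u) p = dJm 0 (hessian u (y_part p)) (X1 h p) (Y1 h p)"
    "lie_endo (ham_field h) (\<lambda>q. dual_endo (\<alpha> q)) p = dnf (tau (y_part p)) (nn (y_part p)) (cplx (X1 h p) (Y1 h p)) (n1 h p)"
    unfolding J N lie_J0 lie_N0 X1_def Y1 n1 by (rule refl)+
  show "transpose (X1 h p) = X1 h p"
    by (simp add: X1_def transpose_minus transpose_add transpose_diff matrix_transpose_mul hessian_sym hB_sym[OF h] hC_sym[OF h] matrix_mul_assoc)
  have st: "transpose (tau y) = tau y" for y by (simp add: tau_def transpose_cscale cmat_transpose hessian_sym)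
  show "transpose (n1 h p) = n1 h p"
    unfolding n1
    by (simp add: transpose_diff transpose_add transpose_minus transpose_cscale matrix_transpose_mul cmat_transpose sym\<xi> st nn_sym hB_sym[OF h] matrix_mul_assoc[symmetric] algebra_simps)
qed

lemma smooth_tau: "smooth tau" "smooth nn"
  unfolding tau_def[abs_def] nn_def[abs_def] by (intro smooth_cscale smooth_cmat smooth_hessian xi)+

lemma smooth_A0: "smooth A0"
  unfolding A0_def[abs_def] N0_def Rem_def
  by (intro smooth_scaleR smooth_map_matrix bounded_linear_Re smooth_nf smooth_tau)

lemma smooth_J0: "smooth J0"
  unfolding J0_block[abs_def] by (intro smooth_block_mat smooth_const smooth_minus smooth_G smooth_hessian)

lemma smooth_R0: "smooth R0"
  by (rule smooth_sqrt[where g = "\<lambda>y. OM ** J0 y" and B = "\<lambda>y. mat 1 - A0 y ** A0 y"])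
    (intro smooth_matrix_mult smooth_const smooth_J0 smooth_diff smooth_A0 J0_g R0_sqrt)+

lemma smooth_C0: "smooth C0"
  unfolding C0_def[abs_def] by (intro smooth_matrix_inv smooth_add smooth_const smooth_R0 R0_det)

text \<open>All coefficient fields are pointwise functions of the Hessian and \<xi>, so unfolding
  them to this shape settles periodicity, including that of the square root.\<close>

lemma periodic: "lattice_periodic (\<lambda>y. F (hessian u y) (\<xi> y))"
  using hessian_periodic xi(2) by (auto simp: lattice_periodic_def)

lemma periodic_all: "lattice_periodic tau" "lattice_periodic nn" "lattice_periodic A0" "lattice_periodic R0" "lattice_periodic C0" "lattice_periodic G"
  "lattice_periodic (hessian u)"
  unfolding tau_def[abs_def] nn_def[abs_def] A0_def[abs_def] R0_def[abs_def] C0_def[abs_def] G_def[abs_def] J0_def N0_def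
  by (rule periodic)+

lemmas R0_defs = R0_def A0_def N0_def J0_def tau_def nn_def

text \<open>The y-component of the Hamiltonian field consists of w-derivatives of h, so
  differentiating a function of y along it gives an exact term.\<close>

lemma w_exact_directional:
  fixes F :: "real^'n \<Rightarrow> complex^'n^'n"
  assumes F: "smooth F" "lattice_periodic F" and h: "smooth h" "lattice_periodic h"
  shows "w_exact_mat (\<lambda>p. frechet_derivative F (at (y_part p)) (\<chi> i. - (1 / 2) * pd (Inr i) h p))"
proof -
  let ?d = "\<lambda>p. frechet_derivative F (at (y_part p)) (\<chi> i. - (1 / 2) * pd (Inr i) h p)"
  have "?d p $ i $ j = (\<Sum>k\<in>UNIV. pd k F (y_part p) $ i $ j * of_real (- (1 / 2) * pd (Inr k) h p))" for i j p
    unfolding frechet_sum_pd[OF smooth_differentiable[OF F(1)]] vec_lambda_beta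
    by (simp add: complex_eq_iff mult.commute)
  moreover have "w_exact (\<lambda>p. pd k F (y_part p) $ i $ j * of_real (- (1 / 2) * pd (Inr k) h p))" for i j k
  proof -
    have "smooth (\<lambda>y. pd k F y $ i $ j)" by (intro smooth_entry smooth_in_pd F)
    moreover have "lattice_periodic (\<lambda>y. pd k F y $ i $ j)"
      using lattice_periodic_pd[OF F(2)] by (auto simp: lattice_periodic_def)
    ultimately show ?thesis using w_exact_mult[OF w_exact_real_pd[OF h]] by blast
  qed
  ultimately show ?thesis unfolding w_exact_mat_def by (simp only:) (intro allI w_exact_sum)
qed

lemma w_exact_dxi: "smooth h \<Longrightarrow> lattice_periodic h \<Longrightarrow> w_exact_mat (\<lambda>p. dxi h p)"
  unfolding dxi_def by (rule w_exact_directional[OF xi(1,2)])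

lemma w_exact_dhs:
  assumes h: "smooth h" "lattice_periodic h" shows "w_exact_mat (\<lambda>p. cmat (dhs h p))"
proof -
  have e: "cmat (dhs h p) = frechet_derivative (\<lambda>y. cmat (hessian u y) :: complex^'n^'n) (at (y_part p)) (\<chi> i. - (1 / 2) * pd (Inr i) h p)" for p
  proof -
    have "(hessian u has_derivative frechet_derivative (hessian u) (at (y_part p))) (at (y_part p))"
      using smooth_differentiable[OF smooth_hessian] frechet_derivative_works by blast
    from frechet_derivative_at[OF bounded_linear.has_derivative[OF bounded_linear_cmat this], symmetric]
    show ?thesis by (simp add: dhs_def)
  qed
  have "lattice_periodic (\<lambda>y. cmat (hessian u y) :: complex^'n^'n)"
    using hessian_periodic by (auto simp: lattice_periodic_def)
  then show ?thesis unfolding e by (intro w_exact_directional smooth_cmat smooth_hessian h)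
qed

text \<open>Every summand contains block A or B or the derivative of \<xi> along the field. The
  fibre variation therefore contributes nothing to the real moment map.\<close>

lemma w_exact_n1:
  assumes h: "smooth h" "lattice_periodic h" shows "w_exact_mat (n1 h)"
proof -
  note A = w_exact_hA[OF h] and B = w_exact_hB[OF h]
  have tn: "smooth (\<lambda>y. tau y ** nn y)" "lattice_periodic (\<lambda>y. tau y ** nn y)" "smooth (\<lambda>y. nn y ** tau y)" "lattice_periodic (\<lambda>y. nn y ** tau y)"
    using smooth_tau periodic_all by (auto intro!: smooth_matrix_mult simp: lattice_periodic_def)
  have e: "n1 h p = (\<i> / 2) *k dxi h p - cmat (hA h p) ** nn (y_part p) - cmat (hB h p) ** (\<lambda>y. tau y ** nn y) (y_part p)
    - (\<lambda>y. nn y ** tau y) (y_part p) ** cmat (hB h p) - nn (y_part p) ** transpose (cmat (hA h p))" for p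
    by (simp add: n1_def matrix_mul_assoc cmat_transpose)
  show ?thesis
    unfolding e[abs_def]
    by (intro w_exact_mat_diff w_exact_mat_cscale w_exact_dxi[OF h] w_exact_mat_right[OF A] w_exact_mat_right[OF B tn(1,2)]
        w_exact_mat_left[OF B tn(3,4)] w_exact_mat_left[OF w_exact_mat_transpose[OF A]] smooth_tau periodic_all)
qed

section \<open>Evaluation of the two moment maps\<close>

definition "M1 y = (mat 1 - b11 (R0 y)) ** G y"

lemma smooth_M1: "smooth M1"
  unfolding M1_def[abs_def] by (intro smooth_matrix_mult smooth_diff smooth_const smooth_b smooth_R0 smooth_G)

lemma periodic_M1: "lattice_periodic M1"
  unfolding M1_def[abs_def] R0_defs G_def by (rule periodic)

lemma hC_hess:
  assumes h: "smooth h"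
  shows "cmat (hC h p) = (1 / 2) *k (\<chi> b a. pd (Inl a) (pd (Inl b) (\<lambda>p. complex_of_real (h p))) p)"
  by (simp add: vec_eq_iff hC_def pd_of_real h smooth_in_pd)

lemma smooth_hC: "smooth h \<Longrightarrow> smooth (\<lambda>p. cmat (hC h p) :: complex^'n^'n)"
  unfolding hC_def
  by (intro smooth_cmat smooth_matI) (simp, intro smooth_divide smooth_const smooth_in_pd; simp)

lemma integral_cube_Re: "smooth F \<Longrightarrow> integral (cbox 0 One) (\<lambda>p. Re (F p)) = Re (integral (cbox 0 One) F)"
  for F :: "'n vec2 \<Rightarrow> complex"
  using integral_linear[OF integrable_smooth bounded_linear_Re, of F] by (simp add: o_def)

lemma integral_trace_hC:
  assumes M: "smooth M" "lattice_periodic M" and h: "smooth h" "lattice_periodic h"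
  shows "integral (cbox 0 One) (\<lambda>p. trace (M (y_part p) ** cmat (hC h p))) =
    (1 / 2) * integral (cbox 0 One) (\<lambda>p. double_divergence M (y_part p) * of_real (h p))"
proof -
  have hc: "smooth (\<lambda>p. complex_of_real (h p))" "lattice_periodic (\<lambda>p. complex_of_real (h p))"
    using h smooth_of_real by (auto simp: lattice_periodic_def)
  show ?thesis
    using integral_double_divergence[OF M hc]
    by (simp add: hC_hess[OF h(1)] cscale_mult_right trace_cscale)
qed

lemma w_exact_smooth: "w_exact F \<Longrightarrow> smooth F"
  by (simp add: w_exact_def)

lemma smooth_trace_hC: "smooth M \<Longrightarrow> smooth h \<Longrightarrow> smooth (\<lambda>p. trace (M (y_part p) ** cmat (hC h p)))" for M :: "real^'n \<Rightarrow> complex^'n^'n"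
  by (intro smooth_trace smooth_matrix_mult smooth_y_part smooth_hC)

text \<open>The pairing is half the trace of \<xi> d\<tau>, and modulo exact terms d\<tau> is minus
  half the y-Hessian of h, whence 1/4. The power of 2 is the density of the volume form.\<close>

lemma moment_C_eq:
  assumes h: "h \<in> ham"
  shows "moment_C (J_of u) \<alpha> h = (2 ^ CARD('n) / 4) * integral (cbox 0 One) (\<lambda>p. double_divergence \<xi> (y_part p) * of_real (h p))"
proof -
  have hs: "smooth h" "lattice_periodic h" using h by (simp_all add: ham_def)
  have cH: "smooth (\<lambda>y. cmat (hessian u y) :: complex^'n^'n)" "lattice_periodic (\<lambda>y. cmat (hessian u y) :: complex^'n^'n)"
    using hessian_periodic by (auto simp: lattice_periodic_def intro: smooth_cmat smooth_hessian)
  let ?H = "\<lambda>p. cmat (hessian u (y_part p)) :: complex^'n^'n"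
  define E where "E p = \<i> *k (cmat (dhs h p) + ?H p ** cmat (hA h p) + transpose (cmat (hA h p)) ** ?H p)
     - ?H p ** (cmat (hB h p) ** ?H p)" for p
  have wE: "w_exact_mat E"
    unfolding E_def[abs_def]
    by (intro w_exact_mat_diff w_exact_mat_cscale w_exact_mat_add w_exact_dhs w_exact_mat_left[OF _ cH] w_exact_mat_right[OF _ cH]
        w_exact_mat_transpose w_exact_hA w_exact_hB hs)
  have wV: "w_exact (\<lambda>p. (1 / 2) * trace (\<xi> (y_part p) ** E p))"
    by (intro w_exact_cmult w_exact_trace w_exact_mat_left wE xi)
  have pr: "pairing (\<alpha> p) (lie_endo (ham_field h) (J_of u) p) =
      - (1 / 2) * trace (\<xi> (y_part p) ** cmat (hC h p)) + (1 / 2) * trace (\<xi> (y_part p) ** E p)" for p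
  proof -
    have "cplx (X1 h p) (Y1 h p) = - cmat (hC h p) + E p"
      by (simp add: cplx_def X1_def Y1_def E_def cmat_add cmat_diff cmat_minus cmat_mult cmat_transpose cscale_add algebra_simps)
    then have "pairing (\<alpha> p) (lie_endo (ham_field h) (J_of u) p) = (1 / 2) * trace (\<xi> (y_part p) ** (- cmat (hC h p) + E p))"
      unfolding \<alpha>_eq using tangent_pair(2)[OF lie_derivatives(3-5)[OF hs(1)] lie_derivatives(1)[OF hs(1)] transpose_transpose, of p]
      by simp
    then show ?thesis by (simp add: matmul_diff_right trace_sub field_simps)
  qed
  have "moment_C (J_of u) \<alpha> h = - (2 ^ CARD('n) *\<^sub>R integral (cbox 0 One)
      (\<lambda>p. - (1 / 2) * trace (\<xi> (y_part p) ** cmat (hC h p)) + (1 / 2) * trace (\<xi> (y_part p) ** E p)))"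
    by (simp only: moment_C_def integral_M_def pr)
  also have "integral (cbox 0 One) (\<lambda>p. - (1 / 2) * trace (\<xi> (y_part p) ** cmat (hC h p)) + (1 / 2) * trace (\<xi> (y_part p) ** E p))
    = integral (cbox 0 One) (\<lambda>p. - (1 / 2) * trace (\<xi> (y_part p) ** cmat (hC h p))) + integral (cbox 0 One) (\<lambda>p. (1 / 2) * trace (\<xi> (y_part p) ** E p))"
    by (intro Henstock_Kurzweil_Integration.integral_add integrable_smooth w_exact_smooth[OF wV] smooth_mult smooth_const smooth_trace_hC xi hs)
  also have "\<dots> = - (1 / 2) * integral (cbox 0 One) (\<lambda>p. trace (\<xi> (y_part p) ** cmat (hC h p)))"
    unfolding w_exact_integral[OF wV] by simp
  finally show ?thesis
    unfolding integral_trace_hC[OF xi(1,2) hs] by (simp add: scaleR_conv_of_real)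
qed

text \<open>The curvature term gives -1/2 times the double divergence of G, from 2 times -1/4. The
  other term gives 1/2 times that of (1 - b11 R) G, where 1/2 comes from block C. The contributions
  of G cancel.\<close>

lemma moment_R_eq:
  assumes h: "h \<in> ham"
  shows "moment_R (J_of u) \<alpha> h = - (2 ^ CARD('n) / 2) *
    Re (integral (cbox 0 One) (\<lambda>p. double_divergence (\<lambda>y. cmat (b11 (R0 y) ** G y)) (y_part p) * of_real (h p)))"
proof -
  have hs: "smooth h" "lattice_periodic h" and h0: "integral (cbox 0 One) h = 0"
    using h by (simp_all add: ham_def integral_M_def)
  let ?I = "integral (cbox (0 :: 'n vec2) One)"
  let ?cM = "\<lambda>y. cmat (M1 y) :: complex^'n^'n" and ?cG = "\<lambda>y. cmat (G y) :: complex^'n^'n"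
  let ?cE = "\<lambda>y. cmat (b11 (R0 y) ** G y) :: complex^'n^'n"
  have sM: "smooth ?cM" "lattice_periodic ?cM" and sG: "smooth ?cG" "lattice_periodic ?cG"
    using periodic_M1 periodic_all(6) by (auto simp: lattice_periodic_def intro: smooth_cmat smooth_M1 smooth_G)
  have cH: "smooth (\<lambda>y. cmat (hessian u y) :: complex^'n^'n)" "lattice_periodic (\<lambda>y. cmat (hessian u y) :: complex^'n^'n)"
    using hessian_periodic by (auto simp: lattice_periodic_def intro: smooth_cmat smooth_hessian)
  have sZ: "smooth (\<lambda>y. cmat (C0 y ** A0 y) :: complex^('n + 'n)^('n + 'n))" "lattice_periodic (\<lambda>y. cmat (C0 y ** A0 y) :: complex^('n + 'n)^('n + 'n))"
    using periodic_all by (auto simp: lattice_periodic_def intro!: smooth_cmat smooth_matrix_mult smooth_C0 smooth_A0)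
  define V where "V p = trace (?cM (y_part p) ** (cmat (hessian u (y_part p)) ** (cmat (hB h p) ** cmat (hessian u (y_part p)))))
     - trace (cmat (C0 (y_part p) ** A0 (y_part p)) ** nf (tau (y_part p)) (\<i> *k n1 h p))" for p
  have "w_exact_mat (\<lambda>p. nf (tau (y_part p)) (\<i> *k n1 h p))"
    unfolding nf_def
    by (intro w_exact_mat_block w_exact_mat_minus w_exact_mat_left w_exact_mat_right w_exact_mat_cscale w_exact_n1 hs smooth_tau periodic_all)
  then have "w_exact (\<lambda>p. trace (?cM (y_part p) ** (cmat (hessian u (y_part p)) ** (cmat (hB h p) ** cmat (hessian u (y_part p)))))
     + (- 1) * trace (cmat (C0 (y_part p) ** A0 (y_part p)) ** nf (tau (y_part p)) (\<i> *k n1 h p)))"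
    by (intro w_exact_add w_exact_cmult w_exact_trace w_exact_mat_left[OF _ sM] w_exact_mat_left[OF _ cH] w_exact_mat_right[OF _ cH] w_exact_hB hs
        w_exact_mat_left[OF _ sZ])
  then have wV: "w_exact V" by (simp add: V_def[abs_def])
  have dc: "dc_BG (J_of u p, \<alpha> p) (lie_endo (ham_field h) (J_of u) p, dual_endo (lie_endo (ham_field h) (\<lambda>q. dual_endo (\<alpha> q)) p))
    = Re (trace (?cM (y_part p) ** cmat (hC h p)) + V p)" for p
  proof -
    have J: "J_of u p = J0 (y_part p)" by (simp add: J_eq)
    have tr: "transpose (dual_endo (lie_endo (ham_field h) (\<lambda>q. dual_endo (\<alpha> q)) p)) = dnf (tau (y_part p)) (nn (y_part p)) (cplx (X1 h p) (Y1 h p)) (n1 h p)"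
      using lie_derivatives(2)[OF hs(1)] by (simp add: dual_endo_def)
    have "dc_BG (J_of u p, \<alpha> p) (lie_endo (ham_field h) (J_of u) p, dual_endo (lie_endo (ham_field h) (\<lambda>q. dual_endo (\<alpha> q)) p)) =
      - trace ((mat 1 - b11 (R0 (y_part p))) ** (G (y_part p) ** X1 h p)) - Re (trace (cmat (C0 (y_part p) ** A0 (y_part p)) ** nf (tau (y_part p)) (\<i> *k n1 h p)))"
      using tangent_pair(1)[OF lie_derivatives(3-5)[OF hs(1)] lie_derivatives(1)[OF hs(1)] tr] unfolding J \<alpha>_eq by blast
    moreover have "- trace ((mat 1 - b11 (R0 (y_part p))) ** (G (y_part p) ** X1 h p)) =
       Re (trace (?cM (y_part p) ** cmat (hC h p)) + trace (?cM (y_part p) ** (cmat (hessian u (y_part p)) ** (cmat (hB h p) ** cmat (hessian u (y_part p))))))"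
      by (simp add: X1_def M1_def[symmetric] matrix_mul_assoc matmul_minus_right trace_minus matrix_add_ldistrib matmul_diff_right trace_sub trace_add Re_trace cmat_mult[symmetric])
    ultimately show ?thesis by (simp add: V_def)
  qed
  have i2: "?I (\<lambda>p. Re (trace (?cM (y_part p) ** cmat (hC h p)) + V p)) = (1 / 2) * Re (?I (\<lambda>p. double_divergence ?cM (y_part p) * of_real (h p)))"
  proof -
    have s: "smooth (\<lambda>p. trace (?cM (y_part p) ** cmat (hC h p)))" by (rule smooth_trace_hC[OF sM(1) hs(1)])
    have "?I (\<lambda>p. Re (trace (?cM (y_part p) ** cmat (hC h p)) + V p)) = Re (?I (\<lambda>p. trace (?cM (y_part p) ** cmat (hC h p)) + V p))"
      by (rule integral_cube_Re[OF smooth_add[OF s w_exact_smooth[OF wV]]])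
    also have "?I (\<lambda>p. trace (?cM (y_part p) ** cmat (hC h p)) + V p) = ?I (\<lambda>p. trace (?cM (y_part p) ** cmat (hC h p))) + ?I V"
      by (intro Henstock_Kurzweil_Integration.integral_add integrable_smooth s w_exact_smooth[OF wV])
    finally show ?thesis by (simp add: w_exact_integral[OF wV] integral_trace_hC[OF sM hs])
  qed
  have ddG: "scalar_curvature (J_of u) p = - (1 / 4) * Re (double_divergence ?cG (y_part p))" for p
  proof -
    have "pd b (pd a (\<lambda>x. ?cG x $ a $ b)) y = of_real (pd b (pd a (\<lambda>x. G x $ a $ b)) y)" for a b y
      by (simp add: pd_of_real smooth_entry smooth_G smooth_in_pd)
    then show ?thesis
      unfolding scalar_curvature_J double_divergence_def by (subst sum.swap) simp
  qed
  define avg where "avg = average_M (scalar_curvature (J_of u))"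
  let ?d = "\<lambda>p :: 'n vec2. double_divergence ?cG (y_part p)"
  have sd: "smooth ?d" by (intro smooth_y_part smooth_double_divergence sG)
  \<comment> \<open>The average of the curvature is multiplied by the integral of h, which vanishes,
    so its value need not be computed.\<close>
  have i1: "?I (\<lambda>p. 2 * (scalar_curvature (J_of u) p - avg) * h p) = - (1 / 2) * Re (?I (\<lambda>p. ?d p * of_real (h p)))"
  proof -
    have sdh: "smooth (\<lambda>p. ?d p * of_real (h p))" by (intro smooth_mult smooth_of_real sd hs)
    have "?I (\<lambda>p. 2 * (scalar_curvature (J_of u) p - avg) * h p) = ?I (\<lambda>p. (- (1 / 2)) * Re (?d p * of_real (h p)) + (- 2 * avg) * h p)"
      by (rule arg_cong[where f = ?I]) (simp add: fun_eq_iff ddG algebra_simps)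
    also have "\<dots> = ?I (\<lambda>p. (- (1 / 2)) * Re (?d p * of_real (h p))) + ?I (\<lambda>p. (- 2 * avg) * h p)"
      by (intro Henstock_Kurzweil_Integration.integral_add integrable_smooth smooth_mult smooth_const smooth_Re sdh hs smooth_of_real sd)
    also have "\<dots> = (- (1 / 2)) * ?I (\<lambda>p. Re (?d p * of_real (h p)))" by (simp only: integral_mult_right h0 mult_zero_right add_0_right)
    finally show ?thesis by (simp only: integral_cube_Re[OF sdh])
  qed
  have dd: "double_divergence ?cM y = double_divergence ?cG y - double_divergence ?cE y" for y
  proof -
    have sE: "smooth (\<lambda>y. ?cE y $ a $ b)" and sGe: "smooth (\<lambda>y. ?cG y $ a $ b)" for a b
      by (intro smooth_entry smooth_cmat smooth_matrix_mult smooth_b smooth_R0 smooth_G)+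
    have e: "(\<lambda>x. ?cM x $ a $ b) = (\<lambda>x. ?cG x $ a $ b + - (?cE x $ a $ b))" for a b
      by (simp add: M1_def matmul_diff_left fun_eq_iff)
    have m: "pd k (\<lambda>x. - f x) = (\<lambda>x. - pd k f x)" if "smooth f" for f :: "real^'n \<Rightarrow> complex" and k
      using pd_bounded_linear[OF bounded_linear_minus[OF bounded_linear_ident] smooth_differentiable[OF that]] by blast
    have a: "pd k (\<lambda>x. f x + g x) = (\<lambda>x. pd k f x + pd k g x)" if "smooth f" "smooth g" for f g :: "real^'n \<Rightarrow> complex" and k
      using pd_add[OF smooth_differentiable[OF that(1)] smooth_differentiable[OF that(2)]] by blast
    have "pd b (pd a (\<lambda>x. ?cM x $ a $ b)) y = pd b (pd a (\<lambda>x. ?cG x $ a $ b)) y - pd b (pd a (\<lambda>x. ?cE x $ a $ b)) y" for a b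
      unfolding e a[OF sGe smooth_minus[OF sE]] m[OF sE] a[OF smooth_in_pd[OF sGe] smooth_minus[OF smooth_in_pd[OF sE]]] m[OF smooth_in_pd[OF sE]]
      by simp
    then show ?thesis by (simp add: double_divergence_def sum_subtractf)
  qed
  have sE: "smooth (\<lambda>p :: 'n vec2. double_divergence ?cE (y_part p))"
    by (intro smooth_y_part smooth_double_divergence smooth_cmat smooth_matrix_mult smooth_b smooth_R0 smooth_G)
  have "?I (\<lambda>p. double_divergence ?cM (y_part p) * of_real (h p)) = ?I (\<lambda>p. ?d p * of_real (h p) - double_divergence ?cE (y_part p) * of_real (h p))"
    by (simp add: dd algebra_simps)
  also have "\<dots> = ?I (\<lambda>p. ?d p * of_real (h p)) - ?I (\<lambda>p. double_divergence ?cE (y_part p) * of_real (h p))"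
    by (intro Henstock_Kurzweil_Integration.integral_diff integrable_smooth smooth_mult sd sE smooth_of_real hs)
  finally have i3: "?I (\<lambda>p. double_divergence ?cM (y_part p) * of_real (h p)) =
    ?I (\<lambda>p. ?d p * of_real (h p)) - ?I (\<lambda>p. double_divergence ?cE (y_part p) * of_real (h p))" .
  have "moment_R (J_of u) \<alpha> h = 2 ^ CARD('n) * (?I (\<lambda>p. 2 * (scalar_curvature (J_of u) p - avg) * h p)
      + ?I (\<lambda>p. Re (trace (?cM (y_part p) ** cmat (hC h p)) + V p)))"
    unfolding moment_R_def integral_M_def avg_def[symmetric] dc by (simp add: distrib_left)
  also have "\<dots> = 2 ^ CARD('n) * (- (1 / 2) * Re (?I (\<lambda>p. double_divergence ?cE (y_part p) * of_real (h p))))"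
    unfolding i1 i2 i3 by (simp add: algebra_simps)
  finally show ?thesis by simp
qed

section \<open>Reality of the double divergence and the equivalences\<close>

definition "sqrtG x = matrix_sqrt (mat 1 - higgs_square u \<xi> x) ** cmat (matrix_inv (hessian u x))"

lemma sqrtG_eq: "sqrtG = (\<lambda>y. cmat (b11 (R0 y) ** G y) + \<i> *k cmat (b12 (R0 y)))"
  by (simp add: fun_eq_iff sqrtG_def sqrt_G)

lemma smooth_sqrtG: "smooth sqrtG" "lattice_periodic sqrtG"
  unfolding sqrtG_eq using periodic_all
  by (auto simp: lattice_periodic_def intro!: smooth_add smooth_cscale smooth_cmat smooth_matrix_mult smooth_b smooth_R0 smooth_G)

text \<open>The imaginary part of \<open>sqrtG\<close> is antisymmetric while second derivatives are
  symmetric in their indices, so its double sum equals its own negative.\<close>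

lemma double_divergence_sqrtG:
  "double_divergence sqrtG y = double_divergence (\<lambda>y. cmat (b11 (R0 y) ** G y)) y"
  "Im (double_divergence sqrtG y) = 0"
proof -
  let ?cE = "\<lambda>y. cmat (b11 (R0 y) ** G y) :: complex^'n^'n"
  let ?q = "\<lambda>a b y. complex_of_real (b12 (R0 y) $ a $ b)"
  have sE: "smooth (\<lambda>y. (b11 (R0 y) ** G y) $ a $ b)" and sq: "smooth (\<lambda>y. b12 (R0 y) $ a $ b)" for a b
    by (intro smooth_entry smooth_matrix_mult smooth_b smooth_R0 smooth_G)+
  have e: "(\<lambda>x. sqrtG x $ a $ b) = (\<lambda>x. ?cE x $ a $ b + \<i> * ?q a b x)" for a b
    by (simp add: sqrtG_eq)
  have sE': "smooth (\<lambda>y. ?cE y $ a $ b)" and sq': "smooth (?q a b)" for a b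
    unfolding cmat_nth by (intro smooth_of_real sE sq)+
  have m: "pd k (\<lambda>x. \<i> * f x) = (\<lambda>x. \<i> * pd k f x)" if "smooth f" for f :: "real^'n \<Rightarrow> complex" and k
    using pd_bounded_linear[OF bounded_linear_mult_right smooth_differentiable[OF that]] by blast
  have a: "pd k (\<lambda>x. f x + g x) = (\<lambda>x. pd k f x + pd k g x)" if "smooth f" "smooth g" for f g :: "real^'n \<Rightarrow> complex" and k
    using pd_add[OF smooth_differentiable[OF that(1)] smooth_differentiable[OF that(2)]] by blast
  have si: "smooth f \<Longrightarrow> smooth (\<lambda>x. \<i> * f x)" for f :: "real^'n \<Rightarrow> complex" by (intro smooth_mult smooth_const)
  have t: "pd b (pd a (\<lambda>x. sqrtG x $ a $ b)) y = pd b (pd a (\<lambda>x. ?cE x $ a $ b)) y + \<i> * pd b (pd a (?q a b)) y" for a b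
    unfolding e a[OF sE' si[OF sq']] m[OF sq'] a[OF smooth_in_pd[OF sE'] si[OF smooth_in_pd[OF sq']]] m[OF smooth_in_pd[OF sq']] ..
  have anti: "pd b (pd a (?q a b)) y = - pd a (pd b (?q b a)) y" for a b
  proof -
    have "?q a b = (\<lambda>x. - ?q b a x)"
    proof
      fix x
      have "b12 (R0 x) $ a $ b = - b12 (R0 x) $ b $ a"
        using arg_cong[OF b12_R0[of x], of "\<lambda>M. M $ b $ a"] by (simp add: transpose_def)
      then show "?q a b x = - ?q b a x" by simp
    qed
    moreover have n: "pd k (\<lambda>x. - f x) = (\<lambda>x. - pd k f x)" if "smooth f" for f :: "real^'n \<Rightarrow> complex" and k
      using pd_bounded_linear[OF bounded_linear_minus[OF bounded_linear_ident] smooth_differentiable[OF that]] by blast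
    ultimately have "pd b (pd a (?q a b)) y = - pd b (pd a (?q b a)) y"
      by (simp add: n[OF sq'] n[OF smooth_in_pd[OF sq']])
    then show ?thesis using pd_commute[OF sq', of y b a b a] by simp
  qed
  let ?S = "\<Sum>a\<in>UNIV. \<Sum>b\<in>UNIV. pd b (pd a (?q a b)) y"
  have "?S = (\<Sum>a\<in>UNIV. \<Sum>b\<in>UNIV. - pd a (pd b (?q b a)) y)" by (intro sum.cong refl anti)
  also have "\<dots> = - ?S" by (subst sum.swap) (simp add: sum_negf)
  finally have "?S = 0" by simp
  then show 1: "double_divergence sqrtG y = double_divergence ?cE y"
    by (simp add: double_divergence_def t sum.distrib sum_distrib_left[symmetric])
  have "pd b (pd a (\<lambda>x. ?cE x $ a $ b)) y = of_real (pd b (pd a (\<lambda>x. (b11 (R0 x) ** G x) $ a $ b)) y)" for a b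
    by (simp add: pd_of_real sE smooth_in_pd)
  then show "Im (double_divergence sqrtG y) = 0" unfolding 1 by (simp add: double_divergence_def)
qed

lemma moment_C_vanishes: "(\<forall>h\<in>ham. moment_C (J_of u) \<alpha> h = 0) \<longleftrightarrow> (\<forall>y. double_divergence \<xi> y = 0)"
  unfolding double_divergence_vanishes_iff[OF xi(1,2), symmetric] by (simp add: moment_C_eq)

text \<open>The real moment map controls only the real part of the integral against h. The imaginary
  part vanishes identically because the double divergence of \<open>sqrtG\<close> is real.\<close>

lemma moment_R_vanishes: "(\<forall>h\<in>ham. moment_R (J_of u) \<alpha> h = 0) \<longleftrightarrow> (\<forall>y. double_divergence sqrtG y = 0)"
proof -
  have "Im (integral (cbox 0 One) (\<lambda>p. double_divergence sqrtG (y_part p) * of_real (h p))) = 0" if "h \<in> ham" for h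
  proof -
    have "smooth h" using that by (simp add: ham_def)
    then have s: "smooth (\<lambda>p. double_divergence sqrtG (y_part p) * of_real (h p))"
      by (intro smooth_mult smooth_y_part smooth_double_divergence smooth_sqrtG smooth_of_real)
    show ?thesis
      using integral_linear[OF integrable_smooth[OF s] bounded_linear_Im] by (simp add: o_def double_divergence_sqrtG(2))
  qed
  then show ?thesis
    unfolding double_divergence_vanishes_iff[OF smooth_sqrtG, symmetric]
    by (simp add: moment_R_eq double_divergence_sqrtG(1)[symmetric] complex_eq_iff)
qed

end

theorem theorem1p1:
  fixes u :: "real^'n::finite \<Rightarrow> real"
    and \<alpha> :: "real^('n + 'n) \<Rightarrow> complex^('n + 'n)^('n + 'n)"
    and \<xi> :: "real^'n \<Rightarrow> complex^'n^'n"
  assumes potential: "symplectic_potential u"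
    and cotangent: "cotangent_field (J_of u) \<alpha>"
    and invariant: "torus_invariant \<alpha>"
    and higgs: "higgs_tensor u \<alpha> \<xi>"
    and radius: "\<And>y. spectral_radius (higgs_square u \<xi> y) < 1"
  shows
    "((\<forall>h\<in>ham. moment_R (J_of u) \<alpha> h = 0 \<and> moment_C (J_of u) \<alpha> h = 0) \<longleftrightarrow>
       (\<forall>y. double_divergence \<xi> y = 0) \<and>
       (\<forall>y. double_divergence
          (\<lambda>x. matrix_sqrt (mat 1 - higgs_square u \<xi> x) ** cmat (matrix_inv (hessian u x))) y = 0))
     \<and> ((\<forall>h\<in>ham. moment_C (J_of u) \<alpha> h = 0) \<longleftrightarrow> (\<forall>y. double_divergence \<xi> y = 0))
     \<and> ((\<forall>h\<in>ham. moment_R (J_of u) \<alpha> h = 0) \<longleftrightarrow>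
       (\<forall>y. double_divergence
          (\<lambda>x. matrix_sqrt (mat 1 - higgs_square u \<xi> x) ** cmat (matrix_inv (hessian u x))) y = 0))"
proof -
  interpret higgs_field u \<alpha> \<xi>
    using potential cotangent higgs radius by unfold_locales
  show ?thesis
    using moment_C_vanishes moment_R_vanishes unfolding sqrtG_def[abs_def] by blast
qed

end
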